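(* Let $n\ge 4$. A complete list of the real irreducible representations of $A_n$ is given by \begin{enumerate} \item $\sigma_\lambda|_{A_n}$, where $\lambda\vdash n$ and either $\lambda\neq\lambda'$, or $\lambda=\lambda'$ and $\epsilon_\lambda=-1$; and \item $\sigma_\lambda^{\pm}$, where $\lambda\vdash n$, $\lambda=\lambda'$ and $\epsilon_\lambda=1$. \end{enumerate} In the first case, $\sigma_\lambda|_{A_n}$ is spinorial if and only if $\chi_\lambda(s_1s_3)\equiv\chi_\lambda(1)\pmod 8$. In the second case, $\sigma_\lambda^+$ is spinorial if and only if $\sigma_\lambda^-$ is spinorial if and only if $\chi_\lambda(s_1s_3)\equiv\chi_\lambda(1)\pmod{16}$.
   Context: For $\lambda\vdash n$, $\lambda'$ is the conjugate partition; $\epsilon_\lambda=1$ if the number of cells of the Young diagram of $\lambda$ strictly above the diagonal is even and $\epsilon_\lambda=-1$ otherwise. $\sigma_\lambda$ is the real Specht module of $S_n$ indexed by $\lambda$, $\pi_\lambda=\sigma_\lambda\otimes\mathbb{C}$ the complex Specht module, and $\chi_\lambda$ its character; $s_1s_3=(1,2)(3,4)$. When $\lambda=\lambda'$, the restriction of $\pi_\lambda$ to $A_n$ is a direct sum of two non-isomorphic irreducible complex representations $\pi_\lambda^+,\pi_\lambda^-$ (each the twist of the other by an odd permutation); when moreover $\epsilon_\lambda=1$ these are orthogonal (admit an invariant nondegenerate symmetric bilinear form), and $\sigma_\lambda^{\pm}$ denotes the unique (up to isomorphism) real representation with $\sigma_\lambda^\pm\otimes_{\mathbb{R}}\mathbb{C}\cong\pi_\lambda^\pm$.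 A real representation of a finite group $G$ on a Euclidean space $V$ is regarded as a homomorphism $\pi:G\to\mathrm{O}(V)$; it is spinorial if there is a homomorphism $\hat\pi:G\to\mathrm{Pin}(V)$ with $\rho\circ\hat\pi=\pi$, where $\rho:\mathrm{Pin}(V)\to\mathrm{O}(V)$ is the standard double cover (Pin group built from the Clifford algebra with $v^2=-|v|^2$). *)

theory Defs
  imports "Jordan_Normal_Form.Matrix" "HOL-Combinatorics.Permutations" "HOL-Combinatorics.Transposition"
    "HOL-Library.FuncSet"
begin

definition is_partition :: "nat list \<Rightarrow> nat \<Rightarrow> bool" where
  "is_partition lam n \<longleftrightarrow> sorted_wrt (\<ge>) lam \<and> (\<forall>x\<in>set lam. 0 < x) \<and> sum_list lam = n"

text \<open>Cells of the Young diagram (English notation, 0-indexed): row i, column j.\<close>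
definition cells :: "nat list \<Rightarrow> (nat \<times> nat) set" where
  "cells lam = {(i, j). i < length lam \<and> j < lam ! i}"

definition conj_part :: "nat list \<Rightarrow> nat list" where
  "conj_part lam = map (\<lambda>j. length (filter (\<lambda>k. j < k) lam)) [0..<fold max lam 0]"

definition eps :: "nat list \<Rightarrow> int" where
  "eps lam = (if even (card {(i, j). (i, j) \<in> cells lam \<and> i < j}) then 1 else -1)"

definition Sym :: "nat \<Rightarrow> (nat \<Rightarrow> nat) set" where
  "Sym n = {p. p permutes {1..n}}"

definition Alt :: "nat \<Rightarrow> (nat \<Rightarrow> nat) set" where
  "Alt n = {p. p permutes {1..n} \<and> evenperm p}"

definition s1s3 :: "nat \<Rightarrow> nat" where
  "s1s3 = transpose 1 2 \<circ> transpose 3 4"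

text \<open>A tabloid of shape lam is encoded by the map sending each entry k in {1..n}
  to its row index.\<close>
definition tabloids :: "nat list \<Rightarrow> nat \<Rightarrow> (nat \<Rightarrow> nat) set" where
  "tabloids lam n = {r \<in> {1..n} \<rightarrow>\<^sub>E {..<length lam}.
      \<forall>i<length lam. card {k \<in> {1..n}. r k = i} = lam ! i}"

definition tableaux :: "nat list \<Rightarrow> nat \<Rightarrow> (nat \<times> nat \<Rightarrow> nat) set" where
  "tableaux lam n = {T \<in> cells lam \<rightarrow>\<^sub>E {1..n}. bij_betw T (cells lam) {1..n}}"

definition row_tabloid :: "nat list \<Rightarrow> nat \<Rightarrow> (nat \<times> nat \<Rightarrow> nat) \<Rightarrow> nat \<Rightarrow> nat" where
  "row_tabloid lam n T = restrict (\<lambda>k. fst (inv_into (cells lam) T k)) {1..n}"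

definition col_stab :: "nat list \<Rightarrow> nat \<Rightarrow> (nat \<times> nat \<Rightarrow> nat) \<Rightarrow> (nat \<Rightarrow> nat) set" where
  "col_stab lam n T = {q. q permutes {1..n} \<and>
      (\<forall>k\<in>{1..n}. snd (inv_into (cells lam) T (q k)) = snd (inv_into (cells lam) T k))}"

text \<open>Action of a permutation g on functions on tabloids: g . delta_r = delta_(r o g^-1).\<close>
definition act :: "(nat \<Rightarrow> nat) \<Rightarrow> ((nat \<Rightarrow> nat) \<Rightarrow> 'a) \<Rightarrow> ((nat \<Rightarrow> nat) \<Rightarrow> 'a)" where
  "act g f = (\<lambda>r. f (r \<circ> g))"

definition polytabloid :: "nat list \<Rightarrow> nat \<Rightarrow> (nat \<times> nat \<Rightarrow> nat) \<Rightarrow> (nat \<Rightarrow> nat) \<Rightarrow> 'a::field" where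
  "polytabloid lam n T = (\<lambda>r. \<Sum>q\<in>col_stab lam n T.
      of_int (sign q) * (if r = row_tabloid lam n T \<circ> inv_into UNIV q then 1 else 0))"

text \<open>Specht module over the field 'a (real: sigma_lam, complex: pi_lam): the span of the polytabloids.\<close>
definition specht :: "nat list \<Rightarrow> nat \<Rightarrow> ((nat \<Rightarrow> nat) \<Rightarrow> 'a::field) set" where
  "specht lam n = {f. \<exists>c. f = (\<lambda>r. \<Sum>T\<in>tableaux lam n. c T * polytabloid lam n T r)}"

definition fsubspace :: "((nat \<Rightarrow> nat) \<Rightarrow> 'a::field) set \<Rightarrow> bool" where
  "fsubspace W \<longleftrightarrow> (\<lambda>r. 0) \<in> W \<and> (\<forall>f\<in>W. \<forall>g\<in>W. \<forall>a. (\<lambda>r. a * f r + g r) \<in> W)"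

definition invariant :: "(nat \<Rightarrow> nat) set \<Rightarrow> ((nat \<Rightarrow> nat) \<Rightarrow> 'a::field) set \<Rightarrow> bool" where
  "invariant G W \<longleftrightarrow> (\<forall>g\<in>G. \<forall>f\<in>W. act g f \<in> W)"

definition irred_subrep :: "(nat \<Rightarrow> nat) set \<Rightarrow> ((nat \<Rightarrow> nat) \<Rightarrow> 'a::field) set
    \<Rightarrow> ((nat \<Rightarrow> nat) \<Rightarrow> 'a) set \<Rightarrow> bool" where
  "irred_subrep G V W \<longleftrightarrow> W \<subseteq> V \<and> fsubspace W \<and> invariant G W \<and> W \<noteq> {\<lambda>r. 0} \<and>
     (\<forall>U. U \<subseteq> W \<and> fsubspace U \<and> invariant G U \<longrightarrow> U = {\<lambda>r. 0} \<or> U = W)"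

definition mat_rep :: "(nat \<Rightarrow> nat) set \<Rightarrow> nat \<Rightarrow> ((nat \<Rightarrow> nat) \<Rightarrow> 'a::field mat) \<Rightarrow> bool" where
  "mat_rep G d \<rho> \<longleftrightarrow> (\<forall>g\<in>G. \<rho> g \<in> carrier_mat d d) \<and> \<rho> id = 1\<^sub>m d \<and>
     (\<forall>g\<in>G. \<forall>h\<in>G. \<rho> (g \<circ> h) = \<rho> g * \<rho> h)"

definition orth_rep :: "(nat \<Rightarrow> nat) set \<Rightarrow> nat \<Rightarrow> ((nat \<Rightarrow> nat) \<Rightarrow> real mat) \<Rightarrow> bool" where
  "orth_rep G d \<rho> \<longleftrightarrow> mat_rep G d \<rho> \<and> (\<forall>g\<in>G. \<rho> g * transpose_mat (\<rho> g) = 1\<^sub>m d)"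

definition irred_mat_rep :: "(nat \<Rightarrow> nat) set \<Rightarrow> nat \<Rightarrow> ((nat \<Rightarrow> nat) \<Rightarrow> 'a::field mat) \<Rightarrow> bool" where
  "irred_mat_rep G d \<rho> \<longleftrightarrow> 0 < d \<and>
     (\<forall>U. U \<subseteq> carrier_vec d \<and> 0\<^sub>v d \<in> U \<and> (\<forall>u\<in>U. \<forall>v\<in>U. \<forall>a. a \<cdot>\<^sub>v u + v \<in> U) \<and>
          (\<forall>g\<in>G. \<forall>u\<in>U. \<rho> g *\<^sub>v u \<in> U) \<longrightarrow> U = {0\<^sub>v d} \<or> U = carrier_vec d)"

definition rep_iso_sub :: "(nat \<Rightarrow> nat) set \<Rightarrow> nat \<Rightarrow> ((nat \<Rightarrow> nat) \<Rightarrow> 'a::field mat)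
    \<Rightarrow> ((nat \<Rightarrow> nat) \<Rightarrow> 'a) set \<Rightarrow> bool" where
  "rep_iso_sub G d \<rho> W \<longleftrightarrow> (\<exists>L :: 'a vec \<Rightarrow> ((nat \<Rightarrow> nat) \<Rightarrow> 'a).
     (\<forall>v\<in>carrier_vec d. \<forall>w\<in>carrier_vec d. \<forall>a. L (a \<cdot>\<^sub>v v + w) = (\<lambda>r. a * L v r + L w r)) \<and>
     inj_on L (carrier_vec d) \<and> L ` carrier_vec d = W \<and>
     (\<forall>g\<in>G. \<forall>v\<in>carrier_vec d. L (\<rho> g *\<^sub>v v) = act g (L v)))"

definition complexify :: "((nat \<Rightarrow> nat) \<Rightarrow> real mat) \<Rightarrow> ((nat \<Rightarrow> nat) \<Rightarrow> complex mat)" where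
  "complexify \<rho> = (\<lambda>g. map_mat complex_of_real (\<rho> g))"

definition mtrace :: "'a::comm_ring_1 mat \<Rightarrow> 'a" where
  "mtrace A = (\<Sum>i<dim_row A. A $$ (i, i))"

text \<open>The character chi_lam of S_n (trace of the Specht representation; it is the same
  for the real and the complex Specht module).\<close>
definition chi :: "nat list \<Rightarrow> nat \<Rightarrow> (nat \<Rightarrow> nat) \<Rightarrow> real" where
  "chi lam n g = (case (SOME (d, \<rho>). mat_rep (Sym n) d \<rho> \<and> rep_iso_sub (Sym n) d \<rho> (specht lam n))
                  of (d, \<rho>) \<Rightarrow> mtrace (\<rho> g))"

definition real_cong :: "real \<Rightarrow> real \<Rightarrow> int \<Rightarrow> bool" where
  "real_cong a b m \<longleftrightarrow> (\<exists>k::int. a - b = of_int (k * m))"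

section \<open>Clifford algebra of R^d with v^2 = -|v|^2, Pin group, spinoriality\<close>

text \<open>Elements of Cl(R^d): coefficient functions on subsets S of {0..<d}
  (basis e_S = e_i1 ... e_ik, i1 < ... < ik).\<close>
type_synonym cl = "nat set \<Rightarrow> real"

definition cl_sign :: "nat set \<Rightarrow> nat set \<Rightarrow> real" where
  "cl_sign S T = (-1) ^ (card {(i, j). i \<in> S \<and> j \<in> T \<and> j < i} + card (S \<inter> T))"

definition cl_mult :: "nat \<Rightarrow> cl \<Rightarrow> cl \<Rightarrow> cl" where
  "cl_mult d x y = (\<lambda>U. \<Sum>S\<in>Pow {..<d}. \<Sum>T\<in>Pow {..<d}.
      if (S - T) \<union> (T - S) = U then cl_sign S T * x S * y T else 0)"

definition cl_one :: cl where
  "cl_one = (\<lambda>U. if U = {} then 1 else 0)"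

definition cl_vec :: "real vec \<Rightarrow> cl" where
  "cl_vec v = (\<lambda>U. if card U = 1 \<and> U \<subseteq> {..<dim_vec v} then v $ (the_elem U) else 0)"

definition cl_alpha :: "cl \<Rightarrow> cl" where
  "cl_alpha x = (\<lambda>U. (-1) ^ card U * x U)"

definition pin :: "nat \<Rightarrow> cl set" where
  "pin d = {foldr (cl_mult d) (map cl_vec us) cl_one | us.
              \<forall>u\<in>set us. u \<in> carrier_vec d \<and> scalar_prod u u = 1}"

text \<open>The covering map rho : Pin(d) -> O(d), rho(x) v = alpha(x) v x^-1, written
  equivalently (x invertible) as alpha(x) e_j = (rho(x) e_j) x.\<close>
definition pin_rho :: "nat \<Rightarrow> cl \<Rightarrow> real mat" where
  "pin_rho d x = (THE M. M \<in> carrier_mat d d \<and>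
      (\<forall>j<d. cl_mult d (cl_alpha x) (cl_vec (unit_vec d j)) = cl_mult d (cl_vec (col M j)) x))"

definition spinorial :: "(nat \<Rightarrow> nat) set \<Rightarrow> nat \<Rightarrow> ((nat \<Rightarrow> nat) \<Rightarrow> real mat) \<Rightarrow> bool" where
  "spinorial G d \<rho> \<longleftrightarrow> (\<exists>\<rho>h :: (nat \<Rightarrow> nat) \<Rightarrow> cl.
     (\<forall>g\<in>G. \<rho>h g \<in> pin d \<and> pin_rho d (\<rho>h g) = \<rho> g) \<and>
     (\<forall>g\<in>G. \<forall>h\<in>G. \<rho>h (g \<circ> h) = cl_mult d (\<rho>h g) (\<rho>h h)))"

end

theory Submission
  imports Defs "Jordan_Normal_Form.Determinant" "HOL-Combinatorics.Orbits"
begin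

text \<open>A representation of the alternating group lifts to the Pin group exactly when the lifts of
  Carmichael's generators, the 3-cycles \<open>(1 2 i)\<close> normalised to have cube 1, satisfy the remaining
  relations. All of these are conjugates of one relation, which says that a lift of \<open>(1 2)(3 4)\<close> squares
  to 1. This lift is a product of \<open>m\<close> orthogonal unit vectors, where the trace is \<open>d - 2m\<close>, so the
  condition is that 4 divides \<open>m\<close>.

  A Specht module restricted to the alternating group splits over the reals only if it is isomorphic
  to its sign twist and the square of the intertwiner is positive; for a self-conjugate shape the
  explicit intertwiner squares to \<open>\<epsilon>\<close> times a positive scalar. If it splits, the two halves are
  interchanged by a transposition, so that each has half of the character of \<open>S\<^sub>n\<close> at \<open>(1 2)(3 4)\<close>,
  and the modulus doubles. The list is complete because no nonzero element of the real group algebra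
  annihilates all Specht modules: otherwise some nonzero class function would be orthogonal to all
  their characters, but by dominance these characters are triangular with respect to summation over
  Young subgroups, and such sums determine a class function.\<close>

section \<open>Clifford words and reflections\<close>

text \<open>A lift of an element of odd order can be corrected by a sign, so cubes can be made 1; a
  square does not see the sign, so the relation for \<open>s1s3\<close> is a genuine obstruction. A
  product of m orthogonal unit vectors squares to (-1)^(m(m+1)/2). Since an element of order 3 is a
  product of an even number of reflections and \<open>s1s3\<close> is a product of two such
  elements, m is even and only m/2 matters. As chi(1) - chi(s1s3) = 2m on an unsplit module,
  \<open>4 dvd m\<close> reads as a congruence modulo 8. The presentation enters only as a count: a
  set of pairs (permutation, lift) that is closed under the generators and has at most n!/2 elements
  must be the graph of a homomorphism. Schur's lemma is needed with real scalars, although the reals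
  are not algebraically closed; it holds because column antisymmetrisation has rank one on the
  permutation module. An irreducible half of a complex Specht module needs a real form. The real
  module is split and its half complexified; any other half is isomorphic to this one or to its
  conjugate by a transposition, and conjugating the index of real matrices keeps them real.\<close>

abbreviation symdiff :: "'a set \<Rightarrow> 'a set \<Rightarrow> 'a set" (infixl "\<triangle>" 65)
  where "S \<triangle> T \<equiv> (S - T) \<union> (T - S)"

section \<open>Basis signs and multiplication in the Clifford algebra\<close>

lemma symdiff_cancel: "S \<triangle> (S \<triangle> U) = U" by blast
lemma symdiff_eq_iff: "S \<triangle> T = U \<longleftrightarrow> T = S \<triangle> U" by blast

text \<open>Sorting the concatenation of the basis words of S and T costs one swap of anticommuting
  generators for each pair with j < i, and each common index contributes a square -1. Both counts
  together are the pairs with j \<le> i, which gives a product over S and T separately.\<close>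

lemma cl_sign_eq_prod:
  assumes "finite S" "finite T"
  shows "cl_sign S T = (\<Prod>i\<in>S. \<Prod>j\<in>T. if j \<le> i then -1 else 1)"
proof -
  have "(\<Prod>i\<in>S. \<Prod>j\<in>T. if j \<le> i then -1 else 1) = (\<Prod>p\<in>S \<times> T. if snd p \<le> fst p then -1 else (1::real))"
    using assms by (simp add: prod.cartesian_product split_def)
  also have "\<dots> = (-1) ^ card {p \<in> S \<times> T. snd p \<le> fst p}"
    using assms by (subst prod.If_cases) (auto intro!: arg_cong[of _ _ "\<lambda>A. (-1) ^ card A"])
  also have "{p \<in> S \<times> T. snd p \<le> fst p} = {(i, j). i \<in> S \<and> j \<in> T \<and> j < i} \<union> (\<lambda>i. (i, i)) ` (S \<inter> T)"
    by auto
  also have "card \<dots> = card {(i, j). i \<in> S \<and> j \<in> T \<and> j < i} + card (S \<inter> T)"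
    using assms
    by (subst card_Un_disjoint) (auto simp: card_image inj_on_def intro: finite_subset[of _ "S \<times> T"])
  finally show ?thesis unfolding cl_sign_def by simp
qed

text \<open>The factors over the intersection occur twice on the right, where they square to
  1.\<close>

lemma prod_symdiff:
  fixes f :: "'b \<Rightarrow> real"
  assumes "finite S" "finite T" "\<And>i. f i * f i = 1"
  shows "prod f (S \<triangle> T) = prod f S * prod f T"
proof -
  have 1: "prod f S = prod f (S - T) * prod f (S \<inter> T)"
    using assms by (metis Diff_Diff_Int Diff_subset mult.commute prod.subset_diff)
  have 2: "prod f T = prod f (T - S) * prod f (S \<inter> T)"
    using assms by (metis Diff_Diff_Int Diff_subset inf_commute mult.commute prod.subset_diff)
  have 3: "prod f (S \<triangle> T) = prod f (S - T) * prod f (T - S)"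
    using assms by (intro prod.union_disjoint) auto
  have "prod f (S \<inter> T) * prod f (S \<inter> T) = 1"
    using assms(3) by (simp flip: prod.distrib)
  then show ?thesis unfolding 1 2 3 by (simp add: algebra_simps)
qed

text \<open>With its right-hand counterpart this makes \<open>cl_sign\<close> a bicharacter on
  finite sets under symmetric difference. The Clifford algebra is then a twisted group algebra, and
  every sign identity below is bilinear algebra.\<close>

lemma cl_sign_symdiff_left:
  assumes "finite S" "finite S'" "finite T"
  shows "cl_sign (S \<triangle> S') T = cl_sign S T * cl_sign S' T"
  using assms by (simp only: cl_sign_eq_prod finite_Un finite_Diff simp_thms)
    (rule prod_symdiff, auto simp flip: prod.distrib intro!: prod.neutral)

lemma cl_sign_symdiff_right:
  assumes "finite S" "finite T" "finite T'"
  shows "cl_sign S (T \<triangle> T') = cl_sign S T * cl_sign S T'"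
proof -
  have "(\<Prod>j\<in>T \<triangle> T'. if j \<le> i then -1 else 1) = (\<Prod>j\<in>T. if j \<le> i then -1 else 1) * (\<Prod>j\<in>T'. if j \<le> i then -1 else (1::real))" for i
    using assms by (intro prod_symdiff) auto
  then show ?thesis using assms by (simp only: cl_sign_eq_prod finite_Un finite_Diff simp_thms prod.distrib)
qed

lemma cl_sign_square: "cl_sign S T * cl_sign S T = 1"
  unfolding cl_sign_def by (simp flip: power_add add: mult_2[symmetric])

lemma cl_sign_empty [simp]: "cl_sign {} T = 1" "cl_sign S {} = 1"
  unfolding cl_sign_def by auto

lemma cl_sign_singletons: "cl_sign {i} {j} = (if j \<le> i then -1 else 1)"
  by (simp add: cl_sign_eq_prod)

text \<open>For fixed S and U the only T with \<open>S \<triangle> T = U\<close> is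
  \<open>S \<triangle> U\<close>, so one of the two sums collapses.\<close>

lemma cl_mult_apply:
  "cl_mult d x y U = (if U \<subseteq> {..<d} then \<Sum>S\<in>Pow {..<d}. cl_sign S (S \<triangle> U) * x S * y (S \<triangle> U) else 0)"
proof -
  have "(\<Sum>T\<in>Pow {..<d}. if S \<triangle> T = U then cl_sign S T * x S * y T else 0)
      = (if U \<subseteq> {..<d} then cl_sign S (S \<triangle> U) * x S * y (S \<triangle> U) else 0)" if "S \<in> Pow {..<d}" for S
  proof -
    have "(\<Sum>T\<in>Pow {..<d}. if S \<triangle> T = U then cl_sign S T * x S * y T else 0)
      = (\<Sum>T\<in>Pow {..<d}. if T = S \<triangle> U then cl_sign S T * x S * y T else 0)"
      by (simp only: symdiff_eq_iff)
    also have "\<dots> = (if S \<triangle> U \<in> Pow {..<d} then cl_sign S (S \<triangle> U) * x S * y (S \<triangle> U) else 0)"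
      by (simp add: sum.delta')
    also have "S \<triangle> U \<in> Pow {..<d} \<longleftrightarrow> U \<subseteq> {..<d}" using that by blast
    finally show ?thesis .
  qed
  then show ?thesis unfolding cl_mult_def by simp
qed

text \<open>Coefficient functions are defined on all sets of naturals; the unit laws hold only for
  those that vanish off the subsets of \<open>{..<d}\<close>.\<close>

definition cl_carrier :: "nat \<Rightarrow> cl set" where
  "cl_carrier d = {x. \<forall>U. \<not> U \<subseteq> {..<d} \<longrightarrow> x U = 0}"

lemma cl_mult_carrier: "cl_mult d x y \<in> cl_carrier d"
  unfolding cl_carrier_def by (simp add: cl_mult_apply)

lemma cl_one_carrier: "cl_one \<in> cl_carrier d"
  unfolding cl_carrier_def cl_one_def by auto

text \<open>A bicharacter is a 2-cocycle, which is exactly associativity of the twisted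
  product.\<close>

lemma cl_mult_assoc: "cl_mult d (cl_mult d x y) z = cl_mult d x (cl_mult d y z)"
proof
  fix U
  show "cl_mult d (cl_mult d x y) z U = cl_mult d x (cl_mult d y z) U"
  proof (cases "U \<subseteq> {..<d}")
    case U: True
    have fin: "finite S" if "S \<subseteq> {..<d}" for S using that finite_subset by blast
    have sub: "S \<triangle> T \<subseteq> {..<d}" if "S \<subseteq> {..<d}" "T \<subseteq> {..<d}" for S T using that by blast
    have "cl_mult d (cl_mult d x y) z U = (\<Sum>S\<in>Pow {..<d}. \<Sum>R\<in>Pow {..<d}.
        cl_sign S (S \<triangle> U) * (cl_sign R (R \<triangle> S) * x R * y (R \<triangle> S)) * z (S \<triangle> U))"
      using U by (simp add: cl_mult_apply sum_distrib_left sum_distrib_right)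
    also have "\<dots> = (\<Sum>R\<in>Pow {..<d}. \<Sum>S\<in>Pow {..<d}.
        cl_sign S (S \<triangle> U) * (cl_sign R (R \<triangle> S) * x R * y (R \<triangle> S)) * z (S \<triangle> U))"
      by (rule sum.swap)
    also have "\<dots> = (\<Sum>R\<in>Pow {..<d}. \<Sum>Q\<in>Pow {..<d}.
        cl_sign R (R \<triangle> U) * x R * (cl_sign Q (Q \<triangle> (R \<triangle> U)) * y Q * z (Q \<triangle> (R \<triangle> U))))"
    proof (rule sum.cong[OF refl])
      fix R assume "R \<in> Pow {..<d}"
      then have R: "R \<subseteq> {..<d}" by simp
      \<comment> \<open>S is the index of the product of the R- and Q-terms; writing it as
        \<open>R \<triangle> Q\<close> turns the sum into one over Q.\<close>
      have bij: "bij_betw (\<lambda>S. R \<triangle> S) (Pow {..<d}) (Pow {..<d})"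
        by (rule bij_betw_byWitness[where f' = "\<lambda>S. R \<triangle> S"]) (use R in \<open>auto simp: symdiff_cancel\<close>)
      have "cl_sign S (S \<triangle> U) * (cl_sign R (R \<triangle> S) * x R * y (R \<triangle> S)) * z (S \<triangle> U)
         = cl_sign R (R \<triangle> U) * x R * (cl_sign (R \<triangle> S) ((R \<triangle> S) \<triangle> (R \<triangle> U)) * y (R \<triangle> S) * z ((R \<triangle> S) \<triangle> (R \<triangle> U)))"
        if "S \<in> Pow {..<d}" for S
      proof -
        have S: "S \<subseteq> {..<d}" using that by simp
        have e: "(R \<triangle> S) \<triangle> (R \<triangle> U) = S \<triangle> U" by blast
        have "cl_sign R (R \<triangle> U) * cl_sign (R \<triangle> S) (S \<triangle> U) = cl_sign S (S \<triangle> U) * cl_sign R (R \<triangle> S)"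
          using fin[OF R] fin[OF S] fin[OF U] cl_sign_square[of R U]
          by (simp add: cl_sign_symdiff_left cl_sign_symdiff_right algebra_simps)
        then show ?thesis unfolding e by (simp add: algebra_simps)
      qed
      then show "(\<Sum>S\<in>Pow {..<d}. cl_sign S (S \<triangle> U) * (cl_sign R (R \<triangle> S) * x R * y (R \<triangle> S)) * z (S \<triangle> U))
        = (\<Sum>Q\<in>Pow {..<d}. cl_sign R (R \<triangle> U) * x R * (cl_sign Q (Q \<triangle> (R \<triangle> U)) * y Q * z (Q \<triangle> (R \<triangle> U))))"
        by (subst sum.reindex_bij_betw[OF bij, symmetric]) (rule sum.cong[OF refl])
    qed
    also have "\<dots> = cl_mult d x (cl_mult d y z) U"
      using U by (auto simp: cl_mult_apply sum_distrib_left intro!: sum.cong)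
    finally show ?thesis .
  qed (simp add: cl_mult_apply)
qed

lemma cl_mult_one_left: "x \<in> cl_carrier d \<Longrightarrow> cl_mult d cl_one x = x"
proof
  fix U assume x: "x \<in> cl_carrier d"
  have "(\<Sum>S\<in>Pow {..<d}. cl_sign S (S \<triangle> U) * cl_one S * x (S \<triangle> U)) = (\<Sum>S\<in>Pow {..<d}. if S = {} then x U else 0)"
    by (rule sum.cong) (auto simp: cl_one_def)
  then show "cl_mult d cl_one x U = x U"
    using x by (auto simp: cl_mult_apply cl_carrier_def)
qed

lemma cl_mult_one_right: "x \<in> cl_carrier d \<Longrightarrow> cl_mult d x cl_one = x"
proof
  fix U assume x: "x \<in> cl_carrier d"
  have "(\<Sum>S\<in>Pow {..<d}. cl_sign S (S \<triangle> U) * x S * cl_one (S \<triangle> U)) = (\<Sum>S\<in>Pow {..<d}. if S = U then x U else 0)"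
    by (rule sum.cong) (auto simp: cl_one_def)
  then show "cl_mult d x cl_one U = x U"
    using x by (auto simp: cl_mult_apply cl_carrier_def)
qed

lemma cl_mult_scale_left: "cl_mult d (\<lambda>U. c * x U) y = (\<lambda>U. c * cl_mult d x y U)"
  by (auto simp: fun_eq_iff cl_mult_apply sum_distrib_left intro!: sum.cong)

lemma cl_mult_scale_right: "cl_mult d x (\<lambda>U. c * y U) = (\<lambda>U. c * cl_mult d x y U)"
  by (auto simp: fun_eq_iff cl_mult_apply sum_distrib_left intro!: sum.cong)

lemma cl_mult_add_left: "cl_mult d (\<lambda>U. x U + x' U) y = (\<lambda>U. cl_mult d x y U + cl_mult d x' y U)"
  by (auto simp: fun_eq_iff cl_mult_apply algebra_simps simp flip: sum.distrib intro!: sum.cong)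

lemma cl_vec_apply: "v \<in> carrier_vec d \<Longrightarrow> cl_vec v U = (if \<exists>i<d. U = {i} then v $ (the_elem U) else 0)"
  unfolding cl_vec_def by (auto simp: card_1_singleton_iff)

lemma cl_vec_singleton: "v \<in> carrier_vec d \<Longrightarrow> i < d \<Longrightarrow> cl_vec v {i} = v $ i"
  by (simp add: cl_vec_apply)

lemma cl_vec_carrier: "v \<in> carrier_vec d \<Longrightarrow> cl_vec v \<in> cl_carrier d"
  unfolding cl_carrier_def by (auto simp: cl_vec_apply)

lemma cl_vec_inj:
  assumes "v \<in> carrier_vec d" "w \<in> carrier_vec d" "cl_vec v = cl_vec w"
  shows "v = w"
  using assms by (intro eq_vecI) (auto simp flip: cl_vec_singleton)

lemma cl_vec_scale_add:
  assumes "v \<in> carrier_vec d" "w \<in> carrier_vec d"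
  shows "cl_vec (a \<cdot>\<^sub>v v + w) = (\<lambda>U. a * cl_vec v U + cl_vec w U)"
proof
  fix U
  have "a \<cdot>\<^sub>v v + w \<in> carrier_vec d" using assms by simp
  then show "cl_vec (a \<cdot>\<^sub>v v + w) U = a * cl_vec v U + cl_vec w U"
    using assms by (auto simp: cl_vec_apply[of _ d])
qed

lemma cl_vec_uminus: "v \<in> carrier_vec d \<Longrightarrow> cl_vec (- v) = (\<lambda>U. - cl_vec v U)"
  by (rule ext) (subst cl_vec_apply[of _ d], auto simp: cl_vec_apply)

lemma sum_Pow_singletons:
  fixes g :: "nat set \<Rightarrow> real"
  assumes "\<And>S. \<nexists>i. i < d \<and> S = {i} \<Longrightarrow> g S = 0"
  shows "(\<Sum>S\<in>Pow {..<d}. g S) = (\<Sum>i<d. g {i})"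
proof -
  have "(\<Sum>S\<in>Pow {..<d}. g S) = (\<Sum>S\<in>(\<lambda>i. {i}) ` {..<d}. g S)"
    by (rule sum.mono_neutral_right) (use assms in auto)
  also have "\<dots> = (\<Sum>i<d. g {i})" by (subst sum.reindex) (auto simp: inj_on_def)
  finally show ?thesis .
qed

lemma cl_vec_mult_left:
  assumes "v \<in> carrier_vec d"
  shows "cl_mult d (cl_vec v) y U =
    (if U \<subseteq> {..<d} then \<Sum>i<d. cl_sign {i} ({i} \<triangle> U) * v $ i * y ({i} \<triangle> U) else 0)"
  unfolding cl_mult_apply
  by (subst sum_Pow_singletons) (auto simp: cl_vec_apply[OF assms])

lemma cl_vec_mult_right:
  assumes "v \<in> carrier_vec d"
  shows "cl_mult d x (cl_vec v) U =
    (if U \<subseteq> {..<d} then \<Sum>i<d. cl_sign ({i} \<triangle> U) {i} * x ({i} \<triangle> U) * v $ i else 0)"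
proof (cases "U \<subseteq> {..<d}")
  case True
  have bij: "bij_betw (\<lambda>S. U \<triangle> S) (Pow {..<d}) (Pow {..<d})"
    by (rule bij_betw_byWitness[where f' = "\<lambda>S. U \<triangle> S"]) (use True in \<open>auto simp: symdiff_cancel\<close>)
  have e: "(U \<triangle> S) \<triangle> U = S" for S :: "nat set" by blast
  have e2: "U \<triangle> S = S \<triangle> U" for S :: "nat set" by blast
  have "cl_mult d x (cl_vec v) U = (\<Sum>S\<in>Pow {..<d}. cl_sign (U \<triangle> S) ((U \<triangle> S) \<triangle> U) * x (U \<triangle> S) * cl_vec v ((U \<triangle> S) \<triangle> U))"
    unfolding cl_mult_apply using True
    by (simp only: if_True) (rule sum.reindex_bij_betw[OF bij, symmetric])
  also have "\<dots> = (\<Sum>S\<in>Pow {..<d}. cl_sign (S \<triangle> U) S * x (S \<triangle> U) * cl_vec v S)"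
    by (simp only: e) (simp only: e2)
  also have "\<dots> = (\<Sum>i<d. cl_sign ({i} \<triangle> U) {i} * x ({i} \<triangle> U) * cl_vec v {i})"
    by (subst sum_Pow_singletons) (auto simp: cl_vec_apply[OF assms])
  finally show ?thesis using True by (auto simp: cl_vec_singleton[OF assms] intro!: sum.cong)
qed (simp add: cl_mult_apply)

text \<open>The Clifford relation uv + vu = -2 <u,v>, stated as left multiplication on an arbitrary
  element so that it applies at the front of a word. In coordinates the mixed terms cancel in pairs
  and the diagonal ones add up.\<close>

lemma cl_vec_anticommute:
  assumes u: "u \<in> carrier_vec d" and v: "v \<in> carrier_vec d" and y: "y \<in> cl_carrier d"
  shows "cl_mult d (cl_vec u) (cl_mult d (cl_vec v) y) U + cl_mult d (cl_vec v) (cl_mult d (cl_vec u) y) U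
    = - 2 * (u \<bullet> v) * y U"
proof (cases "U \<subseteq> {..<d}")
  case U: True
  have finU: "finite U" using U finite_subset by blast
  define c where "c i j = cl_sign {i} ({i} \<triangle> U) * cl_sign {j} ({j} \<triangle> ({i} \<triangle> U)) * y ({j} \<triangle> ({i} \<triangle> U))" for i j
  have exp: "cl_mult d (cl_vec a) (cl_mult d (cl_vec b) y) U = (\<Sum>i<d. \<Sum>j<d. a $ i * b $ j * c i j)"
    if "a \<in> carrier_vec d" "b \<in> carrier_vec d" for a b
  proof -
    have "{i} \<triangle> U \<subseteq> {..<d}" if "i < d" for i using that U by blast
    then show ?thesis using U that
      by (auto simp: cl_vec_mult_left c_def sum_distrib_left mult_ac intro!: sum.cong)
  qed
  \<comment> \<open>For i and j distinct the two orders differ only by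
    \<open>cl_sign {i} {j}\<close> against \<open>cl_sign {j} {i}\<close>, which are opposite
    because exactly one of j \<le> i and i \<le> j holds.\<close>
  have cc: "c i j + c j i = (if i = j then - 2 * y U else 0)" for i j
  proof (cases "i = j")
    case True
    have "cl_sign {i} ({i} \<triangle> U) * cl_sign {i} ({i} \<triangle> ({i} \<triangle> U)) = -1"
      using finU cl_sign_square[of "{i}" U]
      by (simp add: symdiff_cancel cl_sign_symdiff_right cl_sign_singletons algebra_simps)
    then show ?thesis using True unfolding c_def by (simp add: symdiff_cancel)
  next
    case False
    have e: "{j} \<triangle> ({i} \<triangle> U) = {i} \<triangle> ({j} \<triangle> U)" by blast
    have 1: "cl_sign {i} ({i} \<triangle> U) * cl_sign {j} ({j} \<triangle> ({i} \<triangle> U)) = cl_sign {j} {i} * (cl_sign {i} U * cl_sign {j} U)"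
      using finU by (simp add: cl_sign_symdiff_right cl_sign_singletons)
    have 2: "cl_sign {j} ({j} \<triangle> U) * cl_sign {i} ({i} \<triangle> ({j} \<triangle> U)) = cl_sign {i} {j} * (cl_sign {i} U * cl_sign {j} U)"
      using finU by (simp add: cl_sign_symdiff_right cl_sign_singletons)
    have "cl_sign {j} {i} = - cl_sign {i} {j}" using False by (auto simp: cl_sign_singletons)
    then show ?thesis using False 1 2 unfolding c_def e by (simp add: algebra_simps)
  qed
  have "cl_mult d (cl_vec u) (cl_mult d (cl_vec v) y) U + cl_mult d (cl_vec v) (cl_mult d (cl_vec u) y) U
    = (\<Sum>i<d. \<Sum>j<d. u $ i * v $ j * c i j) + (\<Sum>j<d. \<Sum>i<d. v $ j * u $ i * c j i)"
    by (simp add: exp u v)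
  also have "(\<Sum>j<d. \<Sum>i<d. v $ j * u $ i * c j i) = (\<Sum>i<d. \<Sum>j<d. v $ j * u $ i * c j i)"
    by (rule sum.swap)
  also have "(\<Sum>i<d. \<Sum>j<d. u $ i * v $ j * c i j) + \<dots> = (\<Sum>i<d. \<Sum>j<d. u $ i * v $ j * (c i j + c j i))"
    by (simp add: algebra_simps sum.distrib)
  also have "\<dots> = (\<Sum>i<d. \<Sum>j<d. if i = j then u $ i * v $ i * (- 2 * y U) else 0)"
    unfolding cc by (intro sum.cong refl) auto
  also have "\<dots> = (\<Sum>i<d. u $ i * v $ i * (- 2 * y U))"
    by (rule sum.cong) auto
  also have "\<dots> = - 2 * (u \<bullet> v) * y U"
    using v by (simp add: scalar_prod_def sum_distrib_left sum_distrib_right atLeast0LessThan mult_ac flip: sum_negf)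
  finally show ?thesis .
qed (use y in \<open>auto simp: cl_mult_apply cl_carrier_def\<close>)

section \<open>Words of unit vectors and the reflections that they induce\<close>

definition unit_list :: "nat \<Rightarrow> real vec list \<Rightarrow> bool" where
  "unit_list d us \<longleftrightarrow> (\<forall>u\<in>set us. u \<in> carrier_vec d \<and> u \<bullet> u = 1)"

definition cl_word :: "nat \<Rightarrow> real vec list \<Rightarrow> cl" where
  "cl_word d us = foldr (cl_mult d) (map cl_vec us) cl_one"

definition reflection :: "nat \<Rightarrow> real vec \<Rightarrow> real mat" where
  "reflection d u = mat d d (\<lambda>(i, j). (if i = j then 1 else 0) - 2 * u $ i * u $ j)"

definition refl_word :: "nat \<Rightarrow> real vec list \<Rightarrow> real mat" where
  "refl_word d us = foldr (\<lambda>u M. reflection d u * M) us (1\<^sub>m d)"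

lemma unit_list_simps [simp]:
  "unit_list d []"
  "unit_list d (u # us) \<longleftrightarrow> u \<in> carrier_vec d \<and> u \<bullet> u = 1 \<and> unit_list d us"
  "unit_list d (us @ vs) \<longleftrightarrow> unit_list d us \<and> unit_list d vs"
  by (auto simp: unit_list_def)

lemma cl_word_simps [simp]:
  "cl_word d [] = cl_one"
  "cl_word d (u # us) = cl_mult d (cl_vec u) (cl_word d us)"
  by (simp_all add: cl_word_def)

lemma refl_word_simps [simp]:
  "refl_word d [] = 1\<^sub>m d"
  "refl_word d (u # us) = reflection d u * refl_word d us"
  by (simp_all add: refl_word_def)

lemma pin_eq: "pin d = {cl_word d us | us. unit_list d us}"
  unfolding pin_def cl_word_def unit_list_def by simp

lemma cl_word_carrier: "cl_word d us \<in> cl_carrier d"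
  by (cases us) (auto simp: cl_one_carrier cl_mult_carrier)

lemma reflection_carrier [simp]: "reflection d u \<in> carrier_mat d d"
  by (simp add: reflection_def)

lemma refl_word_carrier [simp]: "refl_word d us \<in> carrier_mat d d"
  by (induction us) (auto intro: mult_carrier_mat reflection_carrier)

lemma cl_word_append: "cl_word d (us @ vs) = cl_mult d (cl_word d us) (cl_word d vs)"
  by (induction us) (simp_all add: cl_mult_one_left cl_word_carrier cl_mult_assoc)

lemma unit_vec_square:
  assumes "u \<in> carrier_vec d" "u \<bullet> u = 1" "y \<in> cl_carrier d"
  shows "cl_mult d (cl_vec u) (cl_mult d (cl_vec u) y) = (\<lambda>U. - y U)"
  using cl_vec_anticommute[OF assms(1,1,3)] assms(2) by (auto simp: fun_eq_iff)

lemma cl_vec_uminus_mult: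
  assumes "u \<in> carrier_vec d"
  shows "cl_mult d (cl_vec (- u)) y = (\<lambda>U. - cl_mult d (cl_vec u) y U)"
  using cl_mult_scale_left[of d "-1" "cl_vec u" y] assms by (simp add: cl_vec_uminus)

lemma cl_word_inverse:
  assumes "unit_list d us"
  shows "cl_mult d (cl_word d us) (cl_word d (rev (map uminus us))) = cl_one"
    and "cl_mult d (cl_word d (rev (map uminus us))) (cl_word d us) = cl_one"
proof -
  have *: "cl_mult d (cl_word d us) (cl_word d (rev (map uminus us))) = cl_one \<and>
    cl_mult d (cl_word d (rev (map uminus us))) (cl_word d us) = cl_one"
    using assms
  proof (induction us)
    case Nil
    then show ?case by (simp add: cl_mult_one_left cl_one_carrier)
  next
    case (Cons u us)
    let ?W = "cl_word d us" and ?W' = "cl_word d (rev (map uminus us))"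
    have u: "u \<in> carrier_vec d" "u \<bullet> u = 1" and IH: "cl_mult d ?W ?W' = cl_one" "cl_mult d ?W' ?W = cl_one"
      using Cons by auto
    have last: "cl_word d (rev (map uminus (u # us))) = cl_mult d ?W' (cl_vec (- u))"
      using u by (simp add: cl_word_append cl_mult_one_right cl_vec_carrier)
    have a: "cl_mult d (cl_vec u) (cl_vec (- u)) = cl_one"
    proof -
      have "cl_mult d (cl_vec u) (cl_vec (- u)) = (\<lambda>U. - cl_mult d (cl_vec u) (cl_mult d (cl_vec u) cl_one) U)"
        using u cl_mult_scale_right[of d "cl_vec u" "-1" "cl_vec u"]
        by (simp add: cl_vec_uminus cl_mult_one_right cl_vec_carrier)
      then show ?thesis using unit_vec_square[OF u cl_one_carrier] by simp
    qed
    have b: "cl_mult d (cl_vec (- u)) (cl_mult d (cl_vec u) y) = y" if "y \<in> cl_carrier d" for y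
      using unit_vec_square[OF u that] u by (simp add: cl_vec_uminus_mult)
    have "cl_mult d (cl_mult d (cl_vec u) ?W) (cl_mult d ?W' (cl_vec (- u)))
        = cl_mult d (cl_vec u) (cl_mult d (cl_mult d ?W ?W') (cl_vec (- u)))"
      by (simp add: cl_mult_assoc)
    also have "\<dots> = cl_one" using u by (simp add: IH a cl_mult_one_left cl_vec_carrier)
    finally have 1: "cl_mult d (cl_mult d (cl_vec u) ?W) (cl_mult d ?W' (cl_vec (- u))) = cl_one" .
    have "cl_mult d (cl_mult d ?W' (cl_vec (- u))) (cl_mult d (cl_vec u) ?W)
        = cl_mult d ?W' (cl_mult d (cl_vec (- u)) (cl_mult d (cl_vec u) ?W))"
      by (simp add: cl_mult_assoc)
    also have "\<dots> = cl_one" by (simp add: IH b cl_word_carrier)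
    finally show ?case using 1 unfolding last by simp
  qed
  then show "cl_mult d (cl_word d us) (cl_word d (rev (map uminus us))) = cl_one"
    and "cl_mult d (cl_word d (rev (map uminus us))) (cl_word d us) = cl_one" by auto
qed

lemma unit_list_inverse: "unit_list d us \<Longrightarrow> unit_list d (rev (map uminus us))"
  unfolding unit_list_def by auto

lemma card_symdiff_singleton:
  assumes "finite U"
  shows "even (card ({i} \<triangle> U)) \<longleftrightarrow> odd (card U)"
proof (cases "i \<in> U")
  case True
  then have "{i} \<triangle> U = U - {i}" by auto
  then show ?thesis using True assms by (simp add: card_gt_0_iff) (metis Suc_pred card_gt_0_iff empty_iff even_Suc)
next
  case False
  then have "{i} \<triangle> U = insert i U" by auto
  then show ?thesis using False assms by simp
qed

text \<open>Each vector changes the parity of the degree, so a word is homogeneous for the Z/2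
  grading. Hence \<open>cl_alpha\<close> acts on it by a sign, and its length modulo 2 can be read
  off any nonzero coefficient.\<close>

lemma cl_word_parity: "cl_word d us U \<noteq> 0 \<Longrightarrow> set us \<subseteq> carrier_vec d \<Longrightarrow> even (card U + length us)"
proof (induction us arbitrary: U)
  case Nil
  then show ?case by (auto simp: cl_one_def split: if_splits)
next
  case (Cons u us)
  then have u: "u \<in> carrier_vec d" and nz: "cl_mult d (cl_vec u) (cl_word d us) U \<noteq> 0" by auto
  then have U: "U \<subseteq> {..<d}" by (auto simp: cl_mult_apply split: if_splits)
  then have fin: "finite U" using finite_subset by blast
  have "\<exists>i. cl_word d us ({i} \<triangle> U) \<noteq> 0"
  proof (rule ccontr)
    assume "\<nexists>i. cl_word d us ({i} \<triangle> U) \<noteq> 0"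
    then have z: "cl_word d us ({i} \<triangle> U) = 0" for i by blast
    show False using nz unfolding cl_vec_mult_left[OF u] z mult_zero_right sum.neutral_const if_cancel by blast
  qed
  then obtain i where "cl_word d us ({i} \<triangle> U) \<noteq> 0" ..
  then have "even (card ({i} \<triangle> U) + length us)" using Cons by auto
  then show ?case using card_symdiff_singleton[OF fin, of i]
    by (simp only: even_add length_Cons even_Suc) blast
qed

lemma cl_alpha_word:
  assumes "unit_list d us"
  shows "cl_alpha (cl_word d us) = (\<lambda>U. (-1) ^ length us * cl_word d us U)"
proof
  fix U
  have "cl_word d us U = 0 \<or> even (card U + length us)"
    using cl_word_parity[of d us U] assms unfolding unit_list_def by auto
  then show "cl_alpha (cl_word d us) U = (-1) ^ length us * cl_word d us U"
    unfolding cl_alpha_def by (auto simp: minus_one_power_iff)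
qed

lemma reflection_mult_vec:
  assumes "u \<in> carrier_vec d" "v \<in> carrier_vec d"
  shows "reflection d u *\<^sub>v v = (- 2 * (u \<bullet> v)) \<cdot>\<^sub>v u + v"
proof (rule eq_vecI)
  fix i assume "i < dim_vec ((- 2 * (u \<bullet> v)) \<cdot>\<^sub>v u + v)"
  then have i: "i < d" using assms by simp
  have "(reflection d u *\<^sub>v v) $ i = (\<Sum>j\<in>{0..<d}. ((if i = j then 1 else 0) - 2 * u $ i * u $ j) * v $ j)"
    using i assms by (simp add: reflection_def scalar_prod_def)
  also have "\<dots> = (\<Sum>j\<in>{0..<d}. (if i = j then v $ j else 0)) - 2 * u $ i * (\<Sum>j\<in>{0..<d}. u $ j * v $ j)"
    unfolding sum_distrib_left sum_subtractf[symmetric] by (rule sum.cong) (auto simp: algebra_simps)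
  finally show "(reflection d u *\<^sub>v v) $ i = ((- 2 * (u \<bullet> v)) \<cdot>\<^sub>v u + v) $ i"
    using i assms by (simp add: scalar_prod_def)
qed (use assms in \<open>simp add: reflection_def\<close>)

text \<open>Moving a vector past one unit vector u reflects it in u and costs a factor -1. The
  accumulated sign is the one by which \<open>cl_alpha\<close> changes the word, so that the twisted
  action in the next lemma has no sign.\<close>

lemma refl_word_action:
  assumes "unit_list d us" "v \<in> carrier_vec d"
  shows "cl_mult d (cl_word d us) (cl_vec v) =
    (\<lambda>U. (-1) ^ length us * cl_mult d (cl_vec (refl_word d us *\<^sub>v v)) (cl_word d us) U)"
  using assms
proof (induction us)
  case Nil
  then show ?case by (simp add: cl_mult_one_left cl_mult_one_right cl_vec_carrier)
next
  case (Cons u us)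
  let ?W = "cl_word d us" and ?l = "length us"
  define w where "w = refl_word d us *\<^sub>v v"
  have u: "u \<in> carrier_vec d" "u \<bullet> u = 1" using Cons by auto
  have w: "w \<in> carrier_vec d" using Cons.prems unfolding w_def by (metis mult_mat_vec_carrier refl_word_carrier)
  have IH: "cl_mult d ?W (cl_vec v) = (\<lambda>U. (-1) ^ ?l * cl_mult d (cl_vec w) ?W U)"
    using Cons unfolding w_def by auto
  have R: "refl_word d (u # us) *\<^sub>v v = (- 2 * (u \<bullet> w)) \<cdot>\<^sub>v u + w"
    using u w Cons.prems by (simp add: w_def reflection_mult_vec assoc_mult_mat_vec[of _ d d _ d])
  show ?case
  proof
    fix U
    have "cl_mult d (cl_word d (u # us)) (cl_vec v) U = (-1) ^ ?l * cl_mult d (cl_vec u) (cl_mult d (cl_vec w) ?W) U"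
      by (simp add: cl_mult_assoc IH cl_mult_scale_right)
    moreover have "cl_mult d (cl_vec u) (cl_mult d (cl_vec w) ?W) U
        = - 2 * (u \<bullet> w) * ?W U - cl_mult d (cl_vec w) (cl_mult d (cl_vec u) ?W) U"
      using cl_vec_anticommute[OF u(1) w cl_word_carrier, of us U] by simp
    moreover have "cl_mult d (cl_vec (refl_word d (u # us) *\<^sub>v v)) (cl_word d (u # us)) U
        = 2 * (u \<bullet> w) * ?W U + cl_mult d (cl_vec w) (cl_mult d (cl_vec u) ?W) U"
      unfolding R cl_vec_scale_add[OF u(1) w] cl_mult_add_left cl_mult_scale_left
      using unit_vec_square[OF u cl_word_carrier, of us] by simp
    ultimately show "cl_mult d (cl_word d (u # us)) (cl_vec v) U = (-1) ^ length (u # us) *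
        cl_mult d (cl_vec (refl_word d (u # us) *\<^sub>v v)) (cl_word d (u # us)) U"
      by (simp add: algebra_simps)
  qed
qed

lemma refl_word_action_alpha:
  assumes "unit_list d us" "v \<in> carrier_vec d"
  shows "cl_mult d (cl_alpha (cl_word d us)) (cl_vec v) = cl_mult d (cl_vec (refl_word d us *\<^sub>v v)) (cl_word d us)"
  unfolding cl_alpha_word[OF assms(1)] cl_mult_scale_left refl_word_action[OF assms]
  by (auto simp: fun_eq_iff simp flip: power_add mult.assoc)

lemma cl_word_cancel_right:
  assumes "unit_list d us" "x \<in> cl_carrier d" "y \<in> cl_carrier d" "cl_mult d x (cl_word d us) = cl_mult d y (cl_word d us)"
  shows "x = y"
proof -
  have "cl_mult d (cl_mult d x (cl_word d us)) (cl_word d (rev (map uminus us)))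
      = cl_mult d (cl_mult d y (cl_word d us)) (cl_word d (rev (map uminus us)))" using assms by simp
  then show ?thesis using assms(1-3) by (metis cl_mult_assoc cl_word_inverse(1) cl_mult_one_right)
qed

lemma mat_mult_unit_vec:
  fixes A :: "'a :: comm_ring_1 mat"
  assumes "A \<in> carrier_mat d d'" "j < d'"
  shows "A *\<^sub>v unit_vec d' j = col A j"
  using assms by (intro eq_vecI) auto

text \<open>Uniqueness of the matrix, required by the definite description, holds because a word can
  be cancelled on the right and a vector is determined by its Clifford element.\<close>

lemma pin_rho_word:
  assumes "unit_list d us"
  shows "pin_rho d (cl_word d us) = refl_word d us"
  unfolding pin_rho_def
proof (rule the_equality)
  have "refl_word d us *\<^sub>v unit_vec d j = col (refl_word d us) j" if "j < d" for j
    using that by (simp add: mat_mult_unit_vec[of _ d d])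
  then show "refl_word d us \<in> carrier_mat d d \<and>
    (\<forall>j<d. cl_mult d (cl_alpha (cl_word d us)) (cl_vec (unit_vec d j)) =
           cl_mult d (cl_vec (col (refl_word d us) j)) (cl_word d us))"
    using refl_word_action_alpha[OF assms, of "unit_vec d _"] by simp
next
  fix M assume M: "M \<in> carrier_mat d d \<and>
    (\<forall>j<d. cl_mult d (cl_alpha (cl_word d us)) (cl_vec (unit_vec d j)) = cl_mult d (cl_vec (col M j)) (cl_word d us))"
  show "M = refl_word d us"
  proof (rule mat_col_eqI)
    fix j assume "j < dim_col (refl_word d us)"
    then have j: "j < d" using refl_word_carrier[of d us] by auto
    have c: "col M j \<in> carrier_vec d" "col (refl_word d us) j \<in> carrier_vec d"
      using M by (auto intro: col_carrier_vec[OF j] refl_word_carrier simp del: col_dim)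
    have "refl_word d us *\<^sub>v unit_vec d j = col (refl_word d us) j"
      using j by (simp add: mat_mult_unit_vec[of _ d d])
    then have "cl_mult d (cl_vec (col M j)) (cl_word d us) = cl_mult d (cl_vec (col (refl_word d us) j)) (cl_word d us)"
      using refl_word_action_alpha[OF assms, of "unit_vec d j"] M j by simp
    then have "cl_vec (col M j) = cl_vec (col (refl_word d us) j)"
      by (rule cl_word_cancel_right[OF assms, rotated 2]) (use c in \<open>auto intro: cl_vec_carrier\<close>)
    then show "col M j = col (refl_word d us) j" using c cl_vec_inj by blast
  qed (use M carrier_matD[OF refl_word_carrier[of d us]] in auto)
qed

text \<open>For j in U the generator passes itself without a sign and anticommutes with the other
  |U| - 1 members of U.\<close>

lemma cl_sign_commute_singleton:
  assumes "finite U" "j \<in> U"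
  shows "cl_sign U {j} = - ((-1) ^ card U) * cl_sign {j} U"
proof -
  have "cl_sign U {j} = (\<Prod>i\<in>U. if j \<le> i then -1 else 1)" using assms by (simp add: cl_sign_eq_prod)
  also have "\<dots> = - (\<Prod>i\<in>U - {j}. if j \<le> i then -1 else 1)" using assms by (simp add: prod.remove)
  also have "(\<Prod>i\<in>U - {j}. if j \<le> i then -1 else (1::real)) = (\<Prod>i\<in>U - {j}. - (if i \<le> j then -1 else 1))"
    by (rule prod.cong) auto
  also have "\<dots> = (-1) ^ card (U - {j}) * (\<Prod>i\<in>U - {j}. if i \<le> j then -1 else 1)"
    by (rule prod_uminus)
  also have "\<dots> = - ((-1) ^ card (U - {j})) * (\<Prod>i\<in>U. if i \<le> j then -1 else 1)"
    using assms by (simp add: prod.remove)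
  also have "(\<Prod>i\<in>U. if i \<le> j then -1 else (1::real)) = cl_sign {j} U" using assms by (simp add: cl_sign_eq_prod)
  finally have "cl_sign U {j} = (-1) ^ card (U - {j}) * cl_sign {j} U" by simp
  moreover have "(-1::real) ^ card U = (-1) ^ Suc (card (U - {j}))" by (simp only: card_Suc_Diff1[OF assms])
  ultimately show ?thesis by (simp only: power_Suc)
qed

text \<open>A word acting trivially satisfies alpha(x) v = v x. For nonempty U and j in U, the basis
  element of U fails this relation with j by the sign of the preceding lemma, so its coefficient
  vanishes.\<close>

lemma cl_word_scalar:
  assumes us: "unit_list d us" and R: "refl_word d us = 1\<^sub>m d"
  shows "cl_word d us = (\<lambda>U. cl_word d us {} * cl_one U)"
proof
  fix U
  let ?x = "cl_word d us"
  have "?x U = 0" if ne: "U \<noteq> {}"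
  proof (rule ccontr)
    assume nz: "?x U \<noteq> 0"
    then have U: "U \<subseteq> {..<d}" using cl_word_carrier[of d us] unfolding cl_carrier_def by auto
    then have fin: "finite U" using finite_subset by blast
    obtain j where j: "j \<in> U" using ne by auto
    have par: "even (card U + length us)" using cl_word_parity nz us unfolding unit_list_def by blast
    have jd: "j < d" using j U by auto
    have V: "{j} \<triangle> U \<subseteq> {..<d}" using U jd by auto
    \<comment> \<open>Multiplication by a basis vector permutes basis elements up to sign, so the
      coefficient at \<open>{j} \<triangle> U\<close> comes from U alone.\<close>
    have "cl_mult d ?x (cl_vec (unit_vec d j)) ({j} \<triangle> U) = cl_sign U {j} * ?x U"
    proof -
      have "cl_sign ({i} \<triangle> ({j} \<triangle> U)) {i} * ?x ({i} \<triangle> ({j} \<triangle> U)) * unit_vec d j $ i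
          = (if i = j then cl_sign U {j} * ?x U else 0)" if "i < d" for i
        using that jd by (cases "i = j") (simp_all only: symdiff_cancel index_unit_vec if_True if_False mult_1_right mult_zero_right simp_thms)
      then have "(\<Sum>i<d. cl_sign ({i} \<triangle> ({j} \<triangle> U)) {i} * ?x ({i} \<triangle> ({j} \<triangle> U)) * unit_vec d j $ i)
          = (\<Sum>i<d. if i = j then cl_sign U {j} * ?x U else 0)"
        by (intro sum.cong refl) (simp only: lessThan_iff)
      also have "\<dots> = cl_sign U {j} * ?x U" using jd by simp
      finally show ?thesis
        using cl_vec_mult_right[OF unit_vec_carrier, of d ?x j "{j} \<triangle> U"] V by (simp only: if_True)
    qed
    moreover have "cl_mult d (cl_vec (unit_vec d j)) ?x ({j} \<triangle> U) = cl_sign {j} U * ?x U"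
    proof -
      have "cl_sign {i} ({i} \<triangle> ({j} \<triangle> U)) * unit_vec d j $ i * ?x ({i} \<triangle> ({j} \<triangle> U))
          = (if i = j then cl_sign {j} U * ?x U else 0)" if "i < d" for i
        using that jd by (cases "i = j")
          (simp_all only: symdiff_cancel index_unit_vec if_True if_False mult_1_right mult_zero_right mult_zero_left simp_thms)
      then have "(\<Sum>i<d. cl_sign {i} ({i} \<triangle> ({j} \<triangle> U)) * unit_vec d j $ i * ?x ({i} \<triangle> ({j} \<triangle> U)))
          = (\<Sum>i<d. if i = j then cl_sign {j} U * ?x U else 0)"
        by (intro sum.cong refl) (simp only: lessThan_iff)
      also have "\<dots> = cl_sign {j} U * ?x U" using jd by simp
      finally show ?thesis
        using cl_vec_mult_left[OF unit_vec_carrier, of d j ?x "{j} \<triangle> U"] V by (simp only: if_True)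
    qed
    moreover have "cl_mult d ?x (cl_vec (unit_vec d j)) ({j} \<triangle> U)
        = (-1) ^ length us * cl_mult d (cl_vec (unit_vec d j)) ?x ({j} \<triangle> U)"
      using refl_word_action[OF us, of "unit_vec d j"] R by simp
    moreover have "(-1::real) ^ length us = (-1) ^ card U" using par by (auto simp: minus_one_power_iff)
    ultimately have "- ((-1) ^ card U) * cl_sign {j} U * ?x U = (-1) ^ card U * cl_sign {j} U * ?x U"
      using cl_sign_commute_singleton[OF fin j] by (simp add: mult_ac)
    moreover have "cl_sign {j} U \<noteq> 0" unfolding cl_sign_def by simp
    ultimately show False using nz by simp
  qed
  then show "?x U = ?x {} * cl_one U" by (auto simp: cl_one_def)
qed

section \<open>The coordinate inner product and the kernel of the covering\<close>

definition cl_inner :: "nat \<Rightarrow> cl \<Rightarrow> cl \<Rightarrow> real" where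
  "cl_inner d x y = (\<Sum>U\<in>Pow {..<d}. x U * y U)"

text \<open>A generator permutes the basis up to sign and squares to -1, so its left multiplication
  is skew. For a unit vector, skewness and square -1 together give an isometry, hence words have
  norm 1.\<close>

lemma cl_inner_skew:
  assumes u: "u \<in> carrier_vec d"
  shows "cl_inner d (cl_mult d (cl_vec u) x) y = - cl_inner d x (cl_mult d (cl_vec u) y)"
proof -
  have "cl_inner d (cl_mult d (cl_vec u) x) y
      = (\<Sum>U\<in>Pow {..<d}. \<Sum>i<d. cl_sign {i} ({i} \<triangle> U) * u $ i * x ({i} \<triangle> U) * y U)"
    unfolding cl_inner_def by (simp add: cl_vec_mult_left[OF u] sum_distrib_right)
  also have "\<dots> = (\<Sum>i<d. \<Sum>U\<in>Pow {..<d}. cl_sign {i} ({i} \<triangle> U) * u $ i * x ({i} \<triangle> U) * y U)"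
    by (rule sum.swap)
  also have "\<dots> = (\<Sum>i<d. \<Sum>U\<in>Pow {..<d}. cl_sign {i} U * u $ i * x U * y ({i} \<triangle> U))"
  proof (rule sum.cong[OF refl])
    fix i assume "i \<in> {..<d}"
    then have bij: "bij_betw (\<lambda>S. {i} \<triangle> S) (Pow {..<d}) (Pow {..<d})"
      by (intro bij_betw_byWitness[where f' = "\<lambda>S. {i} \<triangle> S"]) (auto simp: symdiff_cancel)
    show "(\<Sum>U\<in>Pow {..<d}. cl_sign {i} ({i} \<triangle> U) * u $ i * x ({i} \<triangle> U) * y U)
        = (\<Sum>U\<in>Pow {..<d}. cl_sign {i} U * u $ i * x U * y ({i} \<triangle> U))"
      by (subst sum.reindex_bij_betw[OF bij, symmetric]) (simp only: symdiff_cancel)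
  qed
  also have "\<dots> = (\<Sum>U\<in>Pow {..<d}. \<Sum>i<d. cl_sign {i} U * u $ i * x U * y ({i} \<triangle> U))"
    by (rule sum.swap)
  also have "\<dots> = (\<Sum>U\<in>Pow {..<d}. \<Sum>i<d. - (x U * (cl_sign {i} ({i} \<triangle> U) * u $ i * y ({i} \<triangle> U))))"
  proof (intro sum.cong refl)
    fix U i assume "U \<in> Pow {..<d}"
    then have "finite U" using finite_subset by blast
    then have "cl_sign {i} ({i} \<triangle> U) = - cl_sign {i} U"
      by (simp add: cl_sign_symdiff_right cl_sign_singletons)
    then show "cl_sign {i} U * u $ i * x U * y ({i} \<triangle> U) = - (x U * (cl_sign {i} ({i} \<triangle> U) * u $ i * y ({i} \<triangle> U)))"
      by simp
  qed
  also have "\<dots> = - cl_inner d x (cl_mult d (cl_vec u) y)"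
    unfolding cl_inner_def by (simp add: cl_vec_mult_left[OF u] sum_distrib_left sum_negf)
  finally show ?thesis .
qed

lemma cl_word_norm:
  assumes "unit_list d us"
  shows "cl_inner d (cl_word d us) (cl_word d us) = 1"
  using assms
proof (induction us)
  case Nil
  have "cl_inner d cl_one cl_one = (\<Sum>U\<in>Pow {..<d}. if U = {} then 1 else 0)"
    unfolding cl_inner_def by (rule sum.cong) (auto simp: cl_one_def)
  then show ?case by simp
next
  case (Cons u us)
  then show ?case
    by (simp add: cl_inner_skew unit_vec_square cl_word_carrier) (simp add: cl_inner_def sum_negf)
qed

text \<open>A word acting trivially is a scalar, and the norm leaves only the scalars 1 and
  -1.\<close>

lemma cl_word_kernel:
  assumes us: "unit_list d us" and R: "refl_word d us = 1\<^sub>m d"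
  shows "cl_word d us = cl_one \<or> cl_word d us = (\<lambda>U. - cl_one U)"
proof -
  let ?c = "cl_word d us {}"
  have "cl_inner d (\<lambda>U. ?c * cl_one U) (\<lambda>U. ?c * cl_one U) = (\<Sum>U\<in>Pow {..<d}. if U = {} then ?c\<^sup>2 else 0)"
    unfolding cl_inner_def by (rule sum.cong) (auto simp: cl_one_def power2_eq_square)
  then have "?c\<^sup>2 = 1" using cl_word_norm[OF us] cl_word_scalar[OF us R] by simp
  then have "?c = 1 \<or> ?c = -1" by (simp add: power2_eq_1_iff)
  then show ?thesis using cl_word_scalar[OF us R] by auto
qed

lemma reflection_transpose: "transpose_mat (reflection d u) = reflection d u"
  by (rule eq_matI) (auto simp: reflection_def)

lemma reflection_involution:
  assumes "u \<in> carrier_vec d" "u \<bullet> u = 1"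
  shows "reflection d u * reflection d u = 1\<^sub>m d"
proof (rule mat_col_eqI)
  fix j assume "j < dim_col (1\<^sub>m d :: real mat)"
  then have j: "j < d" by simp
  let ?e = "unit_vec d j :: real vec"
  have e: "?e \<in> carrier_vec d" by simp
  have R: "reflection d u *\<^sub>v ?e \<in> carrier_vec d"
    by (metis mult_mat_vec_carrier reflection_carrier e)
  have "col (reflection d u * reflection d u) j = reflection d u *\<^sub>v (reflection d u *\<^sub>v ?e)"
    using j by (simp only: col_mult2[OF reflection_carrier reflection_carrier j] mat_mult_unit_vec[OF reflection_carrier j])
  also have "\<dots> = (- 2 * (u \<bullet> (reflection d u *\<^sub>v ?e))) \<cdot>\<^sub>v u + (reflection d u *\<^sub>v ?e)"
    by (rule reflection_mult_vec[OF assms(1) R])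
  also have "u \<bullet> (reflection d u *\<^sub>v ?e) = - (u \<bullet> ?e)"
    unfolding reflection_mult_vec[OF assms(1) e]
    using assms e by (subst scalar_prod_add_distrib[of _ d]) simp_all
  also have "(- 2 * - (u \<bullet> ?e)) \<cdot>\<^sub>v u + (reflection d u *\<^sub>v ?e) = ?e"
    unfolding reflection_mult_vec[OF assms(1) e] using assms(1) by (intro eq_vecI) auto
  finally show "col (reflection d u * reflection d u) j = col (1\<^sub>m d) j" using j by simp
qed (auto simp: reflection_def)

text \<open>The first vector passes the l remaining, orthogonal ones at the cost of (-1)^l and then
  squares to -1. So each step adds l + 1 to the exponent, giving a triangular number.\<close>

lemma cl_word_square:
  assumes "unit_list d us" "sorted_wrt (\<lambda>u v. u \<bullet> v = 0) us"
  shows "cl_mult d (cl_word d us) (cl_word d us) = (\<lambda>U. (-1) ^ (length us * (length us + 1) div 2) * cl_one U)"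
  using assms
proof (induction us)
  case Nil
  then show ?case by (simp add: cl_mult_one_left cl_one_carrier)
next
  case (Cons u us)
  let ?W = "cl_word d us" and ?l = "length us"
  have u: "u \<in> carrier_vec d" "u \<bullet> u = 1" "\<forall>v\<in>set us. u \<bullet> v = 0" and us: "unit_list d us" using Cons by auto
  have fixu: "refl_word d us *\<^sub>v u = u"
    using us u(3)
  proof (induction us)
    case Nil
    then show ?case using u by simp
  next
    case (Cons v us)
    then have "refl_word d (v # us) *\<^sub>v u = reflection d v *\<^sub>v u"
      using u by (simp add: assoc_mult_mat_vec[of _ d d _ d])
    also have "\<dots> = u" using Cons u by (auto simp: reflection_mult_vec comm_scalar_prod[of v d u] intro!: eq_vecI)
    finally show ?case .
  qed
  have IH: "cl_mult d ?W ?W = (\<lambda>U. (-1) ^ (?l * (?l + 1) div 2) * cl_one U)" using Cons by auto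
  have "cl_mult d (cl_mult d (cl_vec u) ?W) (cl_mult d (cl_vec u) ?W)
      = cl_mult d (cl_vec u) (cl_mult d (cl_mult d ?W (cl_vec u)) ?W)" by (simp add: cl_mult_assoc)
  also have "\<dots> = (\<lambda>U. (-1) ^ ?l * cl_mult d (cl_vec u) (cl_mult d (cl_vec u) (cl_mult d ?W ?W)) U)"
    using refl_word_action[OF us u(1)] by (simp add: fixu cl_mult_scale_left cl_mult_scale_right cl_mult_assoc)
  also have "\<dots> = (\<lambda>U. (-1) ^ (?l + 1 + ?l * (?l + 1) div 2) * cl_one U)"
    using unit_vec_square[OF u(1,2) cl_mult_carrier[of d ?W ?W]] by (simp add: IH power_add mult.assoc)
  also have "?l + 1 + ?l * (?l + 1) div 2 = length (u # us) * (length (u # us) + 1) div 2"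
    by simp
  finally show ?case by simp
qed

section \<open>Orthogonal matrices as products of reflections\<close>

lemma scalar_prod_mult_mat_vec:
  fixes M :: "real mat"
  assumes "M \<in> carrier_mat d d" "v \<in> carrier_vec d" "w \<in> carrier_vec d"
  shows "(M *\<^sub>v v) \<bullet> w = v \<bullet> (transpose_mat M *\<^sub>v w)"
proof -
  have "(M *\<^sub>v v) \<bullet> w = (\<Sum>i\<in>{0..<d}. \<Sum>j\<in>{0..<d}. M $$ (i, j) * v $ j * w $ i)"
    using assms by (simp add: scalar_prod_def sum_distrib_right)
  also have "\<dots> = (\<Sum>j\<in>{0..<d}. \<Sum>i\<in>{0..<d}. M $$ (i, j) * v $ j * w $ i)" by (rule sum.swap)
  also have "\<dots> = v \<bullet> (transpose_mat M *\<^sub>v w)"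
    using assms by (simp add: scalar_prod_def sum_distrib_left mult_ac)
  finally show ?thesis .
qed

lemma orth_mat_inner:
  fixes M :: "real mat"
  assumes "M \<in> carrier_mat d d" "transpose_mat M * M = 1\<^sub>m d" "v \<in> carrier_vec d" "w \<in> carrier_vec d"
  shows "(M *\<^sub>v v) \<bullet> (M *\<^sub>v w) = v \<bullet> w"
proof -
  have "transpose_mat M *\<^sub>v (M *\<^sub>v w) = w"
    using assms by (simp add: assoc_mult_mat_vec[of _ d d _ d, symmetric])
  then show ?thesis using assms by (simp add: scalar_prod_mult_mat_vec[of M d])
qed

text \<open>The difference of two vectors of equal length is orthogonal to their mirror hyperplane;
  c only normalises it.\<close>

lemma unit_vector_between:
  fixes w e :: "real vec"
  assumes "w \<in> carrier_vec d" "e \<in> carrier_vec d" "w \<bullet> w = 1" "e \<bullet> e = 1" "w \<noteq> e"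
  obtains c where "(c \<cdot>\<^sub>v (w - e)) \<bullet> (c \<cdot>\<^sub>v (w - e)) = 1" "reflection d (c \<cdot>\<^sub>v (w - e)) *\<^sub>v w = e"
proof -
  let ?D = "w - e"
  have we: "e \<bullet> w = w \<bullet> e" by (rule comm_scalar_prod[OF assms(2,1)])
  have DD: "?D \<bullet> ?D = 2 - 2 * (w \<bullet> e)" and Dw: "?D \<bullet> w = 1 - w \<bullet> e"
    using assms we by (simp_all add: minus_scalar_prod_distrib[of _ d] scalar_prod_minus_distrib[of _ d])
  have "?D \<noteq> 0\<^sub>v d"
  proof
    assume "?D = 0\<^sub>v d"
    then have "w $ i - e $ i = 0" if "i < d" for i
      using that assms by (metis carrier_vecD index_minus_vec(1) index_zero_vec(1))
    then show False using assms by (metis carrier_vecD eq_iff_diff_eq_0 eq_vecI)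
  qed
  then have pos: "?D \<bullet> ?D > 0"
    using assms conjugate_square_greater_0_vec[of ?D d] by simp
  define c where "c = 1 / sqrt (?D \<bullet> ?D)"
  have cc: "c * c * (?D \<bullet> ?D) = 1" using pos by (simp add: c_def)
  have D: "?D \<in> carrier_vec d" using assms by simp
  have "(c \<cdot>\<^sub>v ?D) \<bullet> (c \<cdot>\<^sub>v ?D) = 1" using D cc by (simp add: mult.assoc)
  moreover have "reflection d (c \<cdot>\<^sub>v ?D) *\<^sub>v w = e"
  proof -
    have "c * c * (2 * (?D \<bullet> w)) = 1" using cc DD Dw by simp
    then have "(- 2 * ((c \<cdot>\<^sub>v ?D) \<bullet> w)) * c = -1" using D assms by (simp add: algebra_simps)
    then have "(- 2 * ((c \<cdot>\<^sub>v ?D) \<bullet> w)) \<cdot>\<^sub>v (c \<cdot>\<^sub>v ?D) = (-1) \<cdot>\<^sub>v ?D"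
      by (simp only: smult_smult_assoc)
    then show ?thesis using D assms by (subst reflection_mult_vec) auto
  qed
  ultimately show ?thesis using that by blast
qed

lemma reflection_eq_self:
  assumes "u \<in> carrier_vec d" "v \<in> carrier_vec d" "u \<bullet> v = 0"
  shows "reflection d u *\<^sub>v v = v"
  using assms by (intro eq_vecI) (auto simp: reflection_mult_vec)

lemma mat_eq_one_if_fixes_units:
  fixes M :: "real mat"
  assumes "M \<in> carrier_mat d d" "\<forall>j<d. M *\<^sub>v unit_vec d j = unit_vec d j"
  shows "M = 1\<^sub>m d"
  using assms by (intro mat_col_eqI) (auto simp flip: mat_mult_unit_vec[of M d d])

lemma unit_vec_prod:
  "i < d \<Longrightarrow> j < d \<Longrightarrow> (unit_vec d i :: real vec) \<bullet> unit_vec d j = (if i = j then 1 else 0)"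
  by (simp add: scalar_prod_right_unit)

text \<open>Induction on the number k of leading basis vectors that the matrix may still move. One
  reflection sends the image of the last of them back without disturbing those already
  fixed.\<close>

theorem Cartan_Dieudonne:
  fixes M :: "real mat"
  assumes "M \<in> carrier_mat d d" "transpose_mat M * M = 1\<^sub>m d"
  obtains us where "unit_list d us" "refl_word d us = M"
proof -
  have "\<exists>us. unit_list d us \<and> refl_word d us = M"
    if "M \<in> carrier_mat d d" "transpose_mat M * M = 1\<^sub>m d" "k \<le> d"
      "\<forall>j<d. k \<le> j \<longrightarrow> M *\<^sub>v unit_vec d j = unit_vec d j" for M :: "real mat" and k
    using that
  proof (induction k arbitrary: M)
    case 0
    then have "M = 1\<^sub>m d" by (intro mat_eq_one_if_fixes_units) auto
    then show ?case by (intro exI[of _ "[]"]) simp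
  next
    case (Suc k)
    let ?e = "unit_vec d k :: real vec"
    define w where "w = M *\<^sub>v ?e"
    have k: "k < d" and e: "?e \<in> carrier_vec d" "?e \<bullet> ?e = 1" using Suc.prems by (auto simp: unit_vec_prod)
    have w: "w \<in> carrier_vec d" "w \<bullet> w = 1" using Suc.prems e unfolding w_def by (auto simp: orth_mat_inner[of M d])
    show ?case
    proof (cases "w = ?e")
      case True
      then show ?thesis using Suc.prems unfolding w_def by (intro Suc.IH) (auto simp: not_less_eq_eq[symmetric] le_Suc_eq Suc_le_eq order_le_less)
    next
      case False
      from unit_vector_between[OF w(1) e(1) w(2) e(2) False] obtain c where
        c: "(c \<cdot>\<^sub>v (w - ?e)) \<bullet> (c \<cdot>\<^sub>v (w - ?e)) = 1" "reflection d (c \<cdot>\<^sub>v (w - ?e)) *\<^sub>v w = ?e" by blast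
      define u where "u = c \<cdot>\<^sub>v (w - ?e)"
      have u: "u \<in> carrier_vec d" "u \<bullet> u = 1" "reflection d u *\<^sub>v w = ?e" using c w e unfolding u_def by auto
      let ?R = "reflection d u"
      have RR: "?R * ?R = 1\<^sub>m d" using reflection_involution u by blast
      have 1: "?R * M \<in> carrier_mat d d" using Suc.prems by (auto intro: mult_carrier_mat reflection_carrier)
      have "transpose_mat (?R * M) * (?R * M) = transpose_mat M * (?R * ?R) * M"
        using Suc.prems by (simp add: transpose_mult[of _ d d _ d] reflection_transpose assoc_mult_mat[of _ d d _ d _ d] mult_carrier_mat[of _ d d _ d])
      then have 2: "transpose_mat (?R * M) * (?R * M) = 1\<^sub>m d" using Suc.prems by (simp add: RR)
      have "(?R * M) *\<^sub>v unit_vec d j = unit_vec d j" if j: "j < d" "k \<le> j" for j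
      proof (cases "j = k")
        case True
        then show ?thesis using Suc.prems u e by (simp add: assoc_mult_mat_vec[of _ d d _ d] w_def)
      next
        case False
        then have fj: "M *\<^sub>v unit_vec d j = unit_vec d j" using j Suc.prems by auto
        \<comment> \<open>M preserves inner products and fixes the later basis vector, so w and
          \<open>?e\<close> have the same product with it and their difference is orthogonal to
          it.\<close>
        have "w \<bullet> unit_vec d j = ?e \<bullet> unit_vec d j"
          using orth_mat_inner[OF Suc.prems(1,2) e(1), of "unit_vec d j"] fj unfolding w_def by simp
        then have "u \<bullet> unit_vec d j = 0"
          unfolding u_def using w e by (simp add: minus_scalar_prod_distrib[of _ d])
        then have "?R *\<^sub>v unit_vec d j = unit_vec d j" using u by (intro reflection_eq_self) auto
        then show ?thesis using Suc.prems u fj by (simp add: assoc_mult_mat_vec[of _ d d _ d])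
      qed
      then obtain us where us: "unit_list d us" "refl_word d us = ?R * M"
        using Suc.IH[OF 1 2] k by auto
      have "refl_word d (u # us) = (?R * ?R) * M"
        using us Suc.prems by (simp add: assoc_mult_mat[of _ d d _ d _ d])
      then have "refl_word d (u # us) = M" using RR Suc.prems by simp
      then show ?thesis using us u by (intro exI[of _ "u # us"]) simp
    qed
  qed
  from this[of M d] assms that show thesis by auto
qed

lemma mtrace_mult_comm:
  assumes "A \<in> carrier_mat n m" "B \<in> carrier_mat m n"
  shows "mtrace (A * B) = mtrace (B * A)"
proof -
  have "mtrace (A * B) = (\<Sum>i<n. \<Sum>j<m. A $$ (i, j) * B $$ (j, i))"
    using assms by (simp add: mtrace_def scalar_prod_def atLeast0LessThan)
  also have "\<dots> = (\<Sum>j<m. \<Sum>i<n. A $$ (i, j) * B $$ (j, i))" by (rule sum.swap)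
  also have "\<dots> = mtrace (B * A)"
    using assms by (simp add: mtrace_def scalar_prod_def atLeast0LessThan mult.commute)
  finally show ?thesis .
qed

lemma mtrace_reflection_mult:
  assumes "u \<in> carrier_vec d" "M \<in> carrier_mat d d"
  shows "mtrace (reflection d u * M) = mtrace M - 2 * (u \<bullet> (M *\<^sub>v u))"
proof -
  have *: "(reflection d u * M) $$ (i, i) = M $$ (i, i) - 2 * (\<Sum>j<d. u $ i * u $ j * M $$ (j, i))" if "i < d" for i
  proof -
    have "(reflection d u * M) $$ (i, i) = (\<Sum>j<d. ((if i = j then 1 else 0) - 2 * u $ i * u $ j) * M $$ (j, i))"
      using that assms by (simp add: reflection_def scalar_prod_def atLeast0LessThan)
    also have "\<dots> = (\<Sum>j<d. (if i = j then M $$ (j, i) else 0)) - 2 * (\<Sum>j<d. u $ i * u $ j * M $$ (j, i))"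
      unfolding sum_distrib_left sum_subtractf[symmetric] by (rule sum.cong) (auto simp: algebra_simps)
    finally show ?thesis using that by simp
  qed
  have dims: "dim_row (reflection d u * M) = d" "dim_row M = d" using assms by (auto simp: reflection_def)
  have "mtrace (reflection d u * M) = (\<Sum>i<d. M $$ (i, i) - 2 * (\<Sum>j<d. u $ i * u $ j * M $$ (j, i)))"
    unfolding mtrace_def dims by (rule sum.cong) (simp_all only: lessThan_iff *)
  also have "\<dots> = mtrace M - 2 * (\<Sum>i<d. \<Sum>j<d. u $ i * u $ j * M $$ (j, i))"
    unfolding mtrace_def dims by (simp only: sum_subtractf sum_distrib_left)
  also have "(\<Sum>i<d. \<Sum>j<d. u $ i * u $ j * M $$ (j, i)) = (\<Sum>j<d. \<Sum>i<d. u $ i * u $ j * M $$ (j, i))"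
    by (rule sum.swap)
  also have "\<dots> = u \<bullet> (M *\<^sub>v u)"
    using assms by (simp add: scalar_prod_def sum_distrib_left mult_ac atLeast0LessThan)
  finally show ?thesis .
qed

text \<open>The same descent, with the extra fact that M exchanges w and the basis vector, so that
  their difference is a -1-eigenvector. Then the reflection commutes with M, the quotient is again a
  symmetric involution, and the vectors collected form an orthonormal basis of the
  -1-eigenspace.\<close>

theorem symmetric_involution_reflections:
  fixes M :: "real mat"
  assumes "M \<in> carrier_mat d d" "transpose_mat M = M" "M * M = 1\<^sub>m d"
  obtains us where "unit_list d us" "sorted_wrt (\<lambda>u v. u \<bullet> v = 0) us" "refl_word d us = M"
    "mtrace M = real d - 2 * real (length us)"
proof -
  have "\<exists>us. unit_list d us \<and> sorted_wrt (\<lambda>u v. u \<bullet> v = 0) us \<and> refl_word d us = M \<and>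
      (\<forall>v\<in>set us. M *\<^sub>v v = - v) \<and> mtrace M = real d - 2 * real (length us)"
    if "M \<in> carrier_mat d d" "transpose_mat M = M" "M * M = 1\<^sub>m d" "k \<le> d"
      "\<forall>j<d. k \<le> j \<longrightarrow> M *\<^sub>v unit_vec d j = unit_vec d j" for M :: "real mat" and k
    using that
  proof (induction k arbitrary: M)
    case 0
    then have "M = 1\<^sub>m d" by (intro mat_eq_one_if_fixes_units) auto
    then show ?case by (intro exI[of _ "[]"]) (simp add: mtrace_def)
  next
    case (Suc k)
    let ?e = "unit_vec d k :: real vec"
    define w where "w = M *\<^sub>v ?e"
    have MM: "transpose_mat M * M = 1\<^sub>m d" using Suc.prems by simp
    have k: "k < d" and e: "?e \<in> carrier_vec d" "?e \<bullet> ?e = 1" using Suc.prems by (auto simp: unit_vec_prod)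
    have w: "w \<in> carrier_vec d" "w \<bullet> w = 1" using Suc.prems e MM unfolding w_def by (auto simp: orth_mat_inner[of M d])
    have Mw: "M *\<^sub>v w = ?e" unfolding w_def
      using Suc.prems e by (simp add: assoc_mult_mat_vec[of _ d d _ d, symmetric])
    show ?case
    proof (cases "w = ?e")
      case True
      then show ?thesis using Suc.prems unfolding w_def by (intro Suc.IH) (auto simp: not_less_eq_eq[symmetric] le_Suc_eq Suc_le_eq order_le_less)
    next
      case False
      from unit_vector_between[OF w(1) e(1) w(2) e(2) False] obtain c where
        c: "(c \<cdot>\<^sub>v (w - ?e)) \<bullet> (c \<cdot>\<^sub>v (w - ?e)) = 1" "reflection d (c \<cdot>\<^sub>v (w - ?e)) *\<^sub>v w = ?e" by blast
      define u where "u = c \<cdot>\<^sub>v (w - ?e)"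
      have u: "u \<in> carrier_vec d" "u \<bullet> u = 1" "reflection d u *\<^sub>v w = ?e" using c w e unfolding u_def by auto
      have Mu: "M *\<^sub>v u = - u"
      proof -
        have "M *\<^sub>v u = c \<cdot>\<^sub>v (M *\<^sub>v w - M *\<^sub>v ?e)"
          unfolding u_def using Suc.prems w e by (simp add: mult_mat_vec[of _ d d] mult_minus_distrib_mat_vec[of _ d d])
        also have "\<dots> = c \<cdot>\<^sub>v (?e - w)" by (simp only: Mw w_def[symmetric])
        also have "\<dots> = - u" unfolding u_def using w e by (intro eq_vecI) (auto simp: algebra_simps)
        finally show ?thesis .
      qed
      let ?R = "reflection d u"
      have RR: "?R * ?R = 1\<^sub>m d" using reflection_involution u by blast
      have 1: "?R * M \<in> carrier_mat d d" using Suc.prems by (auto intro: mult_carrier_mat reflection_carrier)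
      have act: "?R *\<^sub>v (M *\<^sub>v v) = M *\<^sub>v (?R *\<^sub>v v)" if v: "v \<in> carrier_vec d" for v
      proof -
        have Mv: "M *\<^sub>v v \<in> carrier_vec d" using Suc.prems v by simp
        have "u \<bullet> (M *\<^sub>v v) = - (u \<bullet> v)"
          using scalar_prod_mult_mat_vec[OF Suc.prems(1) u(1) v] Suc.prems(2) Mu u v by simp
        then show ?thesis
          unfolding reflection_mult_vec[OF u(1) Mv] reflection_mult_vec[OF u(1) v]
          using Suc.prems u v Mu
          by (simp add: mult_add_distrib_mat_vec[of _ d d] mult_mat_vec[of _ d d]) (intro eq_vecI, auto)
      qed
      have comm: "?R * M = M * ?R"
      proof (rule mat_col_eqI)
        fix j assume "j < dim_col (M * ?R)"
        then have j: "j < d" by (simp add: reflection_def)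
        have "col (?R * M) j = ?R *\<^sub>v (M *\<^sub>v unit_vec d j)"
          using j Suc.prems(1) by (simp only: col_mult2[OF reflection_carrier] mat_mult_unit_vec)
        also have "\<dots> = M *\<^sub>v (?R *\<^sub>v unit_vec d j)" by (rule act) simp
        also have "\<dots> = col (M * ?R) j"
          using j Suc.prems(1) by (simp only: col_mult2[OF _ reflection_carrier] mat_mult_unit_vec[OF reflection_carrier])
        finally show "col (?R * M) j = col (M * ?R) j" .
      qed (use Suc.prems(1) in \<open>auto simp: reflection_def\<close>)
      have 2: "transpose_mat (?R * M) = ?R * M"
        using Suc.prems comm by (simp add: transpose_mult[of _ d d _ d] reflection_transpose)
      have "(?R * M) * (?R * M) = (?R * M) * (M * ?R)"
        by (rule arg_cong[where f = "\<lambda>X. (?R * M) * X", OF comm])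
      also have "\<dots> = ?R * ((M * M) * ?R)"
        using Suc.prems(1) by (simp add: assoc_mult_mat[of _ d d _ d _ d] mult_carrier_mat[of _ d d _ d])
      finally have 3: "(?R * M) * (?R * M) = 1\<^sub>m d"
        using Suc.prems RR by (simp add: left_mult_one_mat[OF reflection_carrier])
      have "(?R * M) *\<^sub>v unit_vec d j = unit_vec d j" if j: "j < d" "k \<le> j" for j
      proof (cases "j = k")
        case True
        then show ?thesis using Suc.prems u e by (simp add: assoc_mult_mat_vec[of _ d d _ d] w_def)
      next
        case False
        then have fj: "M *\<^sub>v unit_vec d j = unit_vec d j" using j Suc.prems by auto
        have "w \<bullet> unit_vec d j = ?e \<bullet> unit_vec d j"
          using orth_mat_inner[OF Suc.prems(1) MM e(1), of "unit_vec d j"] fj unfolding w_def by simp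
        then have "u \<bullet> unit_vec d j = 0"
          unfolding u_def using w e by (simp add: minus_scalar_prod_distrib[of _ d])
        then have "?R *\<^sub>v unit_vec d j = unit_vec d j" using u by (intro reflection_eq_self) auto
        then show ?thesis using Suc.prems u fj by (simp add: assoc_mult_mat_vec[of _ d d _ d])
      qed
      then obtain us where us: "unit_list d us" "sorted_wrt (\<lambda>u v. u \<bullet> v = 0) us" "refl_word d us = ?R * M"
          "\<forall>v\<in>set us. (?R * M) *\<^sub>v v = - v" "mtrace (?R * M) = real d - 2 * real (length us)"
        using Suc.IH[OF 1 2 3] k by auto
      have "refl_word d (u # us) = (?R * ?R) * M"
        using us Suc.prems by (simp add: assoc_mult_mat[of _ d d _ d _ d])
      then have W: "refl_word d (u # us) = M" using RR Suc.prems by simp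
      have "(?R * M) *\<^sub>v u = ?R *\<^sub>v (- u)"
        using Suc.prems(1) u Mu by (simp add: assoc_mult_mat_vec[of _ d d _ d])
      also have "\<dots> = u" using u by (simp add: reflection_mult_vec) (intro eq_vecI, auto)
      finally have RMu: "(?R * M) *\<^sub>v u = u" .
      \<comment> \<open>The new vector is fixed by the symmetric matrix \<open>?R * M\<close> while
        the earlier ones are negated by it; eigenvectors for different eigenvalues are
        orthogonal.\<close>
      have orth: "u \<bullet> v = 0" "M *\<^sub>v v = - v" if "v \<in> set us" for v
      proof -
        have v: "v \<in> carrier_vec d" using us that unfolding unit_list_def by auto
        have "u \<bullet> v = ((?R * M) *\<^sub>v u) \<bullet> v" by (simp add: RMu)
        also have "\<dots> = u \<bullet> ((?R * M) *\<^sub>v v)" using scalar_prod_mult_mat_vec[OF 1 u(1) v] 2 by simp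
        also have "\<dots> = - (u \<bullet> v)" using us(4) that u v by simp
        finally show uv: "u \<bullet> v = 0" by simp
        have "M *\<^sub>v v = (?R * (?R * M)) *\<^sub>v v" using W us by simp
        also have "\<dots> = ?R *\<^sub>v (- v)" using us(4) that v 1 by (simp add: assoc_mult_mat_vec[of _ d d _ d])
        also have "\<dots> = - v" using u v uv by (intro reflection_eq_self) auto
        finally show "M *\<^sub>v v = - v" .
      qed
      have "mtrace M = mtrace (?R * (?R * M))" using W us by simp
      also have "\<dots> = mtrace (?R * M) - 2" using mtrace_reflection_mult[OF u(1) 1] RMu u by simp
      finally show ?thesis using us u orth W Mu by (intro exI[of _ "u # us"]) auto
    qed
  qed
  from this[of M d] assms that show thesis by auto
qed

section \<open>Lifts are unique up to sign\<close>

lemma refl_word_append: "refl_word d (us @ vs) = refl_word d us * refl_word d vs"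
  by (induction us) (simp_all add: left_mult_one_mat[OF refl_word_carrier]
    assoc_mult_mat[OF reflection_carrier refl_word_carrier refl_word_carrier])

lemma reflection_uminus: "u \<in> carrier_vec d \<Longrightarrow> reflection d (- u) = reflection d u"
  by (rule eq_matI) (auto simp: reflection_def)

lemma refl_word_inverse:
  assumes "unit_list d us"
  shows "refl_word d us * refl_word d (rev (map uminus us)) = 1\<^sub>m d"
  using assms
proof (induction us)
  case (Cons u us)
  let ?A = "refl_word d us" and ?B = "refl_word d (rev (map uminus us))" and ?R = "reflection d u"
  have u: "u \<in> carrier_vec d" "u \<bullet> u = 1" and IH: "?A * ?B = 1\<^sub>m d" using Cons by auto
  have "refl_word d (u # us) * refl_word d (rev (map uminus (u # us))) = (?R * ?A) * (?B * ?R)"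
    by (simp add: refl_word_append reflection_uminus[OF u(1)] right_mult_one_mat[OF reflection_carrier])
  also have "\<dots> = ?R * ((?A * ?B) * ?R)"
    by (simp add: assoc_mult_mat[of _ d d _ d _ d] mult_carrier_mat[of _ d d _ d])
  also have "\<dots> = 1\<^sub>m d"
    by (simp add: IH left_mult_one_mat[OF reflection_carrier] reflection_involution[OF u])
  finally show ?case .
qed simp

lemma cl_word_eq_up_to_sign:
  assumes us: "unit_list d us" and vs: "unit_list d vs" and eq: "refl_word d us = refl_word d vs"
  shows "cl_word d us = cl_word d vs \<or> cl_word d us = (\<lambda>U. - cl_word d vs U)"
proof -
  let ?vs' = "rev (map uminus vs)"
  have "refl_word d (us @ ?vs') = 1\<^sub>m d"
    using refl_word_inverse[OF vs] by (simp add: refl_word_append eq)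
  moreover have "unit_list d (us @ ?vs')" using us unit_list_inverse[OF vs] by simp
  ultimately have "cl_word d (us @ ?vs') = cl_one \<or> cl_word d (us @ ?vs') = (\<lambda>U. - cl_one U)"
    by (rule cl_word_kernel[rotated])
  moreover have "cl_word d us = cl_mult d (cl_word d (us @ ?vs')) (cl_word d vs)"
    by (simp add: cl_word_append cl_mult_assoc cl_word_inverse[OF vs] cl_mult_one_right cl_word_carrier)
  ultimately show ?thesis
    using cl_mult_scale_left[of d "-1" cl_one "cl_word d vs"]
    by (auto simp: cl_mult_one_left cl_word_carrier)
qed

text \<open>Two words for the same matrix agree up to sign, hence share a nonzero coefficient, whose
  degree has the parity of both lengths. This takes the place of the determinant.\<close>

lemma cl_word_length_parity:
  assumes us: "unit_list d us" and vs: "unit_list d vs" and eq: "refl_word d us = refl_word d vs"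
  shows "even (length us + length vs)"
proof -
  have "\<exists>U. cl_word d us U \<noteq> 0"
  proof (rule ccontr)
    assume "\<nexists>U. cl_word d us U \<noteq> 0"
    then have "cl_inner d (cl_word d us) (cl_word d us) = 0" unfolding cl_inner_def by simp
    then show False using cl_word_norm[OF us] by simp
  qed
  then obtain U where U: "cl_word d us U \<noteq> 0" ..
  then have "cl_word d vs U \<noteq> 0" using cl_word_eq_up_to_sign[OF us vs eq] by auto
  with U have "even (card U + length us)" "even (card U + length vs)"
    using cl_word_parity us vs unfolding unit_list_def by blast+
  then show ?thesis by simp
qed

lemma pin_carrier: "x \<in> pin d \<Longrightarrow> x \<in> cl_carrier d"
  by (auto simp: pin_eq cl_word_carrier)

lemma pin_one: "cl_one \<in> pin d" "pin_rho d cl_one = 1\<^sub>m d"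
  using pin_rho_word[of d "[]"] by (auto simp: pin_eq intro: exI[of _ "[]"])

lemma pin_mult:
  assumes "x \<in> pin d" "y \<in> pin d"
  shows "cl_mult d x y \<in> pin d" "pin_rho d (cl_mult d x y) = pin_rho d x * pin_rho d y"
proof -
  obtain us vs where *: "x = cl_word d us" "unit_list d us" "y = cl_word d vs" "unit_list d vs"
    using assms by (auto simp: pin_eq)
  show "cl_mult d x y \<in> pin d"
    unfolding pin_eq using * by (auto simp: cl_word_append intro!: exI[of _ "us @ vs"])
  show "pin_rho d (cl_mult d x y) = pin_rho d x * pin_rho d y"
    using * pin_rho_word[of d "us @ vs"] by (simp add: pin_rho_word cl_word_append refl_word_append)
qed

lemma pin_inverse:
  assumes "x \<in> pin d"
  obtains y where "y \<in> pin d" "cl_mult d x y = cl_one" "cl_mult d y x = cl_one"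
proof -
  obtain us where "x = cl_word d us" "unit_list d us" using assms by (auto simp: pin_eq)
  then show thesis
    using that[of "cl_word d (rev (map uminus us))"] cl_word_inverse[of d us] unit_list_inverse[of d us]
    unfolding pin_eq by blast
qed

lemma pin_eq_up_to_sign:
  assumes "x \<in> pin d" "y \<in> pin d" "pin_rho d x = pin_rho d y"
  shows "x = y \<or> x = (\<lambda>U. - y U)"
proof -
  obtain us vs where *: "x = cl_word d us" "unit_list d us" "y = cl_word d vs" "unit_list d vs"
    using assms by (auto simp: pin_eq)
  then have "refl_word d us = refl_word d vs" using assms(3) by (simp add: pin_rho_word)
  from cl_word_eq_up_to_sign[OF *(2,4) this] show ?thesis by (simp add: *)
qed

lemma pin_surj:
  assumes "M \<in> carrier_mat d d" "transpose_mat M * M = 1\<^sub>m d"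
  obtains x where "x \<in> pin d" "pin_rho d x = M"
proof -
  obtain us where us: "unit_list d us" "refl_word d us = M" using Cartan_Dieudonne[OF assms] .
  then show thesis using that[of "cl_word d us"] pin_rho_word[OF us(1)] by (auto simp: pin_eq)
qed

text \<open>Prefixing the same unit vector twice multiplies a word by -1. In dimension 0 there is no
  unit vector and the Pin group is trivial.\<close>

lemma pin_uminus:
  assumes "x \<in> pin d" "0 < d"
  shows "(\<lambda>U. - x U) \<in> pin d" "pin_rho d (\<lambda>U. - x U) = pin_rho d x"
proof -
  obtain us where us: "x = cl_word d us" "unit_list d us" using assms by (auto simp: pin_eq)
  let ?e = "unit_vec d 0 :: real vec"
  have e: "?e \<in> carrier_vec d" "?e \<bullet> ?e = 1" using assms by (auto simp: unit_vec_prod)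
  have w: "cl_word d (?e # ?e # us) = (\<lambda>U. - x U)"
    using unit_vec_square[OF e cl_word_carrier] us by simp
  have u: "unit_list d (?e # ?e # us)" using e us by simp
  show "(\<lambda>U. - x U) \<in> pin d" unfolding pin_eq w[symmetric] using u by blast
  have "refl_word d (?e # ?e # us) = (reflection d ?e * reflection d ?e) * refl_word d us"
    by (simp add: assoc_mult_mat[OF reflection_carrier reflection_carrier refl_word_carrier])
  then show "pin_rho d (\<lambda>U. - x U) = pin_rho d x"
    using pin_rho_word[OF u] w us e
    by (simp add: pin_rho_word reflection_involution left_mult_one_mat[OF refl_word_carrier])
qed

section \<open>Carmichael generators and lifting\<close>

text \<open>Coset enumeration behind Carmichael's presentation of the alternating group: with
  \<^term>\<open>H\<close> for the first \<^term>\<open>k\<close> generators, the cosets are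
  \<open>H\<close>, \<open>H v\<close>, \<open>H v v\<close> and the \<open>H v v v\<^sub>i\<close>, where \<open>v\<close> is the new generator.\<close>
lemma orbit_bound:
  fixes f :: "nat \<Rightarrow> 'b \<Rightarrow> 'b"
  assumes "e \<in> C" "\<And>i x. i < k \<Longrightarrow> x \<in> C \<Longrightarrow> f i x \<in> C"
    and "\<And>i x. i < k \<Longrightarrow> x \<in> C \<Longrightarrow> f i (f i (f i x)) = x"
    and "\<And>i j x. i < k \<Longrightarrow> j < k \<Longrightarrow> i \<noteq> j \<Longrightarrow> x \<in> C \<Longrightarrow> f j (f i x) = f i (f i (f j (f j x)))"
  shows "\<exists>H\<subseteq>C. finite H \<and> 2 * card H \<le> fact (k + 2) \<and> e \<in> H \<and> (\<forall>h\<in>H. \<forall>i<k. f i h \<in> H)"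
  using assms
proof (induction k)
  case 0
  show ?case using 0(1) by (intro exI[of _ "{e}"]) (simp add: fact_2)
next
  case (Suc k)
  have "\<exists>H\<subseteq>C. finite H \<and> 2 * card H \<le> fact (k + 2) \<and> e \<in> H \<and> (\<forall>h\<in>H. \<forall>i<k. f i h \<in> H)"
    by (rule Suc.IH[OF Suc.prems(1) Suc.prems(2)[OF less_SucI] Suc.prems(3)[OF less_SucI]
      Suc.prems(4)[OF less_SucI less_SucI]])
  then obtain H where H: "H \<subseteq> C" "finite H" "2 * card H \<le> fact (k + 2)" "e \<in> H"
    and cl: "\<And>h i. h \<in> H \<Longrightarrow> i < k \<Longrightarrow> f i h \<in> H" by blast
  let ?v = "f k"
  \<comment> \<open>These are k + 3 images of \<open>H\<close>, so the bound grows by the factor k +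
    3, just as the order of the alternating group does from degree k + 2 to degree k + 3.\<close>
  define K where "K = H \<union> ?v ` H \<union> (\<lambda>h. ?v (?v h)) ` H \<union> (\<Union>i<k. (\<lambda>h. f i (?v (?v h))) ` H)"
  have C: "x \<in> C \<Longrightarrow> i \<le> k \<Longrightarrow> f i x \<in> C" for x i using Suc.prems(2)[of i x] by simp
  have cube: "x \<in> C \<Longrightarrow> i \<le> k \<Longrightarrow> f i (f i (f i x)) = x" for x i using Suc.prems(3)[of i x] by simp
  have rel: "x \<in> C \<Longrightarrow> i \<le> k \<Longrightarrow> j \<le> k \<Longrightarrow> i \<noteq> j \<Longrightarrow> f i (f i (f j (f j x))) = f j (f i x)" for x i j
    using Suc.prems(4)[of i j x] by simp
  have "card (\<Union>i<k. (\<lambda>h. f i (?v (?v h))) ` H) \<le> (\<Sum>i<k. card ((\<lambda>h. f i (?v (?v h))) ` H))"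
    by (rule card_UN_le) simp
  also have "\<dots> \<le> (\<Sum>i<k. card H)" by (intro sum_mono card_image_le H)
  finally have c1: "card (\<Union>i<k. (\<lambda>h. f i (?v (?v h))) ` H) \<le> k * card H" by simp
  have "card K \<le> card H + card (?v ` H) + card ((\<lambda>h. ?v (?v h)) ` H) + card (\<Union>i<k. (\<lambda>h. f i (?v (?v h))) ` H)"
    unfolding K_def by (intro order_trans[OF card_Un_le] add_mono order_refl)
  also have "\<dots> \<le> card H + card H + card H + k * card H"
    by (intro add_mono card_image_le H c1 order_refl)
  finally have "card K \<le> (k + 3) * card H" by (simp add: algebra_simps)
  then have "2 * card K \<le> (k + 3) * (2 * card H)" by simp
  also have "\<dots> \<le> (k + 3) * fact (k + 2)" using H(3) by (rule mult_left_mono) simp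
  also have "\<dots> = fact (Suc k + 2)"
  proof -
    have "k + 3 = Suc (k + 2)" by simp
    then show ?thesis by (simp only: add_Suc fact_Suc of_nat_id)
  qed
  finally have card: "2 * card K \<le> fact (Suc k + 2)" .
  have K1: "h \<in> K" if "h \<in> H" for h using that by (simp add: K_def)
  have K2: "?v h \<in> K" if "h \<in> H" for h using that by (simp add: K_def)
  have K3: "?v (?v h) \<in> K" if "h \<in> H" for h using that by (simp add: K_def)
  have four: "f i (?v (?v h)) \<in> K" if "h \<in> H" "i < k" for h i
    using that by (simp add: K_def) blast
  \<comment> \<open>With f acting by right multiplication, the hypothesis on two generators is (v_i
    v_j)^2 = 1 solved by means of the cubes as v_i v_j = v_j^2 v_i^2, which mentions no inverse.
    This instance pushes the new generator out past an old one.\<close>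
  have sw: "f i (?v x) = ?v (?v (f i (f i x)))" if "x \<in> C" "i < k" for x i
    using rel[OF that(1), of k i] that by simp
  have closed: "f j h \<in> K" if "h \<in> K" "j \<le> k" for h j
  proof -
    from \<open>h \<in> K\<close> consider "h \<in> H" | h' where "h' \<in> H" "h = ?v h'" | h' where "h' \<in> H" "h = ?v (?v h')"
      | h' i where "h' \<in> H" "i < k" "h = f i (?v (?v h'))" unfolding K_def by blast
    then show ?thesis
    proof cases
      case 1
      then show ?thesis using cl[of h j] K1 K2 \<open>j \<le> k\<close> by (cases "j = k") simp_all
    next
      case 2
      have h': "h' \<in> C" using 2 H by blast
      show ?thesis
      proof (cases "j = k")
        case False
        then have "f j (f j h') \<in> H" using cl 2 \<open>j \<le> k\<close> by simp
        then show ?thesis using sw[OF h', of j] 2 \<open>j \<le> k\<close> False K3 by simp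
      qed (use 2 K3 in simp)
    next
      case 3
      have h': "h' \<in> C" using 3 H by blast
      show ?thesis using 3 cube[OF h', of k] \<open>j \<le> k\<close> four[of h' j] K1 by (cases "j = k") simp_all
    next
      case 4
      have h': "h' \<in> C" using 4 H by blast
      consider "j = i" | "j = k" | "j < k" "j \<noteq> i" using le_neq_implies_less[OF \<open>j \<le> k\<close>] by blast
      then show ?thesis
      proof cases
        case 1
        have "f i (f i (?v (?v h'))) = ?v (f i h')" using rel[OF h', of i k] 4 by simp
        then show ?thesis using 1 4 cl K2 by simp
      next
        case 2
        have "?v (f i (?v (?v h'))) = f i (f i (?v (?v (?v (?v h')))))"
          using rel[of "?v (?v h')" i k] C[OF C[OF h'], of k k] 4 by simp
        also have "\<dots> = f i (f i (?v h'))" using cube[OF C[OF h'], of k k] by simp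
        also have "\<dots> = f i (?v (?v (f i (f i h'))))" using sw[OF h', of i] 4 by simp
        finally show ?thesis using four[of "f i (f i h')" i] 2 4 cl by simp
      next
        case 3
        have "f j (f i (?v (?v h'))) = f i (f i (f j (f j (?v (?v h')))))"
          using rel[of "?v (?v h')" i j] C[OF C[OF h'], of k k] 4 3 by simp
        also have "\<dots> = f i (f i (?v (f j h')))" using rel[OF h', of j k] 3 by simp
        also have "\<dots> = f i (?v (?v (f i (f i (f j h')))))" using sw[OF C[OF h'], of j i] 4 3 by simp
        finally show ?thesis using four[of "f i (f i (f j h'))" i] 3 4 cl by simp
      qed
    qed
  qed
  have "K \<subseteq> C" using H(1) C by (auto simp: subset_iff K_def)
  then show ?case
    using K1[OF H(4)] card closed H(2)
    by (intro exI[of _ K] conjI ballI allI impI) (simp_all add: less_Suc_eq_le, simp add: K_def)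
qed

section \<open>Closure properties of the symmetric and alternating groups\<close>

lemma finite_Sym: "finite (Sym n)" and finite_Alt: "finite (Alt n)"
proof -
  have "finite {p. p permutes {1..n}}" by (rule finite_permutations) simp
  then show "finite (Sym n)" "finite (Alt n)" unfolding Sym_def Alt_def by (auto intro: finite_subset)
qed

lemma Sym_permutation: "p \<in> Sym n \<Longrightarrow> permutation p"
  unfolding Sym_def by (auto simp: permutation_permutes)

lemma Alt_subset_Sym: "Alt n \<subseteq> Sym n"
  by (auto simp: Alt_def Sym_def)

lemma Alt_iff: "p \<in> Alt n \<longleftrightarrow> p \<in> Sym n \<and> evenperm p"
  by (auto simp: Alt_def Sym_def)

lemma Sym_id [simp]: "id \<in> Sym n" and Alt_id [simp]: "id \<in> Alt n"
  by (auto simp: Alt_def Sym_def permutes_id)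

lemma Sym_comp: "p \<in> Sym n \<Longrightarrow> q \<in> Sym n \<Longrightarrow> p \<circ> q \<in> Sym n"
  by (auto simp: Sym_def permutes_compose)

lemma Sym_inv: "p \<in> Sym n \<Longrightarrow> inv_into UNIV p \<in> Sym n"
  by (auto simp: Sym_def permutes_inv)

lemma Sym_inv_comp: "p \<in> Sym n \<Longrightarrow> inv_into UNIV p \<circ> p = id" "p \<in> Sym n \<Longrightarrow> p \<circ> inv_into UNIV p = id"
  unfolding Sym_def by (auto simp: permutes_inv_o)

lemma evenperm_Sym_comp: "p \<in> Sym n \<Longrightarrow> q \<in> Sym n \<Longrightarrow> evenperm (p \<circ> q) \<longleftrightarrow> (evenperm p \<longleftrightarrow> evenperm q)"
  by (metis Sym_permutation evenperm_comp)

lemma Alt_comp: "p \<in> Alt n \<Longrightarrow> q \<in> Alt n \<Longrightarrow> p \<circ> q \<in> Alt n"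
  by (auto simp: Alt_iff Sym_comp evenperm_Sym_comp[of p n q])

lemma Alt_inv: "p \<in> Alt n \<Longrightarrow> inv_into UNIV p \<in> Alt n"
  using evenperm_inv[OF Sym_permutation] by (auto simp: Alt_iff Sym_inv)

lemma Sym_transpose: "a \<in> {1..n} \<Longrightarrow> b \<in> {1..n} \<Longrightarrow> transpose a b \<in> Sym n"
  by (simp add: Sym_def permutes_swap_id)

lemma card_Alt:
  assumes "2 \<le> n"
  shows "2 * card (Alt n) = fact n"
proof -
  let ?t = "transpose 1 2 :: nat \<Rightarrow> nat"
  have t: "?t \<in> Sym n" "\<not> evenperm ?t" using assms Sym_transpose[of 1 n 2] by (auto simp: evenperm_swap)
  have inv: "?t \<circ> (?t \<circ> p) = p" for p by (simp add: o_assoc)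
  have "bij_betw (\<lambda>p. ?t \<circ> p) (Alt n) (Sym n - Alt n)"
    by (rule bij_betw_byWitness[where f' = "\<lambda>p. ?t \<circ> p"])
      (use t inv in \<open>auto simp: Alt_iff Sym_comp evenperm_Sym_comp\<close>)
  then have "card (Alt n) = card (Sym n - Alt n)" by (rule bij_betw_same_card)
  moreover have "card (Sym n) = card (Alt n) + card (Sym n - Alt n)"
    using card_Un_disjoint[of "Alt n" "Sym n - Alt n"] finite_Sym finite_Alt Alt_subset_Sym[of n]
    by (simp add: Un_absorb1)
  moreover have "card (Sym n) = fact n" unfolding Sym_def by (subst card_permutations) auto
  ultimately show ?thesis by simp
qed

section \<open>Generation of the alternating group by 3-cycles\<close>

definition star3 :: "nat \<Rightarrow> nat \<Rightarrow> nat" where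
  "star3 i = transpose 1 2 \<circ> transpose 1 i"

text \<open>Positive words suffice, because the inverse of a 3-cycle is its square.\<close>

inductive alt_gen :: "nat \<Rightarrow> (nat \<Rightarrow> nat) \<Rightarrow> bool" for n where
  one: "alt_gen n id"
| step: "alt_gen n g \<Longrightarrow> i \<in> {3..n} \<Longrightarrow> alt_gen n (g \<circ> star3 i)"

lemma star3_Alt: "i \<in> {3..n} \<Longrightarrow> star3 i \<in> Alt n"
  unfolding star3_def Alt_iff
  by (auto simp: Sym_comp Sym_transpose evenperm_swap evenperm_comp permutation_swap_id)

lemma star3_cube: "i \<ge> 3 \<Longrightarrow> star3 i \<circ> star3 i \<circ> star3 i = id"
  by (auto simp: star3_def fun_eq_iff transpose_def)

lemma star3_rel: "i \<ge> 3 \<Longrightarrow> j \<ge> 3 \<Longrightarrow> i \<noteq> j \<Longrightarrow> star3 i \<circ> star3 j = transpose 1 j \<circ> transpose 2 i"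
  by (auto simp: star3_def fun_eq_iff transpose_def)

lemma transpose_via_one:
  "a \<noteq> 1 \<Longrightarrow> b \<noteq> 1 \<Longrightarrow> a \<noteq> b \<Longrightarrow> transpose a b = transpose 1 a \<circ> transpose 1 b \<circ> transpose 1 (a :: nat)"
  by (auto simp: fun_eq_iff transpose_def)

text \<open>The appended product is the inverse of \<open>star3 i\<close>, that is, its square, and
  for i = 2 it is the identity.\<close>

lemma alt_gen_inverse_step:
  assumes "alt_gen n g" "i \<in> {2..n}"
  shows "alt_gen n (g \<circ> transpose 1 i \<circ> transpose 1 2)"
proof (cases "i = 2")
  case True
  then show ?thesis using assms by (simp add: comp_assoc)
next
  case False
  then have i: "i \<in> {3..n}" using assms by auto
  have "transpose 1 i \<circ> transpose 1 2 = star3 i \<circ> star3 i"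
    using i by (auto simp: star3_def fun_eq_iff transpose_def)
  then have "g \<circ> transpose 1 i \<circ> transpose 1 2 = g \<circ> star3 i \<circ> star3 i" by (simp add: comp_assoc)
  then show ?thesis using assms(1) i by (simp add: alt_gen.step)
qed

lemma alt_gen_step':
  assumes "alt_gen n g" "i \<in> {2..n}"
  shows "alt_gen n (g \<circ> transpose 1 2 \<circ> transpose 1 i)"
proof (cases "i = 2")
  case True
  then show ?thesis using assms by (simp add: comp_assoc)
next
  case False
  then show ?thesis using assms alt_gen.step[of n g i] by (simp add: star3_def comp_assoc)
qed

text \<open>The transpositions (1 i) generate the symmetric group, and a product of two of them
  becomes a product of 3-cycles after inserting (1 2) twice. The predicate \<open>Q\<close> carries
  odd permutations along, corrected by (1 2), so that one transposition can be appended at a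
  time.\<close>

lemma Alt_alt_gen:
  assumes "2 \<le> n" "p \<in> Alt n"
  shows "alt_gen n p"
proof -
  let ?t = "transpose 1 2 :: nat \<Rightarrow> nat"
  define Q where "Q p \<longleftrightarrow> p \<in> Sym n \<and> (evenperm p \<longrightarrow> alt_gen n p) \<and> (\<not> evenperm p \<longrightarrow> alt_gen n (p \<circ> ?t))" for p
  have t: "?t \<in> Sym n" using assms(1) by (intro Sym_transpose) auto
  have star: "Q (p \<circ> transpose 1 i)" if Q: "Q p" and i: "i \<in> {2..n}" for p i
  proof -
    have s: "transpose 1 i \<in> Sym n" "\<not> evenperm (transpose 1 i)"
      using i by (auto intro: Sym_transpose simp: evenperm_swap)
    have p: "p \<in> Sym n" using Q by (simp add: Q_def)
    have ev: "evenperm (p \<circ> transpose 1 i) \<longleftrightarrow> \<not> evenperm p" using evenperm_Sym_comp[OF p s(1)] s(2) by simp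
    show ?thesis
    proof (cases "evenperm p")
      case True
      then show ?thesis using Q ev alt_gen_inverse_step[of n p i] i Sym_comp[OF p s(1)] by (simp add: Q_def)
    next
      case False
      then have "alt_gen n (p \<circ> ?t \<circ> ?t \<circ> transpose 1 i)" using Q alt_gen_step'[of n "p \<circ> ?t" i] i by (simp add: Q_def)
      moreover have "p \<circ> ?t \<circ> ?t = p" by (simp add: comp_assoc)
      ultimately show ?thesis using False ev Sym_comp[OF p s(1)] by (simp add: Q_def)
    qed
  qed
  have "p permutes {1..n}" using assms(2) by (simp add: Alt_def)
  then have "Q p"
  proof (rule permutes_rev_induct[where P = Q, OF finite_atLeastAtMost])
    show "Q id" by (simp add: Q_def alt_gen.one)
  next
    fix a b p
    assume swap: "a \<in> {1..n}" "b \<in> {1..n}" "a \<noteq> b" "Q p"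
    consider "a = 1" | "b = 1" | "a \<noteq> 1" "b \<noteq> 1" by blast
    then show "Q (p \<circ> transpose a b)"
    proof cases
      case 1
      then show ?thesis using star[OF \<open>Q p\<close>, of b] swap by auto
    next
      case 2
      then have "transpose a b = transpose 1 a" by (simp add: transpose_commute)
      then show ?thesis using star[OF \<open>Q p\<close>, of a] swap 2 by auto
    next
      case 3
      have "Q (p \<circ> transpose 1 a \<circ> transpose 1 b \<circ> transpose 1 a)"
        using swap 3 by (intro star) auto
      then show ?thesis using transpose_via_one[of a b] 3 swap by (simp add: comp_assoc)
    qed
  qed
  then show ?thesis using assms(2) by (simp add: Q_def Alt_iff)
qed

lemma permutes_extend:
  assumes "finite S" "A \<subseteq> S" "f ` A \<subseteq> S" "inj_on f A"
  obtains p where "p permutes S" "\<And>a. a \<in> A \<Longrightarrow> p a = f a"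
proof -
  have fin: "finite A" using assms finite_subset by blast
  have "card (S - A) = card (S - f ` A)"
    using assms fin by (simp add: card_Diff_subset card_image finite_imageI)
  then obtain h where h: "bij_betw h (S - A) (S - f ` A)"
    using assms finite_same_card_bij by (metis finite_Diff)
  define p where "p x = (if x \<in> A then f x else if x \<in> S then h x else x)" for x
  have "bij_betw p A (f ` A)"
    using assms(4) by (subst bij_betw_cong[of A p f]) (auto simp: p_def bij_betw_imageI)
  moreover have "bij_betw p (S - A) (S - f ` A)"
    using h by (subst bij_betw_cong[of "S - A" p h]) (auto simp: p_def)
  ultimately have "bij_betw p (A \<union> (S - A)) (f ` A \<union> (S - f ` A))"
    by (rule bij_betw_combine) auto
  moreover have "A \<union> (S - A) = S" "f ` A \<union> (S - f ` A) = S" using assms by auto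
  ultimately have "bij_betw p S S" by simp
  then have "p permutes S" by (rule bij_imp_permutes) (use assms(2) in \<open>auto simp: p_def\<close>)
  then show thesis using that[of p] by (simp add: p_def)
qed

lemma s1s3_Alt: "4 \<le> n \<Longrightarrow> s1s3 \<in> Alt n"
  unfolding s1s3_def Alt_iff
  by (auto simp: Sym_comp Sym_transpose evenperm_swap evenperm_comp permutation_swap_id)

lemma s1s3_square: "s1s3 \<circ> s1s3 = id"
  by (auto simp: s1s3_def fun_eq_iff transpose_def)

text \<open>The product of two generators is the double transposition (1 j)(2 i). Conjugacy to
  \<open>s1s3\<close> inside the alternating group means that one relation in the Pin group settles
  all of them.\<close>

lemma star3_product_conj:
  assumes "4 \<le> n" "i \<in> {3..n}" "j \<in> {3..n}" "i \<noteq> j"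
  obtains h where "h \<in> Alt n" "star3 i \<circ> star3 j \<circ> h = h \<circ> s1s3"
proof -
  \<comment> \<open>Chosen so that (1 2)(3 4) is carried to (1 j)(2 i).\<close>
  let ?f = "\<lambda>x::nat. if x = 1 then 1 else if x = 2 then j else if x = 3 then 2 else i"
  obtain p where p: "p permutes {1..n}" "\<And>a. a \<in> {1, 2, 3, 4} \<Longrightarrow> p a = ?f a"
    by (rule permutes_extend[of "{1..n}" "{1, 2, 3, 4}" ?f]) (use assms in \<open>auto simp: inj_on_def\<close>)
  have inj: "inj p" using p permutes_inj by blast
  have v: "p 1 = 1" "p 2 = j" "p 3 = 2" "p 4 = i" using p(2) by auto
  have tr: "transpose (p a) (p b) \<circ> p = p \<circ> transpose a b" for a b
    using inj by (auto simp: fun_eq_iff transpose_def inj_def)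
  have "star3 i \<circ> star3 j = transpose (p 1) (p 2) \<circ> transpose (p 3) (p 4)"
    using star3_rel[of i j] assms by (simp only: v) simp
  then have main: "star3 i \<circ> star3 j \<circ> p = p \<circ> s1s3"
    unfolding s1s3_def by (metis comp_assoc tr)
  \<comment> \<open>An odd conjugating permutation is made even by (1 2), which centralises
    \<open>s1s3\<close>.\<close>
  have comm: "transpose 1 2 \<circ> s1s3 = s1s3 \<circ> transpose (1::nat) 2"
    by (auto simp: s1s3_def fun_eq_iff transpose_def)
  have P: "p \<in> Sym n" using p by (simp add: Sym_def)
  have t: "transpose 1 2 \<in> Sym n" using assms(1) by (intro Sym_transpose) auto
  show thesis
  proof (cases "evenperm p")
    case True
    then show ?thesis using that main P by (simp add: Alt_iff)
  next
    case False
    then have "p \<circ> transpose 1 2 \<in> Alt n"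
      using P t by (simp add: Alt_iff Sym_comp evenperm_Sym_comp evenperm_swap)
    moreover have "star3 i \<circ> star3 j \<circ> (p \<circ> transpose 1 2) = p \<circ> transpose 1 2 \<circ> s1s3"
      by (metis main comm comp_assoc)
    ultimately show ?thesis using that by blast
  qed
qed

text \<open>Serves only to show that \<open>s1s3\<close> acts with an even number of
  reflections.\<close>

lemma s1s3_product_of_3_cycles:
  assumes "4 \<le> n"
  obtains a b where "a \<in> Alt n" "b \<in> Alt n" "a \<circ> a \<circ> a = id" "b \<circ> b \<circ> b = id" "s1s3 = a \<circ> b"
proof -
  let ?a = "transpose 1 2 \<circ> transpose 2 (3::nat)" and ?b = "transpose 2 3 \<circ> transpose 3 (4::nat)"
  have "?a \<in> Alt n" "?b \<in> Alt n"
    unfolding Alt_iff using assms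
    by (auto simp: Sym_comp Sym_transpose evenperm_swap evenperm_comp permutation_swap_id)
  moreover have "?a \<circ> ?a \<circ> ?a = id" "?b \<circ> ?b \<circ> ?b = id" "s1s3 = ?a \<circ> ?b"
    by (auto simp: s1s3_def fun_eq_iff transpose_def)
  ultimately show thesis using that by blast
qed

section \<open>Lifting an orthogonal representation\<close>

lemma orth_rep_lift:
  assumes "orth_rep G d \<rho>" "g \<in> G"
  obtains x where "x \<in> pin d" "pin_rho d x = \<rho> g"
proof -
  have c: "\<rho> g \<in> carrier_mat d d" and o: "\<rho> g * transpose_mat (\<rho> g) = 1\<^sub>m d"
    using assms unfolding orth_rep_def mat_rep_def by auto
  have "transpose_mat (\<rho> g) * \<rho> g = 1\<^sub>m d"
    by (rule mat_mult_left_right_inverse[OF c _ o]) (use c in simp)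
  then show thesis using pin_surj[OF c] that by blast
qed

lemma orth_rep_word:
  assumes "orth_rep G d \<rho>" "g \<in> G"
  obtains us where "unit_list d us" "refl_word d us = \<rho> g"
proof -
  obtain x where "x \<in> pin d" "pin_rho d x = \<rho> g" using orth_rep_lift[OF assms] .
  then show thesis using that pin_rho_word by (auto simp: pin_eq)
qed

lemma orth_rep_mult: "orth_rep G d \<rho> \<Longrightarrow> g \<in> G \<Longrightarrow> h \<in> G \<Longrightarrow> \<rho> (g \<circ> h) = \<rho> g * \<rho> h"
  by (simp add: orth_rep_def mat_rep_def)

lemma orth_rep_id: "orth_rep G d \<rho> \<Longrightarrow> \<rho> id = 1\<^sub>m d"
  by (simp add: orth_rep_def mat_rep_def)

lemma orth_rep_carrier: "orth_rep G d \<rho> \<Longrightarrow> g \<in> G \<Longrightarrow> \<rho> g \<in> carrier_mat d d"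
  by (simp add: orth_rep_def mat_rep_def)

text \<open>The word repeated three times represents the identity, as does the empty word, so three
  times its length is even.\<close>

lemma three_cycle_even_word:
  assumes "orth_rep (Alt n) d \<rho>" "a \<in> Alt n" "a \<circ> a \<circ> a = id" "unit_list d us" "refl_word d us = \<rho> a"
  shows "even (length us)"
proof -
  have "refl_word d (us @ us @ us) = \<rho> (a \<circ> (a \<circ> a))"
    using assms by (simp add: refl_word_append orth_rep_mult[OF assms(1)] Alt_comp)
  also have "\<dots> = \<rho> id" using assms(3) by (simp only: comp_assoc)
  finally have "refl_word d (us @ us @ us) = refl_word d []" by (simp only: orth_rep_id[OF assms(1)] refl_word_simps)
  then have "even (length (us @ us @ us) + length ([] :: real vec list))"
    using assms(4) by (intro cl_word_length_parity) auto
  then show ?thesis by simp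
qed

lemma s1s3_word:
  assumes n: "4 \<le> n" and \<rho>: "orth_rep (Alt n) d \<rho>"
  obtains us where "unit_list d us" "sorted_wrt (\<lambda>u v. u \<bullet> v = 0) us" "refl_word d us = \<rho> s1s3"
    "mtrace (\<rho> s1s3) = real d - 2 * real (length us)" "even (length us)"
proof -
  let ?M = "\<rho> s1s3"
  note s = s1s3_Alt[OF n]
  have c: "?M \<in> carrier_mat d d" using orth_rep_carrier[OF \<rho> s] .
  have o: "?M * transpose_mat ?M = 1\<^sub>m d" using \<rho> s unfolding orth_rep_def by auto
  have MM: "?M * ?M = 1\<^sub>m d"
    using orth_rep_mult[OF \<rho> s s] orth_rep_id[OF \<rho>] by (simp add: s1s3_square)
  \<comment> \<open>An orthogonal involution is symmetric, because its transpose and itself are both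
    its inverse.\<close>
  have "transpose_mat ?M = (?M * ?M) * transpose_mat ?M" unfolding MM using c by simp
  also have "\<dots> = ?M * (?M * transpose_mat ?M)" using c by (intro assoc_mult_mat) auto
  also have "\<dots> = ?M" unfolding o using c by simp
  finally have sym: "transpose_mat ?M = ?M" .
  obtain us where us: "unit_list d us" "sorted_wrt (\<lambda>u v. u \<bullet> v = 0) us" "refl_word d us = ?M"
    "mtrace ?M = real d - 2 * real (length us)" using symmetric_involution_reflections[OF c sym MM] .
  obtain a b where ab: "a \<in> Alt n" "b \<in> Alt n" "a \<circ> a \<circ> a = id" "b \<circ> b \<circ> b = id" "s1s3 = a \<circ> b"
    using s1s3_product_of_3_cycles[OF n] .
  obtain as bs where w: "unit_list d as" "refl_word d as = \<rho> a" "unit_list d bs" "refl_word d bs = \<rho> b"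
    using orth_rep_word[OF \<rho>] ab(1,2) by metis
  have "refl_word d us = refl_word d (as @ bs)"
    using us w orth_rep_mult[OF \<rho> ab(1,2)] ab(5) by (simp add: refl_word_append)
  then have "even (length us + length (as @ bs))" using us w by (intro cl_word_length_parity) auto
  moreover have "even (length as)" "even (length bs)"
    using three_cycle_even_word[OF \<rho>] ab w by auto
  ultimately have "even (length us)" by simp
  then show thesis using that us by blast
qed

lemma pin_square_uminus: "cl_mult d (\<lambda>U. - x U) (\<lambda>U. - x U) = cl_mult d x x"
  using cl_mult_scale_left[of d "-1" x "\<lambda>U. - x U"] cl_mult_scale_right[of d x "-1" x] by simp

text \<open>Here \<open>m\<close> is the dimension of the \<open>-1\<close>-eigenspace of \<open>s1s3\<close>. It is even, so a lift of \<open>s1s3\<close> to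
  the Pin group squares to \<open>(-1)\<close> to the power \<open>m / 2\<close>.\<close>
theorem spinorial_iff:
  assumes n: "4 \<le> n" and d: "0 < d" and \<rho>: "orth_rep (Alt n) d \<rho>"
  obtains m :: nat where "mtrace (\<rho> s1s3) = real d - 2 * real m" "spinorial (Alt n) d \<rho> \<longleftrightarrow> 4 dvd m"
proof -
  note s = s1s3_Alt[OF n]
  obtain us where us: "unit_list d us" "sorted_wrt (\<lambda>u v. u \<bullet> v = 0) us" "refl_word d us = \<rho> s1s3"
    "mtrace (\<rho> s1s3) = real d - 2 * real (length us)" "even (length us)"
    using s1s3_word[OF n \<rho>] .
  let ?s = "cl_word d us"
  have sp: "?s \<in> pin d" "pin_rho d ?s = \<rho> s1s3" using us pin_rho_word[OF us(1)] by (auto simp: pin_eq)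
  \<comment> \<open>For length 2k the exponent of the square is k(2k + 1), which has the parity of
    k.\<close>
  have sq: "cl_mult d ?s ?s = cl_one \<longleftrightarrow> 4 dvd length us"
  proof -
    obtain k where k: "length us = 2 * k" using us(5) by (auto elim: evenE)
    have "length us * (length us + 1) div 2 = k * (2 * k + 1)" unfolding k by simp
    then have "cl_mult d ?s ?s = (\<lambda>U. (-1) ^ k * cl_one U)"
      using cl_word_square[OF us(1,2)] by (simp add: minus_one_power_iff)
    moreover have "(\<lambda>U. (-1) ^ k * cl_one U) = cl_one \<longleftrightarrow> even k"
      by (auto simp: cl_one_def fun_eq_iff minus_one_power_iff)
    moreover have "4 dvd length us \<longleftrightarrow> even k" unfolding k by presburger
    ultimately show ?thesis by simp
  qed
  have "spinorial (Alt n) d \<rho> \<longleftrightarrow> 4 dvd length us"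
  proof
    assume "spinorial (Alt n) d \<rho>"
    then obtain \<phi> where \<phi>: "\<And>g. g \<in> Alt n \<Longrightarrow> \<phi> g \<in> pin d \<and> pin_rho d (\<phi> g) = \<rho> g"
      "\<And>g h. g \<in> Alt n \<Longrightarrow> h \<in> Alt n \<Longrightarrow> \<phi> (g \<circ> h) = cl_mult d (\<phi> g) (\<phi> h)"
      unfolding spinorial_def by blast
    have i: "\<phi> id \<in> pin d" "cl_mult d (\<phi> id) (\<phi> id) = \<phi> id"
      using \<phi>(1)[of id] \<phi>(2)[of id id] by auto
    obtain y where y: "cl_mult d y (\<phi> id) = cl_one" using pin_inverse[OF i(1)] .
    \<comment> \<open>A multiplicative lift sends \<open>id\<close> to an idempotent; invertible
      idempotents are 1.\<close>
    have "\<phi> id = cl_mult d (cl_mult d y (\<phi> id)) (\<phi> id)"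
      unfolding y using cl_mult_one_left[OF pin_carrier[OF i(1)]] by simp
    also have "\<dots> = cl_one" by (subst cl_mult_assoc) (simp only: i(2) y)
    finally have one: "\<phi> id = cl_one" .
    have "cl_mult d (\<phi> s1s3) (\<phi> s1s3) = cl_one"
      using \<phi>(2)[OF s s] by (simp add: s1s3_square one)
    moreover have "?s = \<phi> s1s3 \<or> ?s = (\<lambda>U. - \<phi> s1s3 U)"
      using pin_eq_up_to_sign[OF sp(1)] \<phi>(1)[OF s] sp(2) by simp
    ultimately have "cl_mult d ?s ?s = cl_one" by (auto simp: pin_square_uminus)
    then show "4 dvd length us" using sq by blast
  next
    assume "4 dvd length us"
    then have ss: "cl_mult d ?s ?s = cl_one" using sq by blast
    \<comment> \<open>The pullback of the Pin group along \<rho>, on which the generators will act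
      by right multiplication with their chosen lifts.\<close>
    define C where "C = {(g, x). g \<in> Alt n \<and> x \<in> pin d \<and> pin_rho d x = \<rho> g}"
    have lift: "\<exists>x. x \<in> pin d \<and> pin_rho d x = \<rho> (star3 i) \<and> cl_mult d (cl_mult d x x) x = cl_one"
      if i: "i \<in> {3..n}" for i
    proof -
      let ?c = "star3 i"
      have c: "?c \<in> Alt n" "?c \<circ> ?c \<circ> ?c = id" using star3_Alt[OF i] star3_cube[of i] i by auto
      obtain x where x: "x \<in> pin d" "pin_rho d x = \<rho> ?c" using orth_rep_lift[OF \<rho> c(1)] .
      let ?x3 = "cl_mult d (cl_mult d x x) x"
      have p: "?x3 \<in> pin d" using x by (intro pin_mult)
      have "pin_rho d ?x3 = \<rho> ?c * \<rho> ?c * \<rho> ?c" using x pin_mult by simp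
      also have "\<dots> = \<rho> (?c \<circ> ?c \<circ> ?c)"
        using orth_rep_mult[OF \<rho>] Alt_comp[OF c(1) c(1)] c(1) by simp
      also have "\<dots> = pin_rho d cl_one" by (simp only: c(2) pin_one(2) orth_rep_id[OF \<rho>])
      finally have "pin_rho d ?x3 = pin_rho d cl_one" .
      then have "?x3 = cl_one \<or> ?x3 = (\<lambda>U. - cl_one U)" using pin_eq_up_to_sign[OF p pin_one(1)] by blast
      then show ?thesis
      proof
        \<comment> \<open>Three is odd, so replacing x by -x negates the cube.\<close>
        assume "?x3 = (\<lambda>U. - cl_one U)"
        moreover have "cl_mult d (cl_mult d (\<lambda>U. - x U) (\<lambda>U. - x U)) (\<lambda>U. - x U) = (\<lambda>U. - ?x3 U)"
          unfolding pin_square_uminus using cl_mult_scale_right[of d "cl_mult d x x" "-1" x] by simp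
        ultimately show ?thesis using pin_uminus[OF x(1) d] x by (intro exI[of _ "\<lambda>U. - x U"]) simp
      qed (use x in blast)
    qed
    then obtain v where v: "\<And>i. i \<in> {3..n} \<Longrightarrow> v i \<in> pin d \<and> pin_rho d (v i) = \<rho> (star3 i) \<and>
      cl_mult d (cl_mult d (v i) (v i)) (v i) = cl_one" by metis
    \<comment> \<open>The lift of a product of two generators is, up to sign, a conjugate of the
      lift of \<open>s1s3\<close>, and the sign disappears on squaring.\<close>
    have sq1: "cl_mult d (cl_mult d (v i) (v j)) (cl_mult d (v i) (v j)) = cl_one"
      if ij: "i \<in> {3..n}" "j \<in> {3..n}" "i \<noteq> j" for i j
    proof -
      obtain h where h: "h \<in> Alt n" "star3 i \<circ> star3 j \<circ> h = h \<circ> s1s3"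
        using star3_product_conj[OF n ij] .
      obtain x where x: "x \<in> pin d" "pin_rho d x = \<rho> h" using orth_rep_lift[OF \<rho> h(1)] .
      obtain y where y: "y \<in> pin d" "cl_mult d x y = cl_one" "cl_mult d y x = cl_one" using pin_inverse[OF x(1)] .
      let ?w = "cl_mult d (v i) (v j)"
      have vi: "v i \<in> pin d" "pin_rho d (v i) = \<rho> (star3 i)" and vj: "v j \<in> pin d" "pin_rho d (v j) = \<rho> (star3 j)"
        using v[OF ij(1)] v[OF ij(2)] by simp_all
      note si = star3_Alt[OF ij(1)] and sj = star3_Alt[OF ij(2)]
      have w: "?w \<in> pin d" "pin_rho d ?w = \<rho> (star3 i \<circ> star3 j)"
        using pin_mult[OF vi(1) vj(1)] by (simp_all only: vi(2) vj(2) orth_rep_mult[OF \<rho> si sj])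
      have "pin_rho d (cl_mult d ?w x) = \<rho> (star3 i \<circ> star3 j \<circ> h)"
        by (simp only: pin_mult(2)[OF w(1) x(1)] w(2) x(2) orth_rep_mult[OF \<rho> Alt_comp[OF si sj] h(1)])
      also have "\<dots> = pin_rho d (cl_mult d x ?s)"
        by (simp only: h(2) pin_mult(2)[OF x(1) sp(1)] sp(2) x(2) orth_rep_mult[OF \<rho> h(1) s])
      finally have "pin_rho d (cl_mult d ?w x) = pin_rho d (cl_mult d x ?s)" .
      then have "cl_mult d ?w x = cl_mult d x ?s \<or> cl_mult d ?w x = (\<lambda>U. - cl_mult d x ?s U)"
        by (rule pin_eq_up_to_sign[OF pin_mult(1)[OF w(1) x(1)] pin_mult(1)[OF x(1) sp(1)]])
      then have "?w = cl_mult d (cl_mult d x ?s) y \<or> ?w = (\<lambda>U. - cl_mult d (cl_mult d x ?s) y U)"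
      proof -
        have "?w = cl_mult d (cl_mult d ?w x) y"
          by (simp add: cl_mult_assoc y cl_mult_one_right pin_carrier[OF conjunct1[OF v[OF ij(2)]]])
        then show ?thesis
          using \<open>_ \<or> _\<close> cl_mult_scale_left[of d "-1" "cl_mult d x ?s" y] by auto
      qed
      moreover have "cl_mult d (cl_mult d (cl_mult d x ?s) y) (cl_mult d (cl_mult d x ?s) y) = cl_one"
      proof -
        have "cl_mult d (cl_mult d (cl_mult d x ?s) y) (cl_mult d (cl_mult d x ?s) y)
          = cl_mult d x (cl_mult d ?s (cl_mult d (cl_mult d y x) (cl_mult d ?s y)))" by (simp add: cl_mult_assoc)
        also have "\<dots> = cl_mult d x (cl_mult d (cl_mult d ?s ?s) y)"
          by (simp add: y cl_mult_one_left cl_mult_carrier cl_mult_assoc)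
        also have "\<dots> = cl_one" by (simp add: ss y cl_mult_one_left pin_carrier[OF y(1)])
        finally show ?thesis .
      qed
      ultimately show ?thesis by (auto simp: pin_square_uminus)
    qed
    \<comment> \<open>The enumeration counts generators from 0 while the 3-cycles are indexed from
      3, whence the shift and the n - 2 generators.\<close>
    define f where "f i p = (fst p \<circ> star3 (i + 3), cl_mult d (snd p) (v (i + 3)))" for i and p :: "(nat \<Rightarrow> nat) \<times> cl"
    have idx: "i + 3 \<in> {3..n}" if "i < n - 2" for i using that by auto
    have fC: "f i p \<in> C" if i: "i < n - 2" and p: "p \<in> C" for i p
    proof -
      have p': "fst p \<in> Alt n" "snd p \<in> pin d" "pin_rho d (snd p) = \<rho> (fst p)" using p by (auto simp: C_def)
      have vi: "v (i + 3) \<in> pin d" "pin_rho d (v (i + 3)) = \<rho> (star3 (i + 3))" using v[OF idx[OF i]] by simp_all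
      show ?thesis
        using pin_mult[OF p'(2) vi(1)] Alt_comp[OF p'(1) star3_Alt[OF idx[OF i]]]
        by (simp add: C_def f_def p'(3) vi(2) orth_rep_mult[OF \<rho> p'(1) star3_Alt[OF idx[OF i]]])
    qed
    have snd_carrier: "snd p \<in> cl_carrier d" if "p \<in> C" for p using that by (auto simp: C_def pin_carrier)
    have f3: "f i (f i (f i p)) = p" if "i < n - 2" "p \<in> C" for i p
    proof -
      have "cl_mult d (cl_mult d (cl_mult d (snd p) (v (i + 3))) (v (i + 3))) (v (i + 3))
          = cl_mult d (snd p) (cl_mult d (cl_mult d (v (i + 3)) (v (i + 3))) (v (i + 3)))"
        by (simp add: cl_mult_assoc)
      also have "\<dots> = snd p" using v[OF idx[OF that(1)]] snd_carrier[OF that(2)] by (simp add: cl_mult_one_right)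
      finally have 1: "cl_mult d (cl_mult d (cl_mult d (snd p) (v (i + 3))) (v (i + 3))) (v (i + 3)) = snd p" .
      have "fst p \<circ> (star3 (i + 3) \<circ> star3 (i + 3) \<circ> star3 (i + 3)) = fst p"
        using star3_cube[of "i + 3"] by simp
      then have "fst p \<circ> star3 (i + 3) \<circ> star3 (i + 3) \<circ> star3 (i + 3) = fst p"
        by (simp only: comp_assoc)
      then show ?thesis using 1 by (simp only: f_def fst_conv snd_conv prod.collapse)
    qed
    \<comment> \<open>Brings the relations x^3 = y^3 = (xy)^2 = 1 into the inverse-free form that
      the enumeration expects.\<close>
    have inv_rel: "F j (F i q) = F i (F i (F j (F j q)))"
      if cube: "\<And>q. q \<in> C \<Longrightarrow> F i (F i (F i q)) = q" "\<And>q. q \<in> C \<Longrightarrow> F j (F j (F j q)) = q"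
        and sq: "\<And>q. q \<in> C \<Longrightarrow> F j (F i (F j (F i q))) = q"
        and cl: "\<And>q. q \<in> C \<Longrightarrow> F i q \<in> C" "\<And>q. q \<in> C \<Longrightarrow> F j q \<in> C" and q: "q \<in> C"
      for F :: "nat \<Rightarrow> (nat \<Rightarrow> nat) \<times> cl \<Rightarrow> (nat \<Rightarrow> nat) \<times> cl" and i j q
    proof -
      let ?r = "F i (F i (F j (F j q)))"
      have q2: "F j (F j q) \<in> C" using cl q by blast
      have "F j (F i (F j (F i ?r))) = ?r" using sq cl q2 by blast
      moreover have "F i ?r = F j (F j q)" using cube(1)[OF q2] .
      ultimately show ?thesis using cube(2)[OF q] by simp
    qed
    have f2: "f j (f i (f j (f i p))) = p" if "i < n - 2" "j < n - 2" "i \<noteq> j" "p \<in> C" for i j p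
    proof -
      have ne: "i + 3 \<noteq> j + 3" using that by simp
      let ?a = "star3 (i + 3)" and ?b = "star3 (j + 3)" and ?x = "v (i + 3)" and ?y = "v (j + 3)"
      have "cl_mult d (cl_mult d (cl_mult d (cl_mult d (snd p) ?x) ?y) ?x) ?y
          = cl_mult d (snd p) (cl_mult d (cl_mult d ?x ?y) (cl_mult d ?x ?y))" by (simp add: cl_mult_assoc)
      also have "\<dots> = snd p" using sq1[OF idx[OF that(1)] idx[OF that(2)] ne] snd_carrier[OF that(4)] by (simp add: cl_mult_one_right)
      finally have 1: "cl_mult d (cl_mult d (cl_mult d (cl_mult d (snd p) ?x) ?y) ?x) ?y = snd p" .
      have "(?a \<circ> ?b) \<circ> (?a \<circ> ?b) = id"
        using star3_rel[of "i + 3" "j + 3"] ne by (auto simp: fun_eq_iff transpose_def)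
      then have "fst p \<circ> ((?a \<circ> ?b) \<circ> (?a \<circ> ?b)) = fst p" by (simp only: comp_id)
      then have "fst p \<circ> ?a \<circ> ?b \<circ> ?a \<circ> ?b = fst p" by (simp only: comp_assoc)
      then show ?thesis using 1 by (simp only: f_def fst_conv snd_conv prod.collapse)
    qed
    have frel: "f j (f i p) = f i (f i (f j (f j p)))" if "i < n - 2" "j < n - 2" "i \<noteq> j" "p \<in> C" for i j p
      using inv_rel[where F = f and i = i and j = j and q = p, OF f3[OF that(1)] f3[OF that(2)] f2[OF that(1,2,3)] fC[OF that(1)] fC[OF that(2)] that(4)] .
    let ?e = "(id, cl_one) :: (nat \<Rightarrow> nat) \<times> cl"
    have e: "?e \<in> C" using pin_one orth_rep_id[OF \<rho>] by (simp add: C_def)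
    have n2: "n - 2 + 2 = n" using n by simp
    obtain H where H: "H \<subseteq> C" "finite H" "2 * card H \<le> fact n" "?e \<in> H"
      and Hf: "\<forall>h\<in>H. \<forall>i<n - 2. f i h \<in> H"
      using orbit_bound[of ?e C "n - 2" f, OF e fC f3 frel] unfolding n2 by blast
    have Hstep: "(g \<circ> star3 i, cl_mult d x (v i)) \<in> H" if "(g, x) \<in> H" "i \<in> {3..n}" for g x i
    proof -
      have "i - 3 < n - 2" "i - 3 + 3 = i" using that(2) n by auto
      moreover have "f (i - 3) (g, x) \<in> H" using Hf that(1) calculation(1) by blast
      ultimately show ?thesis by (simp add: f_def)
    qed
    \<comment> \<open>\<open>H\<close> is closed under right multiplication by a lift of every word,
      hence behaves like a subgroup that projects onto the alternating group.\<close>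
    have word: "\<exists>y. (h, y) \<in> H \<and> (\<forall>(g, x)\<in>H. (g \<circ> h, cl_mult d x y) \<in> H)" if "alt_gen n h" for h
      using that
    proof (rule alt_gen.induct)
      show "\<exists>y. (id, y) \<in> H \<and> (\<forall>(g, x)\<in>H. (g \<circ> id, cl_mult d x y) \<in> H)"
        using H(1,4) by (intro exI[of _ cl_one]) (auto simp: C_def subset_iff cl_mult_one_right pin_carrier)
    next
      fix h i assume "\<exists>y. (h, y) \<in> H \<and> (\<forall>(g, x)\<in>H. (g \<circ> h, cl_mult d x y) \<in> H)" and i: "i \<in> {3..n}"
      then obtain y where y: "(h, y) \<in> H" "\<And>g x. (g, x) \<in> H \<Longrightarrow> (g \<circ> h, cl_mult d x y) \<in> H" by blast
      have "(g \<circ> (h \<circ> star3 i), cl_mult d x (cl_mult d y (v i))) \<in> H" if "(g, x) \<in> H" for g x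
        using Hstep[OF y(2)[OF that] i] by (simp only: comp_assoc cl_mult_assoc)
      then show "\<exists>y. (h \<circ> star3 i, y) \<in> H \<and> (\<forall>(g, x)\<in>H. (g \<circ> (h \<circ> star3 i), cl_mult d x y) \<in> H)"
        using Hstep[OF y(1) i] by blast
    qed
    have ex: "\<exists>y. (g, y) \<in> H" if "g \<in> Alt n" for g
    proof -
      have "alt_gen n g" using Alt_alt_gen[of n g] that n by simp
      then show ?thesis using word by blast
    qed
    have surj: "Alt n \<subseteq> fst ` H"
    proof
      fix g assume "g \<in> Alt n"
      then obtain y where "(g, y) \<in> H" using ex by blast
      then show "g \<in> fst ` H" by (rule image_eqI[rotated]) simp
    qed
    \<comment> \<open>\<open>H\<close> has at most n!/2 elements and maps onto a set of exactly that
      size, so each permutation has a single lift in \<open>H\<close>. That lift is the desired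
      homomorphism.\<close>
    have "2 * card (Alt n) = fact n" using card_Alt n by simp
    then have "card H \<le> card (fst ` H)"
      using H(3) card_mono[OF finite_imageI[OF H(2)] surj] by linarith
    then have inj: "inj_on fst H" using H(2) by (meson card_image_le eq_card_imp_inj_on le_antisym)
    have uniq: "x = y" if "(g, x) \<in> H" "(g, y) \<in> H" for g x y
      using inj_onD[OF inj, of "(g, x)" "(g, y)"] that by simp
    have "\<exists>\<phi>. \<forall>g\<in>Alt n. (g, \<phi> g) \<in> H" using ex by (intro bchoice ballI) blast
    then obtain \<phi> where \<phi>: "\<And>g. g \<in> Alt n \<Longrightarrow> (g, \<phi> g) \<in> H" by blast
    have "\<phi> (g \<circ> h) = cl_mult d (\<phi> g) (\<phi> h)" if gh: "g \<in> Alt n" "h \<in> Alt n" for g h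
    proof -
      have "alt_gen n h" using Alt_alt_gen[of n h] gh n by simp
      then obtain y where y: "(h, y) \<in> H" "\<And>g x. (g, x) \<in> H \<Longrightarrow> (g \<circ> h, cl_mult d x y) \<in> H" using word by blast
      have "y = \<phi> h" using uniq y(1) \<phi>[OF gh(2)] by blast
      then show ?thesis using uniq y(2)[OF \<phi>[OF gh(1)]] \<phi>[OF Alt_comp[OF gh]] by blast
    qed
    moreover have "\<phi> g \<in> pin d \<and> pin_rho d (\<phi> g) = \<rho> g" if "g \<in> Alt n" for g
      using \<phi>[OF that] H(1) by (auto simp: C_def)
    ultimately show "spinorial (Alt n) d \<rho>" unfolding spinorial_def by blast
  qed
  then show thesis using that us(4) by blast
qed

section \<open>Tableaux and tabloids\<close>

definition rowf :: "nat list \<Rightarrow> (nat \<times> nat \<Rightarrow> nat) \<Rightarrow> nat \<Rightarrow> nat" where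
  "rowf lam T k = fst (inv_into (cells lam) T k)"

definition colf :: "nat list \<Rightarrow> (nat \<times> nat \<Rightarrow> nat) \<Rightarrow> nat \<Rightarrow> nat" where
  "colf lam T k = snd (inv_into (cells lam) T k)"

lemma tableau_bij: "T \<in> tableaux lam n \<Longrightarrow> bij_betw T (cells lam) {1..n}"
  by (simp add: tableaux_def)

lemma tableau_at:
  assumes "T \<in> tableaux lam n" "k \<in> {1..n}"
  shows "(rowf lam T k, colf lam T k) \<in> cells lam" "T (rowf lam T k, colf lam T k) = k"
proof -
  have "k \<in> T ` cells lam" using tableau_bij[OF assms(1)] assms(2) by (simp add: bij_betw_def)
  then show "(rowf lam T k, colf lam T k) \<in> cells lam" "T (rowf lam T k, colf lam T k) = k"
    unfolding rowf_def colf_def by (simp_all add: inv_into_into f_inv_into_f)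
qed

lemma tableau_cell:
  assumes "T \<in> tableaux lam n" "(i, j) \<in> cells lam"
  shows "T (i, j) \<in> {1..n}" "rowf lam T (T (i, j)) = i" "colf lam T (T (i, j)) = j"
  using tableau_bij[OF assms(1)] assms(2) unfolding rowf_def colf_def
  by (auto simp: bij_betw_def)

text \<open>The Young subgroup of a colouring of 1..n. Row and column stabilisers are the cases of
  the two coordinate functions, and a constant colouring gives the whole symmetric group, so the
  reindexing lemmas need only one proof.\<close>

definition stab :: "nat \<Rightarrow> (nat \<Rightarrow> 'b) \<Rightarrow> (nat \<Rightarrow> nat) set" where
  "stab n c = {q \<in> Sym n. \<forall>k\<in>{1..n}. c (q k) = c k}"

lemma stab_subset: "stab n c \<subseteq> Sym n"
  by (auto simp: stab_def)

lemma finite_stab: "finite (stab n c)"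
  using finite_subset[OF stab_subset finite_Sym] .

lemma Sym_in: "q \<in> Sym n \<Longrightarrow> k \<in> {1..n} \<Longrightarrow> q k \<in> {1..n}"
  using permutes_in_image unfolding Sym_def by fastforce

lemma Sym_not_in: "q \<in> Sym n \<Longrightarrow> k \<notin> {1..n} \<Longrightarrow> q k = k"
  unfolding Sym_def by (simp add: permutes_not_in)

lemma Sym_inverses: "q \<in> Sym n \<Longrightarrow> q (inv_into UNIV q x) = x" "q \<in> Sym n \<Longrightarrow> inv_into UNIV q (q x) = x"
  unfolding Sym_def by (auto simp: permutes_inverses)

lemma Sym_ball: "g \<in> Sym n \<Longrightarrow> (\<forall>k\<in>{1..n}. P (g k)) \<longleftrightarrow> (\<forall>k\<in>{1..n}. P k)"
proof -
  assume "g \<in> Sym n"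
  then have "g ` {1..n} = {1..n}" by (simp only: Sym_def mem_Collect_eq permutes_image)
  then have "(\<forall>k\<in>{1..n}. P k) \<longleftrightarrow> (\<forall>k\<in>g ` {1..n}. P k)" by (simp only:)
  then show ?thesis by (simp only: ball_simps)
qed

lemma stab_id: "id \<in> stab n c"
  by (simp add: stab_def)

lemma stab_comp: "p \<in> stab n c \<Longrightarrow> q \<in> stab n c \<Longrightarrow> p \<circ> q \<in> stab n c"
  by (auto simp: stab_def Sym_comp dest: Sym_in)

lemma stab_inv:
  assumes "p \<in> stab n c"
  shows "inv_into UNIV p \<in> stab n c"
proof -
  have p: "p \<in> Sym n" using assms by (simp add: stab_def)
  have "c (inv_into UNIV p k) = c k" if "k \<in> {1..n}" for k
    using assms Sym_in[OF Sym_inv[OF p] that] Sym_inverses(1)[OF p, of k] by (force simp: stab_def)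
  then show ?thesis using Sym_inv[OF p] by (simp add: stab_def)
qed

lemma col_stab_eq: "col_stab lam n T = stab n (colf lam T)"
  by (auto simp: col_stab_def stab_def Sym_def colf_def)

definition row_stab :: "nat list \<Rightarrow> nat \<Rightarrow> (nat \<times> nat \<Rightarrow> nat) \<Rightarrow> (nat \<Rightarrow> nat) set" where
  "row_stab lam n T = stab n (rowf lam T)"

lemma row_tabloid_eq: "row_tabloid lam n T = restrict (rowf lam T) {1..n}"
  by (simp add: row_tabloid_def rowf_def fun_eq_iff)

lemma row_tabloid_comp_eq_iff:
  assumes "p \<in> Sym n"
  shows "row_tabloid lam n T \<circ> p = row_tabloid lam n T \<longleftrightarrow> p \<in> row_stab lam n T"
proof
  assume *: "row_tabloid lam n T \<circ> p = row_tabloid lam n T"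
  have "rowf lam T (p k) = rowf lam T k" if "k \<in> {1..n}" for k
    using fun_cong[OF *, of k] that Sym_in[OF assms that] by (simp add: row_tabloid_eq)
  then show "p \<in> row_stab lam n T" using assms by (simp add: row_stab_def stab_def)
next
  assume "p \<in> row_stab lam n T"
  then show "row_tabloid lam n T \<circ> p = row_tabloid lam n T"
    using Sym_in[OF assms] Sym_not_in[OF assms]
    by (auto simp: row_stab_def stab_def row_tabloid_eq fun_eq_iff restrict_def)
qed

lemma row_col_stab_trivial:
  assumes T: "T \<in> tableaux lam n" and "q \<in> row_stab lam n T" "q \<in> col_stab lam n T"
  shows "q = id"
proof
  fix k
  have q: "q \<in> Sym n" using assms by (simp add: row_stab_def stab_def)
  show "q k = id k"
  proof (cases "k \<in> {1..n}")
    case True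
    then have "rowf lam T (q k) = rowf lam T k" "colf lam T (q k) = colf lam T k"
      using assms by (auto simp: row_stab_def stab_def col_stab_eq)
    then show ?thesis using tableau_at(2)[OF T Sym_in[OF q True]] tableau_at(2)[OF T True] by simp
  qed (simp add: Sym_not_in[OF q])
qed

lemma tabloid_comp:
  assumes "r \<in> tabloids lam n" "g \<in> Sym n"
  shows "r \<circ> g \<in> tabloids lam n"
proof -
  have r: "r \<in> {1..n} \<rightarrow>\<^sub>E {..<length lam}" and c: "\<And>i. i < length lam \<Longrightarrow> card {k \<in> {1..n}. r k = i} = lam ! i"
    using assms(1) by (auto simp: tabloids_def)
  have "r \<circ> g \<in> {1..n} \<rightarrow>\<^sub>E {..<length lam}"
  proof (rule PiE_I)
    fix k assume "k \<in> {1..n}"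
    then show "(r \<circ> g) k \<in> {..<length lam}" using Sym_in[OF assms(2)] r by (auto simp: PiE_iff)
  next
    fix k assume "k \<notin> {1..n}"
    then show "(r \<circ> g) k = undefined" using Sym_not_in[OF assms(2)] r by (auto simp: PiE_iff extensional_def)
  qed
  moreover have "card {k \<in> {1..n}. (r \<circ> g) k = i} = card {k \<in> {1..n}. r k = i}" for i
  proof (rule bij_betw_same_card)
    show "bij_betw g {k \<in> {1..n}. (r \<circ> g) k = i} {k \<in> {1..n}. r k = i}"
      by (rule bij_betw_byWitness[where f' = "inv_into UNIV g"])
        (use Sym_in[OF assms(2)] Sym_in[OF Sym_inv[OF assms(2)]] Sym_inverses[OF assms(2)] in \<open>auto simp del: atLeastAtMost_iff\<close>)
  qed
  ultimately show ?thesis using c by (simp add: tabloids_def)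
qed

lemma tabloid_comp_iff: "g \<in> Sym n \<Longrightarrow> r \<circ> g \<in> tabloids lam n \<longleftrightarrow> r \<in> tabloids lam n"
proof
  assume g: "g \<in> Sym n" and "r \<circ> g \<in> tabloids lam n"
  then have "r \<circ> g \<circ> inv_into UNIV g \<in> tabloids lam n" using tabloid_comp Sym_inv by blast
  then show "r \<in> tabloids lam n" using Sym_inv_comp(2)[OF g] by (simp add: comp_assoc)
qed (rule tabloid_comp)

lemma finite_tabloids: "finite (tabloids lam n)"
proof (rule finite_subset)
  show "tabloids lam n \<subseteq> {1..n} \<rightarrow>\<^sub>E {..<length lam}" by (auto simp: tabloids_def)
qed (rule finite_PiE, auto)

lemma finite_cells: "finite (cells lam)"
proof (rule finite_subset)
  show "cells lam \<subseteq> (SIGMA i:{..<length lam}. {..<lam ! i})" by (auto simp: cells_def)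
qed auto

lemma finite_tableaux: "finite (tableaux lam n)"
proof (rule finite_subset)
  show "tableaux lam n \<subseteq> cells lam \<rightarrow>\<^sub>E {1..n}" by (auto simp: tableaux_def)
qed (rule finite_PiE, auto simp: finite_cells)

lemma row_tabloid_in:
  assumes T: "T \<in> tableaux lam n"
  shows "row_tabloid lam n T \<in> tabloids lam n"
proof -
  have "row_tabloid lam n T \<in> {1..n} \<rightarrow>\<^sub>E {..<length lam}"
    using tableau_at(1)[OF T] by (auto simp: row_tabloid_eq cells_def)
  moreover have "card {k \<in> {1..n}. row_tabloid lam n T k = i} = lam ! i" if "i < length lam" for i
  proof -
    have "bij_betw (\<lambda>j. T (i, j)) {..<lam ! i} {k \<in> {1..n}. row_tabloid lam n T k = i}"
    proof (rule bij_betw_byWitness[where f' = "colf lam T"])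
      show "\<forall>j\<in>{..<lam ! i}. colf lam T (T (i, j)) = j"
        using tableau_cell(3)[OF T] that by (auto simp: cells_def)
      show "\<forall>k\<in>{k \<in> {1..n}. row_tabloid lam n T k = i}. T (i, colf lam T k) = k"
        using tableau_at(2)[OF T] by (auto simp: row_tabloid_eq)
      show "(\<lambda>j. T (i, j)) ` {..<lam ! i} \<subseteq> {k \<in> {1..n}. row_tabloid lam n T k = i}"
      proof (rule image_subsetI)
        fix j assume "j \<in> {..<lam ! i}"
        then have "(i, j) \<in> cells lam" using that by (simp add: cells_def)
        then show "T (i, j) \<in> {k \<in> {1..n}. row_tabloid lam n T k = i}"
          using tableau_cell[OF T] by (simp add: row_tabloid_eq)
      qed
      show "colf lam T ` {k \<in> {1..n}. row_tabloid lam n T k = i} \<subseteq> {..<lam ! i}"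
        using tableau_at(1)[OF T] by (auto simp: row_tabloid_eq cells_def)
    qed
    from bij_betw_same_card[OF this] show ?thesis by simp
  qed
  ultimately show ?thesis by (simp add: tabloids_def)
qed

lemma card_cells: "card (cells lam) = sum_list lam"
proof -
  have "cells lam = (SIGMA i:{..<length lam}. {..<lam ! i})" by (auto simp: cells_def)
  then have "card (cells lam) = (\<Sum>i<length lam. lam ! i)" by (simp add: card_SigmaI)
  then show ?thesis by (simp add: sum_list_sum_nth atLeast0LessThan)
qed

lemma tableaux_nonempty:
  assumes "is_partition lam n"
  shows "tableaux lam n \<noteq> {}"
proof -
  have "card (cells lam) = card {1..n}" using assms by (simp add: card_cells is_partition_def)
  then obtain h where h: "bij_betw h (cells lam) {1..n}"
    using finite_same_card_bij[OF finite_cells, of "{1..n}" lam] by auto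
  have "bij_betw (restrict h (cells lam)) (cells lam) {1..n}"
    using h by (subst bij_betw_cong[where g = h]) auto
  then have "restrict h (cells lam) \<in> tableaux lam n"
    by (auto simp: tableaux_def bij_betw_def)
  then show ?thesis by blast
qed

text \<open>The action of permutations on tableaux by renaming entries; the restriction keeps the
  value off the diagram equal to \<open>undefined\<close>, as tableaux require.\<close>

definition move :: "nat list \<Rightarrow> (nat \<Rightarrow> nat) \<Rightarrow> (nat \<times> nat \<Rightarrow> nat) \<Rightarrow> (nat \<times> nat \<Rightarrow> nat)" where
  "move lam g T = restrict (g \<circ> T) (cells lam)"

lemma move_tableau:
  assumes "T \<in> tableaux lam n" "g \<in> Sym n"
  shows "move lam g T \<in> tableaux lam n"
proof -
  have "bij_betw g {1..n} {1..n}" using assms(2) by (simp add: Sym_def permutes_imp_bij)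
  then have "bij_betw (g \<circ> T) (cells lam) {1..n}" using tableau_bij[OF assms(1)] bij_betw_trans by blast
  then have "bij_betw (move lam g T) (cells lam) {1..n}"
    unfolding move_def by (subst bij_betw_cong[where g = "g \<circ> T"]) auto
  then show ?thesis by (auto simp: tableaux_def bij_betw_def move_def)
qed

lemma move_at:
  assumes T: "T \<in> tableaux lam n" and g: "g \<in> Sym n" and k: "k \<in> {1..n}"
  shows "rowf lam (move lam g T) k = rowf lam T (inv_into UNIV g k)"
    "colf lam (move lam g T) k = colf lam T (inv_into UNIV g k)"
proof -
  let ?k = "inv_into UNIV g k"
  have k': "?k \<in> {1..n}" using Sym_in[OF Sym_inv[OF g] k] .
  let ?c = "(rowf lam T ?k, colf lam T ?k)"
  have c: "?c \<in> cells lam" "T ?c = ?k" using tableau_at[OF T k'] .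
  have "move lam g T ?c = k" using c Sym_inverses(1)[OF g] by (simp add: move_def)
  then show "rowf lam (move lam g T) k = rowf lam T ?k" "colf lam (move lam g T) k = colf lam T ?k"
    using tableau_cell(2,3)[OF move_tableau[OF T g] c(1)] by simp_all
qed

lemma tableaux_transitive:
  assumes "T \<in> tableaux lam n" "T' \<in> tableaux lam n"
  obtains g where "g \<in> Sym n" "T' = move lam g T"
proof -
  define g where "g k = (if k \<in> {1..n} then T' (rowf lam T k, colf lam T k) else k)" for k
  have "bij_betw (\<lambda>k. T' (inv_into (cells lam) T k)) {1..n} {1..n}"
    using bij_betw_trans[OF bij_betw_inv_into[OF tableau_bij[OF assms(1)]] tableau_bij[OF assms(2)]]
    by (simp add: comp_def)
  then have "bij_betw g {1..n} {1..n}"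
    by (subst bij_betw_cong[where g = "\<lambda>k. T' (inv_into (cells lam) T k)"]) (auto simp: g_def rowf_def colf_def)
  then have "g \<in> Sym n" unfolding Sym_def by (auto intro!: bij_imp_permutes simp: g_def)
  moreover have "T' c = move lam g T c" for c
  proof (cases "c \<in> cells lam")
    case True
    then show ?thesis using tableau_cell[OF assms(1), of "fst c" "snd c"] by (simp add: move_def g_def)
  next
    case False
    then show ?thesis using assms(2) by (cases c) (auto simp: move_def tableaux_def PiE_iff extensional_def)
  qed
  ultimately show ?thesis using that by blast
qed

lemma row_tabloid_move:
  assumes "T \<in> tableaux lam n" "g \<in> Sym n"
  shows "row_tabloid lam n (move lam g T) = row_tabloid lam n T \<circ> inv_into UNIV g"
  using move_at(1)[OF assms] Sym_in[OF Sym_inv[OF assms(2)]] Sym_not_in[OF Sym_inv[OF assms(2)]]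
  by (auto simp: row_tabloid_eq fun_eq_iff restrict_def)

lemma col_stab_move:
  assumes T: "T \<in> tableaux lam n" and g: "g \<in> Sym n" and q: "q \<in> Sym n"
  shows "g \<circ> q \<circ> inv_into UNIV g \<in> col_stab lam n (move lam g T) \<longleftrightarrow> q \<in> col_stab lam n T"
proof -
  let ?g' = "inv_into UNIV g"
  have in': "?g' k \<in> {1..n}" if "k \<in> {1..n}" for k using Sym_in[OF Sym_inv[OF g] that] .
  have conj: "g \<circ> q \<circ> ?g' \<in> Sym n" using g q by (intro Sym_comp Sym_inv)
  have "colf lam (move lam g T) ((g \<circ> q \<circ> ?g') k) = colf lam T (q (?g' k))" if "k \<in> {1..n}" for k
    using move_at(2)[OF T g Sym_in[OF conj that]] Sym_inverses(2)[OF g] by simp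
  then have "g \<circ> q \<circ> ?g' \<in> col_stab lam n (move lam g T) \<longleftrightarrow> (\<forall>k\<in>{1..n}. colf lam T (q (?g' k)) = colf lam T (?g' k))"
    using conj move_at(2)[OF T g] by (simp add: col_stab_eq stab_def)
  also have "\<dots> \<longleftrightarrow> (\<forall>k\<in>{1..n}. colf lam T (q k) = colf lam T k)"
    by (rule Sym_ball[OF Sym_inv[OF g]])
  finally show ?thesis using q by (simp add: col_stab_eq stab_def)
qed

section \<open>Column antisymmetrisation and polytabloids\<close>

definition altsum :: "(nat \<Rightarrow> nat) set \<Rightarrow> ((nat \<Rightarrow> nat) \<Rightarrow> 'a) \<Rightarrow> (nat \<Rightarrow> nat) \<Rightarrow> 'a :: field" where
  "altsum C f = (\<lambda>r. \<Sum>q\<in>C. of_int (sign q) * f (r \<circ> q))"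

text \<open>The permutation module on tabloids, realised as functions that vanish off the
  tabloids.\<close>

definition tabloid_space :: "nat list \<Rightarrow> nat \<Rightarrow> ((nat \<Rightarrow> nat) \<Rightarrow> 'a :: field) set" where
  "tabloid_space lam n = {f. \<forall>r. r \<notin> tabloids lam n \<longrightarrow> f r = 0}"

lemma stab_reindex_right:
  assumes "p \<in> stab n c"
  shows "(\<Sum>q\<in>stab n c. f q) = (\<Sum>q\<in>stab n c. f (p \<circ> q))"
proof (rule sum.reindex_bij_witness[where j = "\<lambda>q. inv_into UNIV p \<circ> q" and i = "\<lambda>q. p \<circ> q"])
  have p: "p \<in> Sym n" using assms by (simp add: stab_def)
  show "p \<circ> (inv_into UNIV p \<circ> q) = q" for q using Sym_inv_comp(2)[OF p] by (simp add: o_assoc)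
  show "inv_into UNIV p \<circ> (p \<circ> q) = q" for q using Sym_inv_comp(1)[OF p] by (simp add: o_assoc)
  show "f (p \<circ> (inv_into UNIV p \<circ> q)) = f q" for q using Sym_inv_comp(2)[OF p] by (simp add: o_assoc)
qed (use assms in \<open>auto intro: stab_comp stab_inv\<close>)

lemma stab_reindex_left:
  assumes "p \<in> stab n c"
  shows "(\<Sum>q\<in>stab n c. f q) = (\<Sum>q\<in>stab n c. f (q \<circ> p))"
proof (rule sum.reindex_bij_witness[where j = "\<lambda>q. q \<circ> inv_into UNIV p" and i = "\<lambda>q. q \<circ> p"])
  have p: "p \<in> Sym n" using assms by (simp add: stab_def)
  show "q \<circ> inv_into UNIV p \<circ> p = q" for q using Sym_inv_comp(1)[OF p] by (simp add: comp_assoc)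
  show "q \<circ> p \<circ> inv_into UNIV p = q" for q using Sym_inv_comp(2)[OF p] by (simp add: comp_assoc)
  show "f (q \<circ> inv_into UNIV p \<circ> p) = f q" for q using Sym_inv_comp(1)[OF p] by (simp add: comp_assoc)
qed (use assms in \<open>auto intro: stab_comp stab_inv\<close>)

lemma stab_reindex_inv: "(\<Sum>q\<in>stab n c. f q) = (\<Sum>q\<in>stab n c. f (inv_into UNIV q))"
proof (rule sum.reindex_bij_witness[where j = "inv_into UNIV" and i = "inv_into UNIV"])
  fix q assume "q \<in> stab n c"
  then have "q permutes {1..n}" by (simp add: stab_def Sym_def)
  then have *: "inv_into UNIV (inv_into UNIV q) = q" by (rule permutes_inv_inv)
  show "inv_into UNIV (inv_into UNIV q) = q" "inv_into UNIV (inv_into UNIV q) = q"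
    "f (inv_into UNIV (inv_into UNIV q)) = f q" using * by simp_all
qed (auto intro: stab_inv)

lemma Sym_eq_stab: "Sym n = stab n (\<lambda>_. ())"
  by (auto simp: stab_def)

lemmas Sym_reindex_right = stab_reindex_right[where c = "\<lambda>_. ()", folded Sym_eq_stab]
lemmas Sym_reindex_left = stab_reindex_left[where c = "\<lambda>_. ()", folded Sym_eq_stab]
lemma sign_comp: "p \<in> Sym n \<Longrightarrow> q \<in> Sym n \<Longrightarrow> sign (p \<circ> q) = sign p * sign q"
  using sign_compose Sym_permutation by blast

lemma sign_inv: "p \<in> Sym n \<Longrightarrow> sign (inv_into UNIV p) = sign p"
  using sign_inverse Sym_permutation by blast

lemma of_int_sign_square: "of_int (sign p) * (of_int (sign p) :: 'a :: field) = 1"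
  by (simp flip: of_int_mult)

lemma of_int_sign_cancel: "of_int (sign p) * (of_int (sign p) * x) = (x :: 'a :: field)"
  by (simp flip: mult.assoc of_int_mult)

lemma altsum_twist:
  assumes "p \<in> stab n c"
  shows "altsum (stab n c) f (r \<circ> p) = of_int (sign p) * altsum (stab n c) f r"
proof -
  have "altsum (stab n c) f r = (\<Sum>q\<in>stab n c. of_int (sign (p \<circ> q)) * f (r \<circ> (p \<circ> q)))"
    unfolding altsum_def by (rule stab_reindex_right[OF assms])
  also have "\<dots> = (\<Sum>q\<in>stab n c. of_int (sign p) * (of_int (sign q) * f (r \<circ> p \<circ> q)))"
  proof (rule sum.cong[OF refl])
    fix q assume "q \<in> stab n c"
    then have "sign (p \<circ> q) = sign p * sign q" using assms stab_subset[of n c] by (intro sign_comp) auto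
    then show "of_int (sign (p \<circ> q)) * f (r \<circ> (p \<circ> q)) = of_int (sign p) * (of_int (sign q) * f (r \<circ> p \<circ> q))"
      by (simp add: comp_assoc)
  qed
  finally show ?thesis unfolding altsum_def sum_distrib_left[symmetric]
    by (simp add: of_int_sign_cancel)
qed

lemma act_comp: "act (g \<circ> h) f = act g (act h f)"
  by (simp add: act_def comp_assoc)

lemma act_id [simp]: "act id f = f"
  by (simp add: act_def)

lemma polytabloid_eq_altsum:
  "polytabloid lam n T = altsum (col_stab lam n T) (\<lambda>r. if r = row_tabloid lam n T then 1 else 0)"
proof -
  have "r = row_tabloid lam n T \<circ> inv_into UNIV q \<longleftrightarrow> r \<circ> q = row_tabloid lam n T"
    if "q \<in> col_stab lam n T" for q r
  proof -
    have "q \<in> Sym n" using that by (simp add: col_stab_eq stab_def)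
    then show ?thesis using Sym_inv_comp[of q n] by (metis comp_assoc comp_id)
  qed
  then show ?thesis unfolding polytabloid_def altsum_def by (intro ext sum.cong refl) simp
qed

text \<open>Row and column stabilisers meet only in the identity, so just one term survives. This
  coordinate normalises every later comparison of scalars.\<close>

lemma polytabloid_row_tabloid:
  assumes "T \<in> tableaux lam n"
  shows "polytabloid lam n T (row_tabloid lam n T) = 1"
proof -
  have "polytabloid lam n T (row_tabloid lam n T) = (\<Sum>q\<in>col_stab lam n T. if q = id then 1 else 0)"
    unfolding polytabloid_eq_altsum altsum_def
  proof (intro sum.cong refl)
    fix q assume q: "q \<in> col_stab lam n T"
    then have "q \<in> Sym n" by (simp add: col_stab_eq stab_def)
    then show "of_int (sign q) * (if row_tabloid lam n T \<circ> q = row_tabloid lam n T then 1 else 0) = (if q = id then 1 else 0)"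
      using row_tabloid_comp_eq_iff[of q n lam T] row_col_stab_trivial[OF assms _ q] by auto
  qed
  also have "\<dots> = 1" using stab_id[of n "colf lam T"] finite_stab[of n "colf lam T"] by (simp add: col_stab_eq)
  finally show ?thesis .
qed

lemma altsum_tabloid_space:
  assumes "f \<in> tabloid_space lam n"
  shows "altsum (stab n c) f \<in> tabloid_space lam n"
  unfolding tabloid_space_def
proof clarify
  fix r assume r: "r \<notin> tabloids lam n"
  then have "f (r \<circ> q) = 0" if "q \<in> stab n c" for q
    using assms tabloid_comp_iff[of q n r lam] that by (simp add: tabloid_space_def stab_def)
  then show "altsum (stab n c) f r = 0" by (simp add: altsum_def)
qed

lemma polytabloid_tabloid_space:
  assumes "T \<in> tableaux lam n"
  shows "polytabloid lam n T \<in> tabloid_space lam n"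
  unfolding polytabloid_eq_altsum col_stab_eq
  by (rule altsum_tabloid_space) (use row_tabloid_in[OF assms] in \<open>auto simp: tabloid_space_def\<close>)

lemma transpose_col_stab:
  assumes "a \<in> {1..n}" "b \<in> {1..n}" "c a = c b"
  shows "transpose a b \<in> stab n c"
  using assms by (auto simp: stab_def Sym_transpose transpose_def)

text \<open>The transposition of a and b fixes r and has sign -1 in the stabiliser, so the value
  equals its own negative; characteristic 0 then makes it 0.\<close>

lemma altsum_not_col_injective:
  fixes f :: "(nat \<Rightarrow> nat) \<Rightarrow> 'a :: field_char_0"
  assumes "a \<in> {1..n}" "b \<in> {1..n}" "a \<noteq> b" "c a = c b" "r a = r b"
  shows "altsum (stab n c) f r = 0"
proof -
  have "r \<circ> transpose a b = r" using assms(5) by (auto simp: fun_eq_iff transpose_def)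
  then have "altsum (stab n c) f r = - altsum (stab n c) f r"
    using altsum_twist[OF transpose_col_stab[of a n b c], of f r] assms by (simp add: sign_swap_id)
  then have "2 * altsum (stab n c) f r = 0" by simp
  then show ?thesis by simp
qed

definition col_injective :: "nat list \<Rightarrow> nat \<Rightarrow> (nat \<times> nat \<Rightarrow> nat) \<Rightarrow> (nat \<Rightarrow> nat) \<Rightarrow> bool" where
  "col_injective lam n T r \<longleftrightarrow> (\<forall>a\<in>{1..n}. \<forall>b\<in>{1..n}. colf lam T a = colf lam T b \<and> r a = r b \<longrightarrow> a = b)"

lemma altsum_nonzero_col_injective:
  fixes f :: "(nat \<Rightarrow> nat) \<Rightarrow> 'a :: field_char_0"
  assumes "altsum (col_stab lam n T) f r \<noteq> 0"
  shows "col_injective lam n T r"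
  unfolding col_injective_def
proof (intro ballI impI, elim conjE, rule ccontr)
  fix a b assume "a \<in> {1..n}" "b \<in> {1..n}" "colf lam T a = colf lam T b" "r a = r b" "a \<noteq> b"
  then show False using altsum_not_col_injective[of a n b "colf lam T" r f] assms by (simp add: col_stab_eq)
qed

section \<open>Dominance of shapes\<close>

text \<open>The partial sums of the parts, in terms of which dominance is a pointwise inequality.
  Counting cells makes them comparable with counts by columns.\<close>

definition rows_below :: "nat list \<Rightarrow> nat \<Rightarrow> nat" where
  "rows_below lam k = card {c \<in> cells lam. fst c < k}"

lemma rows_below_eq_sum: "rows_below lam k = (\<Sum>i<k. if i < length lam then lam ! i else 0)"
proof -
  have "{c \<in> cells lam. fst c < k} = (SIGMA i:{i. i < k \<and> i < length lam}. {..<lam ! i})"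
    by (auto simp: cells_def)
  then have "rows_below lam k = (\<Sum>i | i < k \<and> i < length lam. lam ! i)"
    by (simp add: rows_below_def card_SigmaI)
  also have "\<dots> = (\<Sum>i<k. if i < length lam then lam ! i else 0)"
    by (subst sum.inter_filter[symmetric]) (auto intro!: sum.cong)
  finally show ?thesis .
qed

lemma card_tabloid_rows_below:
  assumes "r \<in> tabloids lam n"
  shows "card {x \<in> {1..n}. r x < k} = rows_below lam k"
proof -
  have r: "\<And>x. x \<in> {1..n} \<Longrightarrow> r x < length lam" and c: "\<And>i. i < length lam \<Longrightarrow> card {x \<in> {1..n}. r x = i} = lam ! i"
    using assms by (auto simp: tabloids_def PiE_iff)
  have "{x \<in> {1..n}. r x < k} = (\<Union>i<k. {x \<in> {1..n}. r x = i})" by auto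
  then have "card {x \<in> {1..n}. r x < k} = (\<Sum>i<k. card {x \<in> {1..n}. r x = i})"
    by (simp only:) (rule card_UN_disjoint, auto)
  also have "\<dots> = (\<Sum>i<k. if i < length lam then lam ! i else 0)"
  proof (rule sum.cong[OF refl])
    fix i show "card {x \<in> {1..n}. r x = i} = (if i < length lam then lam ! i else 0)"
    proof (cases "i < length lam")
      case False
      then have "{x \<in> {1..n}. r x = i} = {}" using r by auto
      then show ?thesis using False by (simp only: card.empty if_False)
    qed (simp only: c if_True)
  qed
  finally show ?thesis by (simp add: rows_below_eq_sum)
qed

lemma partition_antimono:
  assumes "is_partition lam n" "i \<le> j" "j < length lam"
  shows "lam ! j \<le> lam ! i"
  using assms sorted_wrt_nth_less[of "(\<ge>)" lam i j] by (cases "i = j") (auto simp: is_partition_def)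

definition col_height :: "nat list \<Rightarrow> nat \<Rightarrow> nat" where
  "col_height lam j = card {i. (i, j) \<in> cells lam}"

lemma col_cells:
  assumes "is_partition lam n"
  shows "(i, j) \<in> cells lam \<longleftrightarrow> i < col_height lam j"
proof -
  let ?L = "{i. (i, j) \<in> cells lam}"
  have fin: "finite ?L" by (rule finite_subset[of _ "{..<length lam}"]) (auto simp: cells_def)
  have down: "i \<in> ?L" if "i' \<in> ?L" "i \<le> i'" for i i'
    using that partition_antimono[OF assms that(2)] by (auto simp: cells_def intro: less_le_trans)
  have "?L = {..<card ?L}"
  proof (cases "?L = {}")
    case False
    then have "Max ?L \<in> ?L" using fin by (rule Max_in[rotated])
    then have "?L = {..Max ?L}" using down Max_ge[OF fin] by blast
    then have "?L = {..<Suc (Max ?L)}" by (simp only: lessThan_Suc_atMost)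
    then show ?thesis by (metis card_lessThan)
  qed simp
  then show ?thesis unfolding col_height_def by blast
qed

lemma card_column:
  assumes T: "T \<in> tableaux lam n"
  shows "card {x \<in> {1..n}. colf lam T x = j} = col_height lam j"
proof -
  have "bij_betw (rowf lam T) {x \<in> {1..n}. colf lam T x = j} {i. (i, j) \<in> cells lam}"
  proof (rule bij_betw_byWitness[where f' = "\<lambda>i. T (i, j)"])
    show "\<forall>x\<in>{x \<in> {1..n}. colf lam T x = j}. T (rowf lam T x, j) = x"
      using tableau_at(2)[OF T] by auto
    show "\<forall>i\<in>{i. (i, j) \<in> cells lam}. rowf lam T (T (i, j)) = i"
      using tableau_cell(2)[OF T] by auto
    show "rowf lam T ` {x \<in> {1..n}. colf lam T x = j} \<subseteq> {i. (i, j) \<in> cells lam}"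
      using tableau_at(1)[OF T] by auto
    show "(\<lambda>i. T (i, j)) ` {i. (i, j) \<in> cells lam} \<subseteq> {x \<in> {1..n}. colf lam T x = j}"
      using tableau_cell[OF T] by (auto simp del: atLeastAtMost_iff)
  qed
  then show ?thesis unfolding col_height_def by (rule bij_betw_same_card)
qed

lemma column_bound:
  assumes T: "T \<in> tableaux lam n" and inj: "col_injective lam n T r"
  shows "card {x \<in> {1..n}. colf lam T x = j \<and> r x < k} \<le> min k (col_height lam j)"
proof -
  let ?A = "{x \<in> {1..n}. colf lam T x = j \<and> r x < k}"
  have "inj_on r ?A" using inj unfolding inj_on_def col_injective_def by blast
  moreover have "r ` ?A \<subseteq> {..<k}" by auto
  ultimately have "card ?A \<le> k" using card_inj_on_le[of r ?A "{..<k}"] by simp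
  moreover have "card ?A \<le> card {x \<in> {1..n}. colf lam T x = j}" by (rule card_mono) auto
  ultimately show ?thesis using card_column[OF T] by simp
qed

lemma sum_over_columns:
  assumes part: "is_partition lam n" and T: "T \<in> tableaux lam n"
  shows "card {x \<in> {1..n}. P x} = (\<Sum>j<n. card {x \<in> {1..n}. colf lam T x = j \<and> P x})"
    and "rows_below lam k = (\<Sum>j<n. min k (col_height lam j))"
proof -
  have width: "j < n" if "(i, j) \<in> cells lam" for i j
  proof -
    have "j < lam ! i" "lam ! i \<in> set lam" using that by (auto simp: cells_def)
    then have "lam ! i \<le> sum_list lam" by (simp add: member_le_sum_list)
    then show ?thesis using part \<open>j < lam ! i\<close> by (simp add: is_partition_def)
  qed
  then have col: "colf lam T x < n" if "x \<in> {1..n}" for x using tableau_at(1)[OF T that] by blast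
  have "{x \<in> {1..n}. P x} = (\<Union>j<n. {x \<in> {1..n}. colf lam T x = j \<and> P x})" using col by blast
  then have "card {x \<in> {1..n}. P x} = card (\<Union>j<n. {x \<in> {1..n}. colf lam T x = j \<and> P x})" by (rule arg_cong)
  also have "\<dots> = (\<Sum>j<n. card {x \<in> {1..n}. colf lam T x = j \<and> P x})"
    by (rule card_UN_disjoint) auto
  finally show "card {x \<in> {1..n}. P x} = (\<Sum>j<n. card {x \<in> {1..n}. colf lam T x = j \<and> P x})" .
  have "{c \<in> cells lam. fst c < k} = prod.swap ` (SIGMA j:{..<n}. {..<min k (col_height lam j)})"
  proof (rule Set.set_eqI)
    fix c :: "nat \<times> nat"
    have mem: "(i, j) \<in> cells lam \<longleftrightarrow> j < n \<and> i < col_height lam j" for i j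
      using width col_cells[OF part] by blast
    show "c \<in> {c \<in> cells lam. fst c < k} \<longleftrightarrow> c \<in> prod.swap ` (SIGMA j:{..<n}. {..<min k (col_height lam j)})"
      by (cases c) (auto simp: mem pair_in_swap_image)
  qed
  then show "rows_below lam k = (\<Sum>j<n. min k (col_height lam j))"
    unfolding rows_below_def by (simp add: card_image card_SigmaI)
qed

text \<open>Entries of one column of T lie in different rows of r, so a column has at most min(k,
  height) entries in the first k rows of r. Summed over the columns this bound is the number of
  cells of the first k rows of lam.\<close>

theorem col_injective_dominates:
  assumes part: "is_partition lam n" and T: "T \<in> tableaux lam n" and r: "r \<in> tabloids mu n"
    and inj: "col_injective lam n T r"
  shows "rows_below mu k \<le> rows_below lam k"
proof -
  have "rows_below mu k = (\<Sum>j<n. card {x \<in> {1..n}. colf lam T x = j \<and> r x < k})"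
    using card_tabloid_rows_below[OF r, of k] sum_over_columns(1)[OF part T, of "\<lambda>x. r x < k"] by simp
  also have "\<dots> \<le> (\<Sum>j<n. min k (col_height lam j))" by (intro sum_mono column_bound T inj)
  finally show ?thesis by (simp add: sum_over_columns(2)[OF part T])
qed

text \<open>This is the equality case of the preceding count: rearranging each column of T realises
  r.\<close>

theorem col_injective_same_shape:
  assumes part: "is_partition lam n" and T: "T \<in> tableaux lam n" and r: "r \<in> tabloids lam n"
    and inj: "col_injective lam n T r"
  obtains p where "p \<in> col_stab lam n T" "r = row_tabloid lam n T \<circ> p"
proof -
  \<comment> \<open>For equal shapes the columnwise bounds add up to the exact total, so none of
    them is strict.\<close>
  have eq: "card {x \<in> {1..n}. colf lam T x = j \<and> r x < k} = min k (col_height lam j)" if "j < n" for j k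
  proof (rule ccontr)
    assume "card {x \<in> {1..n}. colf lam T x = j \<and> r x < k} \<noteq> min k (col_height lam j)"
    with column_bound[OF T inj, of j k]
    have less: "card {x \<in> {1..n}. colf lam T x = j \<and> r x < k} < min k (col_height lam j)"
      by (rule le_neq_trans)
    have "(\<Sum>j<n. card {x \<in> {1..n}. colf lam T x = j \<and> r x < k}) < (\<Sum>j<n. min k (col_height lam j))"
    proof (rule sum_strict_mono_ex1)
      show "\<exists>j\<in>{..<n}. card {x \<in> {1..n}. colf lam T x = j \<and> r x < k} < min k (col_height lam j)"
        using less that by blast
    qed (use column_bound[OF T inj, of _ k] in blast)+
    then show False
      using card_tabloid_rows_below[OF r, of k] sum_over_columns(1)[OF part T, of "\<lambda>x. r x < k"]
        sum_over_columns(2)[OF part T, of k] by linarith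
  qed
  \<comment> \<open>Equality with k the height of the column says that all its entries have r-row
    below that height, so the cell exists.\<close>
  have cell: "(r x, colf lam T x) \<in> cells lam" if x: "x \<in> {1..n}" for x
  proof -
    let ?j = "colf lam T x" and ?h = "col_height lam (colf lam T x)"
    have "?j < n"
    proof (rule ccontr)
      assume "\<not> ?j < n"
      then have "{y \<in> {1..n}. colf lam T y = j \<and> colf lam T y = ?j} = {}" if "j < n" for j using that by auto
      then have "card {y \<in> {1..n}. colf lam T y = ?j} = 0"
        using sum_over_columns(1)[OF part T, of "\<lambda>y. colf lam T y = ?j"] by simp
      then show False using x by auto
    qed
    then have "card {y \<in> {1..n}. colf lam T y = ?j \<and> r y < ?h} = card {y \<in> {1..n}. colf lam T y = ?j}"
      using eq card_column[OF T] by simp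
    then have "{y \<in> {1..n}. colf lam T y = ?j \<and> r y < ?h} = {y \<in> {1..n}. colf lam T y = ?j}"
      by (intro card_subset_eq) auto
    then show ?thesis using x col_cells[OF part] by blast
  qed
  \<comment> \<open>Sends x to the entry of T in the same column and in the row that r
    prescribes.\<close>
  define p where "p x = (if x \<in> {1..n} then T (r x, colf lam T x) else x)" for x
  have p_in: "p x \<in> {1..n}" "rowf lam T (p x) = r x" "colf lam T (p x) = colf lam T x" if "x \<in> {1..n}" for x
    using tableau_cell[OF T cell[OF that]] that by (simp_all add: p_def)
  have "inj_on p {1..n}"
  proof (rule inj_onI)
    fix x y assume xy: "x \<in> {1..n}" "y \<in> {1..n}" "p x = p y"
    then have "r x = r y" "colf lam T x = colf lam T y"
      using p_in(2,3)[OF xy(1)] p_in(2,3)[OF xy(2)] by simp_all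
    then show "x = y" using inj xy(1,2) unfolding col_injective_def by blast
  qed
  moreover from p_in(1) have "p ` {1..n} \<subseteq> {1..n}" by blast
  ultimately have "bij_betw p {1..n} {1..n}" unfolding bij_betw_def by (simp add: endo_inj_surj)
  then have "p permutes {1..n}" by (rule bij_imp_permutes) (simp only: p_def if_False)
  then have "p \<in> Sym n" by (simp add: Sym_def)
  then have "p \<in> col_stab lam n T" using p_in(3) by (simp add: col_stab_eq stab_def)
  moreover have "r = row_tabloid lam n T \<circ> p"
  proof
    fix x show "r x = (row_tabloid lam n T \<circ> p) x"
    proof (cases "x \<in> {1..n}")
      case True
      then show ?thesis using p_in[OF True] by (simp add: row_tabloid_eq)
    next
      case False
      then have "r x = undefined" using r by (simp add: tabloids_def PiE_iff extensional_def)
      then show ?thesis using False by (simp only: p_def row_tabloid_eq restrict_def comp_apply if_False)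
    qed
  qed
  ultimately show thesis using that by blast
qed

section \<open>Specht modules\<close>

lemma fsubspace_zero: "fsubspace W \<Longrightarrow> (\<lambda>r. 0) \<in> W"
  by (simp add: fsubspace_def)

lemma fsubspace_lincomb: "fsubspace W \<Longrightarrow> f \<in> W \<Longrightarrow> g \<in> W \<Longrightarrow> (\<lambda>r. a * f r + g r) \<in> W"
  by (simp add: fsubspace_def)

lemma fsubspace_add: "fsubspace W \<Longrightarrow> f \<in> W \<Longrightarrow> g \<in> W \<Longrightarrow> (\<lambda>r. f r + g r) \<in> W"
  using fsubspace_lincomb[of W f g 1] by simp

lemma fsubspace_scale: "fsubspace W \<Longrightarrow> f \<in> W \<Longrightarrow> (\<lambda>r. a * f r) \<in> W"
  using fsubspace_lincomb[of W f "\<lambda>r. 0" a] fsubspace_zero[of W] by simp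

lemma fsubspace_uminus: "fsubspace W \<Longrightarrow> f \<in> W \<Longrightarrow> (\<lambda>r. - f r) \<in> W"
  using fsubspace_scale[of W f "-1"] by simp

lemma fsubspace_diff: "fsubspace W \<Longrightarrow> f \<in> W \<Longrightarrow> g \<in> W \<Longrightarrow> (\<lambda>r. f r - g r) \<in> W"
  using fsubspace_add[OF _ _ fsubspace_uminus[of W g], of f] by simp

lemma fsubspace_sum:
  assumes "fsubspace W" "\<And>i. i \<in> A \<Longrightarrow> F i \<in> W"
  shows "(\<lambda>r. \<Sum>i\<in>A. c i * F i r) \<in> W"
proof (cases "finite A")
  case True
  then show ?thesis using assms(2)
  proof (induction A rule: finite_induct)
    case (insert x A)
    then show ?case using fsubspace_lincomb[OF assms(1), of "F x" _ "c x"] by simp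
  qed (simp add: fsubspace_zero[OF assms(1)])
qed (simp add: fsubspace_zero[OF assms(1)])

lemma act_zero [simp]: "act g (\<lambda>r. 0) = (\<lambda>r. 0)"
  by (simp add: act_def)

lemma act_lincomb: "act g (\<lambda>r. a * f r + h r) = (\<lambda>r. a * act g f r + act g h r)"
  by (simp add: act_def)

lemma invariantD: "invariant G W \<Longrightarrow> g \<in> G \<Longrightarrow> f \<in> W \<Longrightarrow> act g f \<in> W"
  by (simp add: invariant_def)

lemma invariant_mono: "invariant G W \<Longrightarrow> H \<subseteq> G \<Longrightarrow> invariant H W"
  by (auto simp: invariant_def)

lemma altsum_in_invariant:
  assumes "fsubspace W" "invariant (Sym n) W" "f \<in> W"
  shows "altsum (stab n c) f \<in> W"
proof -
  have "act q f \<in> W" if "q \<in> stab n c" for q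
    using assms that by (auto simp: invariant_def stab_def)
  then have "(\<lambda>r. \<Sum>q\<in>stab n c. of_int (sign q) * act q f r) \<in> W" by (rule fsubspace_sum[OF assms(1)])
  then show ?thesis by (simp add: altsum_def act_def)
qed

lemma polytabloid_twist:
  assumes "q \<in> col_stab lam n T"
  shows "polytabloid lam n T (r \<circ> q) = of_int (sign q) * polytabloid lam n T r"
  using assms unfolding polytabloid_eq_altsum col_stab_eq by (rule altsum_twist)

text \<open>The projection onto a polytabloid: column antisymmetrisation has rank one on the
  permutation module of the same shape.\<close>
theorem altsum_eq_polytabloid:
  fixes f :: "(nat \<Rightarrow> nat) \<Rightarrow> 'a :: field_char_0"
  assumes part: "is_partition lam n" and T: "T \<in> tableaux lam n" and f: "f \<in> tabloid_space lam n"
  shows "altsum (col_stab lam n T) f =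
    (\<lambda>r. altsum (col_stab lam n T) f (row_tabloid lam n T) * polytabloid lam n T r)"
proof
  fix r
  let ?A = "altsum (col_stab lam n T) f" and ?r0 = "row_tabloid lam n T"
  have A: "?A \<in> tabloid_space lam n" unfolding col_stab_eq by (rule altsum_tabloid_space[OF f])
  note e = polytabloid_tabloid_space[OF T, where 'a = 'a]
  show "?A r = ?A ?r0 * polytabloid lam n T r"
  proof (cases "r \<in> tabloids lam n")
    case False
    then show ?thesis using A e by (simp add: tabloid_space_def)
  next
    case r: True
    show ?thesis
    proof (cases "col_injective lam n T r")
      case True
      obtain p where p: "p \<in> col_stab lam n T" "r = ?r0 \<circ> p"
        using col_injective_same_shape[OF part T r True] .
      have "?A r = of_int (sign p) * ?A ?r0"
        using p unfolding p(2) col_stab_eq by (intro altsum_twist)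
      moreover have "polytabloid lam n T r = (of_int (sign p) :: 'a)"
        unfolding p(2) polytabloid_twist[OF p(1)] polytabloid_row_tabloid[OF T] by simp
      ultimately show ?thesis by simp
    next
      case False
      then have "?A r = 0" "polytabloid lam n T r = (0 :: 'a)"
        using altsum_nonzero_col_injective unfolding polytabloid_eq_altsum by blast+
      then show ?thesis by simp
    qed
  qed
qed

lemma specht_polytabloid:
  assumes "T \<in> tableaux lam n"
  shows "(polytabloid lam n T :: _ \<Rightarrow> 'a :: field) \<in> specht lam n"
proof -
  have "(polytabloid lam n T :: _ \<Rightarrow> 'a) = (\<lambda>r. \<Sum>T'\<in>tableaux lam n. (if T' = T then 1 else 0) * polytabloid lam n T' r)"
    using assms by (intro ext) (simp add: if_distrib[of "\<lambda>x. x * _"] finite_tableaux cong: if_cong)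
  then show ?thesis unfolding specht_def mem_Collect_eq by (rule exI[where x = "\<lambda>T'. if T' = T then 1 else 0"])
qed

lemma specht_fsubspace: "fsubspace (specht lam n)"
  unfolding fsubspace_def
proof (intro conjI ballI allI)
  show "(\<lambda>r. 0) \<in> specht lam n" unfolding specht_def by (auto intro!: exI[of _ "\<lambda>_. 0"])
next
  fix f g :: "(nat \<Rightarrow> nat) \<Rightarrow> 'a" and a
  assume "f \<in> specht lam n" "g \<in> specht lam n"
  then obtain c d where "f = (\<lambda>r. \<Sum>T\<in>tableaux lam n. c T * polytabloid lam n T r)"
    "g = (\<lambda>r. \<Sum>T\<in>tableaux lam n. d T * polytabloid lam n T r)"
    unfolding specht_def by blast
  then have "(\<lambda>r. a * f r + g r) = (\<lambda>r. \<Sum>T\<in>tableaux lam n. (a * c T + d T) * polytabloid lam n T r)"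
    by (simp add: sum_distrib_left algebra_simps flip: sum.distrib)
  then show "(\<lambda>r. a * f r + g r) \<in> specht lam n" unfolding specht_def by (auto intro!: exI)
qed

lemma specht_least:
  assumes "fsubspace W" "\<And>T. T \<in> tableaux lam n \<Longrightarrow> polytabloid lam n T \<in> W"
  shows "specht lam n \<subseteq> W"
  unfolding specht_def using fsubspace_sum[OF assms(1), of "tableaux lam n" "polytabloid lam n"] assms(2) by auto

lemma tabloid_space_fsubspace: "fsubspace (tabloid_space lam n)"
  by (simp add: fsubspace_def tabloid_space_def)

lemma specht_tabloid_space: "specht lam n \<subseteq> tabloid_space lam n"
  by (rule specht_least[OF tabloid_space_fsubspace polytabloid_tabloid_space])

lemma polytabloid_move:
  assumes T: "T \<in> tableaux lam n" and g: "g \<in> Sym n"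
  shows "polytabloid lam n (move lam g T) = (act g (polytabloid lam n T) :: _ \<Rightarrow> 'a :: field)"
proof
  fix r
  let ?g' = "inv_into UNIV g"
  have gg: "?g' \<circ> g = id" "g \<circ> ?g' = id" using Sym_inv_comp[OF g] by auto
  have "polytabloid lam n (move lam g T) r = (\<Sum>q\<in>col_stab lam n (move lam g T).
      of_int (sign q) * (if r \<circ> q = row_tabloid lam n T \<circ> ?g' then 1 else (0 :: 'a)))"
    by (simp add: polytabloid_eq_altsum altsum_def row_tabloid_move[OF T g])
  also have "\<dots> = (\<Sum>q\<in>col_stab lam n T. of_int (sign q) * (if r \<circ> g \<circ> q = row_tabloid lam n T then 1 else 0))"
  proof (rule sum.reindex_bij_witness[where i = "\<lambda>q. g \<circ> q \<circ> ?g'" and j = "\<lambda>q. ?g' \<circ> q \<circ> g"])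
    have a: "g \<circ> (?g' \<circ> q \<circ> g) \<circ> ?g' = q" for q using gg by (metis comp_assoc comp_id id_comp)
    have b: "?g' \<circ> (g \<circ> q \<circ> ?g') \<circ> g = q" for q using gg by (metis comp_assoc comp_id id_comp)
    {
      fix q assume q: "q \<in> col_stab lam n (move lam g T)"
      then have qS: "q \<in> Sym n" by (simp add: col_stab_eq stab_def)
      have q'S: "?g' \<circ> q \<circ> g \<in> Sym n" using g qS by (intro Sym_comp Sym_inv)
      show "g \<circ> (?g' \<circ> q \<circ> g) \<circ> ?g' = q" by (rule a)
      show "?g' \<circ> q \<circ> g \<in> col_stab lam n T" using col_stab_move[OF T g q'S] q unfolding a by simp
      have "sign (?g' \<circ> q \<circ> g) = sign q * (sign g * sign g)"
        using g qS by (simp add: sign_comp[of _ n] Sym_comp Sym_inv sign_inv[OF g])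
      then have s: "sign (?g' \<circ> q \<circ> g) = sign q" by simp
      have "r \<circ> g \<circ> (?g' \<circ> q \<circ> g) = r \<circ> q \<circ> g" using gg by (metis comp_assoc comp_id)
      moreover have "r \<circ> q \<circ> g = row_tabloid lam n T \<longleftrightarrow> r \<circ> q = row_tabloid lam n T \<circ> ?g'"
        using gg by (metis comp_assoc comp_id)
      ultimately show "of_int (sign (?g' \<circ> q \<circ> g)) * (if r \<circ> g \<circ> (?g' \<circ> q \<circ> g) = row_tabloid lam n T then 1 else 0)
        = of_int (sign q) * (if r \<circ> q = row_tabloid lam n T \<circ> ?g' then 1 else (0::'a))"
        by (simp only: s)
    }
    {
      fix q assume q: "q \<in> col_stab lam n T"
      then have qS: "q \<in> Sym n" by (simp add: col_stab_eq stab_def)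
      show "?g' \<circ> (g \<circ> q \<circ> ?g') \<circ> g = q" by (rule b)
      show "g \<circ> q \<circ> ?g' \<in> col_stab lam n (move lam g T)" using col_stab_move[OF T g qS] q by simp
    }
  qed
  also have "\<dots> = act g (polytabloid lam n T) r"
    by (simp add: polytabloid_eq_altsum altsum_def act_def)
  finally show "polytabloid lam n (move lam g T) r = (act g (polytabloid lam n T) r :: 'a)" .
qed

lemma specht_invariant: "invariant (Sym n) (specht lam n)"
  unfolding invariant_def
proof (intro ballI)
  fix g and f :: "(nat \<Rightarrow> nat) \<Rightarrow> 'a" assume g: "g \<in> Sym n" and "f \<in> specht lam n"
  then obtain c where f: "f = (\<lambda>r. \<Sum>T\<in>tableaux lam n. c T * polytabloid lam n T r)"
    unfolding specht_def by blast
  have "act g f = (\<lambda>r. \<Sum>T\<in>tableaux lam n. c T * polytabloid lam n (move lam g T) r)"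
    unfolding f using polytabloid_move[OF _ g, of _ lam, where 'a = 'a]
    by (simp add: act_def)
  also have "\<dots> \<in> specht lam n"
    by (rule fsubspace_sum[OF specht_fsubspace]) (rule specht_polytabloid[OF move_tableau[OF _ g]])
  finally show "act g f \<in> specht lam n" .
qed

text \<open>Permutations carry any tableau to any other, so the Specht module is cyclic with an
  arbitrary polytabloid as generator.\<close>

lemma specht_generated:
  assumes "fsubspace W" "invariant (Sym n) W" "T \<in> tableaux lam n" "polytabloid lam n T \<in> W"
  shows "specht lam n \<subseteq> W"
proof (rule specht_least[OF assms(1)])
  fix T' assume "T' \<in> tableaux lam n"
  then obtain g where "g \<in> Sym n" "T' = move lam g T" using tableaux_transitive[OF assms(3)] by blast
  then show "polytabloid lam n T' \<in> W"
    using polytabloid_move[OF assms(3), of g, where 'a = 'a] invariantD[OF assms(2) _ assms(4)] by simp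
qed

lemma specht_nonzero:
  assumes "is_partition lam n"
  shows "specht lam n \<noteq> {\<lambda>r. 0 :: 'a :: field}"
proof
  obtain T where T: "T \<in> tableaux lam n" using tableaux_nonempty[OF assms] by blast
  assume "specht lam n = {\<lambda>r. 0 :: 'a}"
  then have "polytabloid lam n T = (\<lambda>r. 0 :: 'a)" using specht_polytabloid[OF T, where 'a = 'a] by simp
  then show False using polytabloid_row_tabloid[OF T, where 'a = 'a] by simp
qed

text \<open>Column antisymmetrisation is self-adjoint, so pairing with a polytabloid is one
  coordinate of the antisymmetrised function.\<close>

lemma altsum_inner:
  assumes T: "T \<in> tableaux lam n"
  shows "(\<Sum>r\<in>tabloids lam n. u r * polytabloid lam n T r) = altsum (col_stab lam n T) u (row_tabloid lam n T)"
proof -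
  let ?C = "col_stab lam n T" and ?r0 = "row_tabloid lam n T"
  have C: "q \<in> Sym n" if "q \<in> ?C" for q using that by (simp add: col_stab_eq stab_def)
  have "(\<Sum>r\<in>tabloids lam n. u r * polytabloid lam n T r)
      = (\<Sum>r\<in>tabloids lam n. \<Sum>q\<in>?C. if r = ?r0 \<circ> inv_into UNIV q then of_int (sign q) * u r else 0)"
    unfolding polytabloid_def sum_distrib_left by (intro sum.cong refl) auto
  also have "\<dots> = (\<Sum>q\<in>?C. \<Sum>r\<in>tabloids lam n. if r = ?r0 \<circ> inv_into UNIV q then of_int (sign q) * u r else 0)"
    by (rule sum.swap)
  also have "\<dots> = (\<Sum>q\<in>?C. of_int (sign q) * u (?r0 \<circ> inv_into UNIV q))"
  proof (rule sum.cong[OF refl])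
    fix q assume "q \<in> ?C"
    then have "?r0 \<circ> inv_into UNIV q \<in> tabloids lam n"
      using tabloid_comp[OF row_tabloid_in[OF T] Sym_inv[OF C]] by blast
    then show "(\<Sum>r\<in>tabloids lam n. if r = ?r0 \<circ> inv_into UNIV q then of_int (sign q) * u r else 0)
        = of_int (sign q) * u (?r0 \<circ> inv_into UNIV q)" by (simp add: finite_tabloids)
  qed
  also have "\<dots> = (\<Sum>q\<in>?C. of_int (sign (inv_into UNIV q)) * u (?r0 \<circ> inv_into UNIV (inv_into UNIV q)))"
    unfolding col_stab_eq by (rule stab_reindex_inv)
  also have "\<dots> = altsum ?C u ?r0"
    unfolding altsum_def
  proof (rule sum.cong[OF refl])
    fix q assume "q \<in> ?C"
    then have "q \<in> Sym n" "q permutes {1..n}" using C by (auto simp: Sym_def)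
    then show "of_int (sign (inv_into UNIV q)) * u (?r0 \<circ> inv_into UNIV (inv_into UNIV q)) = of_int (sign q) * u (?r0 \<circ> q)"
      by (simp add: sign_inv permutes_inv_inv)
  qed
  finally show ?thesis .
qed

lemma conjugate_one: "conjugate (1 :: 'a :: conjugatable_field) = 1"
proof -
  have "conjugate (1 :: 'a) * conjugate 1 = conjugate 1 * 1" by (simp flip: conjugate_dist_mul)
  moreover have "conjugate (1 :: 'a) \<noteq> 0" by simp
  ultimately show ?thesis using mult_left_cancel by blast
qed

lemma conjugate_of_nat: "conjugate (of_nat k :: 'a :: conjugatable_field) = of_nat k"
  by (induction k) (simp_all add: conjugate_dist_add conjugate_one)

lemma conjugate_of_int: "conjugate (of_int k :: 'a :: conjugatable_field) = of_int k"
  by (cases k) (simp_all add: conjugate_of_nat conjugate_neg conjugate_dist_add conjugate_one del: of_nat_Suc)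

lemma finite_col_stab: "finite (col_stab lam n T)"
  by (simp add: col_stab_eq finite_stab)

lemma conjugate_polytabloid:
  "conjugate (polytabloid lam n T r) = (polytabloid lam n T r :: 'a :: conjugatable_field)"
  by (simp add: polytabloid_def sum_conjugate[OF finite_col_stab] conjugate_dist_mul conjugate_of_int
      conjugate_one if_distrib[of conjugate] cong: if_cong)

text \<open>James' submodule theorem; the conjugation makes the invariant form definite on the Specht module.\<close>
theorem specht_irreducible:
  fixes U :: "((nat \<Rightarrow> nat) \<Rightarrow> 'a :: {conjugatable_ordered_field, field_char_0}) set"
  assumes part: "is_partition lam n" and sub: "U \<subseteq> specht lam n" and U: "fsubspace U" "invariant (Sym n) U"
    and nz: "U \<noteq> {\<lambda>r. 0}"
  shows "U = specht lam n"
proof -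
  obtain u where u: "u \<in> U" "u \<noteq> (\<lambda>r. 0)" using nz fsubspace_zero[OF U(1)] by blast
  have uM: "u \<in> tabloid_space lam n" using u sub specht_tabloid_space by blast
  obtain c where c: "u = (\<lambda>r. \<Sum>T\<in>tableaux lam n. c T * polytabloid lam n T r)"
    using u sub unfolding specht_def by blast
  have "\<exists>T\<in>tableaux lam n. altsum (col_stab lam n T) u (row_tabloid lam n T) \<noteq> 0"
  proof (rule ccontr)
    assume "\<not> ?thesis"
    then have z: "(\<Sum>r\<in>tabloids lam n. u r * polytabloid lam n T r) = 0" if "T \<in> tableaux lam n" for T
      using altsum_inner[OF that, of u] that by simp
    \<comment> \<open>Polytabloids have integer coordinates, so conjugation acts on the coefficients
      only and the hermitian norm of u becomes a combination of the pairings of u with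
      polytabloids.\<close>
    have cu: "conjugate (u r) = (\<Sum>T\<in>tableaux lam n. conjugate (c T) * polytabloid lam n T r)" for r
      unfolding c by (simp add: sum_conjugate[OF finite_tableaux] conjugate_dist_mul conjugate_polytabloid)
    have "(\<Sum>r\<in>tabloids lam n. u r * conjugate (u r))
        = (\<Sum>r\<in>tabloids lam n. \<Sum>T\<in>tableaux lam n. conjugate (c T) * (u r * polytabloid lam n T r))"
      unfolding cu sum_distrib_left by (simp add: mult_ac)
    also have "\<dots> = (\<Sum>T\<in>tableaux lam n. \<Sum>r\<in>tabloids lam n. conjugate (c T) * (u r * polytabloid lam n T r))"
      by (rule sum.swap)
    also have "\<dots> = 0" by (simp add: z flip: sum_distrib_left)
    finally have "u r * conjugate (u r) = 0" if "r \<in> tabloids lam n" for r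
      using sum_nonneg_eq_0_iff[OF finite_tabloids, of lam n "\<lambda>r. u r * conjugate (u r)"] that
      by (simp add: conjugate_square_positive)
    then have "u r = 0" for r using uM by (cases "r \<in> tabloids lam n") (auto simp: tabloid_space_def)
    then show False using u(2) by auto
  qed
  then obtain T where T: "T \<in> tableaux lam n" "altsum (col_stab lam n T) u (row_tabloid lam n T) \<noteq> 0" by blast
  let ?a = "altsum (col_stab lam n T) u (row_tabloid lam n T)"
  \<comment> \<open>Antisymmetrising u stays in U and gives a nonzero multiple of a
    generator.\<close>
  have "(\<lambda>r. ?a * polytabloid lam n T r) \<in> U"
    using altsum_in_invariant[OF U u(1), of "colf lam T"] altsum_eq_polytabloid[OF part T(1) uM]
    unfolding col_stab_eq by simp
  then have "(\<lambda>r. inverse ?a * (?a * polytabloid lam n T r)) \<in> U" by (rule fsubspace_scale[OF U(1)])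
  then have "polytabloid lam n T \<in> U" using T(2) by (simp flip: mult.assoc)
  then show ?thesis using specht_generated[OF U T(1)] sub by blast
qed

section \<open>Intertwiners of Specht modules\<close>

definition lin_on :: "((nat \<Rightarrow> nat) \<Rightarrow> 'a :: field) set \<Rightarrow> (((nat \<Rightarrow> nat) \<Rightarrow> 'a) \<Rightarrow> ((nat \<Rightarrow> nat) \<Rightarrow> 'a)) \<Rightarrow> bool" where
  "lin_on S \<theta> \<longleftrightarrow> (\<forall>f\<in>S. \<forall>g\<in>S. \<forall>a. \<theta> (\<lambda>r. a * f r + g r) = (\<lambda>r. a * \<theta> f r + \<theta> g r))"

text \<open>The integer-valued \<chi> is constantly 1 for ordinary intertwiners and
  \<open>sign\<close> for those that twist by the sign character; composition multiplies
  them.\<close>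

definition equivariant :: "((nat \<Rightarrow> nat) \<Rightarrow> int) \<Rightarrow> (nat \<Rightarrow> nat) set \<Rightarrow> ((nat \<Rightarrow> nat) \<Rightarrow> 'a :: field) set
    \<Rightarrow> (((nat \<Rightarrow> nat) \<Rightarrow> 'a) \<Rightarrow> ((nat \<Rightarrow> nat) \<Rightarrow> 'a)) \<Rightarrow> bool" where
  "equivariant \<chi> G S \<theta> \<longleftrightarrow> lin_on S \<theta> \<and> (\<forall>g\<in>G. \<forall>f\<in>S. \<theta> (act g f) = (\<lambda>r. of_int (\<chi> g) * act g (\<theta> f) r))"

lemma lin_onD: "lin_on S \<theta> \<Longrightarrow> f \<in> S \<Longrightarrow> g \<in> S \<Longrightarrow> \<theta> (\<lambda>r. a * f r + g r) = (\<lambda>r. a * \<theta> f r + \<theta> g r)"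
  by (simp add: lin_on_def)

lemma lin_on_zero:
  assumes "lin_on S \<theta>" "fsubspace S"
  shows "\<theta> (\<lambda>r. 0) = (\<lambda>r. 0)"
  using lin_onD[OF assms(1) fsubspace_zero[OF assms(2)] fsubspace_zero[OF assms(2)], of "-1"] by simp

lemma lin_on_scale:
  assumes "lin_on S \<theta>" "fsubspace S" "f \<in> S"
  shows "\<theta> (\<lambda>r. a * f r) = (\<lambda>r. a * \<theta> f r)"
  using lin_onD[OF assms(1,3) fsubspace_zero[OF assms(2)], of a] lin_on_zero[OF assms(1,2)] by simp

lemma lin_on_sum:
  assumes "lin_on S \<theta>" "fsubspace S" "\<And>i. i \<in> A \<Longrightarrow> F i \<in> S"
  shows "\<theta> (\<lambda>r. \<Sum>i\<in>A. c i * F i r) = (\<lambda>r. \<Sum>i\<in>A. c i * \<theta> (F i) r)"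
proof (cases "finite A")
  case True
  then show ?thesis using assms(3)
  proof (induction A rule: finite_induct)
    case (insert x A)
    have "(\<lambda>r. \<Sum>i\<in>A. c i * F i r) \<in> S" by (rule fsubspace_sum[OF assms(2)]) (use insert in auto)
    then show ?case using insert lin_onD[OF assms(1), of "F x" "\<lambda>r. \<Sum>i\<in>A. c i * F i r" "c x"] by simp
  qed (simp add: lin_on_zero[OF assms(1,2)])
qed (simp add: lin_on_zero[OF assms(1,2)])

lemma equivariantD:
  "equivariant \<chi> G S \<theta> \<Longrightarrow> g \<in> G \<Longrightarrow> f \<in> S \<Longrightarrow> \<theta> (act g f) = (\<lambda>r. of_int (\<chi> g) * act g (\<theta> f) r)"
  by (simp add: equivariant_def)

lemma equivariant_lin: "equivariant \<chi> G S \<theta> \<Longrightarrow> lin_on S \<theta>"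
  by (simp add: equivariant_def)

lemma equivariant_comp:
  assumes "equivariant \<chi> G S \<theta>" "equivariant \<chi>' G S' \<theta>'" "\<And>f. f \<in> S \<Longrightarrow> \<theta> f \<in> S'" "fsubspace S'" "invariant G S'"
  shows "equivariant (\<lambda>g. \<chi> g * \<chi>' g) G S (\<theta>' \<circ> \<theta>)"
  unfolding equivariant_def
proof (intro conjI ballI)
  show "lin_on S (\<theta>' \<circ> \<theta>)"
    unfolding lin_on_def using assms(3)
    by (simp add: lin_onD[OF equivariant_lin[OF assms(1)]] lin_onD[OF equivariant_lin[OF assms(2)]])
  fix g f assume g: "g \<in> G" and f: "f \<in> S"
  have "\<theta>' (\<lambda>r. of_int (\<chi> g) * act g (\<theta> f) r) = (\<lambda>r. of_int (\<chi> g) * \<theta>' (act g (\<theta> f)) r)"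
    by (rule lin_on_scale[OF equivariant_lin[OF assms(2)] assms(4)]) (use assms(3,5) g f in \<open>auto simp: invariant_def\<close>)
  then show "(\<theta>' \<circ> \<theta>) (act g f) = (\<lambda>r. of_int (\<chi> g * \<chi>' g) * act g ((\<theta>' \<circ> \<theta>) f) r)"
    using equivariantD[OF assms(1) g f] equivariantD[OF assms(2) g assms(3)[OF f]] by (simp add: mult.assoc)
qed

lemma equivariant_altsum:
  assumes \<theta>: "equivariant (\<lambda>_. 1) (Sym n) S \<theta>" and S: "fsubspace S" "invariant (Sym n) S" and f: "f \<in> S"
  shows "\<theta> (altsum (stab n c) f) = altsum (stab n c) (\<theta> f)"
proof -
  have q: "q \<in> Sym n" if "q \<in> stab n c" for q using that by (simp add: stab_def)
  have "\<theta> (altsum (stab n c) f) = \<theta> (\<lambda>r. \<Sum>q\<in>stab n c. of_int (sign q) * act q f r)"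
    by (simp add: altsum_def act_def)
  also have "\<dots> = (\<lambda>r. \<Sum>q\<in>stab n c. of_int (sign q) * \<theta> (act q f) r)"
    by (rule lin_on_sum[OF equivariant_lin[OF \<theta>] S(1)]) (use q S f in \<open>auto simp: invariant_def\<close>)
  also have "\<dots> = altsum (stab n c) (\<theta> f)"
    unfolding altsum_def using equivariantD[OF \<theta> q f] by (intro ext sum.cong refl) (simp add: act_def)
  finally show ?thesis .
qed

lemma altsum_polytabloid:
  "altsum (col_stab lam n T) (polytabloid lam n T) = (\<lambda>r. of_nat (card (col_stab lam n T)) * polytabloid lam n T r :: 'a :: field)"
proof
  fix r
  have "altsum (col_stab lam n T) (polytabloid lam n T :: _ \<Rightarrow> 'a) r = (\<Sum>q\<in>col_stab lam n T. polytabloid lam n T r)"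
    unfolding altsum_def by (rule sum.cong) (simp_all add: polytabloid_twist of_int_sign_cancel)
  then show "altsum (col_stab lam n T) (polytabloid lam n T) r = of_nat (card (col_stab lam n T)) * (polytabloid lam n T r :: 'a)"
    by simp
qed

lemma card_stab_pos: "card (stab n c) > 0"
  using stab_id[of n c] finite_stab[of n c] by (auto simp: card_gt_0_iff)

text \<open>An intertwiner commutes with antisymmetrisation, and the latter multiplies the
  polytabloid by the order of the column stabiliser.\<close>

lemma equivariant_polytabloid:
  fixes \<theta> :: "((nat \<Rightarrow> nat) \<Rightarrow> 'a :: field_char_0) \<Rightarrow> _"
  assumes \<theta>: "equivariant (\<lambda>_. 1) (Sym n) (specht lam n) \<theta>" and T: "T \<in> tableaux lam n"
  shows "altsum (col_stab lam n T) (\<theta> (polytabloid lam n T))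
    = (\<lambda>r. of_nat (card (col_stab lam n T)) * \<theta> (polytabloid lam n T) r)"
  using equivariant_altsum[OF \<theta> specht_fsubspace specht_invariant specht_polytabloid[OF T], of "colf lam T"]
    lin_on_scale[OF equivariant_lin[OF \<theta>] specht_fsubspace specht_polytabloid[OF T]]
    altsum_polytabloid[of lam n T, where 'a = 'a]
  by (simp add: col_stab_eq)

lemma lin_on_zero_specht:
  assumes "lin_on (specht lam n) \<theta>" "\<And>T. T \<in> tableaux lam n \<Longrightarrow> \<theta> (polytabloid lam n T) = (\<lambda>r. 0)" "f \<in> specht lam n"
  shows "\<theta> f = (\<lambda>r. 0)"
proof -
  obtain c where c: "f = (\<lambda>r. \<Sum>T\<in>tableaux lam n. c T * polytabloid lam n T r)"
    using assms(3) unfolding specht_def by blast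
  then show ?thesis
    using lin_on_sum[OF assms(1) specht_fsubspace, of "tableaux lam n" "polytabloid lam n" c] assms(2)
    by (simp add: specht_polytabloid)
qed

text \<open>If the image of a polytabloid is nonzero at r, then r is a tabloid of shape mu that is
  injective on the columns of a tableau of shape lam, which forces dominance.\<close>

theorem equivariant_dominates:
  fixes \<theta> :: "((nat \<Rightarrow> nat) \<Rightarrow> 'a :: field_char_0) \<Rightarrow> _"
  assumes part: "is_partition lam n" and \<theta>: "equivariant (\<lambda>_. 1) (Sym n) (specht lam n) \<theta>"
    and into: "\<And>f. f \<in> specht lam n \<Longrightarrow> \<theta> f \<in> tabloid_space mu n"
    and nz: "f \<in> specht lam n" "\<theta> f \<noteq> (\<lambda>r. 0)"
  shows "rows_below mu k \<le> rows_below lam k"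
proof -
  obtain T where T: "T \<in> tableaux lam n" "\<theta> (polytabloid lam n T) \<noteq> (\<lambda>r. 0)"
    using lin_on_zero_specht[OF equivariant_lin[OF \<theta>]] nz by blast
  then obtain r where r: "\<theta> (polytabloid lam n T) r \<noteq> 0" by auto
  have "altsum (col_stab lam n T) (\<theta> (polytabloid lam n T)) r \<noteq> 0"
    using equivariant_polytabloid[OF \<theta> T(1)] r card_stab_pos[of n "colf lam T"] by (simp add: col_stab_eq)
  then have "col_injective lam n T r" by (rule altsum_nonzero_col_injective)
  moreover have "r \<in> tabloids mu n"
    using into[OF specht_polytabloid[OF T(1)]] r by (auto simp: tabloid_space_def)
  ultimately show ?thesis using col_injective_dominates[OF part T(1)] by blast
qed

text \<open>Schur's lemma over any field of characteristic 0. The image of a polytabloid is fixed,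
  up to a nonzero integer, by an operator of rank one whose image is spanned by that same
  polytabloid, so no eigenvalue has to be found.\<close>

theorem equivariant_scalar:
  fixes \<theta> :: "((nat \<Rightarrow> nat) \<Rightarrow> 'a :: field_char_0) \<Rightarrow> _"
  assumes part: "is_partition lam n" and \<theta>: "equivariant (\<lambda>_. 1) (Sym n) (specht lam n) \<theta>"
    and into: "\<And>f. f \<in> specht lam n \<Longrightarrow> \<theta> f \<in> specht lam n"
  obtains c where "\<And>f. f \<in> specht lam n \<Longrightarrow> \<theta> f = (\<lambda>r. c * f r)"
proof -
  obtain T where T: "T \<in> tableaux lam n" using tableaux_nonempty[OF part] by blast
  let ?e = "polytabloid lam n T :: _ \<Rightarrow> 'a" and ?C = "col_stab lam n T"
  note e = specht_polytabloid[OF T, where 'a = 'a]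
  define a where "a = altsum ?C (\<theta> ?e) (row_tabloid lam n T)"
  define c where "c = a / of_nat (card ?C)"
  have "\<theta> ?e \<in> tabloid_space lam n" using into[OF e] specht_tabloid_space by blast
  from altsum_eq_polytabloid[OF part T this]
  have "(\<lambda>r. of_nat (card ?C) * \<theta> ?e r) = (\<lambda>r. a * ?e r)"
    unfolding equivariant_polytabloid[OF \<theta> T] a_def .
  then have main: "\<theta> ?e = (\<lambda>r. c * ?e r)"
    using card_stab_pos[of n "colf lam T"] by (simp add: fun_eq_iff c_def field_simps col_stab_eq)
  define W where "W = {f \<in> specht lam n. \<theta> f = (\<lambda>r. c * f r)}"
  have "fsubspace W"
    unfolding fsubspace_def W_def
    using lin_on_zero[OF equivariant_lin[OF \<theta>] specht_fsubspace] specht_fsubspace[of lam n, where 'a = 'a]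
    by (auto simp: fsubspace_zero fsubspace_lincomb lin_onD[OF equivariant_lin[OF \<theta>]] distrib_left mult.left_commute)
  moreover have "invariant (Sym n) W"
    unfolding invariant_def W_def using specht_invariant[of n lam, where 'a = 'a]
    by (auto simp: invariant_def equivariantD[OF \<theta>]) (simp add: act_def)
  moreover have "?e \<in> W" using e main by (simp add: W_def)
  ultimately have "specht lam n \<subseteq> W" using specht_generated[OF _ _ T] by blast
  then show thesis using that[of c] by (auto simp: W_def)
qed

section \<open>The sign twist\<close>

text \<open>What transposing a tableau achieves: rows and columns exchange their stabilisers. Only
  this enters the construction of the intertwiner.\<close>

definition dual_pair :: "nat \<Rightarrow> nat list \<Rightarrow> (nat \<times> nat \<Rightarrow> nat) \<Rightarrow> nat list \<Rightarrow> (nat \<times> nat \<Rightarrow> nat) \<Rightarrow> bool" where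
  "dual_pair n lam T mu U \<longleftrightarrow> is_partition lam n \<and> is_partition mu n \<and> T \<in> tableaux lam n \<and> U \<in> tableaux mu n \<and>
     col_stab mu n U = row_stab lam n T \<and> row_stab mu n U = col_stab lam n T"

lemma dual_pair_sym: "dual_pair n lam T mu U \<Longrightarrow> dual_pair n mu U lam T"
  by (simp add: dual_pair_def)

text \<open>The intertwiner from a Specht module tensored with the sign character to the Specht module of
  the conjugate shape. For a self-conjugate shape its square is a scalar of sign \<^const>\<open>eps\<close>, which
  decides whether the restriction to the alternating group splits over the reals.\<close>
definition twist :: "nat \<Rightarrow> nat list \<Rightarrow> (nat \<times> nat \<Rightarrow> nat) \<Rightarrow> nat list \<Rightarrow> (nat \<times> nat \<Rightarrow> nat)
    \<Rightarrow> ((nat \<Rightarrow> nat) \<Rightarrow> real) \<Rightarrow> (nat \<Rightarrow> nat) \<Rightarrow> real" where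
  "twist n lam T mu U f = (\<lambda>r. \<Sum>g\<in>Sym n. (of_int (sign g) * f (row_tabloid lam n T \<circ> inv_into UNIV g)) * act g (polytabloid mu n U) r)"

lemma twist_lin: "lin_on S (twist n lam T mu U)"
  unfolding lin_on_def twist_def by (simp add: sum_distrib_left algebra_simps flip: sum.distrib)

lemma Sym_inv_distrib: "g \<in> Sym n \<Longrightarrow> h \<in> Sym n \<Longrightarrow> inv_into UNIV (g \<circ> h) = inv_into UNIV h \<circ> inv_into UNIV g"
  unfolding Sym_def by (auto intro: o_inv_distrib permutes_bij)

lemma Sym_inv_inv: "g \<in> Sym n \<Longrightarrow> inv_into UNIV (inv_into UNIV g) = g"
  by (simp add: Sym_def permutes_inv_inv)

lemma twist_equivariant: "equivariant sign (Sym n) S (twist n lam T mu U)"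
  unfolding equivariant_def
proof (intro conjI twist_lin ballI ext)
  fix h f r assume h: "h \<in> Sym n"
  have *: "inv_into UNIV (h \<circ> g) \<circ> h = inv_into UNIV g" if "g \<in> Sym n" for g
    using Sym_inv_distrib[OF h that] Sym_inv_comp(1)[OF h] by (simp add: comp_assoc)
  have "twist n lam T mu U (act h f) r = (\<Sum>g\<in>Sym n. (of_int (sign (h \<circ> g)) * act h f (row_tabloid lam n T \<circ> inv_into UNIV (h \<circ> g))) * act (h \<circ> g) (polytabloid mu n U) r)"
    unfolding twist_def by (rule Sym_reindex_right[OF h])
  also have "\<dots> = (\<Sum>g\<in>Sym n. of_int (sign h) * ((of_int (sign g) * f (row_tabloid lam n T \<circ> inv_into UNIV g)) * act g (polytabloid mu n U) (r \<circ> h)))"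
  proof (rule sum.cong[OF refl])
    fix g assume g: "g \<in> Sym n"
    have "row_tabloid lam n T \<circ> inv_into UNIV (h \<circ> g) \<circ> h = row_tabloid lam n T \<circ> inv_into UNIV g"
      using *[OF g] by (simp add: comp_assoc)
    then show "(of_int (sign (h \<circ> g)) * act h f (row_tabloid lam n T \<circ> inv_into UNIV (h \<circ> g))) * act (h \<circ> g) (polytabloid mu n U) r
      = of_int (sign h) * ((of_int (sign g) * f (row_tabloid lam n T \<circ> inv_into UNIV g)) * act g (polytabloid mu n U) (r \<circ> h))"
      using sign_comp[OF h g] by (simp add: act_def comp_assoc)
  qed
  also have "\<dots> = of_int (sign h) * act h (twist n lam T mu U f) r"
    by (simp add: twist_def act_def sum_distrib_left)
  finally show "twist n lam T mu U (act h f) r = of_int (sign h) * act h (twist n lam T mu U f) r" .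
qed

lemma twist_specht: "U \<in> tableaux mu n \<Longrightarrow> twist n lam T mu U f \<in> specht mu n"
  unfolding twist_def
  by (rule fsubspace_sum[OF specht_fsubspace]) (rule invariantD[OF specht_invariant _ specht_polytabloid])

text \<open>Only the g = q h with q in the column and h in the row stabiliser of T contribute. The
  sign of g, the sign of q from the polytabloid of T and the sign of h from that of U multiply to 1,
  leaving an unsigned sum.\<close>

lemma twist_polytabloid:
  assumes d: "dual_pair n lam T mu U"
  shows "twist n lam T mu U (polytabloid lam n T) =
    (\<lambda>r. of_nat (card (row_stab lam n T)) * (\<Sum>q\<in>col_stab lam n T. 1 * act q (polytabloid mu n U) r))"
proof
  fix r
  let ?C = "col_stab lam n T" and ?R = "row_stab lam n T" and ?r0 = "row_tabloid lam n T"
  let ?e = "polytabloid mu n U :: _ \<Rightarrow> real"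
  have C: "q \<in> Sym n" if "q \<in> ?C" for q using that by (simp add: col_stab_eq stab_def)
  have R: "q \<in> Sym n" if "q \<in> ?R" for q using that by (simp add: row_stab_def stab_def)
  have RS: "?R \<subseteq> Sym n" using R by blast
  have inner: "(\<Sum>g\<in>Sym n. of_int (sign g) * (of_int (sign q) * (if ?r0 \<circ> inv_into UNIV g \<circ> q = ?r0 then 1 else 0)) * act g ?e r)
      = of_nat (card ?R) * act q ?e r" if q: "q \<in> ?C" for q
  proof -
    note qS = C[OF q]
    \<comment> \<open>Substituting q g for g isolates the condition that g lies in the row
      stabiliser.\<close>
    have "(\<Sum>g\<in>Sym n. of_int (sign g) * (of_int (sign q) * (if ?r0 \<circ> inv_into UNIV g \<circ> q = ?r0 then 1 else 0)) * act g ?e r)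
      = (\<Sum>g\<in>Sym n. of_int (sign (q \<circ> g)) * (of_int (sign q) * (if ?r0 \<circ> inv_into UNIV (q \<circ> g) \<circ> q = ?r0 then 1 else 0)) * act (q \<circ> g) ?e r)"
      by (rule Sym_reindex_right[OF qS])
    also have "\<dots> = (\<Sum>g\<in>Sym n. if g \<in> ?R then act q ?e r else 0)"
    proof (rule sum.cong[OF refl])
      fix g assume g: "g \<in> Sym n"
      have "?r0 \<circ> inv_into UNIV (q \<circ> g) \<circ> q = ?r0 \<circ> inv_into UNIV g"
        using Sym_inv_distrib[OF qS g] Sym_inv_comp(1)[OF qS] by (simp add: comp_assoc)
      moreover have "?r0 \<circ> inv_into UNIV g = ?r0 \<longleftrightarrow> g \<in> ?R"
        using row_tabloid_comp_eq_iff[OF Sym_inv[OF g], of lam T] stab_inv[of g n "rowf lam T"]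
          stab_inv[of "inv_into UNIV g" n "rowf lam T"] Sym_inv_inv[OF g] by (auto simp: row_stab_def)
      moreover have "of_int (sign (q \<circ> g)) * of_int (sign q) * act (q \<circ> g) ?e r = act q ?e r" if "g \<in> ?R"
      proof -
        have "act (q \<circ> g) ?e r = of_int (sign g) * act q ?e r"
          using polytabloid_twist[of g mu n U "r \<circ> q", where 'a = real] d that
          by (simp add: act_def dual_pair_def comp_assoc)
        then have "of_int (sign (q \<circ> g)) * of_int (sign q) * act (q \<circ> g) ?e r
          = (of_int (sign q) * of_int (sign q)) * ((of_int (sign g) * of_int (sign g)) * act q ?e r)"
          using sign_comp[OF qS g] by (simp add: mult_ac)
        then show ?thesis by (simp only: of_int_sign_square mult_1_left)
      qed
      ultimately show "of_int (sign (q \<circ> g)) * (of_int (sign q) * (if ?r0 \<circ> inv_into UNIV (q \<circ> g) \<circ> q = ?r0 then 1 else 0)) * act (q \<circ> g) ?e r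
        = (if g \<in> ?R then act q ?e r else 0)" by simp
    qed
    also have "\<dots> = of_nat (card ?R) * act q ?e r"
      using RS finite_Sym[of n] by (simp add: sum.inter_restrict[symmetric] Int_absorb1)
    finally show ?thesis .
  qed
  have "twist n lam T mu U (polytabloid lam n T) r
    = (\<Sum>g\<in>Sym n. \<Sum>q\<in>?C. of_int (sign g) * (of_int (sign q) * (if ?r0 \<circ> inv_into UNIV g \<circ> q = ?r0 then 1 else 0)) * act g ?e r)"
    by (simp add: twist_def polytabloid_eq_altsum[of lam] altsum_def sum_distrib_left sum_distrib_right)
  also have "\<dots> = (\<Sum>q\<in>?C. \<Sum>g\<in>Sym n. of_int (sign g) * (of_int (sign q) * (if ?r0 \<circ> inv_into UNIV g \<circ> q = ?r0 then 1 else 0)) * act g ?e r)"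
    by (rule sum.swap)
  also have "\<dots> = (\<Sum>q\<in>?C. of_nat (card ?R) * act q ?e r)" by (intro sum.cong refl inner)
  finally show "twist n lam T mu U (polytabloid lam n T) r = of_nat (card ?R) * (\<Sum>q\<in>?C. 1 * act q ?e r)"
    by (simp add: sum_distrib_left)
qed

text \<open>The row symmetriser. The factor 1 fills the coefficient slot of the lemmas on linear
  combinations.\<close>

definition row_sum :: "nat list \<Rightarrow> nat \<Rightarrow> (nat \<times> nat \<Rightarrow> nat) \<Rightarrow> ((nat \<Rightarrow> nat) \<Rightarrow> real) \<Rightarrow> (nat \<Rightarrow> nat) \<Rightarrow> real" where
  "row_sum lam n T f = (\<lambda>r. \<Sum>p\<in>row_stab lam n T. 1 * act p f r)"

lemma row_sum_invariant: "p \<in> row_stab lam n T \<Longrightarrow> row_sum lam n T f (r \<circ> p) = row_sum lam n T f r"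
  unfolding row_sum_def row_stab_def act_def
  by (subst (2) stab_reindex_right[of p]) (simp_all add: comp_assoc)

text \<open>The symmetriser is self-adjoint and its square is the order of the row stabiliser times
  itself, so the pairing is a positive multiple of a sum of squares, and one square is nonzero at
  the row tabloid. Summing over all r0 \<circ> x runs through the tabloids with constant
  multiplicity.\<close>

lemma row_sum_positive:
  fixes e :: "(nat \<Rightarrow> nat) \<Rightarrow> real"
  assumes T: "T \<in> tableaux lam n"
  defines "e \<equiv> polytabloid lam n T" and "r0 \<equiv> row_tabloid lam n T"
  shows "0 < (\<Sum>x\<in>Sym n. e (r0 \<circ> x) * row_sum lam n T e (r0 \<circ> x))"
proof -
  let ?R = "row_stab lam n T" and ?w = "row_sum lam n T e"
  have R: "p \<in> Sym n" if "p \<in> ?R" for p using that by (simp add: row_stab_def stab_def)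
  have "(\<Sum>x\<in>Sym n. ?w (r0 \<circ> x) * ?w (r0 \<circ> x)) = (\<Sum>x\<in>Sym n. \<Sum>p\<in>?R. e (r0 \<circ> x \<circ> p) * ?w (r0 \<circ> x))"
    unfolding row_sum_def[of lam n T e, THEN fun_cong] act_def by (simp add: sum_distrib_right row_sum_def act_def)
  also have "\<dots> = (\<Sum>p\<in>?R. \<Sum>x\<in>Sym n. e (r0 \<circ> x \<circ> p) * ?w (r0 \<circ> x))" by (rule sum.swap)
  also have "\<dots> = (\<Sum>p\<in>?R. \<Sum>x\<in>Sym n. e (r0 \<circ> x) * ?w (r0 \<circ> x))"
  proof (rule sum.cong[OF refl])
    fix p assume p: "p \<in> ?R"
    have "(\<Sum>x\<in>Sym n. e (r0 \<circ> x) * ?w (r0 \<circ> x)) = (\<Sum>x\<in>Sym n. e (r0 \<circ> (x \<circ> p)) * ?w (r0 \<circ> (x \<circ> p)))"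
      by (rule Sym_reindex_left[OF R[OF p]])
    also have "\<dots> = (\<Sum>x\<in>Sym n. e (r0 \<circ> x \<circ> p) * ?w (r0 \<circ> x))"
      using row_sum_invariant[OF p, of e] by (simp add: comp_assoc[symmetric])
    finally show "(\<Sum>x\<in>Sym n. e (r0 \<circ> x \<circ> p) * ?w (r0 \<circ> x)) = (\<Sum>x\<in>Sym n. e (r0 \<circ> x) * ?w (r0 \<circ> x))" by simp
  qed
  also have "\<dots> = real (card ?R) * (\<Sum>x\<in>Sym n. e (r0 \<circ> x) * ?w (r0 \<circ> x))" by simp
  finally have eq: "(\<Sum>x\<in>Sym n. ?w (r0 \<circ> x) * ?w (r0 \<circ> x)) = real (card ?R) * (\<Sum>x\<in>Sym n. e (r0 \<circ> x) * ?w (r0 \<circ> x))" .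
  have "e (r0 \<circ> p) = 1" if "p \<in> ?R" for p
    using row_tabloid_comp_eq_iff[OF R[OF that], of lam T] that polytabloid_row_tabloid[OF T] by (simp add: e_def r0_def)
  then have "?w (r0 \<circ> id) = real (card ?R)" by (simp add: row_sum_def act_def)
  then have "?w (r0 \<circ> id) * ?w (r0 \<circ> id) > 0" using card_stab_pos[of n "rowf lam T"] by (simp add: row_stab_def)
  moreover have "?w (r0 \<circ> id) * ?w (r0 \<circ> id) \<le> (\<Sum>x\<in>Sym n. ?w (r0 \<circ> x) * ?w (r0 \<circ> x))"
    by (rule member_le_sum[of id "Sym n" "\<lambda>x. ?w (r0 \<circ> x) * ?w (r0 \<circ> x)"]) (simp_all add: finite_Sym)
  ultimately have "0 < real (card ?R) * (\<Sum>x\<in>Sym n. e (r0 \<circ> x) * ?w (r0 \<circ> x))" using eq by linarith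
  then show ?thesis by (simp add: zero_less_mult_iff)
qed

text \<open>Up to a positive factor this coordinate is the pairing of the polytabloid with its own
  row symmetrisation.\<close>

lemma altsum_row_sum_positive:
  assumes T: "T \<in> tableaux lam n"
  shows "0 < altsum (col_stab lam n T) (row_sum lam n T (polytabloid lam n T)) (row_tabloid lam n T)"
proof -
  let ?C = "col_stab lam n T" and ?R = "row_stab lam n T" and ?r0 = "row_tabloid lam n T"
  let ?e = "polytabloid lam n T :: _ \<Rightarrow> real"
  let ?w = "row_sum lam n T ?e"
  have C: "q \<in> Sym n" if "q \<in> ?C" for q using that by (simp add: col_stab_eq stab_def)
  have RS: "?R \<subseteq> Sym n" by (auto simp: row_stab_def stab_def)
  have "(\<Sum>x\<in>Sym n. ?e (?r0 \<circ> x) * ?w (?r0 \<circ> x))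
    = (\<Sum>x\<in>Sym n. \<Sum>q\<in>?C. of_int (sign q) * (if ?r0 \<circ> x \<circ> q = ?r0 then 1 else 0) * ?w (?r0 \<circ> x))"
    by (simp add: polytabloid_eq_altsum[THEN fun_cong, of _ _ _ "?r0 \<circ> _"] altsum_def sum_distrib_right)
  also have "\<dots> = (\<Sum>q\<in>?C. \<Sum>x\<in>Sym n. of_int (sign q) * (if ?r0 \<circ> x \<circ> q = ?r0 then 1 else 0) * ?w (?r0 \<circ> x))"
    by (rule sum.swap)
  also have "\<dots> = (\<Sum>q\<in>?C. real (card ?R) * (of_int (sign q) * ?w (?r0 \<circ> inv_into UNIV q)))"
  proof (rule sum.cong[OF refl])
    fix q assume "q \<in> ?C"
    then have q: "q \<in> Sym n" "inv_into UNIV q \<in> Sym n" using C Sym_inv by auto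
    have "(\<Sum>x\<in>Sym n. of_int (sign q) * (if ?r0 \<circ> x \<circ> q = ?r0 then 1 else 0) * ?w (?r0 \<circ> x))
      = (\<Sum>x\<in>Sym n. of_int (sign q) * (if ?r0 \<circ> (x \<circ> inv_into UNIV q) \<circ> q = ?r0 then 1 else 0) * ?w (?r0 \<circ> (x \<circ> inv_into UNIV q)))"
      by (rule Sym_reindex_left[OF q(2)])
    also have "\<dots> = (\<Sum>x\<in>Sym n. if x \<in> ?R then of_int (sign q) * ?w (?r0 \<circ> inv_into UNIV q) else 0)"
    proof (rule sum.cong[OF refl])
      fix x assume x: "x \<in> Sym n"
      have "?r0 \<circ> (x \<circ> inv_into UNIV q) \<circ> q = ?r0 \<circ> x" using Sym_inv_comp(1)[OF q(1)] by (simp add: comp_assoc)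
      moreover have "?r0 \<circ> (x \<circ> inv_into UNIV q) = ?r0 \<circ> inv_into UNIV q" if "?r0 \<circ> x = ?r0"
        using that by (simp add: comp_assoc[symmetric])
      ultimately show "of_int (sign q) * (if ?r0 \<circ> (x \<circ> inv_into UNIV q) \<circ> q = ?r0 then 1 else 0) * ?w (?r0 \<circ> (x \<circ> inv_into UNIV q))
        = (if x \<in> ?R then of_int (sign q) * ?w (?r0 \<circ> inv_into UNIV q) else 0)"
        using row_tabloid_comp_eq_iff[OF x, of lam T] by auto
    qed
    also have "\<dots> = real (card ?R) * (of_int (sign q) * ?w (?r0 \<circ> inv_into UNIV q))"
      using RS finite_Sym[of n] by (simp add: sum.inter_restrict[symmetric] Int_absorb1)
    finally show "(\<Sum>x\<in>Sym n. of_int (sign q) * (if ?r0 \<circ> x \<circ> q = ?r0 then 1 else 0) * ?w (?r0 \<circ> x))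
      = real (card ?R) * (of_int (sign q) * ?w (?r0 \<circ> inv_into UNIV q))" .
  qed
  also have "\<dots> = (\<Sum>q\<in>?C. real (card ?R) * (of_int (sign (inv_into UNIV q)) * ?w (?r0 \<circ> inv_into UNIV (inv_into UNIV q))))"
    unfolding col_stab_eq by (rule stab_reindex_inv)
  also have "\<dots> = real (card ?R) * altsum ?C ?w ?r0"
    unfolding altsum_def sum_distrib_left
    by (intro sum.cong refl) (simp add: sign_inv[OF C] Sym_inv_inv[OF C])
  finally have "0 < real (card ?R) * altsum ?C ?w ?r0" using row_sum_positive[OF T] by simp
  then show ?thesis by (simp add: zero_less_mult_iff)
qed

text \<open>The two signs cancel, so the composite is an intertwiner and hence a scalar by Schur. On
  the polytabloid of T it antisymmetrises the row symmetrisation, and the coordinate at the row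
  tabloid shows that the scalar is positive.\<close>

theorem twist_twist:
  assumes d: "dual_pair n lam T mu U"
  obtains \<gamma> where "\<gamma> > 0" "\<And>f. f \<in> specht lam n \<Longrightarrow> twist n mu U lam T (twist n lam T mu U f) = (\<lambda>r. \<gamma> * f r)"
proof -
  let ?C = "col_stab lam n T" and ?R = "row_stab lam n T"
  let ?e = "polytabloid lam n T :: _ \<Rightarrow> real" and ?e' = "polytabloid mu n U :: _ \<Rightarrow> real"
  let ?J = "twist n lam T mu U" and ?J' = "twist n mu U lam T"
  have T: "T \<in> tableaux lam n" and U: "U \<in> tableaux mu n" and part: "is_partition lam n"
    and st: "col_stab mu n U = ?R" "row_stab mu n U = ?C" using d by (auto simp: dual_pair_def)
  have C: "q \<in> Sym n" if "q \<in> ?C" for q using that by (simp add: col_stab_eq stab_def)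
  have inS: "act q ?e' \<in> specht mu n" if "q \<in> ?C" for q
    using invariantD[OF specht_invariant C[OF that] specht_polytabloid[OF U]] .
  \<comment> \<open>The scalar by which symmetrising the rows and then antisymmetrising the columns
    acts on the polytabloid; the two group orders in \<gamma> come from the two twists.\<close>
  define a where "a = altsum ?C (row_sum lam n T ?e) (row_tabloid lam n T)"
  define \<gamma> where "\<gamma> = real (card ?R) * (real (card ?C) * a)"
  have pos: "\<gamma> > 0"
    using altsum_row_sum_positive[OF T] card_stab_pos[of n "rowf lam T"] card_stab_pos[of n "colf lam T"]
    by (simp add: \<gamma>_def a_def row_stab_def col_stab_eq)
  have Je': "?J' ?e' = (\<lambda>r. real (card ?C) * row_sum lam n T ?e r)"
    using twist_polytabloid[OF dual_pair_sym[OF d]] by (simp add: st row_sum_def)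
  have sumS: "(\<lambda>r. \<Sum>q\<in>?C. 1 * act q ?e' r) \<in> specht mu n" by (rule fsubspace_sum[OF specht_fsubspace inS])
  have "?J' (?J ?e) = (\<lambda>r. real (card ?R) * ?J' (\<lambda>r. \<Sum>q\<in>?C. 1 * act q ?e' r) r)"
    unfolding twist_polytabloid[OF d] by (rule lin_on_scale[OF twist_lin specht_fsubspace sumS])
  also have "?J' (\<lambda>r. \<Sum>q\<in>?C. 1 * act q ?e' r) = (\<lambda>r. \<Sum>q\<in>?C. 1 * ?J' (act q ?e') r)"
    by (rule lin_on_sum[OF twist_lin specht_fsubspace inS])
  also have "\<dots> = (\<lambda>r. real (card ?C) * altsum ?C (row_sum lam n T ?e) r)"
  proof
    fix r
    have "1 * ?J' (act q ?e') r = real (card ?C) * (of_int (sign q) * row_sum lam n T ?e (r \<circ> q))" if "q \<in> ?C" for q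
      using equivariantD[OF twist_equivariant C[OF that] specht_polytabloid[OF U], of mu U lam T]
      by (simp add: Je' act_def)
    then show "(\<Sum>q\<in>?C. 1 * ?J' (act q ?e') r) = real (card ?C) * altsum ?C (row_sum lam n T ?e) r"
      by (simp add: altsum_def sum_distrib_left)
  qed
  also have "altsum ?C (row_sum lam n T ?e) = (\<lambda>r. a * ?e r)"
  proof -
    have "act p ?e \<in> tabloid_space lam n" if "p \<in> ?R" for p
      using invariantD[OF specht_invariant _ specht_polytabloid[OF T], of p, where 'a = real] that specht_tabloid_space
      by (auto simp: row_stab_def stab_def)
    then have "row_sum lam n T ?e \<in> tabloid_space lam n"
      unfolding row_sum_def by (rule fsubspace_sum[OF tabloid_space_fsubspace])
    then show ?thesis unfolding a_def by (rule altsum_eq_polytabloid[OF part T])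
  qed
  finally have base: "?J' (?J ?e) = (\<lambda>r. \<gamma> * ?e r)" by (simp add: \<gamma>_def mult.assoc)
  have eq: "equivariant (\<lambda>g. sign g * sign g) (Sym n) (specht lam n) (?J' \<circ> ?J)"
    by (rule equivariant_comp[OF twist_equivariant twist_equivariant twist_specht[OF U] specht_fsubspace specht_invariant])
  then have eq1: "equivariant (\<lambda>_. 1) (Sym n) (specht lam n) (?J' \<circ> ?J)" by simp
  obtain c where c: "\<And>f. f \<in> specht lam n \<Longrightarrow> (?J' \<circ> ?J) f = (\<lambda>r. c * f r)"
    by (rule equivariant_scalar[OF part eq1]) (auto intro: twist_specht[OF T])
  have "?J' (?J ?e) (row_tabloid lam n T) = c * ?e (row_tabloid lam n T)"
    using fun_cong[OF c[OF specht_polytabloid[OF T]], of "row_tabloid lam n T"] by (simp only: comp_apply)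
  moreover have "?J' (?J ?e) (row_tabloid lam n T) = \<gamma> * ?e (row_tabloid lam n T)"
    by (rule fun_cong[OF base])
  ultimately have "c * ?e (row_tabloid lam n T) = \<gamma> * ?e (row_tabloid lam n T)" by linarith
  then have "c = \<gamma>" by (simp add: polytabloid_row_tabloid[OF T])
  then show thesis using that[OF pos] c by simp
qed

section \<open>Conjugate partitions\<close>

definition flip :: "(nat \<times> nat \<Rightarrow> nat) \<Rightarrow> nat \<times> nat \<Rightarrow> nat" where
  "flip T = (\<lambda>(i, j). T (j, i))"

lemma length_filter_eq_col_height: "length (filter (\<lambda>k. j < k) lam) = col_height lam j"
  unfolding length_filter_conv_card col_height_def by (simp add: cells_def)

lemma fold_max_bound: "x \<in> set lam \<Longrightarrow> x \<le> fold max lam (0::nat)"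
  using Max.set_eq_fold[of 0 lam] Max_ge[of "set (0 # lam)" x] by auto

lemma less_fold_max: "j < fold max lam (0::nat) \<Longrightarrow> \<exists>x\<in>set lam. j < x"
  using Max.set_eq_fold[of 0 lam] Max_in[of "set (0 # lam)"] by fastforce

lemma cells_conj_part:
  assumes "is_partition lam n"
  shows "(j, i) \<in> cells (conj_part lam) \<longleftrightarrow> (i, j) \<in> cells lam"
proof -
  have "(j, i) \<in> cells (conj_part lam) \<longleftrightarrow> j < fold max lam 0 \<and> (i, j) \<in> cells lam"
    unfolding col_cells[OF assms] by (auto simp: cells_def conj_part_def length_filter_eq_col_height)
  moreover have "j < fold max lam 0" if "(i, j) \<in> cells lam"
    using that fold_max_bound[of "lam ! i" lam] by (auto simp: cells_def)
  ultimately show ?thesis by blast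
qed

lemma conj_part_partition:
  assumes "is_partition lam n"
  shows "is_partition (conj_part lam) n"
proof -
  have "length (filter (\<lambda>k. j' < k) lam) \<le> length (filter (\<lambda>k. j < k) lam)" if "j < j'" for j j'
    unfolding length_filter_conv_card by (rule card_mono) (use that in auto)
  then have "sorted_wrt (\<ge>) (conj_part lam)"
    by (simp add: conj_part_def sorted_wrt_iff_nth_less)
  moreover have "\<forall>x\<in>set (conj_part lam). 0 < x"
    unfolding conj_part_def by (auto dest!: less_fold_max simp: filter_empty_conv)
  moreover have "cells (conj_part lam) = prod.swap ` cells lam"
    by (rule Set.set_eqI) (auto simp: cells_conj_part[OF assms] pair_in_swap_image)
  then have "card (cells (conj_part lam)) = card (cells lam)" by (simp add: card_image)
  then have "sum_list (conj_part lam) = n" using assms by (simp add: card_cells is_partition_def)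
  ultimately show ?thesis by (simp add: is_partition_def)
qed

text \<open>Differences of consecutive partial sums give the parts, extended by 0, and positivity of
  the parts recovers the length.\<close>

lemma rows_below_inject:
  assumes "is_partition lam n" "is_partition mu n" "\<And>k. rows_below lam k = rows_below mu k"
  shows "lam = mu"
proof -
  define v where "v xs i = (if i < length xs then xs ! i else 0)" for xs :: "nat list" and i
  have v: "v lam i = v mu i" for i
    using assms(3)[of "Suc i"] assms(3)[of i] by (simp add: rows_below_eq_sum v_def)
  have pos: "i < length xs \<longleftrightarrow> v xs i > 0" if "is_partition xs n" for xs i
    using that by (auto simp: v_def is_partition_def)
  have "i < length lam \<longleftrightarrow> i < length mu" for i using pos[OF assms(1)] pos[OF assms(2)] v by simp
  then have len: "length lam = length mu" by (metis linorder_neqE_nat less_irrefl)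
  show ?thesis
  proof (rule nth_equalityI[OF len])
    fix i assume "i < length lam"
    then show "lam ! i = mu ! i" using v[of i] len by (simp add: v_def)
  qed
qed

lemma flip_tableau:
  assumes "is_partition lam n" "T \<in> tableaux lam n"
  shows "flip T \<in> tableaux (conj_part lam) n"
proof -
  have "bij_betw prod.swap (cells (conj_part lam)) (cells lam)"
    by (rule bij_betw_byWitness[where f' = prod.swap]) (auto simp: cells_conj_part[OF assms(1)])
  then have "bij_betw (T \<circ> prod.swap) (cells (conj_part lam)) {1..n}"
    using tableau_bij[OF assms(2)] by (rule bij_betw_trans)
  moreover have "T \<circ> prod.swap = flip T" by (auto simp: flip_def fun_eq_iff)
  ultimately have bij: "bij_betw (flip T) (cells (conj_part lam)) {1..n}" by simp
  moreover have "flip T c = undefined" if "c \<notin> cells (conj_part lam)" for c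
    using that assms(2) cells_conj_part[OF assms(1)]
    by (cases c) (auto simp: flip_def tableaux_def PiE_iff extensional_def)
  ultimately show ?thesis by (auto simp: tableaux_def PiE_iff extensional_def bij_betw_def)
qed

lemma flip_at:
  assumes "is_partition lam n" "T \<in> tableaux lam n" "k \<in> {1..n}"
  shows "rowf (conj_part lam) (flip T) k = colf lam T k" "colf (conj_part lam) (flip T) k = rowf lam T k"
proof -
  have "(colf lam T k, rowf lam T k) \<in> cells (conj_part lam)" "flip T (colf lam T k, rowf lam T k) = k"
    using tableau_at[OF assms(2,3)] cells_conj_part[OF assms(1)] by (simp_all add: flip_def)
  then show "rowf (conj_part lam) (flip T) k = colf lam T k" "colf (conj_part lam) (flip T) k = rowf lam T k"
    using tableau_cell(2,3)[OF flip_tableau[OF assms(1,2)]] by metis+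
qed

lemma stab_cong: "(\<And>k. k \<in> {1..n} \<Longrightarrow> c k = c' k) \<Longrightarrow> stab n c = stab n c'"
  unfolding stab_def using Sym_in by (auto simp del: atLeastAtMost_iff)

lemma dual_pair_flip:
  assumes "is_partition lam n" "T \<in> tableaux lam n"
  shows "dual_pair n lam T (conj_part lam) (flip T)"
  unfolding dual_pair_def row_stab_def col_stab_eq
  using assms conj_part_partition[OF assms(1)] flip_tableau[OF assms]
    stab_cong[of n "rowf (conj_part lam) (flip T)" "colf lam T", OF flip_at(1)[OF assms]]
    stab_cong[of n "colf (conj_part lam) (flip T)" "rowf lam T", OF flip_at(2)[OF assms]] by blast

definition above_diagonal :: "nat list \<Rightarrow> (nat \<times> nat) set" where
  "above_diagonal lam = {(i, j). (i, j) \<in> cells lam \<and> i < j}"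

text \<open>Reflecting a self-conjugate diagram exchanges each cell above the diagonal with its
  mirror image. The renaming of entries is therefore one transposition per such cell, which is the
  origin of \<open>eps\<close>.\<close>

lemma transposing_permutation:
  assumes part: "is_partition lam n" and self: "conj_part lam = lam" and T: "T \<in> tableaux lam n"
  obtains \<tau> where "\<tau> \<in> Sym n" "sign \<tau> = eps lam" "\<tau> \<circ> \<tau> = id" "flip T = move lam \<tau> T"
proof -
  have sym: "(i, j) \<in> cells lam \<longleftrightarrow> (j, i) \<in> cells lam" for i j
    using cells_conj_part[OF part, of i j] unfolding self by simp
  define pos where "pos k = (rowf lam T k, colf lam T k)" for k
  have pos: "pos k \<in> cells lam" "T (pos k) = k" if "k \<in> {1..n}" for k
    using tableau_at[OF T that] by (simp_all add: pos_def)
  have cell: "T c \<in> {1..n}" "pos (T c) = c" if "c \<in> cells lam" for c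
    using tableau_cell[OF T, of "fst c" "snd c"] that by (simp_all add: pos_def)
  have swap: "prod.swap c \<in> cells lam" if "c \<in> cells lam" for c using that sym by (cases c) auto
  \<comment> \<open>The exchange restricted to the mirror pairs meeting B, so that induction on B
    adds one disjoint transposition at a time.\<close>
  define t where "t B k = (if k \<in> {1..n} \<and> (pos k \<in> B \<or> prod.swap (pos k) \<in> B) then T (prod.swap (pos k)) else k)" for B k
  have main: "t B \<in> Sym n \<and> sign (t B) = (-1) ^ card B" if "finite B" "B \<subseteq> above_diagonal lam" for B
    using that
  proof (induction B rule: finite_induct)
    case empty
    have "t {} = id" by (auto simp: t_def fun_eq_iff)
    then show ?case by (simp only: Sym_id sign_id card.empty power_0 simp_thms)
  next
    case (insert c B)
    have c: "c \<in> cells lam" "prod.swap c \<in> cells lam" "c \<noteq> prod.swap c" "c \<notin> B" "prod.swap c \<notin> B"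
    proof -
      show "c \<in> cells lam" using insert.prems by (auto simp: above_diagonal_def)
      then show "prod.swap c \<in> cells lam" by (rule swap)
      show "c \<noteq> prod.swap c" using insert.prems by (auto simp: above_diagonal_def)
      show "c \<notin> B" by fact
      show "prod.swap c \<notin> B" using insert.prems by (auto simp: above_diagonal_def)
    qed
    let ?s = "transpose (T c) (T (prod.swap c))"
    have neq: "T c \<noteq> T (prod.swap c)" using cell(2)[OF c(1)] cell(2)[OF c(2)] c(3) by metis
    have tB: "t B \<in> Sym n" "sign (t B) = (-1) ^ card B" using insert by auto
    have s: "?s \<in> Sym n" using cell(1) c by (intro Sym_transpose) auto
    have fixed: "t B (T c) = T c" "t B (T (prod.swap c)) = T (prod.swap c)"
      unfolding t_def using cell c by auto
    have eq: "t (insert c B) = t B \<circ> ?s"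
    proof
      fix k
      consider "k = T c" | "k = T (prod.swap c)" | "k \<noteq> T c" "k \<noteq> T (prod.swap c)" by blast
      then show "t (insert c B) k = (t B \<circ> ?s) k"
      proof cases
        case 1
        have "t (insert c B) k = T (prod.swap c)" unfolding t_def 1 using cell[OF c(1)] by simp
        then show ?thesis using 1 fixed by simp
      next
        case 2
        have "t (insert c B) k = T c" unfolding t_def 2 using cell[OF c(2)] by simp
        then show ?thesis using 2 fixed by simp
      next
        case 3
        then have "k \<in> {1..n} \<Longrightarrow> pos k \<noteq> c \<and> prod.swap (pos k) \<noteq> c" using pos by (metis swap_swap)
        then have "t (insert c B) k = t B k" unfolding t_def by auto
        then show ?thesis using 3 by simp
      qed
    qed
    have "sign (t B \<circ> ?s) = (-1) ^ card (insert c B)"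
      using sign_comp[OF tB(1) s] tB(2) neq insert.hyps by (simp add: sign_swap_id)
    then show ?case unfolding eq using Sym_comp[OF tB(1) s] by blast
  qed
  let ?A = "above_diagonal lam"
  have fin: "finite ?A" by (rule finite_subset[OF _ finite_cells]) (auto simp: above_diagonal_def)
  let ?t = "t ?A"
  have t: "?t \<in> Sym n" "sign ?t = (-1) ^ card ?A" using main[OF fin] by auto
  have tk: "?t k = T (prod.swap (pos k))" if k: "k \<in> {1..n}" for k
  proof (cases "pos k \<in> ?A \<or> prod.swap (pos k) \<in> ?A")
    case False
    then have "fst (pos k) = snd (pos k)"
      using pos(1)[OF k] swap[OF pos(1)[OF k]] by (cases "pos k") (auto simp: above_diagonal_def)
    then have "prod.swap (pos k) = pos k" by (cases "pos k") auto
    then show ?thesis using False pos(2)[OF k] by (simp add: t_def)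
  qed (use k in \<open>simp add: t_def\<close>)
  have "eps lam = (-1) ^ card ?A" by (simp add: eps_def above_diagonal_def minus_one_power_iff)
  then have 1: "sign ?t = eps lam" using t(2) by simp
  have 2: "?t \<circ> ?t = id"
  proof
    fix k show "(?t \<circ> ?t) k = id k"
    proof (cases "k \<in> {1..n}")
      case True
      note c = swap[OF pos(1)[OF True]]
      show ?thesis using tk[OF True] tk[OF cell(1)[OF c]] cell(2)[OF c] pos(2)[OF True] by simp
    qed (simp add: Sym_not_in[OF t(1)])
  qed
  have "flip T c = move lam ?t T c" for c
  proof (cases "c \<in> cells lam")
    case True
    then show ?thesis using tk[OF cell(1)[OF True]] cell(2)[OF True] by (cases c) (simp add: move_def flip_def)
  next
    case False
    then have "prod.swap c \<notin> cells lam" using swap[of "prod.swap c"] by auto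
    then show ?thesis using False T by (cases c) (auto simp: move_def flip_def tableaux_def PiE_iff extensional_def)
  qed
  then have "flip T = move lam ?t T" by blast
  then show thesis using that t(1) 1 2 by blast
qed

text \<open>Renaming by \<tau> turns one tableau into the other, so the two intertwiners differ by
  the substitution of g \<circ> \<tau> for g, which costs the sign of \<tau>.\<close>

lemma twist_swap:
  assumes T: "T \<in> tableaux lam n" and \<tau>: "\<tau> \<in> Sym n" "\<tau> \<circ> \<tau> = id"
  shows "twist n lam (move lam \<tau> T) lam T f = (\<lambda>r. of_int (sign \<tau>) * twist n lam T lam (move lam \<tau> T) f r)"
proof
  fix r
  have inv: "inv_into UNIV \<tau> = \<tau>" using Sym_inv_comp(1)[OF \<tau>(1)] \<tau>(2) by (metis comp_assoc comp_id id_comp)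
  have "twist n lam (move lam \<tau> T) lam T f r = (\<Sum>g\<in>Sym n. (of_int (sign (g \<circ> \<tau>)) *
      f (row_tabloid lam n (move lam \<tau> T) \<circ> inv_into UNIV (g \<circ> \<tau>))) * act (g \<circ> \<tau>) (polytabloid lam n T) r)"
    unfolding twist_def by (rule Sym_reindex_left[OF \<tau>(1)])
  also have "\<dots> = (\<Sum>g\<in>Sym n. of_int (sign \<tau>) * ((of_int (sign g) * f (row_tabloid lam n T \<circ> inv_into UNIV g))
      * act g (polytabloid lam n (move lam \<tau> T)) r))"
  proof (rule sum.cong[OF refl])
    fix g assume g: "g \<in> Sym n"
    have "row_tabloid lam n (move lam \<tau> T) \<circ> inv_into UNIV (g \<circ> \<tau>) = row_tabloid lam n T \<circ> (\<tau> \<circ> \<tau>) \<circ> inv_into UNIV g"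
      by (simp only: row_tabloid_move[OF T \<tau>(1)] Sym_inv_distrib[OF g \<tau>(1)] inv comp_assoc)
    then have 1: "row_tabloid lam n (move lam \<tau> T) \<circ> inv_into UNIV (g \<circ> \<tau>) = row_tabloid lam n T \<circ> inv_into UNIV g"
      by (simp only: \<tau>(2) comp_id)
    have 2: "act (g \<circ> \<tau>) (polytabloid lam n T) = act g (polytabloid lam n (move lam \<tau> T) :: _ \<Rightarrow> real)"
      by (simp only: act_comp polytabloid_move[OF T \<tau>(1)])
    show "(of_int (sign (g \<circ> \<tau>)) * f (row_tabloid lam n (move lam \<tau> T) \<circ> inv_into UNIV (g \<circ> \<tau>))) * act (g \<circ> \<tau>) (polytabloid lam n T) r
      = of_int (sign \<tau>) * ((of_int (sign g) * f (row_tabloid lam n T \<circ> inv_into UNIV g)) * act g (polytabloid lam n (move lam \<tau> T)) r)"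
      unfolding 1 2 sign_comp[OF g \<tau>(1)] by simp
  qed
  finally show "twist n lam (move lam \<tau> T) lam T f r = of_int (sign \<tau>) * twist n lam T lam (move lam \<tau> T) f r"
    by (simp add: twist_def sum_distrib_left)
qed

text \<open>When the transposed tableau is a renaming of T, the return map is \<open>eps\<close>
  times the map itself, so the positive scalar of the composite becomes \<open>eps\<close> times a
  positive scalar.\<close>

theorem twist_square:
  assumes part: "is_partition lam n" and self: "conj_part lam = lam"
  shows "\<exists>J. \<exists>\<gamma>>0. equivariant sign (Sym n) (specht lam n) J \<and>
    (\<forall>f\<in>specht lam n. J f \<in> specht lam n \<and> J (J f) = (\<lambda>r. of_int (eps lam) * \<gamma> * f r :: real))"
proof -
  obtain T where T: "T \<in> tableaux lam n" using tableaux_nonempty[OF part] by blast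
  obtain \<tau> where \<tau>: "\<tau> \<in> Sym n" "sign \<tau> = eps lam" "\<tau> \<circ> \<tau> = id" "flip T = move lam \<tau> T"
    using transposing_permutation[OF part self T] .
  let ?U = "move lam \<tau> T"
  have d: "dual_pair n lam T lam ?U" using dual_pair_flip[OF part T] by (simp add: self \<tau>(4))
  obtain \<gamma> where \<gamma>: "\<gamma> > 0" "\<And>f. f \<in> specht lam n \<Longrightarrow> twist n lam ?U lam T (twist n lam T lam ?U f) = (\<lambda>r. \<gamma> * f r)"
    using twist_twist[OF d] by blast
  let ?J = "twist n lam T lam ?U"
  have ss: "of_int (eps lam) * of_int (eps lam) = (1 :: real)" unfolding \<tau>(2)[symmetric] by (rule of_int_sign_square)
  have "?J (?J f) = (\<lambda>r. of_int (eps lam) * \<gamma> * f r)" if "f \<in> specht lam n" for f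
  proof
    fix r
    have "of_int (eps lam) * ?J (?J f) r = \<gamma> * f r"
      using fun_cong[OF \<gamma>(2)[OF that], of r] twist_swap[OF T \<tau>(1,3), of "?J f"] by (simp add: \<tau>(2))
    then have "of_int (eps lam) * (of_int (eps lam) * ?J (?J f) r) = of_int (eps lam) * (\<gamma> * f r)" by simp
    then show "?J (?J f) r = of_int (eps lam) * \<gamma> * f r" using ss by (simp flip: mult.assoc)
  qed
  then show ?thesis
    using twist_specht[OF move_tableau[OF T \<tau>(1)]]
    by (intro exI[of _ ?J] exI[of _ \<gamma>] conjI ballI twist_equivariant \<gamma>(1)) simp_all
qed

section \<open>Restriction to the alternating group\<close>

definition sym_irred :: "nat \<Rightarrow> ((nat \<Rightarrow> nat) \<Rightarrow> 'a :: field) set \<Rightarrow> bool" where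
  "sym_irred n S \<longleftrightarrow> fsubspace S \<and> invariant (Sym n) S \<and>
     (\<forall>U. U \<subseteq> S \<and> fsubspace U \<and> invariant (Sym n) U \<longrightarrow> U = {\<lambda>r. 0} \<or> U = S)"

definition t12 :: "nat \<Rightarrow> nat" where "t12 = transpose 1 2"

lemma t12_Sym: "2 \<le> n \<Longrightarrow> t12 \<in> Sym n"
  unfolding t12_def by (rule Sym_transpose) auto

lemma t12_t12 [simp]: "t12 \<circ> t12 = id" "t12 \<circ> (t12 \<circ> g) = g" "f \<circ> t12 \<circ> t12 = f"
  by (simp_all add: t12_def comp_assoc) (simp add: o_assoc)

lemma t12_odd: "\<not> evenperm t12" and sign_t12: "sign t12 = -1"
  by (simp_all add: t12_def evenperm_swap sign_swap_id)

lemma act_t12_twice [simp]: "act t12 (act t12 f) = f"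
  by (simp add: act_def)

lemma invariant_Sym_from_Alt:
  assumes "2 \<le> n" "invariant (Alt n) W" "\<And>f. f \<in> W \<Longrightarrow> act t12 f \<in> W"
  shows "invariant (Sym n) W"
  unfolding invariant_def
proof (intro ballI)
  fix g f assume g: "g \<in> Sym n" and f: "f \<in> W"
  show "act g f \<in> W"
  proof (cases "evenperm g")
    case True
    then show ?thesis using assms(2) f g by (simp add: invariant_def Alt_iff)
  next
    case False
    have "t12 \<circ> g \<in> Alt n"
      using g False t12_Sym[OF assms(1)] t12_odd evenperm_Sym_comp[OF t12_Sym[OF assms(1)] g]
      by (simp add: Alt_iff Sym_comp)
    then have "act t12 (act (t12 \<circ> g) f) \<in> W" using assms(2,3) f by (simp add: invariant_def)
    then show ?thesis by (simp add: act_comp)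
  qed
qed

lemma t12_conj_Alt:
  assumes "2 \<le> n" "g \<in> Alt n"
  shows "t12 \<circ> g \<circ> t12 \<in> Alt n"
  using assms t12_Sym[OF assms(1)] t12_odd evenperm_Sym_comp[of _ n _] by (auto simp: Alt_iff Sym_comp)

lemma act_t12_conj: "act g (act t12 f) = act t12 (act (t12 \<circ> g \<circ> t12) f)"
  by (simp add: act_comp)

text \<open>Clifford theory for a subgroup of index 2: an irreducible S with a proper nonzero
  invariant subspace of the subgroup. The field is arbitrary, since real and complex modules are
  both needed.\<close>

locale alt_split =
  fixes n :: nat and S W :: "((nat \<Rightarrow> nat) \<Rightarrow> 'a :: field) set"
  assumes n: "2 \<le> n" and irr: "sym_irred n S" and sub: "W \<subseteq> S" and W: "fsubspace W" "invariant (Alt n) W"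
    and nz: "W \<noteq> {\<lambda>r. 0}" and proper: "W \<noteq> S"
begin

lemma S: "fsubspace S" "invariant (Sym n) S"
  using irr by (simp_all add: sym_irred_def)

text \<open>The intersection of W with its t12-translate is invariant under the whole symmetric
  group and is not all of S.\<close>

lemma intersection_trivial:
  assumes "f \<in> W" "act t12 f \<in> W"
  shows "f = (\<lambda>r. 0)"
proof -
  let ?X = "{f \<in> W. act t12 f \<in> W}"
  have "fsubspace ?X"
    using fsubspace_zero[OF W(1)] fsubspace_lincomb[OF W(1)] by (auto simp: fsubspace_def act_lincomb)
  moreover have "invariant (Sym n) ?X"
  proof (rule invariant_Sym_from_Alt[OF n])
    show "invariant (Alt n) ?X"
      unfolding invariant_def
    proof (intro ballI CollectI conjI)
      fix g f assume g: "g \<in> Alt n" and f: "f \<in> ?X"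
      show "act g f \<in> W" using invariantD[OF W(2) g] f by blast
      have "act (t12 \<circ> g \<circ> t12) (act t12 f) \<in> W" using invariantD[OF W(2) t12_conj_Alt[OF n g]] f by blast
      then show "act t12 (act g f) \<in> W" by (simp add: act_comp)
    qed
  qed auto
  moreover have "?X \<subseteq> S" "?X \<noteq> S" using sub proper by auto
  ultimately have "?X = {\<lambda>r. 0}" using irr unfolding sym_irred_def by blast
  then show ?thesis using assms by blast
qed

text \<open>The sum of W and its t12-translate is invariant under the whole symmetric group and
  nonzero, hence equals S.\<close>

lemma decomposition:
  assumes "f \<in> S"
  obtains u v where "u \<in> W" "v \<in> W" "f = (\<lambda>r. u r + act t12 v r)"
proof -
  define Y where "Y = {f. \<exists>u\<in>W. \<exists>v\<in>W. f = (\<lambda>r. u r + act t12 v r)}"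
  have YI: "f \<in> Y" if "u \<in> W" "v \<in> W" "f = (\<lambda>r. u r + act t12 v r)" for f u v
    unfolding Y_def by (intro CollectI bexI[where x = u] bexI[where x = v]) (rule that)+
  have YE: "\<exists>u v. u \<in> W \<and> v \<in> W \<and> f = (\<lambda>r. u r + act t12 v r)" if "f \<in> Y" for f
    using that unfolding Y_def by blast
  have "fsubspace Y"
    unfolding fsubspace_def
  proof (intro conjI ballI allI)
    show "(\<lambda>r. 0) \<in> Y" by (rule YI[OF fsubspace_zero[OF W(1)] fsubspace_zero[OF W(1)]]) simp
    fix f g a assume "f \<in> Y" "g \<in> Y"
    then obtain u v u' v' where *: "u \<in> W" "v \<in> W" "f = (\<lambda>r. u r + act t12 v r)"
      "u' \<in> W" "v' \<in> W" "g = (\<lambda>r. u' r + act t12 v' r)" using YE by meson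
    show "(\<lambda>r. a * f r + g r) \<in> Y"
      by (rule YI[OF fsubspace_lincomb[OF W(1) *(1,4)] fsubspace_lincomb[OF W(1) *(2,5)], of _ a a])
        (rule ext, simp add: *(3,6) act_def distrib_left add.assoc add.left_commute)
  qed
  moreover have "invariant (Sym n) Y"
  proof (rule invariant_Sym_from_Alt[OF n])
    show "invariant (Alt n) Y"
      unfolding invariant_def
    proof (intro ballI)
      fix g f assume g: "g \<in> Alt n" and "f \<in> Y"
      then obtain u v where *: "u \<in> W" "v \<in> W" "f = (\<lambda>r. u r + act t12 v r)" using YE by meson
      have "act g f = (\<lambda>r. act g u r + act g (act t12 v) r)" unfolding *(3) by (simp add: act_def)
      then have "act g f = (\<lambda>r. act g u r + act t12 (act (t12 \<circ> g \<circ> t12) v) r)" by (simp only: act_t12_conj[of g v])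
      then show "act g f \<in> Y"
        by (rule YI[OF invariantD[OF W(2) g *(1)] invariantD[OF W(2) t12_conj_Alt[OF n g] *(2)]])
    qed
    fix f assume "f \<in> Y"
    then obtain u v where *: "u \<in> W" "v \<in> W" "f = (\<lambda>r. u r + act t12 v r)" using YE by meson
    have "act t12 f = (\<lambda>r. act t12 u r + act t12 (act t12 v) r)" unfolding *(3) by (simp add: act_def)
    then have "act t12 f = (\<lambda>r. v r + act t12 u r)" by (simp add: add.commute)
    then show "act t12 f \<in> Y" by (rule YI[OF *(2,1)])
  qed
  moreover have "Y \<subseteq> S"
  proof
    fix f assume "f \<in> Y"
    then obtain u v where *: "u \<in> W" "v \<in> W" "f = (\<lambda>r. u r + act t12 v r)" using YE by meson
    have uv: "u \<in> S" "v \<in> S" using *(1,2) sub by auto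
    show "f \<in> S" unfolding *(3)
      by (rule fsubspace_add[OF S(1) uv(1) invariantD[OF S(2) t12_Sym[OF n] uv(2)]])
  qed
  moreover have "Y \<noteq> {\<lambda>r. 0}"
  proof -
    obtain w where w: "w \<in> W" "w \<noteq> (\<lambda>r. 0)" using nz fsubspace_zero[OF W(1)] by blast
    have "w \<in> Y" by (rule YI[OF w(1) fsubspace_zero[OF W(1)]]) simp
    then show ?thesis using w(2) by blast
  qed
  ultimately have "Y = S" using irr unfolding sym_irred_def by blast
  then show thesis using YE assms that by meson
qed

lemma decomposition_unique:
  assumes "u \<in> W" "v \<in> W" "u' \<in> W" "v' \<in> W" "(\<lambda>r. u r + act t12 v r) = (\<lambda>r. u' r + act t12 v' r)"
  shows "u = u'" "v = v'"
proof -
  let ?w = "\<lambda>r. v' r - v r"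
  have w: "?w \<in> W" using assms fsubspace_diff[OF W(1)] by blast
  have "act t12 ?w = (\<lambda>r. u r - u' r)"
  proof
    fix r show "act t12 ?w r = u r - u' r"
      using fun_cong[OF assms(5), of r] by (simp add: act_def algebra_simps)
  qed
  then have "act t12 ?w \<in> W" using assms fsubspace_diff[OF W(1)] by simp
  then have "?w = (\<lambda>r. 0)" using intersection_trivial w by blast
  then show "v = v'" by (simp add: fun_eq_iff)
  then have "u r = u' r" for r using fun_cong[OF assms(5), of r] by simp
  then show "u = u'" by (rule ext)
qed

text \<open>A nonzero U inside W already decomposes S together with its translate. An element of W
  then has its translated component in W as well, so this component is 0.\<close>

lemma minimal:
  assumes "U \<subseteq> W" "fsubspace U" "invariant (Alt n) U" "U \<noteq> {\<lambda>r. 0}"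
  shows "U = W"
proof -
  interpret U: alt_split n S U
    by unfold_locales (use assms n irr sub proper in auto)
  have "f \<in> U" if f: "f \<in> W" for f
  proof -
    have "f \<in> S" using f sub by blast
    then obtain u v where uv: "u \<in> U" "v \<in> U" "f = (\<lambda>r. u r + act t12 v r)" by (rule U.decomposition)
    have uvW: "u \<in> W" "v \<in> W" using uv(1,2) assms(1) by auto
    have "act t12 v = (\<lambda>r. f r - u r)" unfolding uv(3) by simp
    then have "act t12 v \<in> W" by (simp only: fsubspace_diff[OF W(1) f uvW(1)])
    then have "v = (\<lambda>r. 0)" by (rule intersection_trivial[OF uvW(2)])
    then have "f = u" unfolding uv(3) by simp
    then show ?thesis using uv(1) by (simp only:)
  qed
  then show ?thesis using assms(1) by blast
qed

text \<open>K is 1 on W and -1 on the translate of W. Even permutations preserve both summands and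
  odd ones exchange them, so K commutes with the action up to sign.\<close>

lemma reflection_operator:
  "\<exists>K. equivariant sign (Sym n) S K \<and> (\<forall>f\<in>S. K f \<in> S \<and> K (K f) = f)"
proof -
  define P where "P f u v \<longleftrightarrow> u \<in> W \<and> v \<in> W \<and> (\<forall>r. f r = u r + v (r \<circ> t12))" for f u v
  \<comment> \<open>The choice is made for the value itself; uniqueness of the decomposition
    identifies it with any representation at hand.\<close>
  define K where "K f = (SOME h. \<exists>u v. P f u v \<and> h = (\<lambda>r. u r - v (r \<circ> t12)))" for f
  have PI: "P f u v" if "u \<in> W" "v \<in> W" "\<And>r. f r = u r + v (r \<circ> t12)" for f u v
    using that unfolding P_def by auto
  have PD: "u \<in> W" "v \<in> W" "f r = u r + v (r \<circ> t12)" if "P f u v" for f u v r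
    using that unfolding P_def by auto
  have uniq: "u = u' \<and> v = v'" if p: "P f u v" "P f u' v'" for f u v u' v'
  proof -
    have "(\<lambda>r. u r + act t12 v r) = (\<lambda>r. u' r + act t12 v' r)"
      by (rule ext) (simp only: act_def flip: PD(3)[OF p(1)] PD(3)[OF p(2)])
    then show ?thesis using decomposition_unique[OF PD(1,2)[OF p(1)] PD(1,2)[OF p(2)]] by blast
  qed
  have K: "K f = (\<lambda>r. u r - v (r \<circ> t12))" if p: "P f u v" for f u v
    unfolding K_def
  proof (rule some_equality)
    show "\<exists>u' v'. P f u' v' \<and> (\<lambda>r. u r - v (r \<circ> t12)) = (\<lambda>r. u' r - v' (r \<circ> t12))"
      by (intro exI conjI) (rule p, rule refl)
    fix h assume "\<exists>u v. P f u v \<and> h = (\<lambda>r. u r - v (r \<circ> t12))"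
    then obtain u' v' where *: "P f u' v'" "h = (\<lambda>r. u' r - v' (r \<circ> t12))" by blast
    show "h = (\<lambda>r. u r - v (r \<circ> t12))" using uniq[OF p *(1)] *(2) by simp
  qed
  have exP: "\<exists>u v. P f u v" if fS: "f \<in> S" for f
  proof -
    obtain u v where uv: "u \<in> W" "v \<in> W" "f = (\<lambda>r. u r + act t12 v r)" by (rule decomposition[OF fS])
    have "P f u v" by (rule PI[OF uv(1,2)]) (simp add: uv(3) act_def)
    then show ?thesis by blast
  qed
  have lin: "lin_on S K"
    unfolding lin_on_def
  proof (intro ballI allI)
    fix f g a assume "f \<in> S" "g \<in> S"
    then obtain u v u' v' where p: "P f u v" "P g u' v'" using exP by meson
    have "P (\<lambda>r. a * f r + g r) (\<lambda>r. a * u r + u' r) (\<lambda>r. a * v r + v' r)"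
      by (rule PI[OF fsubspace_lincomb[OF W(1) PD(1)[OF p(1)] PD(1)[OF p(2)]] fsubspace_lincomb[OF W(1) PD(2)[OF p(1)] PD(2)[OF p(2)]]])
        (simp add: PD(3)[OF p(1)] PD(3)[OF p(2)] algebra_simps)
    from K[OF this] show "K (\<lambda>r. a * f r + g r) = (\<lambda>r. a * K f r + K g r)"
      unfolding K[OF p(1)] K[OF p(2)] by (simp add: algebra_simps)
  qed
  have Kt: "K (act t12 f) = (\<lambda>r. - act t12 (K f) r)" if p: "P f u v" for f u v
  proof -
    have "P (act t12 f) v u"
      by (rule PI[OF PD(2,1)[OF p]]) (simp add: act_def PD(3)[OF p] add.commute)
    then show ?thesis by (simp add: K K[OF p] act_def)
  qed
  have Ka: "K (act g f) = act g (K f)" if p: "P f u v" and g: "g \<in> Alt n" for f u v g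
  proof -
    have "P (act g f) (act g u) (act (t12 \<circ> g \<circ> t12) v)"
      by (rule PI[OF invariantD[OF W(2) g PD(1)[OF p]] invariantD[OF W(2) t12_conj_Alt[OF n g] PD(2)[OF p]]])
        (simp add: act_def PD(3)[OF p] o_assoc)
    then show ?thesis by (simp add: K K[OF p] act_def o_assoc)
  qed
  have "K (act g f) = (\<lambda>r. of_int (sign g) * act g (K f) r)" if g: "g \<in> Sym n" and f: "f \<in> S" for g f
  proof -
    obtain u v where p: "P f u v" using exP[OF f] by blast
    show ?thesis
    proof (cases "evenperm g")
      case True
      then have "g \<in> Alt n" using g by (simp add: Alt_iff)
      then show ?thesis using Ka[OF p] True by (simp add: sign_def)
    next
      case False
      have h: "t12 \<circ> g \<in> Alt n"
        using g False t12_Sym[OF n] t12_odd evenperm_Sym_comp[OF t12_Sym[OF n] g] by (simp add: Alt_iff Sym_comp)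
      have "act (t12 \<circ> g) f \<in> S" using invariantD[OF S(2) _ f] h Alt_subset_Sym by blast
      then obtain u' v' where p': "P (act (t12 \<circ> g) f) u' v'" using exP by blast
      have "K (act g f) = K (act t12 (act (t12 \<circ> g) f))" by (simp flip: act_comp)
      also have "\<dots> = (\<lambda>r. - act t12 (act (t12 \<circ> g) (K f)) r)" by (simp only: Kt[OF p'] Ka[OF p h])
      also have "\<dots> = (\<lambda>r. - act g (K f) r)" by (simp flip: act_comp)
      finally show ?thesis using False by (simp add: sign_def)
    qed
  qed
  with lin have eqv: "equivariant sign (Sym n) S K" by (simp add: equivariant_def)
  have KS: "K f \<in> S" "K (K f) = f" if fS: "f \<in> S" for f
  proof -
    obtain u v where p: "P f u v" using exP[OF fS] by blast
    have "P (K f) u (\<lambda>r. - v r)"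
      by (rule PI[OF PD(1)[OF p] fsubspace_uminus[OF W(1) PD(2)[OF p]]]) (simp add: K[OF p])
    from K[OF this] show "K (K f) = f" by (simp add: fun_eq_iff PD(3)[OF p])
    have uv: "u \<in> S" "v \<in> S" using PD(1,2)[OF p] sub by auto
    have "(\<lambda>r. u r - act t12 v r) \<in> S"
      by (rule fsubspace_diff[OF S(1) uv(1) invariantD[OF S(2) t12_Sym[OF n] uv(2)]])
    then show "K f \<in> S" by (simp add: K[OF p] act_def)
  qed
  show ?thesis by (intro exI[of _ K] conjI ballI eqv KS)
qed

end

lemma specht_sym_irred:
  "is_partition lam n \<Longrightarrow> sym_irred n (specht lam n :: (_ \<Rightarrow> 'a :: {conjugatable_ordered_field, field_char_0}) set)"
  unfolding sym_irred_def using specht_fsubspace specht_invariant specht_irreducible by blast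

text \<open>A proper invariant subspace yields an involution \<open>K\<close> that is equivariant up to the sign
  character. Composed with the twist it shows that the shape is self-conjugate and, by Schur's lemma,
  that the square of the twist is the square of a real scalar.\<close>
theorem specht_Alt_irreducible:
  fixes W :: "((nat \<Rightarrow> nat) \<Rightarrow> real) set"
  assumes n: "2 \<le> n" and part: "is_partition lam n" and type: "conj_part lam \<noteq> lam \<or> eps lam = -1"
    and W: "W \<subseteq> specht lam n" "fsubspace W" "invariant (Alt n) W"
  shows "W = {\<lambda>r. 0} \<or> W = specht lam n"
proof (rule ccontr)
  assume neg: "\<not> ?thesis"
  interpret alt_split n "specht lam n" W
    by unfold_locales (use n W neg specht_sym_irred[OF part] in auto)
  obtain K :: "((nat \<Rightarrow> nat) \<Rightarrow> real) \<Rightarrow> ((nat \<Rightarrow> nat) \<Rightarrow> real)" where K0: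
    "equivariant sign (Sym n) (specht lam n) K" "\<forall>f\<in>specht lam n. K f \<in> specht lam n \<and> K (K f) = f"
    using reflection_operator by blast
  have K: "equivariant sign (Sym n) (specht lam n) K" "\<And>f. f \<in> specht lam n \<Longrightarrow> K f \<in> specht lam n"
    "\<And>f. f \<in> specht lam n \<Longrightarrow> K (K f) = f" using K0 by blast+
  obtain T where T: "T \<in> tableaux lam n" using tableaux_nonempty[OF part] by blast
  define e :: "(nat \<Rightarrow> nat) \<Rightarrow> real" where "e = polytabloid lam n T"
  have e: "e \<in> specht lam n" unfolding e_def by (rule specht_polytabloid[OF T])
  have e1: "e (row_tabloid lam n T) = 1" unfolding e_def by (rule polytabloid_row_tabloid[OF T])
  let ?mu = "conj_part lam"
  note d = dual_pair_flip[OF part T]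
  have U: "flip T \<in> tableaux ?mu n" and part': "is_partition ?mu n" using d by (auto simp: dual_pair_def)
  define J where "J = twist n lam T ?mu (flip T)"
  define J' where "J' = twist n ?mu (flip T) lam T"
  have J: "equivariant sign (Sym n) S J" for S unfolding J_def by (rule twist_equivariant)
  have J': "equivariant sign (Sym n) S J'" for S unfolding J'_def by (rule twist_equivariant)
  have JS: "J f \<in> specht ?mu n" for f unfolding J_def by (rule twist_specht[OF U])
  have J'S: "J' f \<in> specht lam n" for f unfolding J'_def by (rule twist_specht[OF T])
  obtain \<gamma> where \<gamma>: "\<gamma> > 0" "\<And>f. f \<in> specht lam n \<Longrightarrow> J' (J f) = (\<lambda>r. \<gamma> * f r)"
    using twist_twist[OF d] unfolding J_def J'_def by blast
  have JJe: "J' (J e) (row_tabloid lam n T) = \<gamma>" using fun_cong[OF \<gamma>(2)[OF e]] e1 by simp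
  have nzJ: "J e \<noteq> (\<lambda>r. 0)"
  proof
    assume "J e = (\<lambda>r. 0)"
    then have "J' (J e) = (\<lambda>r. 0)"
      using lin_on_zero[OF equivariant_lin[OF J'] specht_fsubspace[of ?mu n]] by simp
    then show False using JJe \<gamma>(1) by simp
  qed
  have 1: "equivariant (\<lambda>_. 1) (Sym n) (specht lam n) (J \<circ> K)"
    using equivariant_comp[OF K(1) J K(2) specht_fsubspace specht_invariant] by simp
  \<comment> \<open>J \<circ> K has trivial character, the two signs cancelling, and K is bijective,
    so a nonzero intertwiner relates the two shapes. The composite K \<circ> J' gives the reverse
    inequality.\<close>
  have dom1: "rows_below ?mu k \<le> rows_below lam k" for k
  proof (rule equivariant_dominates[OF part 1])
    show "(J \<circ> K) f \<in> tabloid_space ?mu n" for f using JS specht_tabloid_space by fastforce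
    show "K e \<in> specht lam n" by (rule K(2)[OF e])
    show "(J \<circ> K) (K e) \<noteq> (\<lambda>r. 0)" using K(3)[OF e] nzJ by simp
  qed
  have 2: "equivariant (\<lambda>_. 1) (Sym n) (specht ?mu n) (K \<circ> J')"
    using equivariant_comp[OF J' K(1) J'S specht_fsubspace specht_invariant] by simp
  have dom2: "rows_below lam k \<le> rows_below ?mu k" for k
  proof (rule equivariant_dominates[OF part' 2])
    show "(K \<circ> J') f \<in> tabloid_space lam n" for f using K(2)[OF J'S] specht_tabloid_space by fastforce
    show "J e \<in> specht ?mu n" by (rule JS)
    show "(K \<circ> J') (J e) \<noteq> (\<lambda>r. 0)"
    proof
      assume z: "(K \<circ> J') (J e) = (\<lambda>r. 0)"
      have "J' (J e) = K (K (J' (J e)))" using K(3)[OF J'S] by simp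
      also have "\<dots> = (\<lambda>r. 0)" using z lin_on_zero[OF equivariant_lin[OF K(1)] specht_fsubspace] by simp
      finally show False using JJe \<gamma>(1) by simp
    qed
  qed
  have self: "?mu = lam"
    by (rule rows_below_inject[OF part' part]) (rule le_antisym[OF dom1 dom2])
  then have eps: "eps lam = -1" using type by blast
  obtain J2 :: "((nat \<Rightarrow> nat) \<Rightarrow> real) \<Rightarrow> ((nat \<Rightarrow> nat) \<Rightarrow> real)" and \<gamma>2 :: real where J0:
    "equivariant sign (Sym n) (specht lam n) J2" "\<gamma>2 > 0"
    "\<forall>f\<in>specht lam n. J2 f \<in> specht lam n \<and> J2 (J2 f) = (\<lambda>r. of_int (eps lam) * \<gamma>2 * f r)"
    using twist_square[OF part self] by blast
  have J2: "equivariant sign (Sym n) (specht lam n) J2" "\<And>f. f \<in> specht lam n \<Longrightarrow> J2 f \<in> specht lam n"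
    "\<gamma>2 > 0" "\<And>f. f \<in> specht lam n \<Longrightarrow> J2 (J2 f) = (\<lambda>r. of_int (eps lam) * \<gamma>2 * f r)"
    using J0 by blast+
  have 3: "equivariant (\<lambda>_. 1) (Sym n) (specht lam n) (J2 \<circ> K)"
    using equivariant_comp[OF K(1) J2(1) K(2) specht_fsubspace specht_invariant] by simp
  obtain c where c: "\<And>f. f \<in> specht lam n \<Longrightarrow> (J2 \<circ> K) f = (\<lambda>r. c * f r)"
    by (rule equivariant_scalar[OF part 3]) (use J2(2) K(2) in auto)
  \<comment> \<open>The sign-twisted endomorphism is determined up to a scalar: it is c K with K an
    involution, so its square is c * c, whereas \<open>eps\<close> makes it negative.\<close>
  have J2K: "J2 f = (\<lambda>r. c * K f r)" if "f \<in> specht lam n" for f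
    using c[OF K(2)[OF that]] K(3)[OF that] by simp
  have "J2 (J2 e) = J2 (\<lambda>r. c * K e r)" using J2K[OF e] by simp
  also have "\<dots> = (\<lambda>r. c * J2 (K e) r)"
    by (rule lin_on_scale[OF equivariant_lin[OF J2(1)] specht_fsubspace K(2)[OF e]])
  also have "J2 (K e) = (\<lambda>r. c * e r)" using c[OF e] by simp
  finally have cc: "J2 (J2 e) = (\<lambda>r. c * (c * e r))" .
  have "c * (c * e (row_tabloid lam n T)) = - \<gamma>2 * e (row_tabloid lam n T)"
    using fun_cong[OF cc, of "row_tabloid lam n T"] fun_cong[OF J2(4)[OF e], of "row_tabloid lam n T"] by (simp add: eps)
  then have "c * c = - \<gamma>2" using e1 by simp
  moreover have "0 \<le> c * c" by simp
  ultimately show False using J2(3) by linarith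
qed

text \<open>For \<open>eps\<close> equal to 1 the twist has the real eigenvalues sqrt \<gamma> and -
  sqrt \<gamma>. It commutes with even permutations, so an eigenspace is an invariant
  subspace.\<close>

theorem specht_Alt_reducible:
  assumes n: "2 \<le> n" and part: "is_partition lam n" and self: "conj_part lam = lam" and eps: "eps lam = 1"
  obtains W :: "((nat \<Rightarrow> nat) \<Rightarrow> real) set" where "W \<subseteq> specht lam n" "fsubspace W" "invariant (Alt n) W"
    "W \<noteq> {\<lambda>r. 0}" "W \<noteq> specht lam n"
proof -
  obtain J :: "((nat \<Rightarrow> nat) \<Rightarrow> real) \<Rightarrow> ((nat \<Rightarrow> nat) \<Rightarrow> real)" and \<gamma> :: real where J0:
    "equivariant sign (Sym n) (specht lam n) J" "\<gamma> > 0"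
    "\<forall>f\<in>specht lam n. J f \<in> specht lam n \<and> J (J f) = (\<lambda>r. of_int (eps lam) * \<gamma> * f r)"
    using twist_square[OF part self] by blast
  have J: "equivariant sign (Sym n) (specht lam n) J" "\<And>f. f \<in> specht lam n \<Longrightarrow> J f \<in> specht lam n"
    "\<gamma> > 0" "\<And>f. f \<in> specht lam n \<Longrightarrow> J (J f) = (\<lambda>r. of_int (eps lam) * \<gamma> * f r)"
    using J0 by blast+
  have JJ: "J (J f) = (\<lambda>r. \<gamma> * f r)" if "f \<in> specht lam n" for f using J(4)[OF that] eps by simp
  define s where "s = sqrt \<gamma>"
  have s: "s > 0" "s * s = \<gamma>" using J(3) by (simp_all add: s_def)
  note lin = equivariant_lin[OF J(1)] and sp = specht_fsubspace[of lam n, where 'a = real]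
  obtain T where T: "T \<in> tableaux lam n" using tableaux_nonempty[OF part] by blast
  define e :: "(nat \<Rightarrow> nat) \<Rightarrow> real" where "e = polytabloid lam n T"
  have e: "e \<in> specht lam n" unfolding e_def by (rule specht_polytabloid[OF T])
  have e1: "e (row_tabloid lam n T) = 1" unfolding e_def by (rule polytabloid_row_tabloid[OF T])
  have te: "act t12 e \<in> specht lam n" using invariantD[OF specht_invariant t12_Sym[OF n] e] .
  \<comment> \<open>A scalar commutes with t12, whereas the twist anticommutes with it.\<close>
  have not_scalar: "c = 0" if "\<And>f. f \<in> specht lam n \<Longrightarrow> J f = (\<lambda>r. c * f r)" for c
  proof -
    have "(\<lambda>r. c * act t12 e r) = (\<lambda>r. - act t12 (\<lambda>r. c * e r) r)"
      using equivariantD[OF J(1) t12_Sym[OF n] e] that[OF te] that[OF e] by (simp add: sign_t12)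
    from fun_cong[OF this, of "row_tabloid lam n T \<circ> t12"]
    have "c * e (row_tabloid lam n T) = - (c * e (row_tabloid lam n T))" by (simp add: act_def)
    then show "c = 0" using e1 by simp
  qed
  define W where "W = {f \<in> specht lam n. J f = (\<lambda>r. s * f r)}"
  have "W \<subseteq> specht lam n" by (auto simp: W_def)
  moreover have "fsubspace W"
    unfolding fsubspace_def W_def using lin_on_zero[OF lin sp] sp
    by (auto simp: fsubspace_zero fsubspace_lincomb lin_onD[OF lin] distrib_left mult.left_commute)
  moreover have "invariant (Alt n) W"
    unfolding invariant_def
  proof (intro ballI)
    fix g f assume g: "g \<in> Alt n" and f: "f \<in> W"
    then have gS: "g \<in> Sym n" "sign g = 1" by (auto simp: Alt_iff sign_def)
    have "J (act g f) = (\<lambda>r. s * act g f r)"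
      using equivariantD[OF J(1) gS(1), of f] f gS(2) by (simp add: W_def act_def)
    then show "act g f \<in> W" using invariantD[OF specht_invariant gS(1), of f] f by (simp add: W_def)
  qed
  moreover have "W \<noteq> {\<lambda>r. 0}"
  proof
    assume W0: "W = {\<lambda>r. 0}"
    have "J f = (\<lambda>r. - s * f r)" if f: "f \<in> specht lam n" for f
    proof -
      \<comment> \<open>Since J squares to s * s, the vector s f + J f is an eigenvector for s; if
        no such vector is nonzero, J is the scalar -s.\<close>
      let ?h = "\<lambda>r. s * f r + J f r"
      have "J ?h = (\<lambda>r. s * J f r + \<gamma> * f r)" using lin_onD[OF lin f J(2)[OF f]] JJ[OF f] by simp
      also have "\<dots> = (\<lambda>r. s * ?h r)" by (simp add: s(2)[symmetric] algebra_simps)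
      finally have "?h \<in> W" using fsubspace_lincomb[OF sp f J(2)[OF f]] by (simp add: W_def)
      then have "?h = (\<lambda>r. 0)" using W0 by simp
      then show ?thesis by (auto simp: fun_eq_iff eq_neg_iff_add_eq_0 add.commute)
    qed
    then have "- s = 0" by (rule not_scalar)
    then show False using s by simp
  qed
  moreover have "W \<noteq> specht lam n"
  proof
    assume "W = specht lam n"
    then have "s = 0" by (intro not_scalar) (auto simp: W_def)
    then show False using s by simp
  qed
  ultimately show thesis using that by blast
qed

section \<open>Complexification of spaces of functions\<close>

definition cx :: "((nat \<Rightarrow> nat) \<Rightarrow> real) set \<Rightarrow> ((nat \<Rightarrow> nat) \<Rightarrow> complex) set" where
  "cx W = {f. (\<lambda>r. Re (f r)) \<in> W \<and> (\<lambda>r. Im (f r)) \<in> W}"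

lemma cx_fsubspace:
  assumes "fsubspace W"
  shows "fsubspace (cx W)"
  unfolding fsubspace_def
proof (intro conjI ballI allI)
  show "(\<lambda>r. 0) \<in> cx W" using fsubspace_zero[OF assms] by (simp add: cx_def)
  fix f g a assume fg: "f \<in> cx W" "g \<in> cx W"
  have f: "(\<lambda>r. Re (f r)) \<in> W" "(\<lambda>r. Im (f r)) \<in> W" and g: "(\<lambda>r. Re (g r)) \<in> W" "(\<lambda>r. Im (g r)) \<in> W"
    using fg by (auto simp: cx_def)
  have "(\<lambda>r. Re (a * f r + g r)) = (\<lambda>r. Re a * Re (f r) + (- Im a * Im (f r) + Re (g r)))"
    "(\<lambda>r. Im (a * f r + g r)) = (\<lambda>r. Re a * Im (f r) + (Im a * Re (f r) + Im (g r)))"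
    by (simp_all add: algebra_simps)
  then show "(\<lambda>r. a * f r + g r) \<in> cx W" unfolding cx_def mem_Collect_eq
    by (simp only: fsubspace_lincomb[OF assms f(1) fsubspace_lincomb[OF assms f(2) g(1)]]
      fsubspace_lincomb[OF assms f(2) fsubspace_lincomb[OF assms f(1) g(2)]] simp_thms)
qed

lemma cx_invariant: "invariant G W \<Longrightarrow> invariant G (cx W)"
  by (auto simp: invariant_def cx_def act_def)

lemma cx_subset_imp:
  assumes "fsubspace W'"
  shows "cx W \<subseteq> cx W' \<Longrightarrow> fsubspace W \<Longrightarrow> W \<subseteq> W'"
proof
  fix f assume sub: "cx W \<subseteq> cx W'" and W: "fsubspace W" and f: "f \<in> W"
  then have "(\<lambda>r. complex_of_real (f r)) \<in> cx W" using fsubspace_zero[OF W] by (simp add: cx_def)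
  then have "(\<lambda>r. complex_of_real (f r)) \<in> cx W'" using sub by blast
  then show "f \<in> W'" by (simp add: cx_def)
qed

lemma polytabloid_of_real: "polytabloid lam n T r = complex_of_real (polytabloid lam n T r)"
  by (simp add: polytabloid_def if_distrib[of complex_of_real] cong: if_cong)

text \<open>Polytabloids are real-valued, so the complex Specht module is spanned by the real
  one.\<close>

lemma cx_specht: "cx (specht lam n) = specht lam n"
proof
  show "specht lam n \<subseteq> cx (specht lam n)"
  proof (rule specht_least[OF cx_fsubspace[OF specht_fsubspace]])
    fix T assume "T \<in> tableaux lam n"
    then show "polytabloid lam n T \<in> cx (specht lam n)"
      unfolding cx_def using specht_polytabloid[of T lam n, where 'a = real] fsubspace_zero[OF specht_fsubspace[of lam n]]
      by (simp add: polytabloid_of_real)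
  qed
  have real: "(\<lambda>r. complex_of_real (f r)) \<in> specht lam n" if fS: "f \<in> specht lam n" for f :: "(nat \<Rightarrow> nat) \<Rightarrow> real"
  proof -
    obtain c where "f = (\<lambda>r. \<Sum>T\<in>tableaux lam n. c T * polytabloid lam n T r)" using fS unfolding specht_def by blast
    then have "(\<lambda>r. complex_of_real (f r)) = (\<lambda>r. \<Sum>T\<in>tableaux lam n. complex_of_real (c T) * polytabloid lam n T r)"
      by (simp add: polytabloid_of_real)
    then show ?thesis unfolding specht_def mem_Collect_eq by (rule exI[where x = "\<lambda>T. complex_of_real (c T)"])
  qed
  show "cx (specht lam n) \<subseteq> specht lam n"
  proof
    fix f :: "(nat \<Rightarrow> nat) \<Rightarrow> complex" assume "f \<in> cx (specht lam n)"
    then have "(\<lambda>r. complex_of_real (Im (f r))) \<in> specht lam n" "(\<lambda>r. complex_of_real (Re (f r))) \<in> specht lam n"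
      using real by (auto simp: cx_def)
    then have "(\<lambda>r. \<i> * complex_of_real (Im (f r)) + complex_of_real (Re (f r))) \<in> specht lam n"
      by (rule fsubspace_lincomb[OF specht_fsubspace])
    then show "f \<in> specht lam n" by (simp add: complex_eq[symmetric] add.commute)
  qed
qed

lemma cx_nonzero:
  assumes "fsubspace W" "W \<noteq> {\<lambda>r. 0}"
  shows "cx W \<noteq> {\<lambda>r. 0}"
proof -
  obtain f where f: "f \<in> W" "f \<noteq> (\<lambda>r. 0)" using assms fsubspace_zero by blast
  then have "(\<lambda>r. complex_of_real (f r)) \<in> cx W" using fsubspace_zero[OF assms(1)] by (simp add: cx_def)
  moreover have "(\<lambda>r. complex_of_real (f r)) \<noteq> (\<lambda>r. 0)" using f(2) by (auto simp: fun_eq_iff)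
  ultimately show ?thesis by blast
qed

section \<open>Matrices of representations\<close>

text \<open>The linear part of \<open>rep_iso_sub\<close>, split off so that coordinates can be
  changed without reference to a group.\<close>

definition lin_iso :: "nat \<Rightarrow> ('a :: field vec \<Rightarrow> (nat \<Rightarrow> nat) \<Rightarrow> 'a) \<Rightarrow> ((nat \<Rightarrow> nat) \<Rightarrow> 'a) set \<Rightarrow> bool" where
  "lin_iso d L W \<longleftrightarrow> (\<forall>v\<in>carrier_vec d. \<forall>w\<in>carrier_vec d. \<forall>a. L (a \<cdot>\<^sub>v v + w) = (\<lambda>r. a * L v r + L w r)) \<and>
     inj_on L (carrier_vec d) \<and> L ` carrier_vec d = W"

lemma rep_iso_sub_eq:
  "rep_iso_sub G d \<rho> W \<longleftrightarrow> (\<exists>L. lin_iso d L W \<and> (\<forall>g\<in>G. \<forall>v\<in>carrier_vec d. L (\<rho> g *\<^sub>v v) = act g (L v)))"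
  unfolding rep_iso_sub_def lin_iso_def by blast

lemma lin_isoD:
  assumes "lin_iso d L W"
  shows "v \<in> carrier_vec d \<Longrightarrow> w \<in> carrier_vec d \<Longrightarrow> L (a \<cdot>\<^sub>v v + w) = (\<lambda>r. a * L v r + L w r)"
    and "inj_on L (carrier_vec d)" "L ` carrier_vec d = W" "v \<in> carrier_vec d \<Longrightarrow> L v \<in> W"
  using assms by (auto simp: lin_iso_def)

lemma lin_iso_zero:
  assumes "lin_iso d L W"
  shows "L (0\<^sub>v d) = (\<lambda>r. 0)"
proof -
  have "(-1) \<cdot>\<^sub>v 0\<^sub>v d + 0\<^sub>v d = (0\<^sub>v d :: 'a vec)" by (intro eq_vecI) auto
  then show ?thesis using lin_isoD(1)[OF assms, of "0\<^sub>v d" "0\<^sub>v d" "-1"] by simp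
qed

lemma linear_vec_matrix:
  fixes f :: "'a :: field vec \<Rightarrow> 'a vec"
  assumes into: "\<And>v. v \<in> carrier_vec d \<Longrightarrow> f v \<in> carrier_vec d'"
    and lin: "\<And>v w a. v \<in> carrier_vec d \<Longrightarrow> w \<in> carrier_vec d \<Longrightarrow> f (a \<cdot>\<^sub>v v + w) = a \<cdot>\<^sub>v f v + f w"
  shows "\<exists>P\<in>carrier_mat d' d. \<forall>v\<in>carrier_vec d. P *\<^sub>v v = f v"
proof -
  define P where "P = mat d' d (\<lambda>(i, j). f (unit_vec d j) $ i)"
  have P: "P \<in> carrier_mat d' d" by (simp add: P_def)
  have f0: "f (0\<^sub>v d) = 0\<^sub>v d'"
  proof -
    have e: "(-1) \<cdot>\<^sub>v 0\<^sub>v d + 0\<^sub>v d = (0\<^sub>v d :: 'a vec)" by (intro eq_vecI) auto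
    have "f (0\<^sub>v d) = (-1) \<cdot>\<^sub>v f (0\<^sub>v d) + f (0\<^sub>v d)" using lin[of "0\<^sub>v d" "0\<^sub>v d" "-1"] unfolding e by simp
    also have "\<dots> = 0\<^sub>v d'" using into[of "0\<^sub>v d"] by (intro eq_vecI) auto
    finally show ?thesis .
  qed
  \<comment> \<open>Linearity is assumed for two summands only; k bounds the support of v, and each
    step splits off its last coordinate.\<close>
  have "P *\<^sub>v v = f v" if "v \<in> carrier_vec d" "k \<le> d" "\<forall>i<d. k \<le> i \<longrightarrow> v $ i = 0" for v k
    using that
  proof (induction k arbitrary: v)
    case 0
    then have "v = 0\<^sub>v d" by (intro eq_vecI) auto
    moreover have "P *\<^sub>v 0\<^sub>v d = 0\<^sub>v d'" using P by (intro eq_vecI) auto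
    ultimately show ?case by (simp only: f0)
  next
    case (Suc k)
    define w where "w = vec d (\<lambda>i. if i = k then 0 else v $ i)"
    have w: "w \<in> carrier_vec d" by (simp add: w_def)
    have v: "v = v $ k \<cdot>\<^sub>v unit_vec d k + w" using Suc.prems by (intro eq_vecI) (auto simp: w_def)
    have "P *\<^sub>v w = f w" by (rule Suc.IH[OF w]) (use Suc.prems in \<open>auto simp: w_def le_less Suc_le_eq\<close>)
    moreover have "P *\<^sub>v unit_vec d k = f (unit_vec d k)"
      using into[of "unit_vec d k"] Suc.prems mat_mult_unit_vec[OF P, of k] by (intro eq_vecI) (auto simp: P_def)
    moreover have "P *\<^sub>v (v $ k \<cdot>\<^sub>v unit_vec d k + w) = v $ k \<cdot>\<^sub>v (P *\<^sub>v unit_vec d k) + P *\<^sub>v w"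
      using P w by (simp add: mult_add_distrib_mat_vec[of _ d' d] mult_mat_vec[of _ d' d])
    ultimately show ?case using lin[of "unit_vec d k" w "v $ k"] w v by simp
  qed
  from this[of _ d] show ?thesis using P by auto
qed

lemma mat_eq_by_action:
  fixes A :: "'a :: field mat"
  assumes "A \<in> carrier_mat m d" "B \<in> carrier_mat m d" "\<And>v. v \<in> carrier_vec d \<Longrightarrow> A *\<^sub>v v = B *\<^sub>v v"
  shows "A = B"
  using assms by (intro mat_col_eqI) (auto simp flip: mat_mult_unit_vec[of _ m d])

lemma lin_iso_change:
  assumes "lin_iso d L W" "lin_iso d' L' W"
  shows "\<exists>P\<in>carrier_mat d' d. \<forall>v\<in>carrier_vec d. L' (P *\<^sub>v v) = L v"
proof -
  define f where "f v = inv_into (carrier_vec d') L' (L v)" for v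
  have f: "f v \<in> carrier_vec d'" "L' (f v) = L v" if "v \<in> carrier_vec d" for v
  proof -
    have "L v \<in> L' ` carrier_vec d'" using lin_isoD(3)[OF assms(2)] lin_isoD(4)[OF assms(1) that] by blast
    then show "f v \<in> carrier_vec d'" "L' (f v) = L v" unfolding f_def by (auto intro: inv_into_into f_inv_into_f)
  qed
  have lin: "f (a \<cdot>\<^sub>v v + w) = a \<cdot>\<^sub>v f v + f w" if "v \<in> carrier_vec d" "w \<in> carrier_vec d" for v w a
  proof (rule inj_onD[OF lin_isoD(2)[OF assms(2)]])
    show "L' (f (a \<cdot>\<^sub>v v + w)) = L' (a \<cdot>\<^sub>v f v + f w)"
      using that f by (simp add: lin_isoD(1)[OF assms(1)] lin_isoD(1)[OF assms(2)])
  qed (use that f in auto)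
  have "\<exists>P\<in>carrier_mat d' d. \<forall>v\<in>carrier_vec d. P *\<^sub>v v = f v"
    by (intro linear_vec_matrix f(1) lin)
  then obtain P where P: "P \<in> carrier_mat d' d" "\<forall>v\<in>carrier_vec d. P *\<^sub>v v = f v" by blast
  have "\<forall>v\<in>carrier_vec d. L' (P *\<^sub>v v) = L v" using P(2) f(2) by simp
  then show ?thesis using P(1) by blast
qed

text \<open>The change of coordinates between two models of W conjugates one matrix into the other.
  Hence the trace depends only on the operator F.\<close>

lemma lin_iso_trace:
  fixes A B :: "'a :: field mat"
  assumes L: "lin_iso d L W" and L': "lin_iso d' L' W" and A: "A \<in> carrier_mat d d" and B: "B \<in> carrier_mat d' d'"
    and FA: "\<And>v. v \<in> carrier_vec d \<Longrightarrow> L (A *\<^sub>v v) = F (L v)"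
    and FB: "\<And>v. v \<in> carrier_vec d' \<Longrightarrow> L' (B *\<^sub>v v) = F (L' v)"
  shows "mtrace A = mtrace B"
proof -
  obtain P where P: "P \<in> carrier_mat d' d" "\<And>v. v \<in> carrier_vec d \<Longrightarrow> L' (P *\<^sub>v v) = L v"
    using lin_iso_change[OF L L'] by blast
  obtain Q where Q: "Q \<in> carrier_mat d d'" "\<And>v. v \<in> carrier_vec d' \<Longrightarrow> L (Q *\<^sub>v v) = L' v"
    using lin_iso_change[OF L' L] by blast
  have PQ: "P *\<^sub>v (Q *\<^sub>v v) = v" if "v \<in> carrier_vec d'" for v
    by (rule inj_onD[OF lin_isoD(2)[OF L']]) (use P Q that in auto)
  have PAQ: "P * (A * Q) \<in> carrier_mat d' d'" using A P(1) Q(1) by (meson mult_carrier_mat)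
  have BPAQ: "B *\<^sub>v v = (P * (A * Q)) *\<^sub>v v" if v: "v \<in> carrier_vec d'" for v
  proof (rule inj_onD[OF lin_isoD(2)[OF L']])
    have "L' ((P * (A * Q)) *\<^sub>v v) = L' (P *\<^sub>v (A *\<^sub>v (Q *\<^sub>v v)))"
      using A P(1) Q(1) v by (simp add: assoc_mult_mat_vec[of _ d' d _ d'] assoc_mult_mat_vec[of _ d d _ d'] mult_carrier_mat[of _ d d _ d'])
    also have "\<dots> = F (L (Q *\<^sub>v v))" using A P Q v FA by simp
    also have "\<dots> = L' (B *\<^sub>v v)" using Q v FB by simp
    finally show "L' (B *\<^sub>v v) = L' ((P * (A * Q)) *\<^sub>v v)" by simp
  qed (use B PAQ v in \<open>auto intro: mult_mat_vec_carrier\<close>)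
  have "B = P * (A * Q)" by (rule mat_eq_by_action[OF B PAQ BPAQ])
  then have "mtrace B = mtrace (P * (A * Q))" by simp
  also have "\<dots> = mtrace ((A * Q) * P)" by (rule mtrace_mult_comm[OF P(1)]) (use A Q in auto)
  also have "(A * Q) * P = A"
  proof -
    have QP: "Q *\<^sub>v (P *\<^sub>v v) = v" if "v \<in> carrier_vec d" for v
      by (rule inj_onD[OF lin_isoD(2)[OF L]]) (use P Q that in auto)
    have "Q * P = 1\<^sub>m d"
      using P(1) Q(1) QP by (intro mat_eq_by_action[of _ d d]) (auto simp: assoc_mult_mat_vec[of _ d d' _ d])
    then show ?thesis using A P(1) Q(1) by (simp add: assoc_mult_mat[of _ d d _ d' _ d])
  qed
  finally show ?thesis by simp
qed

section \<open>Orthonormal bases and orthogonal matrix models\<close>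

definition finner :: "'b set \<Rightarrow> ('b \<Rightarrow> real) \<Rightarrow> ('b \<Rightarrow> real) \<Rightarrow> real" where
  "finner X f g = (\<Sum>r\<in>X. f r * g r)"

lemma finner_sum_left: "finner X (\<lambda>r. \<Sum>i\<in>A. c i * F i r) g = (\<Sum>i\<in>A. c i * finner X (F i) g)"
proof -
  have "finner X (\<lambda>r. \<Sum>i\<in>A. c i * F i r) g = (\<Sum>r\<in>X. \<Sum>i\<in>A. c i * (F i r * g r))"
    by (simp add: finner_def sum_distrib_right mult.assoc)
  also have "\<dots> = (\<Sum>i\<in>A. \<Sum>r\<in>X. c i * (F i r * g r))" by (rule sum.swap)
  finally show ?thesis by (simp add: finner_def sum_distrib_left)
qed

lemma finner_commute: "finner X f g = finner X g f"
  by (simp add: finner_def mult.commute)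

lemma finner_diff_left: "finner X (\<lambda>r. f r - h r) g = finner X f g - finner X h g"
  by (simp add: finner_def sum_subtractf left_diff_distrib)

lemma finner_scale_left: "finner X (\<lambda>r. c * f r) g = c * finner X f g"
  by (simp add: finner_def sum_distrib_left mult_ac)

definition orthonormal :: "(nat \<Rightarrow> nat) set \<Rightarrow> nat \<Rightarrow> (nat \<Rightarrow> (nat \<Rightarrow> nat) \<Rightarrow> real) \<Rightarrow> bool" where
  "orthonormal X d b \<longleftrightarrow> (\<forall>i<d. \<forall>j<d. finner X (b i) (b j) = (if i = j then 1 else 0))"

lemma orthonormal_coeff:
  assumes "orthonormal X d b" "i < d"
  shows "finner X (\<lambda>r. \<Sum>j<d. c j * b j r) (b i) = c i"
proof -
  have "finner X (\<lambda>r. \<Sum>j<d. c j * b j r) (b i) = (\<Sum>j<d. if j = i then c i else 0)"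
    unfolding finner_sum_left using assms by (intro sum.cong) (auto simp: orthonormal_def)
  then show ?thesis using assms(2) by simp
qed

lemma orthonormal_residual:
  assumes on: "orthonormal X d b"
  shows "i < d \<Longrightarrow> finner X (\<lambda>r. f r - (\<Sum>j<d. finner X f (b j) * b j r)) (b i) = 0"
    and "finner X (\<lambda>r. f r - (\<Sum>j<d. finner X f (b j) * b j r)) (\<lambda>r. f r - (\<Sum>j<d. finner X f (b j) * b j r))
      = finner X f f - (\<Sum>j<d. (finner X f (b j))\<^sup>2)"
proof -
  let ?c = "\<lambda>j. finner X f (b j)" and ?p = "\<lambda>r. \<Sum>j<d. finner X f (b j) * b j r"
  show 1: "finner X (\<lambda>r. f r - ?p r) (b i) = 0" if "i < d" for i
    using orthonormal_coeff[OF on that, of ?c] by (simp add: finner_diff_left)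
  have "finner X (\<lambda>r. f r - ?p r) ?p = (\<Sum>j<d. ?c j * finner X (b j) (\<lambda>r. f r - ?p r))"
    by (subst finner_commute) (rule finner_sum_left)
  also have "\<dots> = 0" using 1 by (simp add: finner_commute[of X "b _"])
  finally have z: "finner X (\<lambda>r. f r - ?p r) ?p = 0" .
  have "finner X (\<lambda>r. f r - ?p r) (\<lambda>r. f r - ?p r) = finner X f (\<lambda>r. f r - ?p r) - finner X ?p (\<lambda>r. f r - ?p r)"
    by (rule finner_diff_left)
  also have "finner X ?p (\<lambda>r. f r - ?p r) = 0" using z by (simp add: finner_commute)
  also have "finner X f (\<lambda>r. f r - ?p r) = finner X f f - finner X ?p f"
    by (subst finner_commute) (simp add: finner_diff_left)
  also have "finner X ?p f = (\<Sum>j<d. (?c j)\<^sup>2)"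
    unfolding finner_sum_left by (simp add: power2_eq_square finner_commute[of X f])
  finally show "finner X (\<lambda>r. f r - ?p r) (\<lambda>r. f r - ?p r) = finner X f f - (\<Sum>j<d. (?c j)\<^sup>2)" by simp
qed

text \<open>Bessel's inequality for the indicator of x bounds the squares of the coordinates at x by
  1; summing over x gives d on one side and the number of points on the other.\<close>

lemma orthonormal_bound:
  assumes X: "finite X" and on: "orthonormal X d b"
  shows "d \<le> card X"
proof -
  have "(\<Sum>j<d. (b j x)\<^sup>2) \<le> 1" if x: "x \<in> X" for x
  proof -
    define f :: "(nat \<Rightarrow> nat) \<Rightarrow> real" where "f r = (if r = x then 1 else 0)" for r
    have c: "finner X f g = g x" for g
      using x X by (simp add: finner_def f_def if_distrib[of "\<lambda>y. y * _"] cong: if_cong)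
    have "0 \<le> finner X f f - (\<Sum>j<d. (finner X f (b j))\<^sup>2)"
      unfolding orthonormal_residual(2)[OF on, symmetric] by (simp add: finner_def sum_nonneg)
    then show ?thesis by (simp add: c f_def)
  qed
  then have "(\<Sum>x\<in>X. \<Sum>j<d. (b j x)\<^sup>2) \<le> (\<Sum>x\<in>X. 1)" by (rule sum_mono)
  moreover have "(\<Sum>x\<in>X. \<Sum>j<d. (b j x)\<^sup>2) = (\<Sum>j<d. \<Sum>x\<in>X. (b j x)\<^sup>2)" by (rule sum.swap)
  moreover have "(\<Sum>x\<in>X. (b j x)\<^sup>2) = 1" if "j < d" for j
    using on that by (simp add: orthonormal_def finner_def power2_eq_square)
  ultimately show ?thesis by simp
qed

text \<open>A largest orthonormal system exists by the preceding bound. The normalised residual of a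
  vector outside its span would extend it.\<close>

lemma orthonormal_basis:
  assumes X: "finite X" and W: "fsubspace W" and supp: "\<And>f r. f \<in> W \<Longrightarrow> r \<notin> X \<Longrightarrow> f r = 0"
  shows "\<exists>d b. orthonormal X d b \<and> (\<forall>i<d. b i \<in> W) \<and>
    (\<forall>f\<in>W. f = (\<lambda>r. \<Sum>j<d. finner X f (b j) * b j r))"
proof -
  define Q where "Q d \<longleftrightarrow> (\<exists>b. orthonormal X d b \<and> (\<forall>i<d. b i \<in> W))" for d
  have "Q 0" by (simp add: Q_def orthonormal_def)
  moreover have "\<forall>d. Q d \<longrightarrow> d \<le> card X" using orthonormal_bound[OF X] by (auto simp: Q_def)
  ultimately obtain d where d: "Q d" "\<And>d'. Q d' \<Longrightarrow> d' \<le> d"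
    using GreatestI_nat[of Q 0 "card X"] Greatest_le_nat[of Q _ "card X"] by blast
  then obtain b where b: "orthonormal X d b" "\<And>i. i < d \<Longrightarrow> b i \<in> W" by (auto simp: Q_def)
  have "f = (\<lambda>r. \<Sum>j<d. finner X f (b j) * b j r)" if f: "f \<in> W" for f
  proof (rule ccontr)
    define g where "g r = f r - (\<Sum>j<d. finner X f (b j) * b j r)" for r
    assume "f \<noteq> (\<lambda>r. \<Sum>j<d. finner X f (b j) * b j r)"
    then obtain r where r: "g r \<noteq> 0" by (auto simp: fun_eq_iff g_def)
    have p: "(\<lambda>r. \<Sum>j<d. finner X f (b j) * b j r) \<in> W" by (rule fsubspace_sum[OF W]) (use b in auto)
    have gW: "g \<in> W" unfolding g_def by (rule fsubspace_diff[OF W f p])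
    have rX: "r \<in> X" using supp[OF gW, of r] r by blast
    have gb: "finner X g (b i) = 0" if "i < d" for i
      unfolding g_def by (rule orthonormal_residual(1)[OF b(1) that])
    have "0 < g r * g r" using r by (auto simp: zero_less_mult_iff linorder_neq_iff)
    also have "\<dots> \<le> finner X g g" unfolding finner_def by (rule member_le_sum[OF rX, of "\<lambda>r. g r * g r"]) (auto simp: X)
    finally have pos: "finner X g g > 0" .
    define s where "s = 1 / sqrt (finner X g g)"
    define h where "h r = s * g r" for r
    have hW: "h \<in> W" unfolding h_def by (rule fsubspace_scale[OF W gW])
    have "finner X h h = s * s * finner X g g"
      unfolding h_def finner_scale_left by (subst finner_commute) (simp add: finner_scale_left)
    then have hh: "finner X h h = 1" using pos by (simp add: s_def)
    have h_eq: "h = (\<lambda>r. s * g r)" by (simp add: h_def fun_eq_iff)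
    have hb: "finner X h (b i) = 0" "finner X (b i) h = 0" if "i < d" for i
      using gb[OF that] finner_commute[of X "b i" h] by (simp_all add: h_eq finner_scale_left)
    have "orthonormal X (Suc d) (b(d := h))"
      using b(1) hh hb by (auto simp: orthonormal_def less_Suc_eq)
    moreover have "\<forall>i<Suc d. (b(d := h)) i \<in> W" using b(2) hW by (auto simp: less_Suc_eq)
    ultimately have "Q (Suc d)" unfolding Q_def by blast
    then show False using d(2)[of "Suc d"] by simp
  qed
  then show ?thesis using b by blast
qed

lemma finner_act:
  assumes "g \<in> Sym n"
  shows "finner (tabloids lam n) (act g f) (act g h) = finner (tabloids lam n) f h"
proof -
  have "bij_betw (\<lambda>r. r \<circ> g) (tabloids lam n) (tabloids lam n)"
    by (rule bij_betw_byWitness[where f' = "\<lambda>r. r \<circ> inv_into UNIV g"])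
      (use Sym_inv_comp[OF assms] tabloid_comp_iff[OF assms] tabloid_comp_iff[OF Sym_inv[OF assms]] in \<open>auto simp: comp_assoc\<close>)
  from sum.reindex_bij_betw[OF this, of "\<lambda>r. f r * h r"] show ?thesis
    by (simp add: finner_def act_def)
qed

text \<open>Permutations of the tabloids preserve the coordinate inner product, so the matrices in
  an orthonormal basis of W are orthogonal.\<close>

theorem orth_rep_exists:
  assumes W: "fsubspace W" "W \<subseteq> tabloid_space lam n" "invariant G W" and G: "G \<subseteq> Sym n" "id \<in> G"
  shows "\<exists>d \<rho>. orth_rep G d \<rho> \<and> rep_iso_sub G d \<rho> W"
proof -
  let ?X = "tabloids lam n"
  have supp: "f r = 0" if "f \<in> W" "r \<notin> ?X" for f r using that W(2) by (auto simp: tabloid_space_def)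
  have "\<exists>d b. orthonormal ?X d b \<and> (\<forall>i<d. b i \<in> W) \<and>
    (\<forall>f\<in>W. f = (\<lambda>r. \<Sum>j<d. finner ?X f (b j) * b j r))"
    by (rule orthonormal_basis[OF finite_tabloids W(1)]) (rule supp)
  then obtain d b where on: "orthonormal ?X d b" and bW: "\<forall>i<d. b i \<in> W"
    and ex: "\<forall>f\<in>W. f = (\<lambda>r. \<Sum>j<d. finner ?X f (b j) * b j r)"
    by (elim exE conjE)
  define m where "m g i j = finner ?X (act g (b j)) (b i)" for g i j
  define \<rho> where "\<rho> g = mat d d (\<lambda>(i, j). m g i j)" for g
  define L where "L v = (\<lambda>r. \<Sum>i<d. v $ i * b i r)" for v :: "real vec"
  have \<rho>: "\<rho> g \<in> carrier_mat d d" for g by (simp add: \<rho>_def)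
  have coeff: "finner ?X (L v) (b i) = v $ i" if "i < d" for v i
    unfolding L_def by (rule orthonormal_coeff[OF on that])
  have inj: "inj_on L (carrier_vec d)"
  proof (rule inj_onI)
    fix v w assume "v \<in> carrier_vec d" "w \<in> carrier_vec d" "L v = L w"
    then show "v = w" using coeff by (intro eq_vecI) (auto, metis)
  qed
  have LW: "L v \<in> W" for v unfolding L_def by (rule fsubspace_sum[OF W(1)]) (use bW in auto)
  have "L ` carrier_vec d = W"
  proof
    show "W \<subseteq> L ` carrier_vec d"
    proof
      fix f assume f: "f \<in> W"
      have "f = L (vec d (\<lambda>j. finner ?X f (b j)))"
        unfolding L_def using bspec[OF ex f] by (simp add: fun_eq_iff)
      then show "f \<in> L ` carrier_vec d" by (rule image_eqI) simp
    qed
  qed (use LW in auto)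
  moreover have "L (a \<cdot>\<^sub>v v + w) = (\<lambda>r. a * L v r + L w r)" if "v \<in> carrier_vec d" "w \<in> carrier_vec d" for v w a
    using that by (simp add: L_def sum_distrib_left algebra_simps flip: sum.distrib)
  ultimately have iso: "lin_iso d L W" using inj by (simp add: lin_iso_def)
  have gb: "act g (b j) = (\<lambda>r. \<Sum>i<d. m g i j * b i r)" if "act g (b j) \<in> W" for g j
    unfolding m_def using bspec[OF ex that] .
  \<comment> \<open>Stated for any g that keeps the basis in W, because it is also applied to g
    \<circ> h and G is not assumed to be closed under composition.\<close>
  have action: "L (\<rho> g *\<^sub>v v) = act g (L v)" if v: "v \<in> carrier_vec d" and gW: "\<And>j. j < d \<Longrightarrow> act g (b j) \<in> W" for g v
  proof
    fix r
    have "L (\<rho> g *\<^sub>v v) r = (\<Sum>i<d. \<Sum>j<d. m g i j * v $ j * b i r)"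
      using v by (simp add: L_def \<rho>_def scalar_prod_def atLeast0LessThan sum_distrib_right)
    also have "\<dots> = (\<Sum>j<d. \<Sum>i<d. m g i j * v $ j * b i r)" by (rule sum.swap)
    also have "\<dots> = (\<Sum>j<d. v $ j * act g (b j) r)"
      by (intro sum.cong refl) (simp add: gb[OF gW] sum_distrib_left mult_ac)
    finally show "L (\<rho> g *\<^sub>v v) r = act g (L v) r" by (simp add: L_def act_def)
  qed
  have bG: "act g (b j) \<in> W" if "g \<in> G" "j < d" for g j using invariantD[OF W(3)] bW that by blast
  have id: "\<rho> id = 1\<^sub>m d"
    using on by (intro eq_matI) (auto simp: \<rho>_def m_def orthonormal_def)
  have mult: "\<rho> (g \<circ> h) = \<rho> g * \<rho> h" if gh: "g \<in> G" "h \<in> G" for g h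
  proof (rule mat_eq_by_action[OF \<rho> mult_carrier_mat[OF \<rho> \<rho>]])
    fix v :: "real vec" assume v: "v \<in> carrier_vec d"
    have hv: "\<rho> h *\<^sub>v v \<in> carrier_vec d" using \<rho> v by (rule mult_mat_vec_carrier)
    have ghb: "act (g \<circ> h) (b j) \<in> W" if "j < d" for j
      unfolding act_comp by (rule invariantD[OF W(3) gh(1) bG[OF gh(2) that]])
    have "L (\<rho> (g \<circ> h) *\<^sub>v v) = act g (act h (L v))" by (rule trans[OF action[OF v ghb] act_comp])
    also have "\<dots> = L (\<rho> g *\<^sub>v (\<rho> h *\<^sub>v v))"
      by (simp only: action[OF hv bG[OF gh(1)]] action[OF v bG[OF gh(2)]])
    finally have "\<rho> (g \<circ> h) *\<^sub>v v = \<rho> g *\<^sub>v (\<rho> h *\<^sub>v v)"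
      by (rule inj_onD[OF inj]) (use \<rho> v hv in \<open>auto intro: mult_mat_vec_carrier\<close>)
    then show "\<rho> (g \<circ> h) *\<^sub>v v = (\<rho> g * \<rho> h) *\<^sub>v v" by (simp only: assoc_mult_mat_vec[OF \<rho> \<rho> v])
  qed
  have orth: "\<rho> g * transpose_mat (\<rho> g) = 1\<^sub>m d" if g: "g \<in> G" for g
  proof (rule mat_mult_left_right_inverse[OF _ \<rho>])
    show "transpose_mat (\<rho> g) \<in> carrier_mat d d" using \<rho>[of g] by simp
    show "transpose_mat (\<rho> g) * \<rho> g = 1\<^sub>m d"
    proof (rule eq_matI)
      fix j l assume "j < dim_row (1\<^sub>m d :: real mat)" "l < dim_col (1\<^sub>m d :: real mat)"
      then have jl: "j < d" "l < d" by simp_all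
      have "(transpose_mat (\<rho> g) * \<rho> g) $$ (j, l) = (\<Sum>i<d. m g i j * m g i l)"
        using jl by (simp add: \<rho>_def scalar_prod_def atLeast0LessThan)
      also have "\<dots> = (\<Sum>i<d. m g i j * finner ?X (b i) (act g (b l)))"
        by (simp add: m_def finner_commute[of ?X "act g (b l)"])
      also have "\<dots> = finner ?X (act g (b j)) (act g (b l))"
        unfolding arg_cong[OF gb[OF bG[OF g jl(1)]], of "\<lambda>u. finner ?X u (act g (b l))"]
        by (rule finner_sum_left[symmetric])
      also have "\<dots> = finner ?X (b j) (b l)" by (rule finner_act) (use g G in auto)
      also have "\<dots> = 1\<^sub>m d $$ (j, l)" using on jl by (simp add: orthonormal_def)
      finally show "(transpose_mat (\<rho> g) * \<rho> g) $$ (j, l) = 1\<^sub>m d $$ (j, l)" .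
    qed (use \<rho>[of g] in auto)
  qed
  have "orth_rep G d \<rho>" unfolding orth_rep_def mat_rep_def using \<rho> id mult orth by blast
  moreover have "rep_iso_sub G d \<rho> W"
    unfolding rep_iso_sub_eq using iso action[OF _ bG] by blast
  ultimately show ?thesis by blast
qed

section \<open>Completeness of the Specht modules\<close>

lemma orbit_permutation:
  assumes "g \<in> Sym n"
  shows "k \<in> orbit g k" "y \<in> orbit g k \<Longrightarrow> orbit g y = orbit g k"
proof -
  have p: "permutation g" using assms by (rule Sym_permutation)
  show k: "k \<in> orbit g k" by (rule permutation_self_in_orbit[OF p])
  show "orbit g y = orbit g k" if "y \<in> orbit g k"
  proof -
    have "cyclic_on g (orbit g k)" by (rule cyclic_on_orbit'[OF p])
    then show ?thesis using that by (simp add: cyclic_on_alldef)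
  qed
qed

lemma orbit_subset_stab:
  assumes g: "g \<in> Sym n" and h: "h \<in> stab n (orbit g)"
  shows "orbit h k \<subseteq> orbit g k"
proof
  have step: "orbit g (h y) = orbit g y" for y
  proof (cases "y \<in> {1..n}")
    case False
    then have "h y = y" using h Sym_not_in[of h n y] by (simp add: stab_def)
    then show ?thesis by simp
  qed (use h in \<open>simp add: stab_def\<close>)
  fix y assume "y \<in> orbit h k"
  then have "orbit g y = orbit g k"
  proof induction
    case base
    then show ?case by (rule step)
  next
    case (step y)
    then show ?case using \<open>\<And>y. orbit g (h y) = orbit g y\<close> by simp
  qed
  then show "y \<in> orbit g k" using orbit_permutation(1)[OF g, of y] by simp
qed

text \<open>Equal orbits have equal lengths. With the least element as base point of each orbit,
  sending the m-th iterate of g to the m-th iterate of h conjugates g into h.\<close>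

lemma same_orbits_conj:
  assumes g: "g \<in> Sym n" and h: "h \<in> Sym n" and orb: "\<And>k. orbit h k = orbit g k"
  shows "\<exists>x\<in>Sym n. x \<circ> g = h \<circ> x"
proof -
  have pg: "permutation g" and ph: "permutation h" using g h by (auto intro: Sym_permutation)
  have sg: "k \<in> orbit g k" and sh: "k \<in> orbit h k" for k using orbit_permutation(1) g h by blast+
  define b where "b k = (LEAST y. y \<in> orbit g k)" for k
  have b: "b k \<in> orbit g k" for k unfolding b_def by (rule LeastI[of "\<lambda>y. y \<in> orbit g k" k]) (rule sg)
  have ob: "orbit g (b k) = orbit g k" for k by (rule orbit_permutation(2)[OF g b])
  have bc: "b y = b k" if "y \<in> orbit g k" for y k
    unfolding b_def orbit_permutation(2)[OF g that] ..
  define s where "s k = funpow_dist1 g (b k) (b k)" for k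
  have og: "orbit g k = (\<lambda>m. (g ^^ m) (b k)) ` {0..<s k}" for k
    unfolding s_def using orbit_conv_funpow_dist1[OF sg[of "b k"]] by (simp only: ob)
  have oh: "orbit g k = (\<lambda>m. (h ^^ m) (b k)) ` {0..<funpow_dist1 h (b k) (b k)}" for k
    using orbit_conv_funpow_dist1[OF sh[of "b k"]] by (simp only: orb ob)
  have ig: "inj_on (\<lambda>m. (g ^^ m) (b k)) {0..<s k}" for k
    unfolding s_def by (rule inj_on_funpow_dist1[OF sg])
  have ih: "inj_on (\<lambda>m. (h ^^ m) (b k)) {0..<funpow_dist1 h (b k) (b k)}" for k
    by (rule inj_on_funpow_dist1[OF sh])
  have sh_eq: "funpow_dist1 h (b k) (b k) = s k" for k
    using arg_cong[OF og[of k], of card] arg_cong[OF oh[of k], of card] by (simp add: card_image[OF ig] card_image[OF ih])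
  have pos: "s k > 0" for k by (simp add: s_def)
  have gs: "(g ^^ s k) (b k) = b k" for k unfolding s_def by (rule funpow_dist1_prop[OF sg])
  have hs: "(h ^^ s k) (b k) = b k" for k unfolding sh_eq[symmetric] by (rule funpow_dist1_prop[OF sh])
  define j where "j k = inv_into {0..<s k} (\<lambda>m. (g ^^ m) (b k)) k" for k
  have j: "j k < s k" "(g ^^ j k) (b k) = k" for k
  proof -
    have "k \<in> (\<lambda>m. (g ^^ m) (b k)) ` {0..<s k}" using sg[of k] og[of k] by simp
    from inv_into_into[OF this] f_inv_into_f[OF this] show "j k < s k" "(g ^^ j k) (b k) = k" by (simp_all add: j_def)
  qed
  have jI: "j k = m" if "m < s k" "(g ^^ m) (b k) = k" for k m
    using inj_onD[OF ig, of "j k" k m] j[of k] that by simp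
  define x where "x k = (h ^^ j k) (b k)" for k
  have xorb: "x k \<in> orbit g k" for k
  proof -
    have "(h ^^ j k) (b k) \<in> (\<lambda>m. (h ^^ m) (b k)) ` {0..<s k}" using j(1) by simp
    then show ?thesis using oh[of k] by (simp add: x_def sh_eq)
  qed
  have comm: "x (g k) = h (x k)" for k
  proof -
    have "g k \<in> orbit g k" by (rule orbit.base)
    then have bg: "b (g k) = b k" by (rule bc)
    then have sgk: "s (g k) = s k" by (simp add: s_def)
    show ?thesis
    proof (cases "Suc (j k) < s k")
      case True
      have "(g ^^ Suc (j k)) (b (g k)) = g k" using j(2)[of k] by (simp add: bg)
      then have "j (g k) = Suc (j k)" using jI[of "Suc (j k)" "g k"] True sgk by simp
      then show ?thesis by (simp add: x_def bg)
    next
      case False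
      \<comment> \<open>At the last point of a cycle both sides return to the base point, since the
        two cycles have the same length.\<close>
      then have e: "Suc (j k) = s k" using j(1)[of k] by simp
      have "g k = (g ^^ s k) (b k)" using j(2)[of k] unfolding e[symmetric] by simp
      then have "g k = b k" using gs by simp
      then have "j (g k) = 0" using jI[of 0 "g k"] pos[of k] sgk bg by simp
      then have "x (g k) = b k" by (simp add: x_def bg)
      also have "\<dots> = (h ^^ Suc (j k)) (b k)" unfolding e using hs by simp
      finally show ?thesis by (simp add: x_def)
    qed
  qed
  have injx: "inj x"
  proof (rule injI)
    fix y k assume eq: "x y = x k"
    have "orbit g y = orbit g (x y)" "orbit g k = orbit g (x k)"
      using orbit_permutation(2)[OF g xorb] by simp_all
    then have "orbit g y = orbit g k" using eq by simp
    then have byk: "b y = b k" by (simp add: b_def)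
    have "s y = s k" unfolding s_def byk ..
    have "(h ^^ j y) (b k) = (h ^^ j k) (b k)" using eq by (simp add: x_def byk)
    moreover have "j y \<in> {0..<funpow_dist1 h (b k) (b k)}" "j k \<in> {0..<funpow_dist1 h (b k) (b k)}"
      unfolding sh_eq using j(1)[of y] j(1)[of k] \<open>s y = s k\<close> by simp_all
    ultimately have "j y = j k" by (rule inj_onD[OF ih[of k]])
    then have "(g ^^ j y) (b y) = (g ^^ j k) (b k)" by (simp only: byk)
    then show "y = k" by (simp only: j(2))
  qed
  have fixx: "x k = k" if "k \<notin> {1..n}" for k
  proof -
    have "orbit g k = {k}" using Sym_not_in[OF g that] by (simp add: orbit_eq_singleton_iff)
    then show ?thesis using xorb[of k] by simp
  qed
  have "x ` {1..n} \<subseteq> {1..n}"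
  proof
    fix y assume "y \<in> x ` {1..n}"
    then obtain k where k: "k \<in> {1..n}" "y = x k" by blast
    show "y \<in> {1..n}"
    proof (rule ccontr)
      assume "y \<notin> {1..n}"
      then have "x y = x k" using fixx k by simp
      then have "y = k" by (rule injD[OF injx])
      then show False using k(1) \<open>y \<notin> {1..n}\<close> by blast
    qed
  qed
  moreover have "inj_on x {1..n}" using injx by (rule inj_on_subset) simp
  ultimately have "bij_betw x {1..n} {1..n}"
    unfolding bij_betw_def using endo_inj_surj[of "{1..n}" x] by blast
  then have "x permutes {1..n}" by (rule bij_imp_permutes) (rule fixx)
  then have "x \<in> Sym n" by (simp add: Sym_def)
  moreover have "x \<circ> g = h \<circ> x" using comm by (simp add: fun_eq_iff)
  ultimately show ?thesis by blast
qed

definition class_fun :: "nat \<Rightarrow> ((nat \<Rightarrow> nat) \<Rightarrow> real) \<Rightarrow> bool" where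
  "class_fun n f \<longleftrightarrow> (\<forall>x\<in>Sym n. \<forall>g\<in>Sym n. f (x \<circ> g \<circ> inv_into UNIV x) = f g)"

text \<open>Induction on the number of orbits: a permutation preserving every orbit of \<open>g\<close> either has the
  same orbits, hence is conjugate to \<open>g\<close>, or has more of them.\<close>
lemma young_subgroups_separate:
  assumes f: "class_fun n f" and zero: "\<And>c :: nat \<Rightarrow> nat set. (\<Sum>h\<in>stab n c. f h) = 0" and g: "g \<in> Sym n"
  shows "f g = 0"
  using g
proof (induction "n - card (orbit g ` {1..n})" arbitrary: g rule: less_induct)
  case less
  note g = \<open>g \<in> Sym n\<close>
  have gst: "g \<in> stab n (orbit g)"
  proof -
    have "orbit g (g k) = orbit g k" for k by (rule orbit_permutation(2)[OF g]) (rule orbit.base)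
    then show ?thesis using g by (simp add: stab_def)
  qed
  have val: "f h = f g \<or> f h = 0" if h: "h \<in> stab n (orbit g)" for h
  proof (cases "\<forall>k. orbit h k = orbit g k")
    case True
    have hS: "h \<in> Sym n" using h by (simp add: stab_def)
    obtain x where x: "x \<in> Sym n" "x \<circ> g = h \<circ> x" using same_orbits_conj[OF g hS] True by blast
    have "x \<circ> g \<circ> inv_into UNIV x = h" using x Sym_inv_comp(2)[OF x(1)] by (simp add: comp_assoc)
    then show ?thesis using f x(1) g unfolding class_fun_def by metis
  next
    case False
    have hS: "h \<in> Sym n" using h by (simp add: stab_def)
    obtain k where k: "orbit h k \<noteq> orbit g k" using False by blast
    have kn: "k \<in> {1..n}"
    proof (rule ccontr)
      assume "k \<notin> {1..n}"
      then have "orbit h k = {k}" "orbit g k = {k}" using Sym_not_in hS g by (auto simp: orbit_eq_singleton_iff)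
      then show False using k by simp
    qed
    obtain y where y: "y \<in> orbit g k" "y \<notin> orbit h k" using orbit_subset_stab[OF g h, of k] k by blast
    have oy: "orbit g y = orbit g k" by (rule orbit_permutation(2)[OF g y(1)])
    have yn: "y \<in> {1..n}"
    proof (rule ccontr)
      assume "y \<notin> {1..n}"
      then have "orbit g y = {y}" using Sym_not_in[OF g] by (simp add: orbit_eq_singleton_iff)
      then have "k = y" using oy orbit_permutation(1)[OF g, of k] by simp
      then show False using kn \<open>y \<notin> {1..n}\<close> by simp
    qed
    \<comment> \<open>Sends each orbit of h to the orbit of g containing it. It is onto the orbits
      of g but identifies those of y and k, so h has strictly more orbits.\<close>
    let ?\<phi> = "\<lambda>S. \<Union>z\<in>S. orbit g z"
    have \<phi>: "?\<phi> (orbit h z) = orbit g z" for z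
    proof -
      have "orbit g w = orbit g z" if "w \<in> orbit h z" for w
        using orbit_permutation(2)[OF g] orbit_subset_stab[OF g h, of z] that by blast
      then show ?thesis using orbit_permutation(1)[OF hS, of z] by blast
    qed
    have img: "?\<phi> ` (orbit h ` {1..n}) = orbit g ` {1..n}" by (simp only: image_image \<phi>)
    have not_inj: "\<not> inj_on ?\<phi> (orbit h ` {1..n})"
    proof
      assume "inj_on ?\<phi> (orbit h ` {1..n})"
      then have "orbit h y = orbit h k" by (rule inj_onD) (use \<phi> oy yn kn in auto)
      then show False using y(2) orbit_permutation(1)[OF hS, of y] by simp
    qed
    have "card (orbit g ` {1..n}) < card (orbit h ` {1..n})"
      using card_image_le[of "orbit h ` {1..n}" ?\<phi>] eq_card_imp_inj_on[of "orbit h ` {1..n}" ?\<phi>] not_inj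
      unfolding img by fastforce
    moreover have "card (orbit h ` {1..n}) \<le> n" using card_image_le[of "{1..n}" "orbit h"] by simp
    ultimately have "n - card (orbit h ` {1..n}) < n - card (orbit g ` {1..n})" by linarith
    then show ?thesis using less.hyps hS by blast
  qed
  \<comment> \<open>All terms of the sum over the Young subgroup are 0 or \<open>f g\<close>, and g
    itself contributes, so \<open>f g\<close> times a positive number is 0.\<close>
  define A where "A = {h \<in> stab n (orbit g). f h = f g}"
  have "0 = (\<Sum>h\<in>stab n (orbit g). f h)" using zero[of "orbit g"] by simp
  also have "\<dots> = (\<Sum>h\<in>stab n (orbit g). if f h = f g then f g else 0)"
    by (rule sum.cong[OF refl]) (use val in auto)
  also have "\<dots> = real (card A) * f g"
    unfolding A_def using finite_stab[of n "orbit g"] by (simp flip: sum.inter_filter)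
  finally have "real (card A) * f g = 0" by simp
  moreover have "card A > 0" using gst finite_stab[of n "orbit g"] by (auto simp: A_def card_gt_0_iff)
  ultimately show ?case by simp
qed

text \<open>Colour classes arranged by decreasing size are the rows of a tableau. This connects sums
  over arbitrary colourings with the partitions to which dominance applies.\<close>

lemma stab_eq_row_stab:
  fixes c :: "nat \<Rightarrow> 'b"
  shows "\<exists>lam T. is_partition lam n \<and> T \<in> tableaux lam n \<and> stab n c = row_stab lam n T"
proof -
  define F where "F y = {k \<in> {1..n}. c k = y}" for y
  have finF: "finite (F y)" for y by (simp add: F_def)
  obtain ls0 where ls0: "set ls0 = c ` {1..n}" "distinct ls0"
    using finite_distinct_list[of "c ` {1..n}"] by auto
  define ls where "ls = rev (sort_key (\<lambda>y. card (F y)) ls0)"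
  have ls: "set ls = c ` {1..n}" "distinct ls" using ls0 by (simp_all add: ls_def)
  define lam where "lam = map (\<lambda>y. card (F y)) ls"
  have len: "length lam = length ls" by (simp add: lam_def)
  have li: "lam ! i = card (F (ls ! i))" if "i < length ls" for i using that by (simp add: lam_def)
  have "sorted (map (\<lambda>y. card (F y)) (sort_key (\<lambda>y. card (F y)) ls0))" by (rule sorted_sort_key)
  then have sorted: "sorted_wrt (\<ge>) lam"
    unfolding lam_def ls_def rev_map[symmetric] sorted_wrt_rev by simp
  have pos: "\<forall>x\<in>set lam. 0 < x"
  proof
    fix x assume "x \<in> set lam"
    then obtain k where "k \<in> {1..n}" "x = card (F (c k))" using ls by (auto simp: lam_def)
    then have "k \<in> F (c k)" "x = card (F (c k))" by (simp_all add: F_def)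
    then show "0 < x" using finF[of "c k"] by (auto simp only: card_gt_0_iff)
  qed
  have "sum_list lam = (\<Sum>y\<in>set ls. card (F y))"
    unfolding lam_def by (rule sum_list_distinct_conv_sum_set[OF ls(2)])
  also have "\<dots> = card (\<Union>y\<in>set ls. F y)"
    by (rule card_UN_disjoint[symmetric]) (simp_all add: finF, auto simp: F_def)
  also have "(\<Union>y\<in>set ls. F y) = {1..n}" by (auto simp: ls(1) F_def)
  finally have part: "is_partition lam n" using sorted pos by (simp add: is_partition_def)
  define e where "e y = (SOME f. bij_betw f {..<card (F y)} (F y))" for y
  have e: "bij_betw (e y) {..<card (F y)} (F y)" for y
    using someI_ex[OF ex_bij_betw_nat_finite[OF finF[of y]]] by (simp only: e_def atLeast0LessThan)
  define T where "T = (\<lambda>p\<in>cells lam. e (ls ! fst p) (snd p))"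
  have Tc: "T (i, j) = e (ls ! i) j" "T (i, j) \<in> F (ls ! i)" "i < length ls" "j < card (F (ls ! i))" if "(i, j) \<in> cells lam" for i j
  proof -
    show il: "i < length ls" and jl: "j < card (F (ls ! i))" using that len li by (auto simp: cells_def)
    show eq: "T (i, j) = e (ls ! i) j" using that by (simp add: T_def)
    show "T (i, j) \<in> F (ls ! i)" unfolding eq by (rule bij_betwE[OF e, rule_format]) (use jl in simp)
  qed
  have "bij_betw T (cells lam) {1..n}"
    unfolding bij_betw_def
  proof
    show "inj_on T (cells lam)"
    proof (rule inj_onI)
      fix p q assume p: "p \<in> cells lam" and q: "q \<in> cells lam" and eq: "T p = T q"
      obtain i j i' j' where ij: "p = (i, j)" "q = (i', j')" by (cases p, cases q)
      note P = Tc[OF p[unfolded ij]] and Q = Tc[OF q[unfolded ij]]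
      have "c (T p) = ls ! i" "c (T q) = ls ! i'" using P(2) Q(2) by (simp_all add: F_def ij)
      then have ii: "i = i'" using eq ls(2) P(3) Q(3) by (simp add: nth_eq_iff_index_eq)
      have "e (ls ! i) j = e (ls ! i) j'" using eq P(1) Q(1) by (simp add: ij ii)
      then have "j = j'" using bij_betw_imp_inj_on[OF e[of "ls ! i"]] P(4) Q(4) by (simp add: ii inj_on_eq_iff)
      then show "p = q" by (simp add: ij ii)
    qed
    show "T ` cells lam = {1..n}"
    proof
      show "T ` cells lam \<subseteq> {1..n}"
      proof (rule image_subsetI)
        fix p assume "p \<in> cells lam"
        then have "T p \<in> F (ls ! fst p)" using Tc(2)[of "fst p" "snd p"] by simp
        then show "T p \<in> {1..n}" by (simp add: F_def)
      qed
      show "{1..n} \<subseteq> T ` cells lam"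
      proof
        fix k assume k: "k \<in> {1..n}"
        then have "c k \<in> set ls" unfolding ls(1) by (rule imageI)
        then obtain i where i: "i < length ls" "ls ! i = c k" unfolding in_set_conv_nth by blast
        have "k \<in> e (ls ! i) ` {..<card (F (ls ! i))}"
          using bij_betw_imp_surj_on[OF e] k i(2) by (simp add: F_def)
        then obtain j where j: "j < card (F (ls ! i))" "k = e (ls ! i) j" by auto
        have cell: "(i, j) \<in> cells lam" using i(1) j(1) by (simp add: cells_def len li)
        then show "k \<in> T ` cells lam" using imageI[OF cell, of T] Tc(1)[OF cell] j(2) by simp
      qed
    qed
  qed
  then have T: "T \<in> tableaux lam n" by (auto simp: tableaux_def T_def bij_betw_def)
  have row: "c k = ls ! rowf lam T k" "rowf lam T k < length ls" if "k \<in> {1..n}" for k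
    using tableau_at[OF T that] Tc(2,3)[OF tableau_at(1)[OF T that]] by (auto simp: F_def)
  have "stab n c = row_stab lam n T"
    unfolding row_stab_def stab_def
  proof (intro Collect_cong conj_cong refl ball_cong)
    fix q k assume q: "q \<in> Sym n" and k: "k \<in> {1..n}"
    show "c (q k) = c k \<longleftrightarrow> rowf lam T (q k) = rowf lam T k"
      using row[OF k] row[OF Sym_in[OF q k]] ls(2) by (simp add: nth_eq_iff_index_eq)
  qed
  then show ?thesis using part T by blast
qed

text \<open>Back substitution: the unknown of an index of least weight occurs in its own equation
  only, so the other equations are solved first.\<close>

lemma triangular_solvable:
  fixes a :: "'i \<Rightarrow> 'i \<Rightarrow> real" and w :: "'i \<Rightarrow> nat"
  assumes "finite D" "\<And>i. i \<in> D \<Longrightarrow> a i i \<noteq> 0"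
    and "\<And>i j. i \<in> D \<Longrightarrow> j \<in> D \<Longrightarrow> i \<noteq> j \<Longrightarrow> a i j \<noteq> 0 \<Longrightarrow> w i < w j"
  shows "\<exists>c. \<forall>i\<in>D. (\<Sum>j\<in>D. c j * a i j) = b i"
  using assms
proof (induction D rule: finite_psubset_induct)
  case (psubset D)
  show ?case
  proof (cases "D = {}")
    case False
    obtain i0 where i0: "i0 \<in> D" "\<And>i. i \<in> D \<Longrightarrow> w i0 \<le> w i"
      using finite_ranking_induct[of D "\<lambda>_. True" w] arg_min_if_finite[OF psubset.hyps(1) False, of w]
      by (meson not_le)
    define D' where "D' = D - {i0}"
    have D': "D' \<subset> D" "finite D'" "i0 \<notin> D'" "D = insert i0 D'" using i0 psubset.hyps by (auto simp: D'_def)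
    have "\<exists>c. \<forall>i\<in>D'. (\<Sum>j\<in>D'. c j * a i j) = b i"
      by (rule psubset.IH[OF D'(1)]) (use psubset.prems D'(1) in auto)
    then obtain c where c: "\<And>i. i \<in> D' \<Longrightarrow> (\<Sum>j\<in>D'. c j * a i j) = b i" by blast
    define c' where "c' = c(i0 := (b i0 - (\<Sum>j\<in>D'. c j * a i0 j)) / a i0 i0)"
    have same: "(\<Sum>j\<in>D'. c' j * a i j) = (\<Sum>j\<in>D'. c j * a i j)" for i
      by (rule sum.cong) (use D'(3) in \<open>auto simp: c'_def\<close>)
    have "(\<Sum>j\<in>D. c' j * a i j) = b i" if i: "i \<in> D" for i
    proof (cases "i = i0")
      case True
      then show ?thesis using D'(2,3) psubset.prems(1)[OF i0(1)] by (simp add: D'(4) same) (simp add: c'_def)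
    next
      case False
      have "a i i0 = 0" using psubset.prems(2)[OF i i0(1) False] i0(2)[OF i] by fastforce
      then show ?thesis using D'(2,3) c[of i] i False by (simp add: D'(4) same)
    qed
    then show ?thesis by blast
  qed simp
qed

lemma finite_partitions: "finite {lam. is_partition lam n}"
proof (rule finite_subset)
  have "length lam \<le> sum_list lam" if "\<forall>x\<in>set lam. 0 < x" for lam :: "nat list"
    using that by (induction lam) auto
  then show "{lam. is_partition lam n} \<subseteq> {xs. set xs \<subseteq> {..n} \<and> length xs \<le> n}"
    using member_le_sum_list by (auto simp: is_partition_def)
qed (simp add: finite_lists_length_le)

lemma rows_below_full:
  assumes "is_partition lam n" "n \<le> k"
  shows "rows_below lam k = n"
proof -
  have "length xs \<le> sum_list xs" if "\<forall>x\<in>set xs. 0 < x" for xs :: "nat list"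
    using that by (induction xs) auto
  then have "length lam \<le> k" using assms by (fastforce simp: is_partition_def)
  then have "{c \<in> cells lam. fst c < k} = cells lam" by (auto simp: cells_def)
  then show ?thesis using assms(1) by (simp add: rows_below_def card_cells is_partition_def)
qed

text \<open>Summing the partial sums refines dominance to a numerical weight, as the triangular
  system requires.\<close>

lemma rows_below_sum_less:
  assumes "is_partition lam n" "is_partition mu n" "\<And>k. rows_below lam k \<le> rows_below mu k" "lam \<noteq> mu"
  shows "(\<Sum>k<n. rows_below lam k) < (\<Sum>k<n. rows_below mu k)"
proof (rule sum_strict_mono_ex1)
  obtain k where k: "rows_below lam k \<noteq> rows_below mu k" using rows_below_inject[OF assms(1,2)] assms(4) by blast
  then have "k < n" using rows_below_full[OF assms(1), of k] rows_below_full[OF assms(2), of k] by force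
  then show "\<exists>k\<in>{..<n}. rows_below lam k < rows_below mu k" using k assms(3)[of k] by force
qed (use assms(3) in auto)

lemma class_fun_row_sum_shape:
  assumes f: "class_fun n f" and T: "T \<in> tableaux lam n" "T' \<in> tableaux lam n"
  shows "(\<Sum>p\<in>row_stab lam n T'. f p) = (\<Sum>p\<in>row_stab lam n T. f p)"
proof -
  obtain g where g: "g \<in> Sym n" and T': "T' = move lam g T" using tableaux_transitive[OF T] by blast
  let ?i = "inv_into UNIV g"
  note gi = Sym_inv[OF g]
  have mem: "p \<in> row_stab lam n T' \<longleftrightarrow> p \<in> Sym n \<and> (\<forall>k\<in>{1..n}. rowf lam T (?i (p k)) = rowf lam T (?i k))" for p
    using move_at(1)[OF T(1) g] Sym_in[of p n] by (auto simp: row_stab_def stab_def T' simp del: atLeastAtMost_iff)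
  have memT: "q \<in> row_stab lam n T \<longleftrightarrow> q \<in> Sym n \<and> (\<forall>k\<in>{1..n}. rowf lam T (q k) = rowf lam T k)" for q
    by (simp add: row_stab_def stab_def)
  show ?thesis
  proof (rule sum.reindex_bij_witness[where i = "\<lambda>q. g \<circ> q \<circ> ?i" and j = "\<lambda>p. ?i \<circ> p \<circ> g"])
    fix p assume "p \<in> row_stab lam n T'"
    then have p: "p \<in> Sym n" "\<And>k. k \<in> {1..n} \<Longrightarrow> rowf lam T (?i (p k)) = rowf lam T (?i k)" using mem by blast+
    show "g \<circ> (?i \<circ> p \<circ> g) \<circ> ?i = p" by (simp add: fun_eq_iff Sym_inverses[OF g])
    then show "f (?i \<circ> p \<circ> g) = f p"
      using f g Sym_comp[OF Sym_comp[OF gi p(1)] g] unfolding class_fun_def by metis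
    have "rowf lam T ((?i \<circ> p \<circ> g) k) = rowf lam T k" if "k \<in> {1..n}" for k
      using p(2)[OF Sym_in[OF g that]] by (simp add: Sym_inverses[OF g])
    then show "?i \<circ> p \<circ> g \<in> row_stab lam n T" using memT Sym_comp[OF Sym_comp[OF gi p(1)] g] by blast
  next
    fix q assume "q \<in> row_stab lam n T"
    then have q: "q \<in> Sym n" "\<And>k. k \<in> {1..n} \<Longrightarrow> rowf lam T (q k) = rowf lam T k" using memT by blast+
    show "?i \<circ> (g \<circ> q \<circ> ?i) \<circ> g = q" by (simp add: fun_eq_iff Sym_inverses[OF g])
    have "rowf lam T (?i ((g \<circ> q \<circ> ?i) k)) = rowf lam T (?i k)" if "k \<in> {1..n}" for k
      using q(2)[OF Sym_in[OF gi that]] by (simp add: Sym_inverses[OF g])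
    then show "g \<circ> q \<circ> ?i \<in> row_stab lam n T'" using mem Sym_comp[OF Sym_comp[OF g q(1)] gi] by blast
  qed
qed

section \<open>Characters summed over Young subgroups\<close>

text \<open>The symmetrised function is fixed by each p and p preserves the inner product, so every
  translate of f has the same pairing with it.\<close>

lemma row_sum_self_inner:
  "real (card (row_stab lam n T)) * finner (tabloids mu n) (row_sum lam n T f) f
    = finner (tabloids mu n) (row_sum lam n T f) (row_sum lam n T f)"
proof -
  let ?X = "tabloids mu n" and ?R = "row_stab lam n T" and ?a = "row_sum lam n T f"
  have "finner ?X ?a ?a = (\<Sum>p\<in>?R. 1 * finner ?X (act p f) ?a)"
    by (subst (1) row_sum_def) (rule finner_sum_left)
  also have "\<dots> = (\<Sum>p\<in>?R. finner ?X ?a f)"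
  proof (rule sum.cong[OF refl])
    fix p assume p: "p \<in> ?R"
    then have pS: "p \<in> Sym n" using stab_subset by (auto simp: row_stab_def)
    have "act p ?a = ?a" using row_sum_invariant[OF p] by (simp add: act_def)
    then have "finner ?X (act p f) ?a = finner ?X (act p f) (act p ?a)" by simp
    also have "\<dots> = finner ?X f ?a" by (rule finner_act[OF pS])
    finally show "1 * finner ?X (act p f) ?a = finner ?X ?a f" by (simp add: finner_commute)
  qed
  finally show ?thesis by simp
qed

text \<open>Two entries sharing a row of T and a column of U give a transposition that fixes the row
  sum and negates the polytabloid, so the result is 0. Otherwise the row tabloid of T is injective
  on the columns of U.\<close>

lemma row_sum_polytabloid_dominates:
  assumes part: "is_partition mu n" and U: "U \<in> tableaux mu n" and T: "T \<in> tableaux lam n"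
    and nz: "row_sum lam n T (polytabloid mu n U) r \<noteq> 0"
  shows "rows_below lam k \<le> rows_below mu k"
proof (rule col_injective_dominates[OF part U row_tabloid_in[OF T]])
  show "col_injective mu n U (row_tabloid lam n T)"
    unfolding col_injective_def
  proof (intro ballI impI, rule ccontr)
    fix a b assume ab: "a \<in> {1..n}" "b \<in> {1..n}" "a \<noteq> b"
      and eq: "colf mu U a = colf mu U b \<and> row_tabloid lam n T a = row_tabloid lam n T b"
    let ?t = "transpose a b"
    have tc: "?t \<in> col_stab mu n U" using ab eq by (simp add: col_stab_eq transpose_col_stab)
    have "rowf lam T a = rowf lam T b" using ab eq by (simp add: row_tabloid_eq)
    then have tr: "?t \<in> stab n (rowf lam T)" using ab by (simp add: transpose_col_stab)
    have "row_sum lam n T (polytabloid mu n U) r = (\<Sum>p\<in>row_stab lam n T. act (p \<circ> ?t) (polytabloid mu n U) r)"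
      unfolding row_sum_def row_stab_def by (subst stab_reindex_left[OF tr]) simp
    also have "\<dots> = (\<Sum>p\<in>row_stab lam n T. - polytabloid mu n U (r \<circ> p))"
      using polytabloid_twist[OF tc, where 'a = real] ab(3) by (intro sum.cong refl) (simp add: act_def o_assoc sign_swap_id)
    also have "\<dots> = - row_sum lam n T (polytabloid mu n U) r" by (simp add: row_sum_def act_def sum_negf)
    finally show False using nz by simp
  qed
qed

text \<open>A positive multiple of the character of the Specht module, written without traces.\<close>
definition sandwich :: "nat \<Rightarrow> nat list \<Rightarrow> (nat \<times> nat \<Rightarrow> nat) \<Rightarrow> (nat \<Rightarrow> nat) \<Rightarrow> real" where
  "sandwich n mu U g = (\<Sum>y\<in>Sym n. finner (tabloids mu n) (act g (act y (polytabloid mu n U))) (act y (polytabloid mu n U)))"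

lemma sandwich_class_fun: "class_fun n (sandwich n mu U)"
  unfolding class_fun_def
proof (intro ballI)
  fix x g assume x: "x \<in> Sym n" and g: "g \<in> Sym n"
  let ?X = "tabloids mu n" and ?e = "polytabloid mu n U"
  have "sandwich n mu U (x \<circ> g \<circ> inv_into UNIV x)
    = (\<Sum>y\<in>Sym n. finner ?X (act (x \<circ> g \<circ> inv_into UNIV x) (act (x \<circ> y) ?e)) (act (x \<circ> y) ?e))"
    unfolding sandwich_def by (rule Sym_reindex_right) (use x Sym_eq_stab in blast)
  also have "\<dots> = sandwich n mu U g"
    unfolding sandwich_def
  proof (rule sum.cong[OF refl])
    fix y
    have A: "act (x \<circ> g \<circ> inv_into UNIV x) (act (x \<circ> y) ?e) = act x (act g (act y ?e))"
      using Sym_inverses[OF x] by (simp add: act_def fun_eq_iff comp_def)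
    show "finner ?X (act (x \<circ> g \<circ> inv_into UNIV x) (act (x \<circ> y) ?e)) (act (x \<circ> y) ?e)
      = finner ?X (act g (act y ?e)) (act y ?e)"
      unfolding A unfolding act_comp[of x y] by (rule finner_act[OF x])
  qed
  finally show "sandwich n mu U (x \<circ> g \<circ> inv_into UNIV x) = sandwich n mu U g" .
qed

text \<open>The row symmetriser is a multiple of an orthogonal projection, so the sum is, up to a
  positive factor, a sum of squared norms. It vanishes only if every term does, and no
  multiplicities need to be computed.\<close>

lemma sandwich_row_sum:
  "real (card (row_stab lam n T)) * (\<Sum>p\<in>row_stab lam n T. sandwich n mu U p)
    = (\<Sum>y\<in>Sym n. finner (tabloids mu n) (row_sum lam n T (act y (polytabloid mu n U))) (row_sum lam n T (act y (polytabloid mu n U))))"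
proof -
  let ?X = "tabloids mu n" and ?e = "polytabloid mu n U" and ?R = "row_stab lam n T"
  have "(\<Sum>p\<in>?R. sandwich n mu U p) = (\<Sum>y\<in>Sym n. \<Sum>p\<in>?R. 1 * finner ?X (act p (act y ?e)) (act y ?e))"
    unfolding sandwich_def by (subst sum.swap) simp
  also have "\<dots> = (\<Sum>y\<in>Sym n. finner ?X (row_sum lam n T (act y ?e)) (act y ?e))"
    unfolding row_sum_def by (intro sum.cong refl) (rule finner_sum_left[symmetric])
  finally show ?thesis by (simp add: sum_distrib_left row_sum_self_inner)
qed

lemma sandwich_row_sum_dominates:
  assumes part: "is_partition mu n" and U: "U \<in> tableaux mu n" and T: "T \<in> tableaux lam n"
    and nz: "(\<Sum>p\<in>row_stab lam n T. sandwich n mu U p) \<noteq> 0"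
  shows "rows_below lam k \<le> rows_below mu k"
proof -
  have "real (card (row_stab lam n T)) \<noteq> 0" using card_stab_pos[of n "rowf lam T"] by (simp add: row_stab_def)
  then have "(\<Sum>y\<in>Sym n. finner (tabloids mu n) (row_sum lam n T (act y (polytabloid mu n U))) (row_sum lam n T (act y (polytabloid mu n U)))) \<noteq> 0"
    using nz unfolding sandwich_row_sum[symmetric] by simp
  then obtain y where y: "y \<in> Sym n" "finner (tabloids mu n) (row_sum lam n T (act y (polytabloid mu n U))) (row_sum lam n T (act y (polytabloid mu n U))) \<noteq> 0"
    by (rule sum.not_neutral_contains_not_neutral)
  have "\<exists>r. row_sum lam n T (act y (polytabloid mu n U)) r \<noteq> 0"
  proof (rule ccontr)
    assume "\<not> ?thesis"
    then show False using y(2) by (simp add: finner_def)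
  qed
  then obtain r where "row_sum lam n T (act y (polytabloid mu n U)) r \<noteq> 0" by blast
  then have "row_sum lam n T (polytabloid mu n (move mu y U)) r \<noteq> 0" by (simp only: polytabloid_move[OF U y(1)] simp_thms)
  then show ?thesis by (rule row_sum_polytabloid_dominates[OF part move_tableau[OF U y(1)] T])
qed

lemma sandwich_row_sum_nonzero:
  assumes T: "T \<in> tableaux lam n"
  shows "(\<Sum>p\<in>row_stab lam n T. sandwich n lam T p) \<noteq> 0"
proof
  let ?X = "tabloids lam n" and ?e = "polytabloid lam n T :: _ \<Rightarrow> real" and ?R = "row_stab lam n T" and ?r = "row_tabloid lam n T"
  let ?F = "\<lambda>y. finner ?X (row_sum lam n T (act y ?e)) (row_sum lam n T (act y ?e))"
  assume "(\<Sum>p\<in>?R. sandwich n lam T p) = 0"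
  then have "(\<Sum>y\<in>Sym n. ?F y) = 0" unfolding sandwich_row_sum[symmetric] by simp
  moreover have "?F y \<ge> 0" for y by (simp add: finner_def sum_nonneg)
  ultimately have "?F id = 0" using Sym_id finite_Sym sum_nonneg_eq_0_iff[of "Sym n" ?F] by blast
  then have "finner ?X (row_sum lam n T ?e) (row_sum lam n T ?e) = 0" by (simp only: act_id)
  then have "\<forall>r\<in>?X. row_sum lam n T ?e r * row_sum lam n T ?e r = 0"
    unfolding finner_def by (subst (asm) sum_nonneg_eq_0_iff) (auto simp: finite_tabloids)
  then have "row_sum lam n T ?e ?r = 0" using row_tabloid_in[OF T] by auto
  moreover have "row_sum lam n T ?e ?r = (\<Sum>p\<in>?R. 1)"
    unfolding row_sum_def
  proof (rule sum.cong[OF refl])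
    fix p assume p: "p \<in> ?R"
    then have "p \<in> Sym n" using stab_subset by (auto simp: row_stab_def)
    then have "?r \<circ> p = ?r" using p row_tabloid_comp_eq_iff by blast
    then show "1 * act p ?e ?r = 1" using polytabloid_row_tabloid[OF T, where 'a = real] by (simp add: act_def)
  qed
  ultimately show False using card_stab_pos[of n "rowf lam T"] by (simp add: row_stab_def)
qed

lemma class_fun_lincomb:
  assumes "class_fun n f" "\<And>i. i \<in> A \<Longrightarrow> class_fun n (h i)"
  shows "class_fun n (\<lambda>g. f g - (\<Sum>i\<in>A. c i * h i g))"
  using assms unfolding class_fun_def by (intro ballI arg_cong2[of _ _ _ _ "(-)"] sum.cong) auto

text \<open>Triangularity yields a combination of the Specht characters with the same sums over
  Young subgroups as f, so f equals this combination. But f is also orthogonal to each of these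
  characters, hence to itself.\<close>

lemma class_fun_zero:
  assumes f: "class_fun n f"
    and kill: "\<And>lam s r. is_partition lam n \<Longrightarrow> s \<in> specht lam n \<Longrightarrow> (\<Sum>g\<in>Sym n. f g * act g s r) = (0 :: real)"
    and g: "g \<in> Sym n"
  shows "f g = 0"
proof -
  define T where "T lam = (SOME T. T \<in> tableaux lam n)" for lam
  have T: "T lam \<in> tableaux lam n" if "is_partition lam n" for lam
    using tableaux_nonempty[OF that] unfolding T_def by (simp add: some_in_eq)
  let ?P = "{lam. is_partition lam n}"
  define h where "h mu = sandwich n mu (T mu)" for mu
  have h: "class_fun n (h mu)" for mu unfolding h_def by (rule sandwich_class_fun)
  have "\<exists>c. \<forall>lam\<in>?P. (\<Sum>mu\<in>?P. c mu * (\<Sum>p\<in>row_stab lam n (T lam). h mu p)) = (\<Sum>p\<in>row_stab lam n (T lam). f p)"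
  proof (rule triangular_solvable[OF finite_partitions])
    show "(\<Sum>p\<in>row_stab lam n (T lam). h lam p) \<noteq> 0" if "lam \<in> ?P" for lam
      unfolding h_def by (rule sandwich_row_sum_nonzero) (use T that in simp)
    fix lam mu assume lm: "lam \<in> ?P" "mu \<in> ?P" "lam \<noteq> mu" and nz: "(\<Sum>p\<in>row_stab lam n (T lam). h mu p) \<noteq> 0"
    have "rows_below lam k \<le> rows_below mu k" for k
      by (rule sandwich_row_sum_dominates[OF _ _ _ nz[unfolded h_def]]) (use lm T in auto)
    then show "(\<Sum>k<n. rows_below lam k) < (\<Sum>k<n. rows_below mu k)" using rows_below_sum_less lm by blast
  qed
  then obtain c where c: "\<And>lam. is_partition lam n \<Longrightarrow>
    (\<Sum>mu\<in>?P. c mu * (\<Sum>p\<in>row_stab lam n (T lam). h mu p)) = (\<Sum>p\<in>row_stab lam n (T lam). f p)" by blast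
  define d where "d g = f g - (\<Sum>mu\<in>?P. c mu * h mu g)" for g
  have dc: "class_fun n d" unfolding d_def by (rule class_fun_lincomb[OF f h])
  have "(\<Sum>x\<in>stab n k. d x) = 0" for k :: "nat \<Rightarrow> nat set"
  proof -
    obtain lam U where U: "is_partition lam n" "U \<in> tableaux lam n" "stab n k = row_stab lam n U"
      using stab_eq_row_stab[of n k] by blast
    have "(\<Sum>x\<in>stab n k. d x) = (\<Sum>p\<in>row_stab lam n (T lam). d p)"
      unfolding U(3) by (rule class_fun_row_sum_shape[OF dc T[OF U(1)] U(2)])
    also have "\<dots> = (\<Sum>p\<in>row_stab lam n (T lam). f p) - (\<Sum>mu\<in>?P. \<Sum>p\<in>row_stab lam n (T lam). c mu * h mu p)"
      unfolding d_def sum_subtractf by (subst (2) sum.swap) simp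
    also have "\<dots> = 0" using c[OF U(1)] by (simp add: sum_distrib_left)
    finally show ?thesis .
  qed
  then have "d x = 0" if "x \<in> Sym n" for x using young_subgroups_separate[OF dc _ that] by blast
  then have fx: "f x = (\<Sum>mu\<in>?P. c mu * h mu x)" if "x \<in> Sym n" for x using that by (simp add: d_def)
  \<comment> \<open>The character pairs f with matrix coefficients of the Specht module, on which f
    acts as 0 by hypothesis.\<close>
  have fh: "(\<Sum>x\<in>Sym n. f x * h mu x) = 0" if mu: "is_partition mu n" for mu
  proof -
    let ?X = "tabloids mu n" and ?e = "polytabloid mu n (T mu) :: _ \<Rightarrow> real"
    have "(\<Sum>x\<in>Sym n. f x * h mu x) = (\<Sum>y\<in>Sym n. \<Sum>x\<in>Sym n. f x * finner ?X (act x (act y ?e)) (act y ?e))"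
      unfolding h_def sandwich_def sum_distrib_left by (rule sum.swap)
    also have "\<dots> = (\<Sum>y\<in>Sym n. finner ?X (\<lambda>r. \<Sum>x\<in>Sym n. f x * act x (act y ?e) r) (act y ?e))"
      by (simp only: finner_sum_left)
    also have "\<dots> = 0"
    proof (rule sum.neutral, rule ballI)
      fix y assume y: "y \<in> Sym n"
      have "act y ?e \<in> specht mu n" by (rule invariantD[OF specht_invariant y specht_polytabloid[OF T[OF mu]]])
      then show "finner ?X (\<lambda>r. \<Sum>x\<in>Sym n. f x * act x (act y ?e) r) (act y ?e) = 0"
        using kill[OF mu] by (simp add: finner_def)
    qed
    finally show ?thesis .
  qed
  have "(\<Sum>x\<in>Sym n. f x * f x) = (\<Sum>x\<in>Sym n. \<Sum>mu\<in>?P. c mu * (f x * h mu x))"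
  proof (rule sum.cong[OF refl])
    fix x assume "x \<in> Sym n"
    from fx[OF this] have "f x * f x = f x * (\<Sum>mu\<in>?P. c mu * h mu x)" by simp
    then show "f x * f x = (\<Sum>mu\<in>?P. c mu * (f x * h mu x))" by (simp add: sum_distrib_left mult_ac)
  qed
  also have "\<dots> = (\<Sum>mu\<in>?P. c mu * (\<Sum>x\<in>Sym n. f x * h mu x))"
    by (subst sum.swap) (simp add: sum_distrib_left)
  also have "\<dots> = 0" using fh by simp
  finally show ?thesis using g finite_Sym[of n] by (simp add: sum_nonneg_eq_0_iff)
qed

text \<open>The general element is reduced to a class function: f sums over all u the conjugates of
  the correlation of x with itself. It still annihilates the Specht modules, and its value at the
  identity is a positive multiple of the sum of the squares of x.\<close>

theorem specht_complete:
  fixes x :: "(nat \<Rightarrow> nat) \<Rightarrow> real"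
  assumes kill: "\<And>lam s r. is_partition lam n \<Longrightarrow> s \<in> specht lam n \<Longrightarrow> (\<Sum>g\<in>Sym n. x g * act g s r) = 0"
    and g: "g \<in> Sym n"
  shows "x g = 0"
proof -
  define f where "f g = (\<Sum>u\<in>Sym n. \<Sum>a\<in>Sym n. x a * x (a \<circ> (inv_into UNIV u \<circ> g \<circ> u)))" for g
  have "class_fun n f"
    unfolding class_fun_def
  proof (intro ballI)
    fix y g assume y: "y \<in> Sym n" and g: "g \<in> Sym n"
    let ?h = "y \<circ> g \<circ> inv_into UNIV y"
    have "f ?h = (\<Sum>u\<in>Sym n. \<Sum>a\<in>Sym n. x a * x (a \<circ> (inv_into UNIV (y \<circ> u) \<circ> ?h \<circ> (y \<circ> u))))"
      unfolding f_def by (rule Sym_reindex_right) (use y Sym_eq_stab in blast)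
    also have "\<dots> = f g"
      unfolding f_def
    proof (rule sum.cong[OF refl])
      fix u assume u: "u \<in> Sym n"
      have "inv_into UNIV (y \<circ> u) \<circ> ?h \<circ> (y \<circ> u) = inv_into UNIV u \<circ> g \<circ> u"
        unfolding Sym_inv_distrib[OF y u] by (simp add: fun_eq_iff Sym_inverses[OF y])
      then show "(\<Sum>a\<in>Sym n. x a * x (a \<circ> (inv_into UNIV (y \<circ> u) \<circ> ?h \<circ> (y \<circ> u)))) = (\<Sum>a\<in>Sym n. x a * x (a \<circ> (inv_into UNIV u \<circ> g \<circ> u)))"
        by simp
    qed
    finally show "f ?h = f g" .
  qed
  moreover have "(\<Sum>g\<in>Sym n. f g * act g s r) = 0" if lam: "is_partition lam n" and s: "s \<in> specht lam n" for lam s r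
  proof -
    have inner: "(\<Sum>g\<in>Sym n. x (a \<circ> (inv_into UNIV u \<circ> g \<circ> u)) * act g s r) = 0" if u: "u \<in> Sym n" and a: "a \<in> Sym n" for u a
    proof -
      \<comment> \<open>Chosen so that replacing g by p g u^-1 turns the argument of x into g; the
        extra factors act on s and r, which are arbitrary.\<close>
      let ?p = "u \<circ> inv_into UNIV a" and ?i = "inv_into UNIV u"
      have p: "?p \<in> Sym n" using u a by (simp add: Sym_comp Sym_inv)
      have "(\<Sum>g\<in>Sym n. x (a \<circ> (?i \<circ> g \<circ> u)) * act g s r) = (\<Sum>g\<in>Sym n. x (a \<circ> (?i \<circ> (?p \<circ> g) \<circ> u)) * act (?p \<circ> g) s r)"
        by (rule Sym_reindex_right) (use p Sym_eq_stab in blast)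
      also have "\<dots> = (\<Sum>g\<in>Sym n. x (a \<circ> (?i \<circ> (?p \<circ> (g \<circ> ?i)) \<circ> u)) * act (?p \<circ> (g \<circ> ?i)) s r)"
        by (rule Sym_reindex_left) (use Sym_inv[OF u] Sym_eq_stab in blast)
      also have "\<dots> = (\<Sum>g\<in>Sym n. x g * act g (act ?i s) (r \<circ> ?p))"
      proof (rule sum.cong[OF refl])
        fix g
        have "a \<circ> (?i \<circ> (?p \<circ> (g \<circ> ?i)) \<circ> u) = g" by (simp add: fun_eq_iff Sym_inverses[OF u] Sym_inverses[OF a])
        then show "x (a \<circ> (?i \<circ> (?p \<circ> (g \<circ> ?i)) \<circ> u)) * act (?p \<circ> (g \<circ> ?i)) s r = x g * act g (act ?i s) (r \<circ> ?p)"
          by (simp add: act_def o_assoc)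
      qed
      also have "\<dots> = 0" by (rule kill[OF lam invariantD[OF specht_invariant Sym_inv[OF u] s]])
      finally show ?thesis .
    qed
    have "(\<Sum>g\<in>Sym n. f g * act g s r) = (\<Sum>g\<in>Sym n. \<Sum>u\<in>Sym n. \<Sum>a\<in>Sym n. x a * (x (a \<circ> (inv_into UNIV u \<circ> g \<circ> u)) * act g s r))"
      by (simp add: f_def sum_distrib_right mult.assoc)
    also have "\<dots> = (\<Sum>u\<in>Sym n. \<Sum>g\<in>Sym n. \<Sum>a\<in>Sym n. x a * (x (a \<circ> (inv_into UNIV u \<circ> g \<circ> u)) * act g s r))"
      by (rule sum.swap)
    also have "\<dots> = (\<Sum>u\<in>Sym n. \<Sum>a\<in>Sym n. \<Sum>g\<in>Sym n. x a * (x (a \<circ> (inv_into UNIV u \<circ> g \<circ> u)) * act g s r))"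
      by (intro sum.cong refl sum.swap)
    also have "\<dots> = 0" using inner by (simp flip: sum_distrib_left)
    finally show ?thesis .
  qed
  ultimately have "f id = 0" using class_fun_zero[of n f id] Sym_id by blast
  moreover have "f id = (\<Sum>u\<in>Sym n. \<Sum>a\<in>Sym n. x a * x a)"
    unfolding f_def
  proof (rule sum.cong[OF refl])
    fix u assume u: "u \<in> Sym n"
    show "(\<Sum>a\<in>Sym n. x a * x (a \<circ> (inv_into UNIV u \<circ> id \<circ> u))) = (\<Sum>a\<in>Sym n. x a * x a)"
      using Sym_inv_comp[OF u] by simp
  qed
  ultimately have "real (card (Sym n)) * (\<Sum>a\<in>Sym n. x a * x a) = 0" by simp
  moreover have "card (Sym n) > 0" using Sym_id[of n] finite_Sym[of n] unfolding card_gt_0_iff by blast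
  ultimately have "(\<Sum>a\<in>Sym n. x a * x a) = 0" by simp
  then show ?thesis using g finite_Sym[of n] by (simp add: sum_nonneg_eq_0_iff)
qed

section \<open>Real and complex representations\<close>

lemma lin_iso_image_fsubspace:
  assumes L: "lin_iso d L W" and U: "U \<subseteq> carrier_vec d" "0\<^sub>v d \<in> U" "\<forall>u\<in>U. \<forall>v\<in>U. \<forall>a. a \<cdot>\<^sub>v u + v \<in> U"
  shows "fsubspace (L ` U)"
  unfolding fsubspace_def
proof (intro conjI ballI allI)
  show "(\<lambda>r. 0) \<in> L ` U" using imageI[OF U(2), of L] by (simp only: lin_iso_zero[OF L])
  fix f g a assume "f \<in> L ` U" "g \<in> L ` U"
  then obtain u v where uv: "u \<in> U" "v \<in> U" "f = L u" "g = L v" by blast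
  have "L (a \<cdot>\<^sub>v u + v) = (\<lambda>r. a * f r + g r)"
    using lin_isoD(1)[OF L, of u v a] uv U(1) by auto
  then show "(\<lambda>r. a * f r + g r) \<in> L ` U" using imageI[of "a \<cdot>\<^sub>v u + v" U L] U(3) uv(1,2) by simp
qed

text \<open>Image and preimage under L match the invariant subspaces of the matrices with those of
  W; positive dimension corresponds to W being nonzero.\<close>

lemma lin_iso_irred:
  assumes L: "lin_iso d L W" and act: "\<forall>g\<in>G. \<forall>v\<in>carrier_vec d. L (\<rho> g *\<^sub>v v) = act g (L v)"
    and \<rho>: "mat_rep G d \<rho>"
  shows "irred_mat_rep G d \<rho> \<longleftrightarrow>
    W \<noteq> {\<lambda>r. 0} \<and> (\<forall>U. U \<subseteq> W \<and> fsubspace U \<and> invariant G U \<longrightarrow> U = {\<lambda>r. 0} \<or> U = W)"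
proof -
  note inj = lin_isoD(2)[OF L] and im = lin_isoD(3)[OF L] and zero = lin_iso_zero[OF L]
  have d: "0 < d \<longleftrightarrow> W \<noteq> {\<lambda>r. 0}"
  proof
    assume "0 < d"
    show "W \<noteq> {\<lambda>r. 0}"
    proof
      assume "W = {\<lambda>r. 0}"
      then have "L (unit_vec d 0) = L (0\<^sub>v d)" using lin_isoD(4)[OF L, of "unit_vec d 0"] zero by simp
      then have "unit_vec d 0 = (0\<^sub>v d :: 'a vec)" by (rule inj_onD[OF inj]) auto
      from arg_cong[OF this, of "\<lambda>v. v $ 0"] show False using \<open>0 < d\<close> by simp
    qed
  next
    assume W: "W \<noteq> {\<lambda>r. 0}"
    show "0 < d"
    proof (rule ccontr)
      assume "\<not> 0 < d"
      then have "v = 0\<^sub>v d" if "v \<in> carrier_vec d" for v :: "'a vec"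
        using that by (intro eq_vecI) simp_all
      then have "carrier_vec d = {0\<^sub>v d :: 'a vec}" using zero_carrier_vec[of d] by blast
      then have "W = L ` {0\<^sub>v d}" by (simp only: im[symmetric])
      then show False using W by (simp add: zero)
    qed
  qed
  define vs where "vs U \<longleftrightarrow> U \<subseteq> carrier_vec d \<and> 0\<^sub>v d \<in> U \<and> (\<forall>u\<in>U. \<forall>v\<in>U. \<forall>a. a \<cdot>\<^sub>v u + v \<in> U)
    \<and> (\<forall>g\<in>G. \<forall>u\<in>U. \<rho> g *\<^sub>v u \<in> U)" for U
  have to: "L ` U \<subseteq> W \<and> fsubspace (L ` U) \<and> invariant G (L ` U)" if U: "vs U" for U
  proof (intro conjI)
    show "L ` U \<subseteq> W" using U im unfolding vs_def by blast
    show "fsubspace (L ` U)" by (rule lin_iso_image_fsubspace[OF L]) (use U vs_def in auto)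
    show "invariant G (L ` U)" unfolding invariant_def
    proof (intro ballI)
      fix g f assume g: "g \<in> G" and "f \<in> L ` U"
      then obtain u where u: "u \<in> U" "f = L u" by blast
      have "act g f = L (\<rho> g *\<^sub>v u)" using act g u U by (auto simp: vs_def)
      then show "act g f \<in> L ` U" using U g u(1) by (simp add: vs_def)
    qed
  qed
  have "(\<forall>U. vs U \<longrightarrow> U = {0\<^sub>v d} \<or> U = carrier_vec d) \<longleftrightarrow>
    (\<forall>U. U \<subseteq> W \<and> fsubspace U \<and> invariant G U \<longrightarrow> U = {\<lambda>r. 0} \<or> U = W)" (is "?A \<longleftrightarrow> ?B")
  proof
    assume B: ?B
    show ?A
    proof (intro allI impI)
      fix U assume U: "vs U"
      have sub: "U \<subseteq> carrier_vec d" and z: "{0\<^sub>v d} \<subseteq> carrier_vec d" using U by (auto simp: vs_def)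
      have "L ` U = L ` {0\<^sub>v d} \<or> L ` U = L ` carrier_vec d" using B to[OF U] im zero by simp
      then show "U = {0\<^sub>v d} \<or> U = carrier_vec d"
        using inj_on_image_eq_iff[OF inj sub z] inj_on_image_eq_iff[OF inj sub order_refl] by blast
    qed
  next
    assume A: ?A
    show ?B
    proof (intro allI impI)
      fix U assume U: "U \<subseteq> W \<and> fsubspace U \<and> invariant G U"
      define V where "V = {v \<in> carrier_vec d. L v \<in> U}"
      have LV: "L ` V = U" using U im unfolding V_def by blast
      have "vs V"
        unfolding vs_def
      proof (intro conjI ballI allI)
        show "0\<^sub>v d \<in> V" using U fsubspace_zero[of U] zero by (simp add: V_def)
        show "a \<cdot>\<^sub>v u + v \<in> V" if "u \<in> V" "v \<in> V" for u v a
          using that U fsubspace_lincomb[of U "L u" "L v" a] by (simp add: V_def lin_isoD(1)[OF L])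
        show "\<rho> g *\<^sub>v u \<in> V" if "g \<in> G" "u \<in> V" for g u
          using that U \<rho> invariantD[of G U g "L u"] act mult_mat_vec_carrier[of "\<rho> g" d d u] by (simp add: V_def mat_rep_def)
      qed (auto simp: V_def)
      then have "V = {0\<^sub>v d} \<or> V = carrier_vec d" using A by blast
      then show "U = {\<lambda>r. 0} \<or> U = W" using LV im zero by auto
    qed
  qed
  then show ?thesis unfolding irred_mat_rep_def vs_def d by blast
qed

lemma rep_iso_sub_irred:
  assumes "rep_iso_sub G d \<rho> W" "mat_rep G d \<rho>"
  shows "irred_mat_rep G d \<rho> \<longleftrightarrow>
    W \<noteq> {\<lambda>r. 0} \<and> (\<forall>U. U \<subseteq> W \<and> fsubspace U \<and> invariant G U \<longrightarrow> U = {\<lambda>r. 0} \<or> U = W)"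
proof -
  obtain L where "lin_iso d L W" "\<forall>g\<in>G. \<forall>v\<in>carrier_vec d. L (\<rho> g *\<^sub>v v) = act g (L v)"
    using assms(1) unfolding rep_iso_sub_eq by blast
  then show ?thesis by (rule lin_iso_irred[OF _ _ assms(2)])
qed

lemma complexify_mat_rep: "mat_rep G d \<rho> \<Longrightarrow> mat_rep G d (complexify \<rho>)"
proof -
  assume \<rho>: "mat_rep G d \<rho>"
  have "map_mat complex_of_real (\<rho> (g \<circ> h)) = map_mat complex_of_real (\<rho> g) * map_mat complex_of_real (\<rho> h)"
    if "g \<in> G" "h \<in> G" for g h
  proof -
    have "\<rho> (g \<circ> h) = \<rho> g * \<rho> h" "\<rho> g \<in> carrier_mat d d" "\<rho> h \<in> carrier_mat d d" using \<rho> that by (auto simp: mat_rep_def)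
    then show ?thesis by (simp add: of_real_hom.mat_hom_mult)
  qed
  then show ?thesis using \<rho> by (auto simp: mat_rep_def complexify_def of_real_hom.mat_hom_one)
qed

lemma map_vec_Re_Im_mult:
  assumes "A \<in> carrier_mat d d" "v \<in> carrier_vec d"
  shows "map_vec Re (map_mat complex_of_real A *\<^sub>v v) = A *\<^sub>v map_vec Re v"
    "map_vec Im (map_mat complex_of_real A *\<^sub>v v) = A *\<^sub>v map_vec Im v"
  using assms by (auto intro!: eq_vecI sum.cong simp: scalar_prod_def)

lemma map_vec_Re_Im_lincomb:
  assumes "v \<in> carrier_vec d" "w \<in> carrier_vec d"
  shows "map_vec Re (a \<cdot>\<^sub>v v + w) = Re a \<cdot>\<^sub>v map_vec Re v + (- Im a \<cdot>\<^sub>v map_vec Im v + map_vec Re w)"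
    "map_vec Im (a \<cdot>\<^sub>v v + w) = Re a \<cdot>\<^sub>v map_vec Im v + (Im a \<cdot>\<^sub>v map_vec Re v + map_vec Im w)"
  using assms by (auto intro!: eq_vecI)

lemma rep_iso_sub_complexify:
  assumes "rep_iso_sub G d \<rho> W" and \<rho>: "mat_rep G d \<rho>"
  shows "rep_iso_sub G d (complexify \<rho>) (cx W)"
proof -
  obtain L where L: "lin_iso d L W" and act: "\<forall>g\<in>G. \<forall>v\<in>carrier_vec d. L (\<rho> g *\<^sub>v v) = act g (L v)"
    using assms(1) unfolding rep_iso_sub_eq by blast
  define M where "M v = (\<lambda>r. Complex (L (map_vec Re v) r) (L (map_vec Im v) r))" for v :: "complex vec"
  have lin: "L (a \<cdot>\<^sub>v u + v) r = a * L u r + L v r" if "u \<in> carrier_vec d" "v \<in> carrier_vec d" for a u v r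
    using fun_cong[OF lin_isoD(1)[OF L that], of a r] .
  have Mlin: "M (a \<cdot>\<^sub>v v + w) = (\<lambda>r. a * M v r + M w r)" if vw: "v \<in> carrier_vec d" "w \<in> carrier_vec d" for v w a
  proof
    fix r
    show "M (a \<cdot>\<^sub>v v + w) r = a * M v r + M w r"
      using vw unfolding M_def map_vec_Re_Im_lincomb[OF vw]
      by (simp add: lin complex_eq_iff)
  qed
  have inj: "inj_on M (carrier_vec d)"
  proof (rule inj_onI)
    fix v w assume v: "v \<in> carrier_vec d" and w: "w \<in> carrier_vec d" and eq: "M v = M w"
    have "L (map_vec Re v) = L (map_vec Re w)" "L (map_vec Im v) = L (map_vec Im w)"
      using fun_cong[OF eq] by (auto simp: M_def fun_eq_iff)
    then have "map_vec Re v = map_vec Re w" "map_vec Im v = map_vec Im w"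
      using inj_onD[OF lin_isoD(2)[OF L]] v w by simp_all
    then have eqs: "map_vec Re v $ i = map_vec Re w $ i" "map_vec Im v $ i = map_vec Im w $ i" for i by simp_all
    show "v = w"
    proof (rule eq_vecI)
      fix i assume "i < dim_vec w"
      then show "v $ i = w $ i" using eqs[of i] v w by (simp add: complex_eq_iff)
    qed (use v w in simp)
  qed
  have "M ` carrier_vec d = cx W"
  proof
    show "M ` carrier_vec d \<subseteq> cx W"
    proof (rule image_subsetI)
      fix v :: "complex vec" assume v: "v \<in> carrier_vec d"
      have "L (map_vec Re v) \<in> W" "L (map_vec Im v) \<in> W" by (rule lin_isoD(4)[OF L], use v in simp)+
      then show "M v \<in> cx W" by (simp add: M_def cx_def)
    qed
    show "cx W \<subseteq> M ` carrier_vec d"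
    proof
      fix f assume f: "f \<in> cx W"
      then have "(\<lambda>r. Re (f r)) \<in> L ` carrier_vec d" "(\<lambda>r. Im (f r)) \<in> L ` carrier_vec d"
        by (simp_all only: lin_isoD(3)[OF L] cx_def mem_Collect_eq)
      then obtain a b where ab: "a \<in> carrier_vec d" "L a = (\<lambda>r. Re (f r))" "b \<in> carrier_vec d" "L b = (\<lambda>r. Im (f r))"
        by (elim imageE) metis
      let ?v = "vec d (\<lambda>i. Complex (a $ i) (b $ i))"
      have "map_vec Re ?v = a" "map_vec Im ?v = b" using ab by (auto intro!: eq_vecI)
      then have "M ?v = f" by (simp add: M_def ab(2,4) fun_eq_iff)
      then show "f \<in> M ` carrier_vec d" using imageI[of ?v "carrier_vec d" M] by simp
    qed
  qed
  then have "lin_iso d M (cx W)" using Mlin inj by (simp add: lin_iso_def)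
  moreover have "M (complexify \<rho> g *\<^sub>v v) = act g (M v)" if g: "g \<in> G" and v: "v \<in> carrier_vec d" for g v
  proof -
    have A: "\<rho> g \<in> carrier_mat d d" using \<rho> g by (simp add: mat_rep_def)
    show ?thesis unfolding M_def complexify_def map_vec_Re_Im_mult[OF A v] using act g v by (simp add: act_def)
  qed
  ultimately show ?thesis unfolding rep_iso_sub_eq by blast
qed

text \<open>An invariant real subspace has an invariant complexification, whose real vectors give it
  back.\<close>

lemma irred_of_complexify:
  assumes \<rho>: "mat_rep G d \<rho>" and irr: "irred_mat_rep G d (complexify \<rho>)"
  shows "irred_mat_rep G d \<rho>"
  unfolding irred_mat_rep_def
proof (intro conjI allI impI)
  show "0 < d" using irr by (simp add: irred_mat_rep_def)
  fix U assume U: "U \<subseteq> carrier_vec d \<and> 0\<^sub>v d \<in> U \<and> (\<forall>u\<in>U. \<forall>v\<in>U. \<forall>a. a \<cdot>\<^sub>v u + v \<in> U) \<and>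
          (\<forall>g\<in>G. \<forall>u\<in>U. \<rho> g *\<^sub>v u \<in> U)"
  have add: "a \<cdot>\<^sub>v u + v \<in> U" if "u \<in> U" "v \<in> U" for a u v using U that by blast
  define V where "V = {v \<in> carrier_vec d. map_vec Re v \<in> U \<and> map_vec Im v \<in> U}"
  have z: "map_vec Re (0\<^sub>v d) = 0\<^sub>v d" "map_vec Im (0\<^sub>v d) = 0\<^sub>v d" by (auto intro!: eq_vecI)
  have "V \<subseteq> carrier_vec d \<and> 0\<^sub>v d \<in> V \<and> (\<forall>u\<in>V. \<forall>v\<in>V. \<forall>a. a \<cdot>\<^sub>v u + v \<in> V) \<and>
          (\<forall>g\<in>G. \<forall>u\<in>V. complexify \<rho> g *\<^sub>v u \<in> V)"
  proof (intro conjI ballI allI)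
    show "0\<^sub>v d \<in> V" using U z by (simp add: V_def)
    fix u v a assume u: "u \<in> V" and "v \<in> V"
    then have uv: "u \<in> carrier_vec d" "v \<in> carrier_vec d" and "map_vec Re u \<in> U" "map_vec Im u \<in> U" "map_vec Re v \<in> U" "map_vec Im v \<in> U"
      by (auto simp: V_def)
    then show "a \<cdot>\<^sub>v u + v \<in> V" unfolding V_def mem_Collect_eq map_vec_Re_Im_lincomb[OF uv]
      by (intro conjI add) simp_all
  next
    fix g u assume g: "g \<in> G" and u: "u \<in> V"
    have A: "\<rho> g \<in> carrier_mat d d" using \<rho> g by (simp add: mat_rep_def)
    have uc: "u \<in> carrier_vec d" using u by (simp add: V_def)
    have "map_mat complex_of_real (\<rho> g) *\<^sub>v u \<in> carrier_vec d" using A uc by (intro mult_mat_vec_carrier[of _ d d]) auto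
    then show "complexify \<rho> g *\<^sub>v u \<in> V"
      using u U g unfolding complexify_def V_def by (simp add: map_vec_Re_Im_mult[OF A uc])
  qed (auto simp: V_def)
  then have V: "V = {0\<^sub>v d} \<or> V = carrier_vec d" using irr unfolding irred_mat_rep_def by blast
  have re: "map_vec Re (map_vec complex_of_real u) = u" "map_vec Im (map_vec complex_of_real u) = 0\<^sub>v d"
    if "u \<in> carrier_vec d" for u using that by (auto intro!: eq_vecI)
  have iff: "map_vec complex_of_real u \<in> V \<longleftrightarrow> u \<in> U" if u: "u \<in> carrier_vec d" for u
    using u U re[OF u] by (simp add: V_def)
  from V show "U = {0\<^sub>v d} \<or> U = carrier_vec d"
  proof
    assume V0: "V = {0\<^sub>v d}"
    have "u = 0\<^sub>v d" if "u \<in> U" for u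
    proof -
      have u: "u \<in> carrier_vec d" using U that by blast
      then have "map_vec complex_of_real u = 0\<^sub>v d" using iff[OF u] that V0 by simp
      then show ?thesis using re(1)[OF u] z(1) by simp
    qed
    then show ?thesis using U by blast
  next
    assume "V = carrier_vec d"
    then have "u \<in> U" if "u \<in> carrier_vec d" for u using iff[OF that] that by simp
    then show ?thesis using U by blast
  qed
qed

lemma rep_iso_sub_trace:
  fixes \<rho> \<rho>' :: "(nat \<Rightarrow> nat) \<Rightarrow> 'a :: field mat"
  assumes "rep_iso_sub G d \<rho> W" "mat_rep G d \<rho>" "rep_iso_sub H d' \<rho>' W" "mat_rep H d' \<rho>'" "g \<in> G" "g \<in> H"
  shows "mtrace (\<rho> g) = mtrace (\<rho>' g)"
proof -
  obtain L where L: "lin_iso d L W" "\<forall>g\<in>G. \<forall>v\<in>carrier_vec d. L (\<rho> g *\<^sub>v v) = act g (L v)"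
    using assms(1) unfolding rep_iso_sub_eq by blast
  obtain L' where L': "lin_iso d' L' W" "\<forall>g\<in>H. \<forall>v\<in>carrier_vec d'. L' (\<rho>' g *\<^sub>v v) = act g (L' v)"
    using assms(3) unfolding rep_iso_sub_eq by blast
  show ?thesis
    by (rule lin_iso_trace[OF L(1) L'(1), where F = "act g"]) (use assms L L' in \<open>auto simp: mat_rep_def\<close>)
qed

text \<open>\<open>chi\<close> uses a chosen matrix model of the whole symmetric group. The trace is
  independent of the model, so a model for any set of permutations containing g computes it.\<close>

lemma chi_eq:
  assumes "rep_iso_sub G d \<rho> (specht lam n)" "mat_rep G d \<rho>" "G \<subseteq> Sym n" "g \<in> G"
  shows "chi lam n g = mtrace (\<rho> g)"
proof -
  let ?P = "\<lambda>(d, \<rho>). mat_rep (Sym n) d \<rho> \<and> rep_iso_sub (Sym n) d \<rho> (specht lam n :: (_ \<Rightarrow> real) set)"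
  obtain d' \<rho>' where "?P (d', \<rho>')"
    using orth_rep_exists[OF specht_fsubspace specht_tabloid_space specht_invariant order_refl Sym_id] unfolding orth_rep_def by blast
  then have "?P (SOME p. ?P p)" by (rule someI)
  then obtain e \<sigma> where *: "(SOME p. ?P p) = (e, \<sigma>)" "?P (e, \<sigma>)" by (cases "SOME p. ?P p") auto
  then have "chi lam n g = mtrace (\<sigma> g)" by (simp add: chi_def)
  also have "\<dots> = mtrace (\<rho> g)"
    by (rule rep_iso_sub_trace[of "Sym n", OF _ _ assms(1,2)]) (use *(2) assms in auto)
  finally show ?thesis .
qed

lemma mtrace_one: "mtrace (1\<^sub>m d) = of_nat d"
  by (simp add: mtrace_def)

section \<open>The two halves of a split module: projections and traces\<close>

context alt_split
begin

lemma projections: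
  "\<exists>p q. \<forall>f\<in>S. p f \<in> W \<and> q f \<in> W \<and> f = (\<lambda>r. p f r + act t12 (q f) r)"
proof -
  have "\<exists>uv. fst uv \<in> W \<and> snd uv \<in> W \<and> f = (\<lambda>r. fst uv r + act t12 (snd uv) r)" if f: "f \<in> S" for f
  proof -
    obtain u v where uv: "u \<in> W" "v \<in> W" "f = (\<lambda>r. u r + act t12 v r)" by (rule decomposition[OF f])
    show ?thesis by (rule exI[where x = "(u, v)"]) (use uv in simp)
  qed
  then have "\<forall>f\<in>S. \<exists>uv. fst uv \<in> W \<and> snd uv \<in> W \<and> f = (\<lambda>r. fst uv r + act t12 (snd uv) r)" by blast
  from bchoice[OF this] obtain P
    where P: "\<forall>f\<in>S. fst (P f) \<in> W \<and> snd (P f) \<in> W \<and> f = (\<lambda>r. fst (P f) r + act t12 (snd (P f)) r)" ..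
  show ?thesis by (rule exI[where x = "\<lambda>f. fst (P f)"], rule exI[where x = "\<lambda>f. snd (P f)"]) (rule P)
qed

text \<open>The coordinate in the translated half is pulled back to W by t12, so q intertwines g
  with its conjugate by t12.\<close>

lemma projections_equivariant:
  "\<exists>p q. lin_on S p \<and> lin_on S q \<and> (\<forall>f\<in>S. p f \<in> W \<and> q f \<in> W \<and> f = (\<lambda>r. p f r + act t12 (q f) r))
    \<and> (\<forall>g\<in>Alt n. \<forall>f\<in>S. p (act g f) = act g (p f) \<and> q (act g f) = act (t12 \<circ> g \<circ> t12) (q f))"
proof -
  obtain p q where pq: "\<forall>f\<in>S. p f \<in> W \<and> q f \<in> W \<and> f = (\<lambda>r. p f r + act t12 (q f) r)" using projections by blast
  have W': "p f \<in> W" "q f \<in> W" if "f \<in> S" for f using pq that by blast+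
  have eq: "f r = p f r + act t12 (q f) r" if fS: "f \<in> S" for f r
  proof -
    have "f = (\<lambda>r. p f r + act t12 (q f) r)" using pq fS by blast
    from fun_cong[OF this, of r] show ?thesis .
  qed
  have uniq: "p f = u \<and> q f = v" if f: "f \<in> S" and u: "u \<in> W" and v: "v \<in> W" and e: "\<And>r. f r = u r + act t12 v r" for f u v
  proof -
    have "(\<lambda>r. p f r + act t12 (q f) r) = (\<lambda>r. u r + act t12 v r)"
      by (rule ext) (simp only: e[symmetric] eq[OF f, symmetric])
    then show ?thesis using decomposition_unique[OF W'[OF f] u v] by blast
  qed
  have lin: "p (\<lambda>r. a * f r + g r) = (\<lambda>r. a * p f r + p g r) \<and> q (\<lambda>r. a * f r + g r) = (\<lambda>r. a * q f r + q g r)"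
    if f: "f \<in> S" and g: "g \<in> S" for f g a
  proof (rule uniq[OF fsubspace_lincomb[OF S(1) f g] fsubspace_lincomb[OF W(1) W'(1)[OF f] W'(1)[OF g]] fsubspace_lincomb[OF W(1) W'(2)[OF f] W'(2)[OF g]]])
    fix r show "a * f r + g r = a * p f r + p g r + act t12 (\<lambda>r. a * q f r + q g r) r"
      using eq[OF f, of r] eq[OF g, of r] by (simp add: act_def algebra_simps)
  qed
  have eqv: "p (act g f) = act g (p f) \<and> q (act g f) = act (t12 \<circ> g \<circ> t12) (q f)" if g: "g \<in> Alt n" and f: "f \<in> S" for g f
  proof (rule uniq)
    show "act g f \<in> S" using invariantD[OF S(2) _ f] g Alt_subset_Sym by blast
    show "act g (p f) \<in> W" by (rule invariantD[OF W(2) g W'(1)[OF f]])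
    show "act (t12 \<circ> g \<circ> t12) (q f) \<in> W" by (rule invariantD[OF W(2) t12_conj_Alt[OF n g] W'(2)[OF f]])
    fix r show "act g f r = act g (p f) r + act t12 (act (t12 \<circ> g \<circ> t12) (q f)) r"
      unfolding act_t12_conj[symmetric] using eq[OF f, of "r \<circ> g"] by (simp add: act_def o_assoc)
  qed
  show ?thesis
  proof (rule exI[where x = p], rule exI[where x = q], intro conjI)
    show "lin_on S p" "lin_on S q" unfolding lin_on_def using lin by blast+
    show "\<forall>g\<in>Alt n. \<forall>f\<in>S. p (act g f) = act g (p f) \<and> q (act g f) = act (t12 \<circ> g \<circ> t12) (q f)" using eqv by blast
  qed (rule pq)
qed

text \<open>Since \<open>t12\<close> commutes with \<open>g\<close>, the two summands of \<open>S\<close> contribute equally to the trace.\<close>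
lemma trace_double:
  assumes \<rho>: "rep_iso_sub (Alt n) d \<rho> W" "mat_rep (Alt n) d \<rho>" and \<sigma>: "rep_iso_sub G e \<sigma> S" "mat_rep G e \<sigma>"
    and g: "g \<in> Alt n" "g \<in> G" "t12 \<circ> g = g \<circ> t12"
  shows "mtrace (\<sigma> g) = 2 * mtrace (\<rho> g)"
proof -
  obtain L where L: "lin_iso d L W" and act: "\<forall>g\<in>Alt n. \<forall>v\<in>carrier_vec d. L (\<rho> g *\<^sub>v v) = act g (L v)"
    using \<rho>(1) unfolding rep_iso_sub_eq by blast
  obtain M where M: "lin_iso e M S" and actM: "\<forall>g\<in>G. \<forall>v\<in>carrier_vec e. M (\<sigma> g *\<^sub>v v) = act g (M v)"
    using \<sigma>(1) unfolding rep_iso_sub_eq by blast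
  have A: "\<rho> g \<in> carrier_mat d d" using \<rho>(2) g by (simp add: mat_rep_def)
  let ?Z = "0\<^sub>m d d"
  \<comment> \<open>Acting by g in both halves: coordinates are taken in two copies of W, the second
    carried by t12. Because t12 commutes with g, both blocks are the same matrix.\<close>
  let ?B = "four_block_mat (\<rho> g) ?Z ?Z (\<rho> g)"
  define N where "N v = (\<lambda>r. L (vec_first v d) r + act t12 (L (vec_last v d)) r)" for v
  have LW: "L v \<in> W" if "v \<in> carrier_vec d" for v using lin_isoD(4)[OF L that] .
  have fl: "vec_first (a \<cdot>\<^sub>v v + w) d = a \<cdot>\<^sub>v vec_first v d + vec_first w d"
    "vec_last (a \<cdot>\<^sub>v v + w) d = a \<cdot>\<^sub>v vec_last v d + vec_last w d" if "v \<in> carrier_vec (d + d)" "w \<in> carrier_vec (d + d)" for v w a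
    using that by (intro eq_vecI; simp add: vec_first_def vec_last_def)+
  have lin: "L (a \<cdot>\<^sub>v u + v) r = a * L u r + L v r" if "u \<in> carrier_vec d" "v \<in> carrier_vec d" for a u v r
    using fun_cong[OF lin_isoD(1)[OF L that], of a r] .
  have "N (a \<cdot>\<^sub>v v + w) = (\<lambda>r. a * N v r + N w r)" if vw: "v \<in> carrier_vec (d + d)" "w \<in> carrier_vec (d + d)" for v w a
    unfolding N_def fl[OF vw] by (rule ext) (simp add: act_def lin distrib_left)
  moreover have "inj_on N (carrier_vec (d + d))"
  proof (rule inj_onI)
    fix v w assume v: "v \<in> carrier_vec (d + d)" and w: "w \<in> carrier_vec (d + d)" and e: "N v = N w"
    have "L (vec_first v d) = L (vec_first w d)" "L (vec_last v d) = L (vec_last w d)"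
      using decomposition_unique[OF _ _ _ _ e[unfolded N_def]] LW by (simp_all add: vec_first_carrier vec_last_carrier)
    then have "vec_first v d = vec_first w d" "vec_last v d = vec_last w d"
      by (auto intro: inj_onD[OF lin_isoD(2)[OF L]])
    then show "v = w" using vec_first_last_append[OF v] vec_first_last_append[OF w] by metis
  qed
  moreover have "N ` carrier_vec (d + d) = S"
  proof
    show "N ` carrier_vec (d + d) \<subseteq> S"
    proof (rule image_subsetI)
      fix v
      have "L (vec_first v d) \<in> S" "L (vec_last v d) \<in> S" using LW sub by auto
      then show "N v \<in> S" unfolding N_def by (rule fsubspace_add[OF S(1) _ invariantD[OF S(2) t12_Sym[OF n]]])
    qed
    show "S \<subseteq> N ` carrier_vec (d + d)"
    proof
      fix f assume "f \<in> S"
      then obtain u v where uv: "u \<in> W" "v \<in> W" "f = (\<lambda>r. u r + act t12 v r)" by (rule decomposition)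
      have "u \<in> L ` carrier_vec d" "v \<in> L ` carrier_vec d" using uv(1,2) by (simp_all only: lin_isoD(3)[OF L])
      then obtain a b where ab: "a \<in> carrier_vec d" "u = L a" "b \<in> carrier_vec d" "v = L b" by (elim imageE) metis
      have "vec_first (a @\<^sub>v b) d = a" "vec_last (a @\<^sub>v b) d = b"
        using ab(1,3) by (intro eq_vecI; simp add: vec_first_def vec_last_def)+
      then have "f = N (a @\<^sub>v b)" by (simp only: N_def uv(3) ab(2,4))
      then show "f \<in> N ` carrier_vec (d + d)" by (rule image_eqI) (use ab in simp)
    qed
  qed
  ultimately have N: "lin_iso (d + d) N S" by (simp add: lin_iso_def)
  have sum_split: "(\<Sum>i<k + l. f i) = (\<Sum>i<k. f i) + (\<Sum>i<l. f (k + i))" for f :: "nat \<Rightarrow> 'a" and k l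
    by (induction l) (simp_all add: add.assoc)
  have "mtrace (\<sigma> g) = mtrace ?B"
  proof (rule lin_iso_trace[OF M N, where F = "act g"])
    show "\<sigma> g \<in> carrier_mat e e" using \<sigma>(2) g by (simp add: mat_rep_def)
    show "?B \<in> carrier_mat (d + d) (d + d)" using A by (rule four_block_carrier_mat[OF _ A])
    show "M (\<sigma> g *\<^sub>v v) = act g (M v)" if "v \<in> carrier_vec e" for v using actM g(2) that by blast
    fix v :: "'a vec" assume v: "v \<in> carrier_vec (d + d)"
    let ?u = "vec_first v d" and ?w = "vec_last v d"
    have uw: "?u \<in> carrier_vec d" "?w \<in> carrier_vec d" by simp_all
    have "?B *\<^sub>v v = ?B *\<^sub>v (?u @\<^sub>v ?w)" by (simp only: vec_first_last_append[OF v])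
    also have "\<dots> = (\<rho> g *\<^sub>v ?u) @\<^sub>v (\<rho> g *\<^sub>v ?w)" by (rule mult_mat_vec_split[OF A A uw])
    finally have B: "?B *\<^sub>v v = (\<rho> g *\<^sub>v ?u) @\<^sub>v (\<rho> g *\<^sub>v ?w)" .
    have c: "\<rho> g *\<^sub>v ?u \<in> carrier_vec d" "\<rho> g *\<^sub>v ?w \<in> carrier_vec d" using A uw by (auto intro: mult_mat_vec_carrier)
    have s: "vec_first (a @\<^sub>v b) d = a" "vec_last (a @\<^sub>v b) d = b" if "a \<in> carrier_vec d" "b \<in> carrier_vec d" for a b :: "'a vec"
      using that by (intro eq_vecI; simp add: vec_first_def vec_last_def)+
    have La: "L (\<rho> g *\<^sub>v ?u) = act g (L ?u)" "L (\<rho> g *\<^sub>v ?w) = act g (L ?w)" using act g(1) uw by blast+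
    have "act t12 (act g (L ?w)) = act g (act t12 (L ?w))" by (simp only: act_comp[symmetric] g(3))
    then show "N (?B *\<^sub>v v) = act g (N v)"
      unfolding B N_def s[OF c] La by (simp add: act_def)
  qed
  also have "\<dots> = (\<Sum>i<d + d. ?B $$ (i, i))" using A by (simp add: mtrace_def)
  also have "\<dots> = (\<Sum>i<d. ?B $$ (i, i)) + (\<Sum>i<d. ?B $$ (d + i, d + i))"
    by (rule sum_split)
  also have "\<dots> = 2 * mtrace (\<rho> g)" using A by (simp add: mtrace_def)
  finally show ?thesis .
qed

end

text \<open>A nonzero map between irreducible spaces is bijective even if it commutes with G only up
  to an involution a, since kernel and image are still invariant. It transports a matrix model of X
  to W with indices changed by a.\<close>

lemma rep_iso_sub_twist:
  assumes W: "fsubspace W" "invariant G W" and Wirr: "\<forall>U. U \<subseteq> W \<and> fsubspace U \<and> invariant G U \<longrightarrow> U = {\<lambda>r. 0} \<or> U = W"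
    and Xirr: "\<forall>U. U \<subseteq> X \<and> fsubspace U \<and> invariant G U \<longrightarrow> U = {\<lambda>r. 0} \<or> U = X"
    and lin: "lin_on W \<theta>" and into: "\<And>f. f \<in> W \<Longrightarrow> \<theta> f \<in> X"
    and eqv: "\<And>g f. g \<in> G \<Longrightarrow> f \<in> W \<Longrightarrow> \<theta> (act g f) = act (a g) (\<theta> f)"
    and a: "\<And>g. g \<in> G \<Longrightarrow> a g \<in> G" "\<And>g. g \<in> G \<Longrightarrow> a (a g) = g"
    and nz: "f0 \<in> W" "\<theta> f0 \<noteq> (\<lambda>r. 0)" and \<rho>: "rep_iso_sub G d \<rho> X" "mat_rep G d \<rho>"
  shows "rep_iso_sub G d (\<lambda>g. \<rho> (a g)) W"
proof -
  obtain L where L: "lin_iso d L X" and act: "\<forall>g\<in>G. \<forall>v\<in>carrier_vec d. L (\<rho> g *\<^sub>v v) = act g (L v)"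
    using \<rho>(1) unfolding rep_iso_sub_eq by blast
  note \<theta>0 = lin_on_zero[OF lin W(1)]
  define K where "K = {f \<in> W. \<theta> f = (\<lambda>r. 0)}"
  have "fsubspace K"
    unfolding fsubspace_def
  proof (intro conjI ballI allI)
    show "(\<lambda>r. 0) \<in> K" using fsubspace_zero[OF W(1)] \<theta>0 by (simp add: K_def)
    fix f g c assume "f \<in> K" "g \<in> K"
    then show "(\<lambda>r. c * f r + g r) \<in> K"
      using lin_onD[OF lin, of f g c] fsubspace_lincomb[OF W(1), of f g c] by (simp add: K_def)
  qed
  moreover have "invariant G K"
    unfolding invariant_def
  proof (intro ballI)
    fix g f assume "g \<in> G" "f \<in> K"
    then show "act g f \<in> K" using eqv[of g f] invariantD[OF W(2), of g f] by (simp add: K_def)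
  qed
  moreover have "K \<noteq> W" "K \<subseteq> W" using nz by (auto simp: K_def)
  ultimately have K0: "K = {\<lambda>r. 0}" using Wirr by blast
  have inj: "inj_on \<theta> W"
  proof (rule inj_onI)
    fix f g assume f: "f \<in> W" and g: "g \<in> W" and e: "\<theta> f = \<theta> g"
    have "\<theta> (\<lambda>r. (-1) * f r + g r) = (\<lambda>r. 0)" unfolding lin_onD[OF lin f g] e by simp
    then have "(\<lambda>r. (-1) * f r + g r) \<in> K" unfolding K_def using fsubspace_lincomb[OF W(1) f g, of "-1"] by blast
    then have "(\<lambda>r. (-1) * f r + g r) = (\<lambda>r. 0)" using K0 by blast
    from fun_cong[OF this] show "f = g" by (simp add: fun_eq_iff)
  qed
  have "fsubspace (\<theta> ` W)"
    unfolding fsubspace_def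
  proof (intro conjI ballI allI)
    show "(\<lambda>r. 0) \<in> \<theta> ` W" using imageI[OF fsubspace_zero[OF W(1)], of \<theta>] by (simp only: \<theta>0)
    fix f g c assume "f \<in> \<theta> ` W" "g \<in> \<theta> ` W"
    then obtain f' g' where fg: "f' \<in> W" "g' \<in> W" "f = \<theta> f'" "g = \<theta> g'" by blast
    show "(\<lambda>r. c * f r + g r) \<in> \<theta> ` W"
      using imageI[OF fsubspace_lincomb[OF W(1) fg(1,2), of c], of \<theta>] by (simp only: lin_onD[OF lin fg(1,2)] fg(3,4))
  qed
  moreover have "invariant G (\<theta> ` W)"
    unfolding invariant_def
  proof (intro ballI)
    fix g f assume g: "g \<in> G" and "f \<in> \<theta> ` W"
    then obtain f' where f': "f' \<in> W" "f = \<theta> f'" by blast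
    have "act g f = \<theta> (act (a g) f')" using eqv[OF a(1)[OF g] f'(1)] a(2)[OF g] f'(2) by simp
    then show "act g f \<in> \<theta> ` W" using invariantD[OF W(2) a(1)[OF g] f'(1)] by blast
  qed
  moreover have "\<theta> ` W \<subseteq> X" "\<theta> ` W \<noteq> {\<lambda>r. 0}" using into nz by auto
  ultimately have im: "\<theta> ` W = X" using Xirr by blast
  define N where "N v = inv_into W \<theta> (L v)" for v
  have N: "N v \<in> W" "\<theta> (N v) = L v" if "v \<in> carrier_vec d" for v
  proof -
    have "L v \<in> \<theta> ` W" using lin_isoD(4)[OF L that] im by simp
    then show "N v \<in> W" "\<theta> (N v) = L v" unfolding N_def by (simp_all add: inv_into_into f_inv_into_f)
  qed
  have NI: "N v = f" if "f \<in> W" "\<theta> f = L v" for f v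
    using inv_into_f_f[OF inj that(1)] that(2) by (simp add: N_def)
  have "N (c \<cdot>\<^sub>v v + w) = (\<lambda>r. c * N v r + N w r)" if vw: "v \<in> carrier_vec d" "w \<in> carrier_vec d" for v w c
    by (rule NI[OF fsubspace_lincomb[OF W(1) N(1)[OF vw(1)] N(1)[OF vw(2)]]])
      (simp only: lin_onD[OF lin N(1)[OF vw(1)] N(1)[OF vw(2)]] N(2)[OF vw(1)] N(2)[OF vw(2)] lin_isoD(1)[OF L vw])
  moreover have "inj_on N (carrier_vec d)"
  proof (rule inj_onI)
    fix v w assume v: "v \<in> carrier_vec d" and w: "w \<in> carrier_vec d" and e: "N v = N w"
    have "L v = L w" using N(2)[OF v] N(2)[OF w] e by simp
    then show "v = w" by (rule inj_onD[OF lin_isoD(2)[OF L] _ v w])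
  qed
  moreover have "N ` carrier_vec d = W"
  proof
    show "N ` carrier_vec d \<subseteq> W" using N(1) by blast
    show "W \<subseteq> N ` carrier_vec d"
    proof
      fix f assume f: "f \<in> W"
      then have "\<theta> f \<in> L ` carrier_vec d" using into by (simp only: lin_isoD(3)[OF L])
      then obtain v where "v \<in> carrier_vec d" "\<theta> f = L v" by blast
      then show "f \<in> N ` carrier_vec d" using NI[OF f] by (intro image_eqI[of f N v]) simp_all
    qed
  qed
  ultimately have "lin_iso d N W" by (simp add: lin_iso_def)
  moreover have "N (\<rho> (a g) *\<^sub>v v) = act g (N v)" if g: "g \<in> G" and v: "v \<in> carrier_vec d" for g v
  proof (rule NI[OF invariantD[OF W(2) g N(1)[OF v]]])
    have "L (\<rho> (a g) *\<^sub>v v) = act (a g) (L v)" using act a(1)[OF g] v by blast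
    then show "\<theta> (act g (N v)) = L (\<rho> (a g) *\<^sub>v v)" using eqv[OF g N(1)[OF v]] N(2)[OF v] by simp
  qed
  ultimately show ?thesis unfolding rep_iso_sub_eq by blast
qed

section \<open>Real irreducible representations of the alternating group\<close>

text \<open>Used with c = 2 for an unsplit module and c = 4 for a half, whose character at the two
  elements in question is half of \<open>chi\<close>; this yields the moduli 8 and 16.\<close>

lemma real_cong_iff_dvd:
  assumes "a - b = - (of_int c * real m)" "c > 0"
  shows "real_cong a b (4 * c) \<longleftrightarrow> 4 dvd m"
proof
  assume "real_cong a b (4 * c)"
  then obtain k where "- (of_int c * real m) = of_int (k * (4 * c))" using assms(1) by (auto simp: real_cong_def)
  then have "of_int c * (real m + 4 * of_int k) = (0 :: real)" by (simp add: algebra_simps)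
  then have "real_of_int (int m) = real_of_int (- 4 * k)" using assms(2) by simp
  then have "int m = - 4 * k" by (simp only: of_int_eq_iff)
  then have "4 dvd int m" by simp
  then show "4 dvd m" by presburger
next
  assume "4 dvd m"
  then obtain l where "m = 4 * l" by (elim dvdE)
  then have "a - b = of_int (- int l * (4 * c))" using assms(1) by simp
  then show "real_cong a b (4 * c)" unfolding real_cong_def by blast
qed

lemma orth_rep_mat_rep: "orth_rep G d \<rho> \<Longrightarrow> mat_rep G d \<rho>"
  by (simp add: orth_rep_def)

lemma specht_spinorial_iff:
  assumes n: "4 \<le> n" and \<rho>: "orth_rep (Alt n) d \<rho>" "rep_iso_sub (Alt n) d \<rho> (specht lam n)" and d: "0 < d"
  shows "spinorial (Alt n) d \<rho> \<longleftrightarrow> real_cong (chi lam n s1s3) (chi lam n id) 8"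
proof -
  have chi: "chi lam n g = mtrace (\<rho> g)" if "g \<in> Alt n" for g
    by (rule chi_eq[OF \<rho>(2) orth_rep_mat_rep[OF \<rho>(1)] Alt_subset_Sym that])
  obtain m :: nat where m: "mtrace (\<rho> s1s3) = real d - 2 * real m" "spinorial (Alt n) d \<rho> \<longleftrightarrow> 4 dvd m"
    by (rule spinorial_iff[OF n d \<rho>(1)])
  have "chi lam n s1s3 - chi lam n id = - (of_int 2 * real m)"
    using m(1) orth_rep_id[OF \<rho>(1)] by (simp add: chi[OF s1s3_Alt[OF n]] chi[OF Alt_id] mtrace_one)
  from real_cong_iff_dvd[OF this] show ?thesis using m(2) by simp
qed

lemma specht_rep_irred:
  assumes n: "2 \<le> n" and part: "is_partition lam n" and type: "conj_part lam \<noteq> lam \<or> eps lam = -1"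
    and \<rho>: "mat_rep (Alt n) d \<rho>" "rep_iso_sub (Alt n) d \<rho> (specht lam n :: (_ \<Rightarrow> real) set)"
  shows "irred_mat_rep (Alt n) d \<rho>"
  using rep_iso_sub_irred[OF \<rho>(2,1)] specht_nonzero[OF part] specht_Alt_irreducible[OF n part type] by blast

text \<open>A real splitting remains proper after complexification, so the locale applies to the
  complex Specht module.\<close>

lemma specht_cx_split:
  assumes n: "2 \<le> n" and part: "is_partition lam n" and \<sigma>: "\<sigma> \<subseteq> specht lam n" "fsubspace \<sigma>" "invariant (Alt n) \<sigma>"
    "\<sigma> \<noteq> {\<lambda>r. 0}" "\<sigma> \<noteq> specht lam n"
  shows "alt_split n (specht lam n) (cx \<sigma>)"
proof
  show "cx \<sigma> \<subseteq> specht lam n" using \<sigma>(1) unfolding cx_specht[symmetric] by (auto simp: cx_def)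
  show "cx \<sigma> \<noteq> specht lam n"
  proof
    assume "cx \<sigma> = specht lam n"
    then have "cx (specht lam n) \<subseteq> cx \<sigma>" by (simp only: cx_specht)
    then have "specht lam n \<subseteq> \<sigma>" by (rule cx_subset_imp[OF \<sigma>(2) _ specht_fsubspace])
    then show False using \<sigma>(1,5) by blast
  qed
qed (use n part \<sigma> specht_sym_irred cx_fsubspace cx_invariant cx_nonzero in auto)

lemma irred_subrepD:
  assumes "irred_subrep G V W"
  shows "W \<subseteq> V" "fsubspace W" "invariant G W" "W \<noteq> {\<lambda>r. 0}"
    "\<forall>U. U \<subseteq> W \<and> fsubspace U \<and> invariant G U \<longrightarrow> U = {\<lambda>r. 0} \<or> U = W"
  using assms by (simp_all add: irred_subrep_def)

text \<open>If X were all of S, the given W would be a proper nonzero invariant subspace of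
  it.\<close>

lemma (in alt_split) irred_subrep_split:
  assumes "irred_subrep (Alt n) S X"
  shows "alt_split n S X"
proof
  show "X \<noteq> S" using irred_subrepD(5)[OF assms] sub W nz proper by blast
qed (use n irr irred_subrepD[OF assms] in auto)

lemma (in alt_split) irred: "\<forall>U. U \<subseteq> W \<and> fsubspace U \<and> invariant (Alt n) U \<longrightarrow> U = {\<lambda>r. 0} \<or> U = W"
  using minimal by blast

lemma (in alt_split) irred_subrep: "irred_subrep (Alt n) S W"
  unfolding irred_subrep_def using sub W nz irred by blast

text \<open>W is an arbitrary irreducible subspace and need not be the complexification of \<sigma>.
  A nonzero vector of W has a nonzero component in one of the two halves, so W is isomorphic to that
  complexification or to its conjugate by t12; both have real orthogonal matrices.\<close>

lemma split_orth_rep_exists: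
  fixes W :: "((nat \<Rightarrow> nat) \<Rightarrow> complex) set" and \<sigma> :: "((nat \<Rightarrow> nat) \<Rightarrow> real) set"
  assumes n: "2 \<le> n" and part: "is_partition lam n" and \<sigma>: "\<sigma> \<subseteq> specht lam n" "fsubspace \<sigma>" "invariant (Alt n) \<sigma>"
    "\<sigma> \<noteq> {\<lambda>r. 0}" "\<sigma> \<noteq> specht lam n"
    and W: "irred_subrep (Alt n) (specht lam n) W"
  shows "\<exists>d \<rho>. orth_rep (Alt n) d \<rho> \<and> rep_iso_sub (Alt n) d (complexify \<rho>) W"
proof -
  interpret A: alt_split n "specht lam n" "cx \<sigma>" by (rule specht_cx_split[OF n part \<sigma>])
  note W = irred_subrepD[OF W]
  obtain d \<rho> where \<rho>: "orth_rep (Alt n) d \<rho>" "rep_iso_sub (Alt n) d \<rho> \<sigma>"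
    using orth_rep_exists[OF \<sigma>(2) order_trans[OF \<sigma>(1) specht_tabloid_space] \<sigma>(3) Alt_subset_Sym Alt_id] by blast
  note mr = orth_rep_mat_rep[OF \<rho>(1)]
  have iso: "rep_iso_sub (Alt n) d (complexify \<rho>) (cx \<sigma>)" by (rule rep_iso_sub_complexify[OF \<rho>(2) mr])
  obtain p q where pq: "lin_on (specht lam n) p" "lin_on (specht lam n) q"
    "\<forall>f\<in>specht lam n. p f \<in> cx \<sigma> \<and> q f \<in> cx \<sigma> \<and> f = (\<lambda>r. p f r + act t12 (q f) r)"
    "\<forall>g\<in>Alt n. \<forall>f\<in>specht lam n. p (act g f) = act g (p f) \<and> q (act g f) = act (t12 \<circ> g \<circ> t12) (q f)"
    using A.projections_equivariant by blast
  have WS: "f \<in> specht lam n" if "f \<in> W" for f using that W(1) by blast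
  have lin: "lin_on W p" "lin_on W q" using pq(1,2) WS unfolding lin_on_def by blast+
  obtain w where w: "w \<in> W" "w \<noteq> (\<lambda>r. 0)" using W(2,4) fsubspace_zero[OF W(2)] by blast
  show ?thesis
  proof (cases "p w = (\<lambda>r. 0)")
    case False
    have "rep_iso_sub (Alt n) d (\<lambda>g. complexify \<rho> g) W"
      by (rule rep_iso_sub_twist[where a = "\<lambda>g. g", OF W(2,3,5) A.irred lin(1) _ _ _ _ w(1) False iso complexify_mat_rep[OF mr]])
        (use pq(3,4) WS in blast)+
    then show ?thesis using \<rho>(1) by blast
  next
    case True
    let ?a = "\<lambda>g. t12 \<circ> g \<circ> t12"
    have nz': "q w \<noteq> (\<lambda>r. 0)"
    proof
      assume "q w = (\<lambda>r. 0)"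
      then have "(\<lambda>r. p w r + act t12 (q w) r) = (\<lambda>r. 0)" by (simp add: True)
      then show False using pq(3) WS[OF w(1)] w(2) by metis
    qed
    have aa: "?a (?a g) = g" for g by (simp add: comp_assoc)
    \<comment> \<open>Here q supplies the isomorphism, at the price of conjugating the index of the
      matrices by t12.\<close>
    have "rep_iso_sub (Alt n) d (\<lambda>g. complexify \<rho> (?a g)) W"
      by (rule rep_iso_sub_twist[where a = ?a, OF W(2,3,5) A.irred lin(2) _ _ t12_conj_Alt[OF n] aa w(1) nz' iso complexify_mat_rep[OF mr]])
        (use pq(3,4) WS in blast)+
    then have "rep_iso_sub (Alt n) d (complexify (\<lambda>g. \<rho> (?a g))) W" by (simp only: complexify_def)
    moreover have "orth_rep (Alt n) d (\<lambda>g. \<rho> (?a g))"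
      unfolding orth_rep_def mat_rep_def
    proof (intro conjI ballI)
      show "\<rho> (?a g) \<in> carrier_mat d d" if "g \<in> Alt n" for g
        by (rule orth_rep_carrier[OF \<rho>(1) t12_conj_Alt[OF n that]])
      have "?a id = id" by simp
      then show "\<rho> (?a id) = 1\<^sub>m d" by (simp only: orth_rep_id[OF \<rho>(1)])
      show "\<rho> (?a (g \<circ> h)) = \<rho> (?a g) * \<rho> (?a h)" if gh: "g \<in> Alt n" "h \<in> Alt n" for g h
      proof -
        have "?a (g \<circ> h) = ?a g \<circ> ?a h" by (simp add: comp_assoc)
        then show ?thesis by (simp only: orth_rep_mult[OF \<rho>(1) t12_conj_Alt[OF n gh(1)] t12_conj_Alt[OF n gh(2)]])
      qed
      show "\<rho> (?a g) * transpose_mat (\<rho> (?a g)) = 1\<^sub>m d" if "g \<in> Alt n" for g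
        using \<rho>(1) t12_conj_Alt[OF n that] by (simp add: orth_rep_def)
    qed
    ultimately show ?thesis by blast
  qed
qed

lemma t12_s1s3_commute: "t12 \<circ> s1s3 = s1s3 \<circ> t12"
  by (auto simp: t12_def s1s3_def fun_eq_iff transpose_def)

lemma mtrace_complexify: "mtrace (map_mat complex_of_real A) = complex_of_real (mtrace A)" if "A \<in> carrier_mat d d"
  using that by (simp add: mtrace_def)

text \<open>Traces are compared through W itself, so the criterion depends on lam alone and holds
  for both halves at once. The identity and \<open>s1s3\<close> commute with t12, as halving the
  character requires.\<close>

lemma split_rep_spinorial_iff:
  fixes W :: "((nat \<Rightarrow> nat) \<Rightarrow> complex) set"
  assumes n: "4 \<le> n" and W: "alt_split n (specht lam n) W" and \<rho>: "orth_rep (Alt n) d \<rho>" "rep_iso_sub (Alt n) d (complexify \<rho>) W"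
    and d: "0 < d"
  shows "spinorial (Alt n) d \<rho> \<longleftrightarrow> real_cong (chi lam n s1s3) (chi lam n id) 16"
proof -
  interpret A: alt_split n "specht lam n" W by (rule W)
  obtain e \<sigma> where \<sigma>: "orth_rep (Sym n) e \<sigma>" "rep_iso_sub (Sym n) e \<sigma> (specht lam n)"
    using orth_rep_exists[OF specht_fsubspace specht_tabloid_space specht_invariant order_refl Sym_id] by blast
  note m\<sigma> = orth_rep_mat_rep[OF \<sigma>(1)] and m\<rho> = orth_rep_mat_rep[OF \<rho>(1)]
  have iso: "rep_iso_sub (Sym n) e (complexify \<sigma>) (specht lam n)"
    using rep_iso_sub_complexify[OF \<sigma>(2) m\<sigma>] by (simp only: cx_specht)
  have chi: "chi lam n g = 2 * mtrace (\<rho> g)" if g: "g \<in> Alt n" "t12 \<circ> g = g \<circ> t12" for g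
  proof -
    have gS: "g \<in> Sym n" using g(1) Alt_subset_Sym by blast
    have "complex_of_real (mtrace (\<sigma> g)) = mtrace (complexify \<sigma> g)"
      unfolding complexify_def by (rule mtrace_complexify[OF orth_rep_carrier[OF \<sigma>(1) gS], symmetric])
    also have "\<dots> = 2 * mtrace (complexify \<rho> g)"
      by (rule A.trace_double[OF \<rho>(2) complexify_mat_rep[OF m\<rho>] iso complexify_mat_rep[OF m\<sigma>] g(1) gS g(2)])
    also have "\<dots> = complex_of_real (2 * mtrace (\<rho> g))"
      unfolding complexify_def mtrace_complexify[OF orth_rep_carrier[OF \<rho>(1) g(1)]] by simp
    finally have "mtrace (\<sigma> g) = 2 * mtrace (\<rho> g)" by (simp only: of_real_eq_iff)
    then show ?thesis using chi_eq[OF \<sigma>(2) m\<sigma> order_refl gS] by simp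
  qed
  obtain m :: nat where m: "mtrace (\<rho> s1s3) = real d - 2 * real m" "spinorial (Alt n) d \<rho> \<longleftrightarrow> 4 dvd m"
    by (rule spinorial_iff[OF n d \<rho>(1)])
  have "chi lam n s1s3 - chi lam n id = - (of_int 4 * real m)"
    using m(1) orth_rep_id[OF \<rho>(1)] chi[OF s1s3_Alt[OF n] t12_s1s3_commute] chi[OF Alt_id] by (simp add: mtrace_one)
  from real_cong_iff_dvd[OF this] show ?thesis using m(2) by simp
qed

lemma split_rep_irred:
  assumes W: "irred_subrep G V W" and \<rho>: "mat_rep G d \<rho>" "rep_iso_sub G d (complexify \<rho>) W"
  shows "irred_mat_rep G d \<rho>"
proof (rule irred_of_complexify[OF \<rho>(1)])
  show "irred_mat_rep G d (complexify \<rho>)"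
    unfolding rep_iso_sub_irred[OF \<rho>(2) complexify_mat_rep[OF \<rho>(1)]] using irred_subrepD(4,5)[OF W] by blast
qed

lemma Alt_reindex:
  assumes p: "p \<in> Alt n"
  shows "(\<Sum>g\<in>Alt n. f g) = (\<Sum>g\<in>Alt n. f (p \<circ> g))"
proof (rule sum.reindex_bij_witness[where i = "\<lambda>g. p \<circ> g" and j = "\<lambda>g. inv_into UNIV p \<circ> g"])
  have pS: "p \<in> Sym n" using p Alt_subset_Sym by blast
  show c: "p \<circ> (inv_into UNIV p \<circ> g) = g" and "inv_into UNIV p \<circ> (p \<circ> g) = g" for g
    by (simp_all add: fun_eq_iff Sym_inverses[OF pS])
  show "f (p \<circ> (inv_into UNIV p \<circ> g)) = f g" for g by (simp only: c)
qed (use p Alt_comp Alt_inv in auto)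

text \<open>The map sending \<open>v\<close> to the sum of \<open>(\<rho> (g\<inverse>) v)\<^sub>0 \<cdot> g s\<close> over the alternating group is
  equivariant; completeness provides a vector \<open>s\<close> for which it does not vanish.\<close>
theorem Alt_irred_in_specht:
  assumes \<rho>: "mat_rep (Alt n) d \<rho>" and irr: "irred_mat_rep (Alt n) d (\<rho> :: _ \<Rightarrow> real mat)"
  shows "\<exists>lam W. is_partition lam n \<and> W \<subseteq> specht lam n \<and> fsubspace W \<and> invariant (Alt n) W \<and> rep_iso_sub (Alt n) d \<rho> W"
proof -
  have d: "0 < d" using irr by (simp add: irred_mat_rep_def)
  have car: "\<rho> g \<in> carrier_mat d d" if "g \<in> Alt n" for g using \<rho> that by (simp add: mat_rep_def)
  let ?i = "\<lambda>g :: nat \<Rightarrow> nat. inv_into UNIV g"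
  have cari: "\<rho> (?i g) \<in> carrier_mat d d" if "g \<in> Alt n" for g by (rule car[OF Alt_inv[OF that]])
  \<comment> \<open>A matrix coefficient of the contragredient. It is 1 at the identity, so
    completeness provides a Specht module on which it does not act as 0.\<close>
  define x where "x g = (if g \<in> Alt n then \<rho> (?i g) $$ (0, 0) else 0)" for g
  have "x id \<noteq> 0" using \<rho> d by (simp add: x_def mat_rep_def inv_id)
  then obtain lam s r0 where lam: "is_partition lam n" and s: "s \<in> specht lam n"
    and nz: "(\<Sum>g\<in>Sym n. x g * act g s r0) \<noteq> 0"
    using specht_complete[of n x id] Sym_id by blast
  define L where "L v = (\<lambda>r. \<Sum>g\<in>Alt n. (\<rho> (?i g) *\<^sub>v v) $ 0 * act g s r)" for v
  have gs: "act g s \<in> specht lam n" if "g \<in> Alt n" for g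
    using invariantD[OF specht_invariant _ s] that Alt_subset_Sym by blast
  have LS: "L v \<in> specht lam n" for v
    unfolding L_def by (rule fsubspace_sum[OF specht_fsubspace gs])
  have lin: "L (a \<cdot>\<^sub>v v + w) = (\<lambda>r. a * L v r + L w r)" if vw: "v \<in> carrier_vec d" "w \<in> carrier_vec d" for v w a
  proof
    fix r
    have "(\<rho> (?i g) *\<^sub>v (a \<cdot>\<^sub>v v + w)) $ 0 = a * (\<rho> (?i g) *\<^sub>v v) $ 0 + (\<rho> (?i g) *\<^sub>v w) $ 0" if g: "g \<in> Alt n" for g
      using cari[OF g] vw d by (simp add: mult_add_distrib_mat_vec[of _ d d] mult_mat_vec[of _ d d])
    then have "L (a \<cdot>\<^sub>v v + w) r = (\<Sum>g\<in>Alt n. a * ((\<rho> (?i g) *\<^sub>v v) $ 0 * act g s r) + (\<rho> (?i g) *\<^sub>v w) $ 0 * act g s r)"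
      unfolding L_def by (intro sum.cong refl) (simp add: algebra_simps)
    then show "L (a \<cdot>\<^sub>v v + w) r = a * L v r + L w r" by (simp add: L_def sum.distrib sum_distrib_left)
  qed
  have eqv: "L (\<rho> h *\<^sub>v v) = act h (L v)" if h: "h \<in> Alt n" and v: "v \<in> carrier_vec d" for h v
  proof
    fix r
    have "L (\<rho> h *\<^sub>v v) r = (\<Sum>g\<in>Alt n. (\<rho> (?i (h \<circ> g)) *\<^sub>v (\<rho> h *\<^sub>v v)) $ 0 * act (h \<circ> g) s r)"
      unfolding L_def by (rule Alt_reindex[OF h])
    also have "\<dots> = (\<Sum>g\<in>Alt n. (\<rho> (?i g) *\<^sub>v v) $ 0 * act g s (r \<circ> h))"
    proof (rule sum.cong[OF refl])
      fix g assume g: "g \<in> Alt n"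
      have hS: "h \<in> Sym n" and gS: "g \<in> Sym n" using h g Alt_subset_Sym by auto
      have "?i (h \<circ> g) \<circ> h = ?i g"
        unfolding Sym_inv_distrib[OF hS gS] by (simp add: fun_eq_iff Sym_inverses[OF hS])
      then have "\<rho> (?i g) = \<rho> (?i (h \<circ> g)) * \<rho> h"
        using \<rho> Alt_inv[OF Alt_comp[OF h g]] h unfolding mat_rep_def by metis
      then have "\<rho> (?i (h \<circ> g)) *\<^sub>v (\<rho> h *\<^sub>v v) = \<rho> (?i g) *\<^sub>v v"
        using assoc_mult_mat_vec[OF cari[OF Alt_comp[OF h g]] car[OF h] v] by simp
      then show "(\<rho> (?i (h \<circ> g)) *\<^sub>v (\<rho> h *\<^sub>v v)) $ 0 * act (h \<circ> g) s r = (\<rho> (?i g) *\<^sub>v v) $ 0 * act g s (r \<circ> h)"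
        by (simp add: act_def o_assoc)
    qed
    finally show "L (\<rho> h *\<^sub>v v) r = act h (L v) r" by (simp add: L_def act_def)
  qed
  have L0: "L (0\<^sub>v d) = (\<lambda>r. 0)"
  proof
    fix r
    have "(\<rho> (?i g) *\<^sub>v 0\<^sub>v d) $ 0 = 0" if g: "g \<in> Alt n" for g
      using cari[OF g] d by simp
    then show "L (0\<^sub>v d) r = 0" unfolding L_def by (intro sum.neutral) simp
  qed
  define K where "K = {v \<in> carrier_vec d. L v = (\<lambda>r. 0)}"
  have "K \<subseteq> carrier_vec d \<and> 0\<^sub>v d \<in> K \<and> (\<forall>u\<in>K. \<forall>v\<in>K. \<forall>a. a \<cdot>\<^sub>v u + v \<in> K) \<and> (\<forall>g\<in>Alt n. \<forall>u\<in>K. \<rho> g *\<^sub>v u \<in> K)"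
  proof (intro conjI ballI allI)
    show "0\<^sub>v d \<in> K" using L0 by (simp add: K_def)
    show "a \<cdot>\<^sub>v u + v \<in> K" if "u \<in> K" "v \<in> K" for u v a using that by (simp add: K_def lin)
    show "\<rho> g *\<^sub>v u \<in> K" if "g \<in> Alt n" "u \<in> K" for g u
      using that mult_mat_vec_carrier[OF car[OF that(1)], of u] eqv[OF that(1), of u] by (simp add: K_def)
  qed (auto simp: K_def)
  then have "K = {0\<^sub>v d} \<or> K = carrier_vec d" by (rule mp[OF spec[OF conjunct2[OF irr[unfolded irred_mat_rep_def]]]])
  moreover have "unit_vec d 0 \<notin> K"
  proof
    \<comment> \<open>The value of L at the first basis vector is the nonzero sum obtained from
      completeness, so the invariant subspace K is proper, hence 0.\<close>
    assume "unit_vec d 0 \<in> K"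
    then have "L (unit_vec d 0) r0 = 0" by (simp add: K_def)
    moreover have "L (unit_vec d 0) r0 = (\<Sum>g\<in>Alt n. x g * act g s r0)"
      unfolding L_def
    proof (rule sum.cong[OF refl])
      fix g assume g: "g \<in> Alt n"
      have "(\<rho> (?i g) *\<^sub>v unit_vec d 0) $ 0 = x g"
        using mat_mult_unit_vec[OF cari[OF g] d] cari[OF g] d g by (simp add: x_def)
      then show "(\<rho> (?i g) *\<^sub>v unit_vec d 0) $ 0 * act g s r0 = x g * act g s r0" by simp
    qed
    also have "\<dots> = (\<Sum>g\<in>Sym n. x g * act g s r0)"
      by (rule sum.mono_neutral_left[OF finite_Sym Alt_subset_Sym]) (simp add: x_def)
    ultimately show False using nz by simp
  qed
  ultimately have K0: "K = {0\<^sub>v d}" by auto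
  have "inj_on L (carrier_vec d)"
  proof (rule inj_onI)
    fix v w assume v: "v \<in> carrier_vec d" and w: "w \<in> carrier_vec d" and e: "L v = L w"
    have "L ((-1) \<cdot>\<^sub>v v + w) = (\<lambda>r. 0)" unfolding lin[OF v w] e by simp
    then have "(-1) \<cdot>\<^sub>v v + w \<in> K" using v w by (simp add: K_def)
    then have z: "(-1) \<cdot>\<^sub>v v + w = 0\<^sub>v d" unfolding K0 by (rule singletonD)
    show "v = w"
    proof (rule eq_vecI)
      fix i assume "i < dim_vec w"
      then show "v $ i = w $ i" using arg_cong[OF z, of "\<lambda>u. u $ i"] v w by simp
    qed (use v w in simp)
  qed
  then have iso: "lin_iso d L (L ` carrier_vec d)" using lin by (simp add: lin_iso_def)
  have "rep_iso_sub (Alt n) d \<rho> (L ` carrier_vec d)"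
    unfolding rep_iso_sub_eq by (intro exI[of _ L] conjI ballI iso eqv)
  moreover have "fsubspace (L ` carrier_vec d)" by (rule lin_iso_image_fsubspace[OF iso]) auto
  moreover have "invariant (Alt n) (L ` carrier_vec d)"
    unfolding invariant_def
  proof (intro ballI)
    fix g f assume g: "g \<in> Alt n" and "f \<in> L ` carrier_vec d"
    then obtain v where v: "v \<in> carrier_vec d" "f = L v" by blast
    have "act g f = L (\<rho> g *\<^sub>v v)" using eqv[OF g v(1)] v(2) by simp
    then show "act g f \<in> L ` carrier_vec d" using mult_mat_vec_carrier[OF car[OF g] v(1)] by blast
  qed
  moreover have "L ` carrier_vec d \<subseteq> specht lam n" using LS by blast
  ultimately show ?thesis using lam by blast
qed

text \<open>The split case ranges over every irreducible complex subspace W of the Specht module,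
  hence over both halves, and \<rho> is any real orthogonal form of W. Both halves are spinorial
  under the same condition because it involves only lam.\<close>

theorem theorem4p2:
  fixes n :: nat
  assumes "4 \<le> n"
  shows
   "(\<forall>lam. is_partition lam n \<and> (conj_part lam \<noteq> lam \<or> eps lam = -1) \<longrightarrow>
       (\<exists>d \<rho>. orth_rep (Alt n) d \<rho> \<and> rep_iso_sub (Alt n) d \<rho> (specht lam n)) \<and>
       (\<forall>d \<rho>. orth_rep (Alt n) d \<rho> \<and> rep_iso_sub (Alt n) d \<rho> (specht lam n) \<longrightarrow>
          irred_mat_rep (Alt n) d \<rho> \<and>
          (spinorial (Alt n) d \<rho> \<longleftrightarrow> real_cong (chi lam n s1s3) (chi lam n id) 8)))
  \<and> (\<forall>lam W. is_partition lam n \<and> conj_part lam = lam \<and> eps lam = 1 \<and>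
        irred_subrep (Alt n) (specht lam n) (W :: ((nat \<Rightarrow> nat) \<Rightarrow> complex) set) \<longrightarrow>
       (\<exists>d \<rho>. orth_rep (Alt n) d \<rho> \<and> rep_iso_sub (Alt n) d (complexify \<rho>) W) \<and>
       (\<forall>d \<rho>. orth_rep (Alt n) d \<rho> \<and> rep_iso_sub (Alt n) d (complexify \<rho>) W \<longrightarrow>
          irred_mat_rep (Alt n) d \<rho> \<and>
          (spinorial (Alt n) d \<rho> \<longleftrightarrow> real_cong (chi lam n s1s3) (chi lam n id) 16)))
  \<and> (\<forall>d \<rho>. orth_rep (Alt n) d \<rho> \<and> irred_mat_rep (Alt n) d \<rho> \<longrightarrow>
       (\<exists>lam. is_partition lam n \<and> (conj_part lam \<noteq> lam \<or> eps lam = -1) \<and>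
              rep_iso_sub (Alt n) d \<rho> (specht lam n))
     \<or> (\<exists>lam W. is_partition lam n \<and> conj_part lam = lam \<and> eps lam = 1 \<and>
              irred_subrep (Alt n) (specht lam n) (W :: ((nat \<Rightarrow> nat) \<Rightarrow> complex) set) \<and>
              rep_iso_sub (Alt n) d (complexify \<rho>) W))"
proof (intro conjI allI impI)
  have n2: "2 \<le> n" using assms by simp
  {
    fix lam assume "is_partition lam n \<and> (conj_part lam \<noteq> lam \<or> eps lam = -1)"
    then have part: "is_partition lam n" and type: "conj_part lam \<noteq> lam \<or> eps lam = -1" by blast+
    have "invariant (Alt n) (specht lam n :: (_ \<Rightarrow> real) set)" by (rule invariant_mono[OF specht_invariant Alt_subset_Sym])
    then show "\<exists>d \<rho>. orth_rep (Alt n) d \<rho> \<and> rep_iso_sub (Alt n) d \<rho> (specht lam n)"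
      by (rule orth_rep_exists[OF specht_fsubspace specht_tabloid_space _ Alt_subset_Sym Alt_id])
    fix d \<rho> assume "orth_rep (Alt n) d \<rho> \<and> rep_iso_sub (Alt n) d \<rho> (specht lam n)"
    then have \<rho>: "orth_rep (Alt n) d \<rho>" "rep_iso_sub (Alt n) d \<rho> (specht lam n)" by blast+
    show irr: "irred_mat_rep (Alt n) d \<rho>" by (rule specht_rep_irred[OF n2 part type orth_rep_mat_rep[OF \<rho>(1)] \<rho>(2)])
    have "0 < d" using irr by (simp only: irred_mat_rep_def)
    then show "spinorial (Alt n) d \<rho> \<longleftrightarrow> real_cong (chi lam n s1s3) (chi lam n id) 8"
      by (rule specht_spinorial_iff[OF assms \<rho>])
  }
  {
    fix lam and W :: "((nat \<Rightarrow> nat) \<Rightarrow> complex) set"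
    assume a: "is_partition lam n \<and> conj_part lam = lam \<and> eps lam = 1 \<and> irred_subrep (Alt n) (specht lam n) W"
    then have part: "is_partition lam n" and self: "conj_part lam = lam" and eps: "eps lam = 1"
      and W: "irred_subrep (Alt n) (specht lam n) W" by blast+
    obtain \<sigma> :: "((nat \<Rightarrow> nat) \<Rightarrow> real) set" where \<sigma>: "\<sigma> \<subseteq> specht lam n" "fsubspace \<sigma>" "invariant (Alt n) \<sigma>"
      "\<sigma> \<noteq> {\<lambda>r. 0}" "\<sigma> \<noteq> specht lam n" by (rule specht_Alt_reducible[OF n2 part self eps])
    show "\<exists>d \<rho>. orth_rep (Alt n) d \<rho> \<and> rep_iso_sub (Alt n) d (complexify \<rho>) W"
      by (rule split_orth_rep_exists[OF n2 part \<sigma> W])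
    fix d \<rho> assume "orth_rep (Alt n) d \<rho> \<and> rep_iso_sub (Alt n) d (complexify \<rho>) W"
    then have \<rho>: "orth_rep (Alt n) d \<rho>" "rep_iso_sub (Alt n) d (complexify \<rho>) W" by blast+
    show irr: "irred_mat_rep (Alt n) d \<rho>" by (rule split_rep_irred[OF W orth_rep_mat_rep[OF \<rho>(1)] \<rho>(2)])
    have "alt_split n (specht lam n) W"
      by (rule alt_split.irred_subrep_split[OF specht_cx_split[OF n2 part \<sigma>] W])
    moreover have "0 < d" using irr by (simp only: irred_mat_rep_def)
    ultimately show "spinorial (Alt n) d \<rho> \<longleftrightarrow> real_cong (chi lam n s1s3) (chi lam n id) 16"
      by (intro split_rep_spinorial_iff[OF assms _ \<rho>])
  }
  fix d \<rho> assume "orth_rep (Alt n) d \<rho> \<and> irred_mat_rep (Alt n) d \<rho>"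
  then have \<rho>: "mat_rep (Alt n) d \<rho>" "irred_mat_rep (Alt n) d \<rho>" by (simp_all add: orth_rep_def)
  obtain lam and \<sigma> :: "((nat \<Rightarrow> nat) \<Rightarrow> real) set" where part: "is_partition lam n"
    and \<sigma>: "\<sigma> \<subseteq> specht lam n" "fsubspace \<sigma>" "invariant (Alt n) \<sigma>" and iso: "rep_iso_sub (Alt n) d \<rho> \<sigma>"
    using Alt_irred_in_specht[OF \<rho>] by blast
  have nz: "\<sigma> \<noteq> {\<lambda>r. 0}" and min: "\<forall>U. U \<subseteq> \<sigma> \<and> fsubspace U \<and> invariant (Alt n) U \<longrightarrow> U = {\<lambda>r. 0} \<or> U = \<sigma>"
    using \<rho>(2) unfolding rep_iso_sub_irred[OF iso \<rho>(1)] by blast+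
  show "(\<exists>lam. is_partition lam n \<and> (conj_part lam \<noteq> lam \<or> eps lam = -1) \<and>
              rep_iso_sub (Alt n) d \<rho> (specht lam n))
     \<or> (\<exists>lam W. is_partition lam n \<and> conj_part lam = lam \<and> eps lam = 1 \<and>
              irred_subrep (Alt n) (specht lam n) (W :: ((nat \<Rightarrow> nat) \<Rightarrow> complex) set) \<and>
              rep_iso_sub (Alt n) d (complexify \<rho>) W)"
  proof (cases "conj_part lam \<noteq> lam \<or> eps lam = -1")
    case True
    have "\<sigma> = specht lam n" using specht_Alt_irreducible[OF n2 part True \<sigma>] nz by blast
    then show ?thesis using part True iso by blast
  next
    case False
    then have self: "conj_part lam = lam" and eps: "eps lam = 1" by (auto simp: eps_def split: if_splits)
    have "\<sigma> \<noteq> specht lam n"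
    proof
      assume eq: "\<sigma> = specht lam n"
      show False by (rule specht_Alt_reducible[OF n2 part self eps]) (use min eq in blast)
    qed
    \<comment> \<open>The real subspace is only known to be irreducible over the reals; as a proper
      one it splits the complex Specht module too, and halves of a split module are
      irreducible.\<close>
    then have "irred_subrep (Alt n) (specht lam n) (cx \<sigma>)"
      by (rule alt_split.irred_subrep[OF specht_cx_split[OF n2 part \<sigma> nz]])
    then show ?thesis using part self eps rep_iso_sub_complexify[OF iso \<rho>(1)] by blast
  qed
qed

end
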